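(* For integers $\ell,e\ge2$ and $\boldsymbol s\in\mathbb Z^\ell$ let $\mathsf c_{e,\boldsymbol s}(q)=\sum_{n\ge0}c_{e,\boldsymbol s}(n)q^n$ be the generating function, by size, of the $(e,\boldsymbol s)$-cores. The following hold (with $n$ ranging over $\mathbb N$). Level $\ell=2$: - $\mathsf c_{2,(0,0)}(q)=\psi(q^2)$; $c_{2,(0,0)}(n)>0$ iff $n$ is pronic. - $\mathsf c_{2,(0,1)}(q)=\phi(q)$; $c_{2,(0,1)}(n)>0$ iff $n$ is a square. - $\mathsf c_{4,(0,0)}(q)=\psi(q^2)\psi(q^4)^2$; $c_{4,(0,0)}(n)>0$ iff $n$ is even. - $\mathsf c_{4,(0,1)}(q)=\psi(q^2)\psi(q)^2$; $c_{4,(0,1)}(n)>0$ for all $n$. - $\mathsf c_{4,(0,2)}(q)=\psi(q^2)\left(\phi(q^2)^2+2q\psi(q^4)^2\right)$; $c_{4,(0,2)}(n)>0$ for all $n$. - $\mathsf c_{6,(0,0)}(q)=\psi(q^2)\mathsf c_3(q^4)^2$; $c_{6,(0,0)}(n)>0$ iff $n$ is even. - $\mathsf c_{6,(0,2)}(q)=\psi(q^2)\left(\mathsf c_3(q)^2-q^2\mathsf c_3(q^4)^2\right)$; $c_{6,(0,2)}(n)>0$ for all $n$. - $\mathsf c_{6,(0,3)}(q)+2q\,\mathsf c_{6,(0,1)}(q)=\phi(q)\mathsf c_3(q)^2$. Level $\ell=3$: - $\mathsf c_{3,(0,0,0)}(q)=\mathsf c_3(q^3)$; $c_{3,(0,0,0)}(n)=0$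 for all $n\equiv1,2\bmod3$. - $\mathsf c_{3,(0,0,1)}(q)=\mathsf c_3(q)$; it is not the case that $c_{3,(0,0,1)}(n)>0$ for all $n$. - $\mathsf c_{3,(0,1,2)}(q)=\mathsf r^3_0(q^3)+3q\,\mathsf c_3(q^3)$; $c_{3,(0,1,2)}(n)=0$ for all $n\equiv2\bmod3$. Level $\ell=4$: - $\mathsf c_{4,(0,0,0,0)}(q)=\psi(q^4)\psi(q^8)^2$; $c_{4,(0,0,0,0)}(n)>0$ iff $4\mid n$. - $\mathsf c_{4,(0,0,1,2)}(q)+\mathsf c_{4,(0,1,1,1)}(q)=\psi(q)^3$, and $\mathsf c_{4,(0,0,0,1)}(q)=\mathsf c_{4,(0,1,1,1)}(q)$; $c_{4,(0,0,0,1)}(n)=0$ for $n=4,19,112$. - $\mathsf c_{4,(0,1,2,3)}(q)+4q\,\mathsf c_{4,(0,0,0,2)}(q)=\phi(q^2)^3+8q\,\phi(q^2)\psi(q^4)^2$; $c_{4,(0,0,0,2)}(n)=0$ for infinitely many odd $n$, and $c_{4,(0,1,2,3)}(n)=0$ for infinitely many even $n$. - $\mathsf c_{4,(0,0,1,1)}(q)=\psi(q^4)\psi(q^2)^2$; $c_{4,(0,0,1,1)}(n)>0$ iff $n$ is even. - $\mathsf c_{4,(0,0,2,2)}(q)=\psi(q^4)\left(\phi(q^4)^2+2q^2\psi(q^8)^2\right)$; $c_{4,(0,0,2,2)}(n)>0$ iff $n$ is even. - $\mathsf c_{4,(0,1,1,2)}(q)=\psi(q^4)\left(\phi(q^2)^2+2q\psi(q^4)^2\right)$;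 $c_{4,(0,1,1,2)}(n)>0$ iff $n\not\equiv3\bmod4$.
   Context: $\mathbb N=\{0,1,2,\dots\}$. A partition $\lambda=(\lambda_1\ge\lambda_2\ge\cdots)$ is a weakly decreasing sequence in $\mathbb N$ with finitely many nonzero terms; $|\lambda|=\sum_i\lambda_i$. An $\ell$-partition is an $\ell$-tuple $\boldsymbol\lambda=(\lambda^1,\dots,\lambda^\ell)$ of partitions, of size $|\boldsymbol\lambda|=\sum_j|\lambda^j|$. For $\boldsymbol s\in\mathbb Z^\ell$ put $S^{(j)}=\{\lambda^j_k-k+1+s_j : k\ge1\}\subset\mathbb Z$; the abacus of the charged $\ell$-partition $|\boldsymbol\lambda,\boldsymbol s\rangle$ is $\{(\beta,j):\beta\in S^{(j)}\}\subset\mathbb Z\times\{1,\dots,\ell\}$. $(e,\boldsymbol s)$-cores: level-rank duality LR maps charged $\ell$-partitions to charged $e$-partitions, being induced on abaci by the bijection $\mathbb Z\times\{1,\dots,\ell\}\to\mathbb Z\times\{1,\dots,e\}$, $(k,j)\mapsto\left(\ell(\lfloor\frac{k-1}{e}\rfloor+1)-j+1,\ ((k-1)\bmod e)+1\right)$. An $\ell$-partition $\boldsymbol\lambda$ is an $(e,\boldsymbol s)$-core if $\mathrm{LR}(|\boldsymbol\lambda,\boldsymbol s\rangle)$ has empty underlying $e$-partition; equivalently $S^{(1)}\subseteq S^{(2)}\subseteq\dots\subseteq S^{(\ell)}\subseteq S^{(1)}+e$. $\mathsf c_3(q)=\sum q^{|\lambda|}$, summed over partitions $\lambda$ that are 3-cores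 (no removable rim hook of length 3). $\phi(q)=\sum_{n\in\mathbb Z}q^{n^2}$, $\psi(q)=\sum_{t\ge0}q^{t(t+1)/2}$. A pronic number is one of the form $k(k+1)$, $k\in\mathbb N$. $\mathsf r^3_0(q)=\sum q^{\mathrm{rk}(\boldsymbol\sigma)}$ over $\boldsymbol\sigma\in\mathbb Z^3$ with $\sigma_1+\sigma_2+\sigma_3=0$, where for $\boldsymbol\sigma\in\mathbb Z^\ell$, $\mathrm{rk}(\boldsymbol\sigma)=\left\lceil\frac{Y-\ell+1}{2\ell}\right\rceil$ with $Y=\sum_i\sum_{j\ne i}\sigma_i(\sigma_i-\sigma_j)$.
   Formalization: In the level-4 identity for ψ(q)^3 a missing factor q is supplied: it reads c_{4,(0,0,1,2)}(q) + q c_{4,(0,1,1,1)}(q) = ψ(q)^3, because as printed the constant terms are 2 on the left and 1 on the right. *)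

theory Defs
  imports "HOL-Computational_Algebra.Computational_Algebra"
begin

section \<open>Partitions and charged multipartitions\<close>

text \<open>
  Parts are indexed from 0: the value \<open>lam k\<close> is the part usually written with index \<open>k + 1\<close>.
\<close>

definition is_partition :: "(nat \<Rightarrow> nat) \<Rightarrow> bool" where
  "is_partition lam \<longleftrightarrow> antimono lam \<and> finite {k. lam k \<noteq> 0}"

definition psize :: "(nat \<Rightarrow> nat) \<Rightarrow> nat" where
  "psize lam = (\<Sum>k | lam k \<noteq> 0. lam k)"

definition is_multipartition :: "nat \<Rightarrow> (nat \<Rightarrow> nat) list \<Rightarrow> bool" where
  "is_multipartition l \<Lambda> \<longleftrightarrow> length \<Lambda> = l \<and> (\<forall>lam\<in>set \<Lambda>. is_partition lam)"

definition msize :: "(nat \<Rightarrow> nat) list \<Rightarrow> nat" where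
  "msize \<Lambda> = (\<Sum>lam\<leftarrow>\<Lambda>. psize lam)"

text \<open>
  With parts indexed from 0, the beta-number \<open>lam\<^sub>k - k + 1 + s\<close> (for \<open>k \<ge> 1\<close>) becomes
  \<open>lam k - k + s\<close> (for \<open>k \<ge> 0\<close>).
\<close>

definition beta_set :: "(nat \<Rightarrow> nat) \<Rightarrow> int \<Rightarrow> int set" where
  "beta_set lam s = {int (lam k) - int k + s | k. True}"

text \<open>
  The runners of the abacus are numbered from 1, as in the formula for level-rank duality below;
  runner \<open>j\<close> belongs to the list entry with index \<open>j - 1\<close>.
\<close>

definition abacus :: "(nat \<Rightarrow> nat) list \<Rightarrow> int list \<Rightarrow> (int \<times> nat) set" where
  "abacus \<Lambda> s = {(\<beta>, j). 1 \<le> j \<and> j \<le> length \<Lambda> \<and> \<beta> \<in> beta_set (\<Lambda> ! (j - 1)) (s ! (j - 1))}"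


section \<open>Level-rank duality and cores\<close>

definition LR :: "nat \<Rightarrow> nat \<Rightarrow> int \<times> nat \<Rightarrow> int \<times> nat" where
  "LR l e = (\<lambda>(k, j). (int l * ((k - 1) div int e + 1) - int j + 1, nat ((k - 1) mod int e) + 1))"

text \<open>
  A charged multipartition is determined by its abacus, so the level-rank dual of
  \<open>\<Lambda>\<close> with charge \<open>s\<close> has empty underlying \<open>e\<close>-partition iff the image of the
  abacus under \<open>LR\<close> is the abacus of the empty \<open>e\<close>-partition with some charge \<open>t\<close>.
\<close>

definition is_core :: "nat \<Rightarrow> int list \<Rightarrow> (nat \<Rightarrow> nat) list \<Rightarrow> bool" where
  "is_core e s \<Lambda> \<longleftrightarrow> is_multipartition (length s) \<Lambda> \<and>
     (\<exists>t. length t = e \<and> LR (length s) e ` abacus \<Lambda> s = abacus (replicate e (\<lambda>_. 0)) t)"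


section \<open>Ordinary 3-cores\<close>

definition young :: "(nat \<Rightarrow> nat) \<Rightarrow> (nat \<times> nat) set" where
  "young lam = {(i, j). j < lam i}"

definition adjacent :: "((nat \<times> nat) \<times> (nat \<times> nat)) set" where
  "adjacent = {((i, j), (i', j')). \<bar>int i - int i'\<bar> + \<bar>int j - int j'\<bar> = 1}"

text \<open>
  A removable rim hook is a set of cells whose removal leaves the Young diagram of a partition,
  which is connected through edges of cells and which contains no 2-by-2 square.
\<close>

definition removable_rim_hook :: "(nat \<Rightarrow> nat) \<Rightarrow> (nat \<times> nat) set \<Rightarrow> bool" where
  "removable_rim_hook lam R \<longleftrightarrow>
     R \<noteq> {} \<and> R \<subseteq> young lam \<and>
     (\<exists>mu. is_partition mu \<and> young mu = young lam - R) \<and>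
     (\<forall>x\<in>R. \<forall>y\<in>R. (x, y) \<in> (adjacent \<inter> R \<times> R)\<^sup>*) \<and>
     (\<nexists>i j. {(i, j), (i + 1, j), (i, j + 1), (i + 1, j + 1)} \<subseteq> R)"

definition is_ordinary_core :: "nat \<Rightarrow> (nat \<Rightarrow> nat) \<Rightarrow> bool" where
  "is_ordinary_core h lam \<longleftrightarrow> is_partition lam \<and> (\<nexists>R. removable_rim_hook lam R \<and> card R = h)"


section \<open>Generating functions\<close>

text \<open>
  \<open>gen_series A w\<close> is the sum of \<open>q ^ w x\<close> over \<open>x \<in> A\<close>. It is only used for weights that are
  nonnegative on \<open>A\<close> and take each value only finitely often there.
\<close>

definition gen_series :: "'a set \<Rightarrow> ('a \<Rightarrow> int) \<Rightarrow> int fps" where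
  "gen_series A w = Abs_fps (\<lambda>n. int (card {x \<in> A. w x = int n}))"

abbreviation q :: "int fps" where
  "q \<equiv> fps_X"

definition core_series :: "nat \<Rightarrow> int list \<Rightarrow> int fps" where
  "core_series e s = gen_series {\<Lambda>. is_core e s \<Lambda>} (\<lambda>\<Lambda>. int (msize \<Lambda>))"

definition core_coeff :: "nat \<Rightarrow> int list \<Rightarrow> nat \<Rightarrow> int" where
  "core_coeff e s n = fps_nth (core_series e s) n"

definition c3 :: "int fps" where
  "c3 = gen_series {lam. is_ordinary_core 3 lam} (\<lambda>lam. int (psize lam))"

definition phi :: "int fps" where
  "phi = gen_series (UNIV :: int set) (\<lambda>n. n ^ 2)"

definition psi :: "int fps" where
  "psi = gen_series (UNIV :: nat set) (\<lambda>t. int (t * (t + 1) div 2))"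

definition rk :: "int list \<Rightarrow> int" where
  "rk \<sigma> = (let l = length \<sigma>;
               Y = (\<Sum>i<l. \<Sum>j\<in>{..<l} - {i}. \<sigma> ! i * (\<sigma> ! i - \<sigma> ! j))
           in \<lceil>(real_of_int Y - real l + 1) / (2 * real l)\<rceil>)"

definition r30 :: "int fps" where
  "r30 = gen_series {\<sigma>. length \<sigma> = 3 \<and> sum_list \<sigma> = 0} rk"

definition pronic :: "nat \<Rightarrow> bool" where
  "pronic n \<longleftrightarrow> (\<exists>k. n = k * (k + 1))"

end

theory Submission
  imports Defs "HOL-Analysis.Infinite_Sum"
begin

text \<open>
  Level-rank duality sends the cores with charge \<open>s\<close> of length \<open>l\<close> to abaci of empty \<open>e\<close>-partitions, and
  such an abacus is just its charge \<open>t\<close>, an integer tuple of length \<open>e\<close>. On runner \<open>j\<close> of the original abacus,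
  the beads in residue class \<open>m\<close> modulo \<open>e\<close> fill everything below level \<open>(t\<^sub>m + j) div l\<close>; hence the
  cores of charge \<open>s\<close> are the tuples for which these levels add up to \<open>s\<^sub>j\<close> for every \<open>j\<close>
  (\<open>core_tuples_bij\<close>), and when \<open>e = k l\<close> the size is, up to a constant depending on \<open>s\<close>, a
  quadratic polynomial in \<open>t\<close> that does not involve \<open>s\<close> (\<open>core_size_quadratic\<close>).

  So all tuples with a prescribed sum, weighted by this polynomial, split into the cores of finitely
  many charges (\<open>tuples_of_sum_series\<close>). Cyclic rotation and translation of the charge leave the core
  series alone, conjugation reverses the charge, and repeating every entry of the charge \<open>k\<close> times
  replaces \<open>q\<close> by \<open>q\<^sup>k\<close>. After these identifications only a few core series remain, and a linear
  combination of them is the theta series of a coset of a root lattice of type A. A change of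
  variables then makes the quadratic form diagonal: for \<open>e = 4\<close> the three sums \<open>t\<^sub>0 + t\<^sub>i\<close> are orthogonal
  coordinates, which produces the products of \<open>\<phi>\<close> and \<open>\<psi>\<close>; for \<open>e = 6\<close> the entries of even and of odd
  index form two triples, and triples of any fixed sum are counted by the series of 3-cores; for
  \<open>e = l = 3\<close> the lattice is the hexagonal one and the decompositions come from the similarity of
  ratio \<open>\<surd>3\<close> that maps it into itself. Beads also show that a partition is a 3-core in the
  sense of rim hooks iff it is a core for \<open>e = 3\<close> and charge \<open>[0]\<close> (\<open>c3_core_series\<close>).

  Positivity of the products of three one-dimensional theta series amounts to representing a number
  as a sum of three squares with prescribed parities, for numbers congruent to 1 or 2 modulo 4 and to
  3 modulo 8. This is derived here from identities between functions of a real variable \<open>y \<in> (0,1)\<close>: the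
  product of the three theta functions is rewritten as a sum over odd \<open>D > 0\<close> of \<open>y\<close> to the power \<open>D\<^sup>2\<close>,
  times a hyperbolic cotangent or cosecant, times a finite sum of negative powers
  (\<open>G1_eq\<close>, \<open>G2_eq\<close>, \<open>G3_eq\<close>). The rewritten series has nonnegative coefficients and its term \<open>D = 1\<close> already
  contains every admissible exponent (\<open>representation_transfer\<close>). For \<open>e = 6\<close> the square of the series of
  3-cores has positive coefficients because every natural number is a sum of two values of
  \<open>x\<^sup>2 + x y + y\<^sup>2\<close>, which is proved by descent (\<open>all_two_hexnorms\<close>). The vanishing statements are
  congruence obstructions, except for three isolated coefficients, which are settled by a finite search.
\<close>

section \<open>Beta-numbers and the tuples of cores\<close>

lemma gen_series_bij:
  assumes "bij_betw f A B" "\<And>x. x \<in> A \<Longrightarrow> v (f x) = w x"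
  shows "gen_series A w = gen_series B v"
proof -
  have "card {x \<in> A. w x = int n} = card {x \<in> B. v x = int n}" for n
  proof (rule bij_betw_same_card[of f], rule bij_betwI')
    fix y assume "y \<in> {x \<in> B. v x = int n}"
    then obtain x where "x \<in> A" "y = f x" using assms(1) by (auto simp: bij_betw_def)
    with \<open>y \<in> _\<close> assms(2) show "\<exists>x\<in>{x \<in> A. w x = int n}. y = f x" by auto
  qed (use assms in \<open>auto simp: bij_betw_def inj_on_def\<close>)
  then show ?thesis by (simp add: gen_series_def)
qed

section \<open>Partitions and bead configurations\<close>

lemma beta_strict:
  assumes "is_partition lam" "i < j"
  shows "int (lam j) - int j + s < int (lam i) - int i + s"
proof -
  have "lam j \<le> lam i" using assms by (auto simp: is_partition_def antimono_def)
  then show ?thesis using assms(2) by linarith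
qed

lemma beta_card_above:
  assumes "is_partition lam"
  shows "card {y \<in> beta_set lam s. y > int (lam k) - int k + s} = k"
proof -
  let ?b = "\<lambda>k. int (lam k) - int k + s"
  have mono: "?b i > ?b j \<longleftrightarrow> i < j" for i j
    using beta_strict[OF assms, of i j s] beta_strict[OF assms, of j i s] by (cases i j rule: linorder_cases) auto
  have "{y \<in> beta_set lam s. y > ?b k} = ?b ` {..<k}"
    unfolding beta_set_def using mono by auto
  moreover have "inj_on ?b {..<k}"
    by (rule inj_onI) (metis mono less_irrefl linorder_neqE_nat)
  ultimately show ?thesis by (simp add: card_image)
qed

lemma partition_eventually_zero:
  assumes "is_partition lam" obtains K where "\<And>k. k \<ge> K \<Longrightarrow> lam k = 0"
proof -
  have "finite {k. lam k \<noteq> 0}" using assms by (simp add: is_partition_def)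
  then obtain K where "\<forall>k\<in>{k. lam k \<noteq> 0}. k < K" using finite_nat_set_iff_bounded by blast
  then show thesis using that[of K] by (metis linorder_not_less mem_Collect_eq)
qed

lemma beta_set_inj:
  assumes "is_partition lam" "is_partition mu" "beta_set lam s = beta_set mu s'"
  shows "lam = mu" "s = s'"
proof -
  have e: "int (lam k) - int k + s = int (mu k) - int k + s'" for k
  proof -
    have "int (lam k) - int k + s \<in> beta_set mu s'" using assms(3) by (auto simp: beta_set_def)
    then obtain j where j: "int (lam k) - int k + s = int (mu j) - int j + s'" by (auto simp: beta_set_def)
    then have "j = k" using beta_card_above[OF assms(1), of s k] beta_card_above[OF assms(2), of s' j] assms(3) by simp
    with j show ?thesis by simp
  qed
  obtain K1 where "\<And>k. k \<ge> K1 \<Longrightarrow> lam k = 0" using partition_eventually_zero[OF assms(1)] by blast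
  moreover obtain K2 where "\<And>k. k \<ge> K2 \<Longrightarrow> mu k = 0" using partition_eventually_zero[OF assms(2)] by blast
  ultimately show s: "s = s'" using e[of "max K1 K2"] by simp
  show "lam = mu" using e s by auto
qed

lemma psize_finite_support:
  assumes "finite A" "{k. lam k \<noteq> 0} \<subseteq> A" shows "psize lam = sum lam A"
  unfolding psize_def by (rule sum.mono_neutral_left) (use assms in auto)

lemma psize_cons:
  assumes "is_partition lam"
  shows "psize (case_nat m lam) = m + psize lam"
proof -
  obtain K where K: "\<And>k. k \<ge> K \<Longrightarrow> lam k = 0" using partition_eventually_zero[OF assms] by blast
  have 1: "psize lam = sum lam {..<K}"
    by (rule psize_finite_support) (use K linorder_not_less in blast)+
  have "psize (case_nat m lam) = sum (case_nat m lam) {..<Suc K}"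
  proof (rule psize_finite_support)
    show "{k. case_nat m lam k \<noteq> 0} \<subseteq> {..<Suc K}"
    proof (rule subsetI, rule ccontr)
      fix k assume k: "k \<in> {k. case_nat m lam k \<noteq> 0}" "k \<notin> {..<Suc K}"
      then obtain i where "k = Suc i" "i \<ge> K" by (cases k) auto
      with k K show False by simp
    qed
  qed simp
  then show ?thesis unfolding sum.lessThan_Suc_shift 1 by simp
qed

text \<open>
  Beads are added in increasing order: a new largest bead at distance \<open>m\<close> above the
  top of the filled part prepends a part \<open>m\<close>. The size is the sum of the beads minus
  the sum of the positions they would occupy if packed.
\<close>

lemma partition_of_beads:
  assumes "finite F" "\<And>x. x \<in> F \<Longrightarrow> x > L"
  shows "\<exists>lam. is_partition lam \<and> beta_set lam (L + int (card F)) = {..L} \<union> F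
     \<and> 2 * int (psize lam) = 2 * \<Sum>F - int (card F) * (2 * L + int (card F) + 1)"
  using assms
proof (induction F rule: finite_linorder_max_induct)
  case empty
  have "beta_set (\<lambda>_. 0) L = {..L}"
  proof (intro equalityI subsetI)
    fix x assume "x \<in> {..L}" then have "x = int 0 - int (nat (L - x)) + L" by simp
    then show "x \<in> beta_set (\<lambda>_. 0) L" unfolding beta_set_def by blast
  qed (auto simp: beta_set_def)
  moreover have "is_partition (\<lambda>_. 0)" by (simp add: is_partition_def antimono_def)
  ultimately show ?case by (intro exI[of _ "\<lambda>_. 0"]) (simp add: psize_def)
next
  case (insert m F)
  then obtain lam where lam: "is_partition lam" "beta_set lam (L + int (card F)) = {..L} \<union> F"
     "2 * int (psize lam) = 2 * \<Sum>F - int (card F) * (2 * L + int (card F) + 1)" by auto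
  define s where "s = L + int (card F) + 1"
  have mF: "m \<notin> F" using insert.hyps by auto
  then have s: "s = L + int (card (insert m F))" using insert.hyps by (simp add: s_def)
  have "int (lam 0) - int 0 + (L + int (card F)) \<in> beta_set lam (L + int (card F))" unfolding beta_set_def by blast
  then have "int (lam 0) + (L + int (card F)) < m"
    using lam(2) insert.prems[of m] insert.hyps(2) by auto
  then have ge: "m - s \<ge> int (lam 0)" by (simp add: s_def)
  let ?mu = "case_nat (nat (m - s)) lam"
  have bk: "int (?mu 0) - int 0 + s = m" "int (?mu (Suc k)) - int (Suc k) + s = int (lam k) - int k + (L + int (card F))" for k
    using ge by (auto simp: s_def)
  have "beta_set ?mu s = insert m (beta_set lam (L + int (card F)))"
  proof (intro equalityI subsetI)
    fix x assume "x \<in> beta_set ?mu s"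
    then obtain k where "x = int (?mu k) - int k + s" unfolding beta_set_def by blast
    then show "x \<in> insert m (beta_set lam (L + int (card F)))"
    proof (cases k)
      case (Suc i)
      with bk(2)[of i] \<open>x = _\<close> have "x = int (lam i) - int i + (L + int (card F))" by simp
      then show ?thesis by (auto simp: beta_set_def)
    qed (use bk(1) in simp)
  next
    fix x assume "x \<in> insert m (beta_set lam (L + int (card F)))"
    then show "x \<in> beta_set ?mu s" unfolding beta_set_def using bk[symmetric] by blast
  qed
  moreover have "is_partition ?mu"
  proof -
    have "antimono ?mu"
    proof (rule antimonoI)
      fix i j :: nat assume "i \<le> j"
      have a: "lam i \<le> lam j" if "j \<le> i" for i j using lam(1) that by (auto simp: is_partition_def antimono_def)
      have "lam i \<le> nat (m - s)" for i using a[of 0 i] ge by linarith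
      with a \<open>i \<le> j\<close> show "?mu j \<le> ?mu i" by (auto split: nat.split)
    qed
    moreover have "finite {k. ?mu k \<noteq> 0}"
    proof (rule finite_subset)
      show "{k. ?mu k \<noteq> 0} \<subseteq> insert 0 (Suc ` {k. lam k \<noteq> 0})"
      proof
        fix k assume "k \<in> {k. ?mu k \<noteq> 0}"
        then show "k \<in> insert 0 (Suc ` {k. lam k \<noteq> 0})" by (cases k) auto
      qed
      show "finite (insert 0 (Suc ` {k. lam k \<noteq> 0}))" using lam(1) by (simp add: is_partition_def)
    qed
    ultimately show ?thesis by (simp add: is_partition_def)
  qed
  moreover have "2 * int (psize ?mu) = 2 * \<Sum>(insert m F) - int (card (insert m F)) * (2 * L + int (card (insert m F)) + 1)"
    using lam(3) ge insert.hyps mF by (simp add: psize_cons[OF lam(1)] s_def algebra_simps)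
  ultimately show ?case using lam(2) s by (intro exI[of _ ?mu]) auto
qed

section \<open>Cores\<close>

text \<open>
  The number of the first empty level in residue class \<open>m\<close> of component
  \<open>j\<close>, if the dual abacus is that of the empty partition with charge
  \<open>t\<close>.
\<close>

definition runner_level :: "nat \<Rightarrow> int list \<Rightarrow> nat \<Rightarrow> nat \<Rightarrow> int" where
  "runner_level l t j m = (t ! m + int j) div int l"

definition core_beads :: "nat \<Rightarrow> nat \<Rightarrow> int list \<Rightarrow> nat \<Rightarrow> int set" where
  "core_beads e l t j = {k. (k - 1) div int e < runner_level l t j (nat ((k - 1) mod int e))}"

definition core_tuples :: "nat \<Rightarrow> int list \<Rightarrow> int list set" where
  "core_tuples e s = {t. length t = e \<and> (\<forall>j<length s. (\<Sum>m<e. runner_level (length s) t j m) = s ! j)}"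

text \<open>
  The sum of the sizes of the components, in terms of the runner levels; see
  \<open>partition_of_core_beads\<close> for a single component.
\<close>

definition core_size :: "nat \<Rightarrow> int list \<Rightarrow> int list \<Rightarrow> int" where
  "core_size e s t = (\<Sum>j<length s. (\<Sum>m<e. int e * (runner_level (length s) t j m * (runner_level (length s) t j m - 1))
      + 2 * (int m + 1) * runner_level (length s) t j m) - s ! j * (s ! j + 1)) div 2"

lemma LR_inj:
  assumes "l > 0" "e > 0" "1 \<le> j" "j \<le> l" "1 \<le> j'" "j' \<le> l" "LR l e (k, j) = LR l e (k', j')"
  shows "k = k'" "j = j'"
proof -
  define a a' where "a = (k - 1) div int e" and "a' = (k' - 1) div int e"
  have e1: "int l * (a + 1) - int j + 1 = int l * (a' + 1) - int j' + 1" and m: "nat ((k - 1) mod int e) = nat ((k' - 1) mod int e)"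
    using assms(7) by (simp_all add: LR_def a_def a'_def)
  have m': "(k - 1) mod int e = (k' - 1) mod int e"
    using m assms(2) by (simp add: eq_nat_nat_iff)
  have "a = (int l * a + (int l - int j)) div int l" using assms by simp
  also have "int l * a + (int l - int j) = int l * a' + (int l - int j')" using e1 by (simp add: algebra_simps)
  also have "\<dots> div int l = a'" using assms by simp
  finally have a: "a = a'" .
  then show "j = j'" using e1 by simp
  have "k - 1 = a * int e + (k - 1) mod int e" by (simp add: a_def)
  also have "\<dots> = a' * int e + (k' - 1) mod int e" unfolding a m' ..
  also have "\<dots> = k' - 1" by (simp add: a'_def)
  finally have "k - 1 = k' - 1" .
  then show "k = k'" by simp
qed

lemma LR_surj:
  assumes "l > 0" "e > 0" "1 \<le> m" "m \<le> e"
  obtains k j where "1 \<le> j" "j \<le> l" "LR l e (k, j) = (\<beta>, m)"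
proof -
  define a where "a = (\<beta> - 1) div int l"
  define j where "j = l - nat ((\<beta> - 1) mod int l)"
  define k where "k = a * int e + int m"
  have r: "0 \<le> (\<beta> - 1) mod int l" "(\<beta> - 1) mod int l < int l" using assms by auto
  define r where "r = (\<beta> - 1) mod int l"
  have "0 \<le> r" "r < int l" using r by (auto simp: r_def)
  then have j: "1 \<le> j" "j \<le> l" "int j = int l - (\<beta> - 1) mod int l"
    unfolding j_def r_def[symmetric] by linarith+
  have "k - 1 = a * int e + int (m - 1)" using assms by (simp add: k_def of_nat_diff)
  then have "(k - 1) div int e = a" "(k - 1) mod int e = int (m - 1)"
    using assms by (simp_all only:) simp_all
  moreover have "int l * (a + 1) - int j + 1 = \<beta>"
    unfolding j(3) a_def using mult_div_mod_eq[of "int l" "\<beta> - 1"] by (simp add: algebra_simps)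
  ultimately have "LR l e (k, j) = (\<beta>, m)" using assms by (simp add: LR_def)
  with j that show thesis by blast
qed

lemma abacus_empty: "abacus (replicate e (\<lambda>_. 0)) t = {(\<beta>, m). 1 \<le> m \<and> m \<le> e \<and> \<beta> \<le> t ! (m - 1)}"
proof -
  have "beta_set (\<lambda>_. 0) L = {..L}" for L
  proof (intro equalityI subsetI)
    fix x assume "x \<in> {..L}" then have "x = int 0 - int (nat (L - x)) + L" by simp
    then show "x \<in> beta_set (\<lambda>_. 0) L" unfolding beta_set_def by blast
  qed (auto simp: beta_set_def)
  then show ?thesis by (auto simp: abacus_def)
qed

lemma le_div_iff_mult_le: "c > 0 \<Longrightarrow> x \<le> y div c \<longleftrightarrow> x * c \<le> (y::int)"
proof
  assume c: "c > 0" "x \<le> y div c"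
  then have "x * c \<le> y div c * c" by (intro mult_right_mono) auto
  also have "\<dots> \<le> y" using c div_mult_mod_eq[of y c] pos_mod_sign[of c y] by linarith
  finally show "x * c \<le> y" .
next
  assume c: "c > 0" "x * c \<le> y"
  then have "x * c div c \<le> y div c" by (intro zdiv_mono1) auto
  then show "x \<le> y div c" using c by simp
qed

lemma LR_below_iff:
  assumes "l > 0" "e > 0" "1 \<le> j"
  shows "LR l e (k, j) \<in> abacus (replicate e (\<lambda>_. 0)) t \<longleftrightarrow> k \<in> core_beads e l t (j - 1)"
proof -
  define a where "a = (k - 1) div int e"
  define m where "m = nat ((k - 1) mod int e)"
  have "(k - 1) mod int e < int e" using assms by simp
  then have m: "m < e" by (simp add: m_def nat_less_iff assms)
  have "LR l e (k, j) \<in> abacus (replicate e (\<lambda>_. 0)) t \<longleftrightarrow> int l * (a + 1) - int j + 1 \<le> t ! m"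
    using m by (simp add: LR_def abacus_empty a_def m_def)
  also have "\<dots> \<longleftrightarrow> (a + 1) * int l \<le> t ! m + int (j - 1)" using assms by (simp add: of_nat_diff algebra_simps)
  also have "\<dots> \<longleftrightarrow> a + 1 \<le> (t ! m + int (j - 1)) div int l"
    using assms by (simp add: le_div_iff_mult_le)
  finally show ?thesis by (simp add: core_beads_def runner_level_def a_def m_def add1_zle_eq)
qed

text \<open>
  Level-rank duality is a bijection of the two abaci, so the abacus of a core is the full preimage
  of the abacus of an empty partition; \<open>LR_below_iff\<close> computes this preimage runner
  by runner.
\<close>

lemma is_core_iff:
  assumes l: "length s > 0" and e: "e > 0"
  shows "is_core e s \<Lambda> \<longleftrightarrow> is_multipartition (length s) \<Lambda> \<and>
     (\<exists>t. length t = e \<and> (\<forall>j<length s. beta_set (\<Lambda> ! j) (s ! j) = core_beads e (length s) t j))"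
proof -
  let ?l = "length s"
  have "LR ?l e ` abacus \<Lambda> s = abacus (replicate e (\<lambda>_. 0)) t \<longleftrightarrow> (\<forall>j<?l. beta_set (\<Lambda> ! j) (s ! j) = core_beads e ?l t j)"
    (is "?A = ?B \<longleftrightarrow> ?R") if m: "is_multipartition ?l \<Lambda>" for t
  proof -
    have len: "length \<Lambda> = ?l" using m by (simp add: is_multipartition_def)
    have A: "LR ?l e (k, Suc j) \<in> ?A \<longleftrightarrow> k \<in> beta_set (\<Lambda> ! j) (s ! j)" if "j < ?l" for k j
    proof
      assume "LR ?l e (k, Suc j) \<in> ?A"
      then obtain k' j' where kj: "LR ?l e (k, Suc j) = LR ?l e (k', j')" "(k', j') \<in> abacus \<Lambda> s" by auto
      then have "1 \<le> j'" "j' \<le> ?l" by (auto simp: abacus_def len)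
      with LR_inj[OF l e _ _ _ _ kj(1)] that kj(2) show "k \<in> beta_set (\<Lambda> ! j) (s ! j)"
        by (auto simp: abacus_def)
    next
      assume "k \<in> beta_set (\<Lambda> ! j) (s ! j)"
      then have "(k, Suc j) \<in> abacus \<Lambda> s" using that by (simp add: abacus_def len)
      then show "LR ?l e (k, Suc j) \<in> ?A" by (rule imageI)
    qed
    have B: "LR ?l e (k, Suc j) \<in> ?B \<longleftrightarrow> k \<in> core_beads e ?l t j" for k j
      using LR_below_iff[OF l e, of "Suc j" k t] by simp
    have AS: "?A \<subseteq> {(\<beta>, m). 1 \<le> m \<and> m \<le> e}"
    proof -
      have "nat ((k - 1) mod int e) + 1 \<le> e" for k :: int
      proof -
        have "(k - 1) mod int e < int e" using e by simp
        then have "nat ((k - 1) mod int e) < e" using e by (simp add: nat_less_iff)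
        then show ?thesis by simp
      qed
      then show ?thesis by (auto simp: LR_def)
    qed
    show ?thesis
    proof
      assume "?A = ?B"
      then show ?R using A B by blast
    next
      assume R: ?R
      show "?A = ?B"
      proof (intro equalityI subsetI)
        fix p assume "p \<in> ?A"
        then obtain \<beta> mm where p: "p = (\<beta>, mm)" "1 \<le> mm" "mm \<le> e" using AS by auto
        obtain k j where "1 \<le> j" "j \<le> ?l" "LR ?l e (k, j) = p" using LR_surj[OF l e p(2,3)] p(1) by metis
        with A[of "j-1" k] B[of k "j-1"] R \<open>p \<in> ?A\<close> show "p \<in> ?B" by simp
      next
        fix p assume "p \<in> ?B"
        then obtain \<beta> mm where p: "p = (\<beta>, mm)" "1 \<le> mm" "mm \<le> e" by (auto simp: abacus_empty)
        obtain k j where "1 \<le> j" "j \<le> ?l" "LR ?l e (k, j) = p" using LR_surj[OF l e p(2,3)] p(1) by metis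
        with A[of "j-1" k] B[of k "j-1"] R \<open>p \<in> ?B\<close> show "p \<in> ?A" by simp
      qed
    qed
  qed
  then show ?thesis unfolding is_core_def by blast
qed

lemma runner_level_inj:
  assumes "l > 0" "\<And>j. j < l \<Longrightarrow> runner_level l t j m = runner_level l t' j m"
  shows "t ! m = t' ! m"
proof -
  have *: "\<not> t ! m < t' ! m" if e: "\<And>j. j < l \<Longrightarrow> runner_level l t j m = runner_level l t' j m" for t t'
  proof
    assume lt: "t ! m < t' ! m"
    define j where "j = nat ((- (t' ! m)) mod int l)"
    have r: "0 \<le> (- (t' ! m)) mod int l" "(- (t' ! m)) mod int l < int l" using assms(1) by auto
    then have j: "j < l" "int j = (- (t' ! m)) mod int l" by (auto simp: j_def)
    define c where "c = (t' ! m + int j) div int l"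
    have "(t' ! m + int j) mod int l = 0" unfolding j(2) by (simp add: mod_add_right_eq)
    then have "t' ! m + int j = c * int l" unfolding c_def using div_mult_mod_eq[of "t' ! m + int j" "int l"] by simp
    moreover have "c * int l \<le> t ! m + int j"
      using e[OF j(1)] assms(1) by (simp add: runner_level_def c_def flip: le_div_iff_mult_le)
    ultimately show False using lt by simp
  qed
  show ?thesis using *[of t t'] *[of t' t] assms(2) by force
qed

lemma core_beads_eq_iff:
  assumes "e > 0" shows "core_beads e l t j = core_beads e l t' j \<longleftrightarrow> (\<forall>m<e. runner_level l t j m = runner_level l t' j m)"
proof
  assume eq: "core_beads e l t j = core_beads e l t' j"
  show "\<forall>m<e. runner_level l t j m = runner_level l t' j m"
  proof (intro allI impI)
    fix m assume m: "m < e"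
    have mem: "a * int e + int m + 1 \<in> core_beads e l t j \<longleftrightarrow> a < runner_level l t j m" for a t
      using m by (simp add: core_beads_def)
    then have "a < runner_level l t j m \<longleftrightarrow> a < runner_level l t' j m" for a using eq by metis
    from this[of "runner_level l t j m"] this[of "runner_level l t' j m"] show "runner_level l t j m = runner_level l t' j m" by simp
  qed
next
  assume eq: "\<forall>m<e. runner_level l t j m = runner_level l t' j m"
  have "nat ((k - 1) mod int e) < e" for k :: int using assms by (simp add: nat_less_iff)
  then show "core_beads e l t j = core_beads e l t' j" using eq by (simp add: core_beads_def)
qed

lemma gauss_int_sum: "2 * (\<Sum>i<n. int i + c) = int n * (int n - 1 + 2 * c)"
  by (induction n) (auto simp: algebra_simps)

text \<open>
  The beads consist of everything below a common level together with arithmetic progressions of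
  difference \<open>e\<close>, whose sums are evaluated by \<open>gauss_int_sum\<close>.
\<close>

lemma partition_of_core_beads:
  assumes e: "e > 0"
  shows "\<exists>lam. is_partition lam \<and> beta_set lam (\<Sum>m<e. runner_level l t j m) = core_beads e l t j
    \<and> 2 * int (psize lam) = (\<Sum>m<e. int e * (runner_level l t j m * (runner_level l t j m - 1)) + 2 * (int m + 1) * runner_level l t j m)
         - (\<Sum>m<e. runner_level l t j m) * ((\<Sum>m<e. runner_level l t j m) + 1)"
proof -
  define n where "n m = runner_level l t j m" for m
  define N where "N = Max (insert 0 ((\<lambda>m. - n m) ` {..<e}))"
  have N: "N \<ge> 0" "\<And>m. m < e \<Longrightarrow> n m + N \<ge> 0"
  proof -
    show "N \<ge> 0" unfolding N_def by (rule Max_ge) auto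
    fix m assume "m < e"
    then have "- n m \<le> N" unfolding N_def by (intro Max_ge) auto
    then show "n m + N \<ge> 0" by simp
  qed
  define L where "L = - int e * N"
  let ?k = "\<lambda>(m,i). (int i - N) * int e + int m + 1"
  let ?I = "Sigma {..<e} (\<lambda>m. {..<nat (n m + N)})"
  define F where "F = ?k ` ?I"
  have dm: "(?k (m,i) - 1) div int e = int i - N" "(?k (m,i) - 1) mod int e = int m" if "m < e" for m i
    using that by simp_all
  have inj: "inj_on ?k ?I"
  proof (rule inj_onI)
    fix p p' assume p: "p \<in> ?I" "p' \<in> ?I" "?k p = ?k p'"
    obtain m i m' i' where d: "p = (m,i)" "p' = (m',i')" by fastforce
    have "m < e" "m' < e" using p d by auto
    have E: "(int i - N) * int e + int m = (int i' - N) * int e + int m'" using p(3) d by simp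
    have D: "((int i - N) * int e + int m) div int e = int i - N" "((int i - N) * int e + int m) mod int e = int m"
      "((int i' - N) * int e + int m') div int e = int i' - N" "((int i' - N) * int e + int m') mod int e = int m'"
      using \<open>m < e\<close> \<open>m' < e\<close> by simp_all
    have "int i - N = int i' - N" "int m = int m'" using D unfolding E by simp_all
    then show "p = p'" using d by simp
  qed
  have S: "sum f F = (\<Sum>m<e. \<Sum>i<nat (n m + N). f (?k (m,i)))" for f :: "int \<Rightarrow> int"
    unfolding F_def by (subst sum.reindex[OF inj], subst sum.Sigma) (auto intro!: sum.cong)
  have fin: "finite F" unfolding F_def by auto
  have FL: "x > L" if xF: "x \<in> F" for x
  proof -
    obtain p where p: "p \<in> ?I" "x = ?k p" using xF unfolding F_def by blast
    obtain m i where "p = (m,i)" by (cases p)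
    with p have x: "x = ?k (m,i)" "m < e" by auto
    have "int i * int e \<ge> 0" by simp
    then show ?thesis unfolding x L_def by (simp add: algebra_simps add_pos_nonneg)
  qed
  have card: "int (card F) = (\<Sum>m<e. n m) + int e * N"
  proof -
    have "int (card F) = (\<Sum>m<e. int (nat (n m + N)))" using S[of "\<lambda>_. 1"] by simp
    also have "\<dots> = (\<Sum>m<e. n m + N)" by (rule sum.cong) (use N in auto)
    finally show ?thesis by (simp add: sum.distrib)
  qed
  have "{..L} \<union> F = core_beads e l t j"
  proof (intro equalityI subsetI)
    fix x assume "x \<in> {..L} \<union> F"
    then show "x \<in> core_beads e l t j"
    proof
      assume "x \<in> {..L}"
      then have "x - 1 < - N * int e" by (simp add: L_def mult.commute)
      then have a: "(x - 1) div int e < - N" using le_div_iff_mult_le[of "int e" "-N" "x - 1"] e by force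
      have "nat ((x - 1) mod int e) < e" using e by (simp add: nat_less_iff)
      with N(2)[OF this] a show ?thesis by (simp add: core_beads_def n_def)
    next
      assume "x \<in> F"
      then obtain p where p: "p \<in> ?I" "x = ?k p" unfolding F_def by blast
      obtain m i where "p = (m,i)" by (cases p)
      with p have x: "x = ?k (m,i)" "m < e" "i < nat (n m + N)" by auto
      then show ?thesis using dm[OF x(2), of i] by (simp add: core_beads_def n_def [symmetric])
    qed
  next
    fix x assume x: "x \<in> core_beads e l t j"
    define a m where "a = (x - 1) div int e" and "m = nat ((x - 1) mod int e)"
    have m: "m < e" "int m = (x - 1) mod int e" using e by (auto simp: m_def nat_less_iff)
    have xe: "x = a * int e + int m + 1" unfolding m a_def using div_mult_mod_eq[of "x - 1" "int e"] by simp
    have an: "a < n m" using x by (simp add: core_beads_def a_def m_def n_def)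
    show "x \<in> {..L} \<union> F"
    proof (cases "a \<ge> - N")
      case True
      then have "x = ?k (m, nat (a + N))" "(m, nat (a + N)) \<in> ?I" using an m xe by auto
      then show ?thesis unfolding F_def by blast
    next
      case False
      then have "(a + 1) * int e \<le> - N * int e" by (intro mult_right_mono) auto
      then show ?thesis using m(1) by (simp add: xe L_def algebra_simps)
    qed
  qed
  moreover have "2 * \<Sum>F - int (card F) * (2 * L + int (card F) + 1)
     = (\<Sum>m<e. int e * (n m * (n m - 1)) + 2 * (int m + 1) * n m) - (\<Sum>m<e. n m) * ((\<Sum>m<e. n m) + 1)"
  proof -
    have inner: "2 * (\<Sum>i<nat (n m + N). ?k (m,i)) = int e * (n m * (n m - 1)) + 2 * (int m + 1) * n m + (2 * (int m + 1) * N - int e * (N * (N + 1)))" if "m < e" for m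
    proof -
      have "(\<Sum>i<nat (n m + N). ?k (m,i)) = (\<Sum>i<nat (n m + N). int e * (int i + - N) + (int m + 1))"
        by (rule sum.cong) (auto simp: algebra_simps)
      also have "\<dots> = int e * (\<Sum>i<nat (n m + N). int i + - N) + int (nat (n m + N)) * (int m + 1)"
        by (simp add: sum.distrib sum_distrib_left)
      finally have "2 * (\<Sum>i<nat (n m + N). ?k (m,i)) = int e * (2 * (\<Sum>i<nat (n m + N). int i + - N)) + 2 * (int (nat (n m + N)) * (int m + 1))" by simp
      also have "\<dots> = int e * ((n m + N) * (n m + N - 1 + 2 * (- N))) + 2 * ((n m + N) * (int m + 1))"
        unfolding gauss_int_sum using N(2)[OF that] by simp
      finally show ?thesis by (simp add: algebra_simps)
    qed
    have g: "2 * (\<Sum>m<e. int m + 1) = int e * (int e + 1)" using gauss_int_sum[where n = e and c = 1] by simp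
    have "2 * \<Sum>F = (\<Sum>m<e. 2 * (\<Sum>i<nat (n m + N). ?k (m,i)))"
      using S[of "\<lambda>x. x"] by (simp add: sum_distrib_left)
    also have "\<dots> = (\<Sum>m<e. int e * (n m * (n m - 1)) + 2 * (int m + 1) * n m + (2 * (int m + 1) * N - int e * (N * (N + 1))))"
      by (rule sum.cong) (use inner in auto)
    also have "\<dots> = (\<Sum>m<e. int e * (n m * (n m - 1)) + 2 * (int m + 1) * n m) + (\<Sum>m<e. 2 * (int m + 1) * N - int e * (N * (N + 1)))"
      by (rule sum.distrib)
    also have "(\<Sum>m<e. 2 * (int m + 1) * N - int e * (N * (N + 1))) = (2 * (\<Sum>m<e. int m + 1)) * N - int e * (int e * (N * (N + 1)))"
      by (simp add: sum_subtractf sum_distrib_left sum_distrib_right mult.assoc)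
    finally have "2 * \<Sum>F = (\<Sum>m<e. int e * (n m * (n m - 1)) + 2 * (int m + 1) * n m) + (int e * (int e + 1) * N - int e * (int e * (N * (N + 1))))"
      unfolding g .
    then show ?thesis unfolding card L_def by (simp add: algebra_simps)
  qed
  moreover have "L + int (card F) = (\<Sum>m<e. n m)" by (simp add: card L_def)
  ultimately show ?thesis using partition_of_beads[OF fin FL] unfolding n_def by metis
qed

text \<open>
  A core determines \<open>t\<close> because the levels of all components in one residue class
  determine \<open>t\<^sub>m\<close>; conversely each tuple yields bead sets, and the charge
  condition says that they have the right charge.
\<close>

theorem core_tuples_bij:
  assumes l: "length s > 0" and e: "e > 0"
  shows "\<exists>f. bij_betw f {\<Lambda>. is_core e s \<Lambda>} (core_tuples e s) \<and> (\<forall>\<Lambda>. is_core e s \<Lambda> \<longrightarrow> core_size e s (f \<Lambda>) = int (msize \<Lambda>))"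
proof -
  let ?l = "length s"
  define P where "P t j lam \<longleftrightarrow> is_partition lam \<and> beta_set lam (\<Sum>m<e. runner_level ?l t j m) = core_beads e ?l t j
    \<and> 2 * int (psize lam) = (\<Sum>m<e. int e * (runner_level ?l t j m * (runner_level ?l t j m - 1)) + 2 * (int m + 1) * runner_level ?l t j m)
         - (\<Sum>m<e. runner_level ?l t j m) * ((\<Sum>m<e. runner_level ?l t j m) + 1)" for t j lam
  define pt where "pt t j = (SOME lam. P t j lam)" for t j
  have pt: "P t j (pt t j)" for t j
  proof -
    have "\<exists>lam. P t j lam" using partition_of_core_beads[OF e, of ?l t j] unfolding P_def .
    then show ?thesis unfolding pt_def by (rule someI_ex)
  qed
  define f where "f t = map (pt t) [0..<?l]" for t
  have ch: "(\<Sum>m<e. runner_level ?l t j m) = s ! j" if "t \<in> core_tuples e s" "j < ?l" for t j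
    using that by (simp add: core_tuples_def)
  have beta: "beta_set (pt t j) (s ! j) = core_beads e ?l t j" "is_partition (pt t j)" if "t \<in> core_tuples e s" "j < ?l" for t j
    using pt[of t j] ch[OF that] by (auto simp: P_def)
  have "bij_betw f (core_tuples e s) {\<Lambda>. is_core e s \<Lambda>}"
  proof (rule bij_betwI')
    fix t t' assume t: "t \<in> core_tuples e s" "t' \<in> core_tuples e s"
    show "f t = f t' \<longleftrightarrow> t = t'"
    proof
      assume "f t = f t'"
      then have "pt t j = pt t' j" if "j < ?l" for j
        using that unfolding f_def by (metis nth_map_upt add.left_neutral diff_zero map_eq_conv atLeastLessThan_iff le0 set_upt)
      then have "core_beads e ?l t j = core_beads e ?l t' j" if "j < ?l" for j
        using beta(1)[OF t(1) that] beta(1)[OF t(2) that] that by simp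
      then have "t ! m = t' ! m" if "m < e" for m
        using that by (intro runner_level_inj[OF l]) (auto simp: core_beads_eq_iff[OF e])
      then show "t = t'" using t by (intro nth_equalityI) (auto simp: core_tuples_def)
    qed simp
  next
    fix t assume t: "t \<in> core_tuples e s"
    then show "f t \<in> {\<Lambda>. is_core e s \<Lambda>}"
      unfolding mem_Collect_eq is_core_iff[OF l e]
      by (intro conjI exI[of _ t]) (auto simp: f_def is_multipartition_def beta core_tuples_def)
  next
    fix \<Lambda> assume "\<Lambda> \<in> {\<Lambda>. is_core e s \<Lambda>}"
    then obtain t where t: "is_multipartition ?l \<Lambda>" "length t = e" "\<And>j. j < ?l \<Longrightarrow> beta_set (\<Lambda> ! j) (s ! j) = core_beads e ?l t j"
      by (auto simp: is_core_iff[OF l e])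
    have len: "length \<Lambda> = ?l" using t by (simp add: is_multipartition_def)
    have eq: "\<Lambda> ! j = pt t j" "(\<Sum>m<e. runner_level ?l t j m) = s ! j" if "j < ?l" for j
    proof -
      have "is_partition (\<Lambda> ! j)" using t(1) that by (simp add: is_multipartition_def)
      moreover have "is_partition (pt t j)" "beta_set (\<Lambda> ! j) (s ! j) = beta_set (pt t j) (\<Sum>m<e. runner_level ?l t j m)"
        using pt[of t j] t(3)[OF that] by (auto simp: P_def)
      ultimately show "\<Lambda> ! j = pt t j" "(\<Sum>m<e. runner_level ?l t j m) = s ! j"
        using beta_set_inj by blast+
    qed
    have "t \<in> core_tuples e s" using t(2) eq(2) by (simp add: core_tuples_def)
    moreover have "\<Lambda> = f t" by (rule nth_equalityI) (auto simp: f_def len eq)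
    ultimately show "\<exists>t\<in>core_tuples e s. \<Lambda> = f t" by blast
  qed
  moreover have "int (msize (f t)) = core_size e s t" if t: "t \<in> core_tuples e s" for t
  proof -
    have "msize (f t) = (\<Sum>j<?l. psize (pt t j))"
      unfolding msize_def f_def by (simp add: interv_sum_list_conv_sum_set_nat o_def atLeast0LessThan)
    then have "2 * int (msize (f t)) = (\<Sum>j<?l. 2 * int (psize (pt t j)))" by (simp add: sum_distrib_left)
    also have "\<dots> = (\<Sum>j<?l. (\<Sum>m<e. int e * (runner_level ?l t j m * (runner_level ?l t j m - 1))
        + 2 * (int m + 1) * runner_level ?l t j m) - s ! j * (s ! j + 1))"
    proof (rule sum.cong)
      fix j assume "j \<in> {..<?l}"
      then have "j < ?l" by simp
      show "2 * int (psize (pt t j)) = (\<Sum>m<e. int e * (runner_level ?l t j m * (runner_level ?l t j m - 1))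
        + 2 * (int m + 1) * runner_level ?l t j m) - s ! j * (s ! j + 1)"
        using pt[of t j] ch[OF t \<open>j < ?l\<close>] unfolding P_def by simp
    qed simp
    finally show ?thesis unfolding core_size_def by simp
  qed
  ultimately have b: "bij_betw f (core_tuples e s) {\<Lambda>. is_core e s \<Lambda>}" and m: "\<And>t. t \<in> core_tuples e s \<Longrightarrow> int (msize (f t)) = core_size e s t"
    by blast+
  have "core_size e s (the_inv_into (core_tuples e s) f \<Lambda>) = int (msize \<Lambda>)" if "is_core e s \<Lambda>" for \<Lambda>
  proof -
    have "\<Lambda> \<in> f ` core_tuples e s" using b that by (simp add: bij_betw_def)
    then obtain t where "t \<in> core_tuples e s" "\<Lambda> = f t" by blast
    then show ?thesis using m b by (simp add: bij_betw_def the_inv_into_f_f)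
  qed
  with bij_betw_the_inv_into[OF b] show ?thesis by blast
qed

theorem core_series_tuples:
  assumes l: "length s > 0" and e: "e > 0"
  shows "core_series e s = gen_series (core_tuples e s) (core_size e s)"
proof -
  obtain f where f: "bij_betw f {\<Lambda>. is_core e s \<Lambda>} (core_tuples e s)" "\<And>\<Lambda>. is_core e s \<Lambda> \<Longrightarrow> core_size e s (f \<Lambda>) = int (msize \<Lambda>)"
    using core_tuples_bij[OF l e] by blast
  show ?thesis unfolding core_series_def by (rule gen_series_bij[OF f(1)]) (use f(2) in auto)
qed

section \<open>Generating series of weighted sets\<close>

text \<open>
  The finiteness condition under which \<open>gen_series\<close> behaves additively and
  multiplicatively; without it the cardinality of an infinite fibre would count as zero.
\<close>

definition graded :: "'a set \<Rightarrow> ('a \<Rightarrow> int) \<Rightarrow> bool" where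
  "graded A w \<longleftrightarrow> (\<forall>x\<in>A. 0 \<le> w x) \<and> (\<forall>n. finite {x\<in>A. w x = n})"

lemma nth_gen_series: "fps_nth (gen_series A w) n = int (card {x\<in>A. w x = int n})"
  by (simp add: gen_series_def)

lemma nth_gen_series_pos:
  assumes "graded A w" shows "fps_nth (gen_series A w) n > 0 \<longleftrightarrow> (\<exists>x\<in>A. w x = int n)"
proof -
  have "finite {x\<in>A. w x = int n}" using assms by (simp add: graded_def)
  then show ?thesis by (simp add: nth_gen_series card_gt_0_iff) blast
qed

lemma graded_bij:
  assumes "bij_betw f A B" "\<And>x. x \<in> A \<Longrightarrow> v (f x) = w x" "graded A w"
  shows "graded B v"
  unfolding graded_def
proof (intro conjI ballI allI)
  have B: "B = f ` A" using assms(1) by (simp add: bij_betw_def)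
  show "0 \<le> v y" if "y \<in> B" for y using that assms by (auto simp: B graded_def)
  show "finite {y\<in>B. v y = n}" for n
  proof (rule finite_subset)
    show "{y\<in>B. v y = n} \<subseteq> f ` {x\<in>A. w x = n}" using assms(2) by (auto simp: B)
    show "finite (f ` {x\<in>A. w x = n})" using assms(3) by (simp add: graded_def)
  qed
qed

lemma graded_cong:
  assumes "A = B" "\<And>x. x \<in> B \<Longrightarrow> w x = v x" shows "graded A w \<longleftrightarrow> graded B v"
proof -
  have "{x \<in> B. w x = n} = {x \<in> B. v x = n}" for n using assms(2) by auto
  then show ?thesis using assms by (simp add: graded_def)
qed

lemma gen_series_cong:
  assumes "A = B" "\<And>x. x \<in> B \<Longrightarrow> w x = v x" shows "gen_series A w = gen_series B v"
proof -
  have "{x \<in> B. w x = n} = {x \<in> B. v x = n}" for n using assms(2) by auto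
  then show ?thesis using assms by (simp add: gen_series_def)
qed

lemma graded_subset: "graded B w \<Longrightarrow> A \<subseteq> B \<Longrightarrow> graded A w"
proof -
  assume g: "graded B w" and s: "A \<subseteq> B"
  have "finite {x \<in> A. w x = n}" for n
    by (rule finite_subset[of _ "{x \<in> B. w x = n}"]) (use g s in \<open>auto simp: graded_def\<close>)
  with g s show ?thesis by (auto simp: graded_def)
qed

lemma graded_Un: "graded A w \<Longrightarrow> graded B w \<Longrightarrow> graded (A \<union> B) w"
proof -
  have "{x \<in> A \<union> B. w x = n} = {x \<in> A. w x = n} \<union> {x \<in> B. w x = n}" for n by auto
  then show "graded A w \<Longrightarrow> graded B w \<Longrightarrow> graded (A \<union> B) w" by (auto simp: graded_def)
qed

lemma gen_series_Un:
  assumes "graded A w" "graded B w" "A \<inter> B = {}"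
  shows "gen_series (A \<union> B) w = gen_series A w + gen_series B w"
proof (rule fps_ext)
  fix n
  have "{x \<in> A \<union> B. w x = int n} = {x \<in> A. w x = int n} \<union> {x \<in> B. w x = int n}" by auto
  moreover have "card ({x \<in> A. w x = int n} \<union> {x \<in> B. w x = int n}) = card {x \<in> A. w x = int n} + card {x \<in> B. w x = int n}"
    by (rule card_Un_disjoint) (use assms in \<open>auto simp: graded_def\<close>)
  ultimately show "fps_nth (gen_series (A \<union> B) w) n = fps_nth (gen_series A w + gen_series B w) n"
    by (simp add: nth_gen_series)
qed

lemma gen_series_UNION:
  assumes "finite I" "\<And>i. i \<in> I \<Longrightarrow> graded (A i) w" "\<And>i j. i \<in> I \<Longrightarrow> j \<in> I \<Longrightarrow> i \<noteq> j \<Longrightarrow> A i \<inter> A j = {}"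
  shows "gen_series (\<Union>i\<in>I. A i) w = (\<Sum>i\<in>I. gen_series (A i) w)" "graded (\<Union>i\<in>I. A i) w"
  using assms
proof (induction I rule: finite_induct)
  case empty
  { case 1 show ?case by (simp add: gen_series_def fps_zero_def) }
  { case 2 show ?case by (simp add: graded_def) }
next
  case (insert i I)
  { case 1
    then have "gen_series (A i \<union> (\<Union>i\<in>I. A i)) w = gen_series (A i) w + gen_series (\<Union>i\<in>I. A i) w"
      using insert by (intro gen_series_Un) blast+
    then show ?case using 1 insert by simp }
  { case 2 then show ?case using insert by (simp add: graded_Un) }
qed

lemma graded_shift: "graded A w \<Longrightarrow> graded A (\<lambda>x. w x + int k)"
proof -
  assume g: "graded A w"
  have "{x \<in> A. w x + int k = n} = {x \<in> A. w x = n - int k}" for n by auto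
  with g show ?thesis by (auto simp: graded_def)
qed

lemma gen_series_shift:
  assumes "graded A w"
  shows "gen_series A (\<lambda>x. w x + int k) = q ^ k * gen_series A w"
proof (rule fps_ext)
  fix n
  show "fps_nth (gen_series A (\<lambda>x. w x + int k)) n = fps_nth (q ^ k * gen_series A w) n"
  proof (cases "n < k")
    case True
    then have E: "{x \<in> A. w x + int k = int n} = {}" using assms by (force simp: graded_def)
    show ?thesis using True unfolding nth_gen_series fps_X_power_mult_nth E by simp
  next
    case False
    then have "w x + int k = int n \<longleftrightarrow> w x = int (n - k)" for x by auto
    then show ?thesis using False unfolding nth_gen_series fps_X_power_mult_nth by simp
  qed
qed

lemma graded_times:
  assumes "graded A w" "graded B v"
  shows "graded (A \<times> B) (\<lambda>(a,b). w a + v b)"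
  unfolding graded_def
proof (intro conjI ballI allI)
  fix n :: int
  have "{p \<in> A \<times> B. (case p of (a,b) \<Rightarrow> w a + v b) = n} \<subseteq> (\<Union>i\<in>{0..n}. {a\<in>A. w a = i} \<times> {b\<in>B. v b = n - i})"
    using assms by (auto simp: graded_def)
  moreover have "finite (\<Union>i\<in>{0..n}. {a\<in>A. w a = i} \<times> {b\<in>B. v b = n - i})" using assms by (auto simp: graded_def)
  ultimately show "finite {p \<in> A \<times> B. (case p of (a,b) \<Rightarrow> w a + v b) = n}" by (rule finite_subset)
qed (use assms in \<open>auto simp: graded_def\<close>)

lemma gen_series_times:
  assumes "graded A w" "graded B v"
  shows "gen_series (A \<times> B) (\<lambda>(a,b). w a + v b) = gen_series A w * gen_series B v"
proof (rule fps_ext)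
  fix n :: nat
  let ?S = "\<lambda>i. {a\<in>A. w a = int i} \<times> {b\<in>B. v b = int (n - i)}"
  have "{p \<in> A \<times> B. (case p of (a,b) \<Rightarrow> w a + v b) = int n} = (\<Union>i\<in>{0..n}. ?S i)"
  proof (intro equalityI subsetI)
    fix p assume p: "p \<in> {p \<in> A \<times> B. (case p of (a,b) \<Rightarrow> w a + v b) = int n}"
    then obtain a b where ab: "p = (a,b)" "a \<in> A" "b \<in> B" "w a + v b = int n" by auto
    have "0 \<le> w a" "0 \<le> v b" using ab assms by (auto simp: graded_def)
    then have "nat (w a) \<in> {0..n}" "p \<in> ?S (nat (w a))" using ab by auto
    then show "p \<in> (\<Union>i\<in>{0..n}. ?S i)" by blast
  qed auto
  then have "card {p \<in> A \<times> B. (case p of (a,b) \<Rightarrow> w a + v b) = int n} = card (\<Union>i\<in>{0..n}. ?S i)" by simp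
  also have "\<dots> = (\<Sum>i\<in>{0..n}. card (?S i))"
    by (rule card_UN_disjoint) (use assms in \<open>auto simp: graded_def\<close>)
  finally show "fps_nth (gen_series (A \<times> B) (\<lambda>(a,b). w a + v b)) n = fps_nth (gen_series A w * gen_series B v) n"
    by (simp add: nth_gen_series fps_mult_nth card_cartesian_product)
qed

lemma graded_scale: assumes "graded A w" "k > 0" shows "graded A (\<lambda>x. int k * w x)"
  unfolding graded_def
proof (intro conjI ballI allI)
  fix n :: int
  have "{x \<in> A. int k * w x = n} \<subseteq> {x \<in> A. w x = n div int k}" using assms(2) by auto
  moreover have "finite {x \<in> A. w x = n div int k}" using assms(1) by (simp add: graded_def)
  ultimately show "finite {x \<in> A. int k * w x = n}" by (rule finite_subset)
qed (use assms in \<open>auto simp: graded_def\<close>)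

lemma gen_series_compose:
  assumes "k > 0"
  shows "gen_series A w oo q ^ k = gen_series A (\<lambda>x. int k * w x)"
proof (rule fps_ext)
  fix n :: nat
  show "fps_nth (gen_series A w oo q ^ k) n = fps_nth (gen_series A (\<lambda>x. int k * w x)) n"
  proof (cases "k dvd n")
    case True
    then obtain m where m: "n = k * m" by blast
    have "int k * w x = int n \<longleftrightarrow> w x = int m" for x using assms m by auto
    then show ?thesis using assms by (simp add: fps_nth_compose_X_power nth_gen_series m)
  next
    case False
    have "int k * w x \<noteq> int n" for x
    proof
      assume "int k * w x = int n"
      then have "int k dvd int n" by (metis dvd_triv_left)
      with False show False by simp
    qed
    then show ?thesis using False by (simp add: fps_nth_compose_X_power nth_gen_series)
  qed
qed

section \<open>Finiteness\<close>

lemma partition_part_le: "is_partition lam \<Longrightarrow> lam k \<le> psize lam"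
proof (cases "lam k = 0")
  case False
  assume p: "is_partition lam"
  show ?thesis unfolding psize_def by (rule member_le_sum) (use p False in \<open>auto simp: is_partition_def\<close>)
qed simp

lemma partition_length_le: assumes "is_partition lam" "k \<ge> psize lam" shows "lam k = 0"
proof (rule ccontr)
  assume nz: "lam k \<noteq> 0"
  have "lam i \<noteq> 0" if "i \<le> k" for i
  proof -
    have "lam k \<le> lam i" using assms(1) that by (auto simp: is_partition_def antimono_def)
    with nz show ?thesis by simp
  qed
  then have "{..k} \<subseteq> {k. lam k \<noteq> 0}" by auto
  then have "sum lam {..k} \<le> psize lam"
    unfolding psize_def by (rule sum_mono2[rotated]) (use assms in \<open>auto simp: is_partition_def\<close>)
  moreover have "(\<Sum>i\<in>{..k}. 1) \<le> sum lam {..k}" by (rule sum_mono) (use \<open>\<And>i. i \<le> k \<Longrightarrow> lam i \<noteq> 0\<close> in force)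
  ultimately show False using assms(2) by simp
qed

text \<open>
  Both the parts and their number are bounded by the size.
\<close>

lemma finite_partitions: "finite {lam. is_partition lam \<and> psize lam \<le> n}"
proof (rule inj_on_finite[where f = "\<lambda>lam. map lam [0..<n]"])
  show "inj_on (\<lambda>lam. map lam [0..<n]) {lam. is_partition lam \<and> psize lam \<le> n}"
  proof (rule inj_onI)
    fix lam mu assume a: "lam \<in> {lam. is_partition lam \<and> psize lam \<le> n}" "mu \<in> {lam. is_partition lam \<and> psize lam \<le> n}"
      "map lam [0..<n] = map mu [0..<n]"
    show "lam = mu"
    proof
      fix k show "lam k = mu k"
      proof (cases "k < n")
        case True then show ?thesis using a(3) by simp
      next
        case False
        then show ?thesis using a(1,2) partition_length_le[of lam k] partition_length_le[of mu k] by simp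
      qed
    qed
  qed
  show "(\<lambda>lam. map lam [0..<n]) ` {lam. is_partition lam \<and> psize lam \<le> n} \<subseteq> {xs. set xs \<subseteq> {..n} \<and> length xs = n}"
    using partition_part_le order_trans by fastforce
  show "finite {xs. set xs \<subseteq> {..n} \<and> length xs = n}" by (rule finite_lists_length_eq) simp
qed

lemma graded_cores: "graded {\<Lambda>. is_core e s \<Lambda>} (\<lambda>\<Lambda>. int (msize \<Lambda>))"
  unfolding graded_def
proof (intro conjI ballI allI)
  fix n :: int
  have "{\<Lambda> \<in> {\<Lambda>. is_core e s \<Lambda>}. int (msize \<Lambda>) = n} \<subseteq> {xs. set xs \<subseteq> {lam. is_partition lam \<and> psize lam \<le> nat n} \<and> length xs = length s}"
    by (auto simp: is_core_def is_multipartition_def msize_def member_le_sum_list intro!: member_le_sum_list)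
  then show "finite {\<Lambda> \<in> {\<Lambda>. is_core e s \<Lambda>}. int (msize \<Lambda>) = n}"
    by (rule finite_subset) (rule finite_lists_length_eq[OF finite_partitions])
qed simp

lemma graded_tuples:
  assumes l: "length s > 0" and e: "e > 0" shows "graded (core_tuples e s) (core_size e s)"
  using core_tuples_bij[OF assms] graded_cores[of e s] by (auto intro: graded_bij)

section \<open>Symmetries of cores\<close>

lemma core_size_twice:
  "2 * core_size e s t = (\<Sum>j<length s. (\<Sum>m<e. int e * (runner_level (length s) t j m * (runner_level (length s) t j m - 1))
      + 2 * (int m + 1) * runner_level (length s) t j m) - s ! j * (s ! j + 1))"
proof -
  have "even (\<Sum>j<length s. (\<Sum>m<e. int e * (runner_level (length s) t j m * (runner_level (length s) t j m - 1))
      + 2 * (int m + 1) * runner_level (length s) t j m) - s ! j * (s ! j + 1))"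
    by (intro dvd_sum dvd_diff) auto
  then show ?thesis unfolding core_size_def by simp
qed

lemma core_series_bij:
  assumes "length s > 0" "length s' > 0" "e > 0"
    and "bij_betw f (core_tuples e s) (core_tuples e s')"
    and "\<And>t. t \<in> core_tuples e s \<Longrightarrow> core_size e s' (f t) = core_size e s t"
  shows "core_series e s' = core_series e s"
  using gen_series_bij[where w = "core_size e s" and v = "core_size e s'", OF assms(4,5)] core_series_tuples[OF assms(1,3)] core_series_tuples[OF assms(2,3)] by simp

text \<open>
  Translating every component by one position moves residue class \<open>m\<close> to \<open>m +
  1\<close>, and the last class to the first one, one level higher. On tuples this is a cyclic
  shift in which the last entry grows by \<open>l\<close>.
\<close>

lemma core_series_charge_shift:
  assumes l: "length s > 0" and e: "e > 0"
  shows "core_series e (map (\<lambda>x. x + 1) s) = core_series e s"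
proof -
  obtain p where p: "e = Suc p" using e by (cases e) auto
  let ?l = "length s" and ?s = "map (\<lambda>x. x + 1) s"
  let ?f = "\<lambda>t. (t ! p + int ?l) # butlast t" and ?g = "\<lambda>t. tl t @ [hd t - int ?l]"
  have rl0: "runner_level ?l (?f t) j 0 = runner_level ?l t j p + 1" for t j
  proof -
    have "(t ! p + int ?l + int j) div int ?l = ((t ! p + int j) + int ?l) div int ?l" by (simp only: ac_simps)
    also have "\<dots> = (t ! p + int j) div int ?l + 1" using l by simp
    finally show "runner_level ?l (?f t) j 0 = runner_level ?l t j p + 1" by (simp add: runner_level_def)
  qed
  have rlS: "runner_level ?l (?f t) j (Suc m) = runner_level ?l t j m" if "length t = e" "m < p" for t j m
    using that p by (simp add: runner_level_def nth_butlast)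
  have cs: "(\<Sum>m<e. runner_level ?l (?f t) j m) = (\<Sum>m<e. runner_level ?l t j m) + 1" if "length t = e" for t j
    unfolding p sum.lessThan_Suc_shift[of "runner_level ?l (?f t) j"] sum.lessThan_Suc[of "runner_level ?l t j"]
    using rl0[of t j] rlS[OF that] by simp
  have fg: "?f (?g t) = t" "?g (?f t) = t" if lt: "length t = e" for t
  proof -
    obtain a u where t: "t = a # u" "length u = p" using lt p by (cases t) auto
    show "?f (?g t) = t" using t by (simp add: nth_append)
    obtain b v where t: "t = v @ [b]" "length v = p" using lt p by (cases t rule: rev_cases) auto
    show "?g (?f t) = t" using t by (simp add: nth_append)
  qed
  have cs': "(\<Sum>m<e. runner_level ?l (?g t) j m) = (\<Sum>m<e. runner_level ?l t j m) - 1" if "length t = e" for t j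
    using cs[of "?g t" j] fg(1)[OF that] that p by simp
  show ?thesis
  proof (rule core_series_bij[OF l _ e, of _ ?f])
    show "bij_betw ?f (core_tuples e s) (core_tuples e ?s)"
    proof (rule bij_betw_byWitness[of _ ?g])
      show "?f ` core_tuples e s \<subseteq> core_tuples e ?s" using cs p by (auto simp: core_tuples_def)
      show "?g ` core_tuples e ?s \<subseteq> core_tuples e s" using cs' p by (auto simp: core_tuples_def)
    qed (use fg in \<open>auto simp: core_tuples_def\<close>)
  next
    fix t assume "t \<in> core_tuples e s"
    then have len: "length t = e" and ch: "\<And>j. j < ?l \<Longrightarrow> (\<Sum>m<e. runner_level ?l t j m) = s ! j" by (auto simp: core_tuples_def)
    have "2 * core_size e ?s (?f t) = 2 * core_size e s t"
      unfolding core_size_twice length_map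
    proof (rule sum.cong)
      fix j assume "j \<in> {..<?l}"
      then have j: "j < ?l" by simp
      let ?F = "\<lambda>t m. int e * (runner_level ?l t j m * (runner_level ?l t j m - 1)) + 2 * (int m + 1) * runner_level ?l t j m"
      let ?n = "runner_level ?l t j"
      have "(\<Sum>m<e. ?F (?f t) m) = (int e * ((?n p + 1) * ?n p) + 2 * (?n p + 1)) + (\<Sum>m<p. int e * (?n m * (?n m - 1)) + 2 * (int m + 2) * ?n m)"
        unfolding p sum.lessThan_Suc_shift unfolding p[symmetric] rl0 using rlS[OF len, of _ j] by (simp add: algebra_simps)
      also have "(\<Sum>m<p. int e * (?n m * (?n m - 1)) + 2 * (int m + 2) * ?n m) = (\<Sum>m<p. ?F t m) + 2 * (\<Sum>m<p. ?n m)"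
        unfolding sum_distrib_left sum.distrib[symmetric] by (rule sum.cong) (auto simp: algebra_simps)
      finally have "(\<Sum>m<e. ?F (?f t) m) = (\<Sum>m<e. ?F t m) + 2 * (\<Sum>m<e. ?n m) + 2"
        unfolding p by (simp add: algebra_simps)
      then show "(\<Sum>m<e. ?F (?f t) m) - ?s ! j * (?s ! j + 1) = (\<Sum>m<e. ?F t m) - s ! j * (s ! j + 1)"
        using ch[OF j] j by (simp add: algebra_simps)
    qed simp
    then show "core_size e ?s (?f t) = core_size e s t" by simp
  qed (use l in simp)
qed

text \<open>
  Increasing all \<open>t\<^sub>m\<close> by one moves each component into the role of its
  predecessor; the first component becomes the last one, with all levels raised by one and hence
  the charge raised by \<open>e\<close>.
\<close>

lemma core_series_rotate:
  assumes e: "e > 0"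
  shows "core_series e (xs @ [x + int e]) = core_series e (x # xs)"
proof -
  let ?s = "x # xs" and ?s' = "xs @ [x + int e]"
  define p where "p = length xs"
  let ?l = "Suc p"
  have len: "length ?s = ?l" "length ?s' = ?l" by (auto simp: p_def)
  let ?f = "map (\<lambda>x. x + 1)" and ?g = "map (\<lambda>x. x - (1::int))"
  have rl: "runner_level ?l (?f t) p m = runner_level ?l t 0 m + 1" "\<And>j. runner_level ?l (?f t) j m = runner_level ?l t (Suc j) m"
    if "m < length t" for t m
  proof -
    have "(t ! m + 1 + int p) div int ?l = (t ! m + int ?l) div int ?l" by (simp add: add.commute add.left_commute)
    also have "\<dots> = t ! m div int ?l + 1" by simp
    finally show "runner_level ?l (?f t) p m = runner_level ?l t 0 m + 1" using that by (simp add: runner_level_def)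
  qed (use that in \<open>simp add: runner_level_def add.commute add.left_commute\<close>)
  have cs: "(\<Sum>m<e. runner_level ?l (?f t) p m) = (\<Sum>m<e. runner_level ?l t 0 m) + int e"
      "\<And>j. (\<Sum>m<e. runner_level ?l (?f t) j m) = (\<Sum>m<e. runner_level ?l t (Suc j) m)" if "length t = e" for t
    using rl that by (auto simp: sum.distrib)
  have nth': "?s' ! p = x + int e" "\<And>j. j < p \<Longrightarrow> ?s' ! j = xs ! j" by (auto simp: p_def nth_append)
  have iff: "?f t \<in> core_tuples e ?s' \<longleftrightarrow> t \<in> core_tuples e ?s" for t
  proof -
    have A: "(\<forall>j<?l. h j = ?s' ! j) \<longleftrightarrow> h p = x + int e \<and> (\<forall>j<p. h j = xs ! j)" for h by (auto simp: All_less_Suc nth')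
    have B: "(\<forall>j<?l. h j = ?s ! j) \<longleftrightarrow> h 0 = x \<and> (\<forall>j<p. h (Suc j) = xs ! j)" for h by (auto simp: All_less_Suc2)
    show ?thesis unfolding core_tuples_def len mem_Collect_eq A B using cs[of t] by auto
  qed
  show ?thesis
  proof (rule core_series_bij[OF _ _ e, of _ _ ?f])
    show "bij_betw ?f (core_tuples e ?s) (core_tuples e ?s')"
    proof (rule bij_betw_byWitness[of _ ?g])
      show "?f ` core_tuples e ?s \<subseteq> core_tuples e ?s'" using iff by auto
      have "?g t \<in> core_tuples e ?s" if "t \<in> core_tuples e ?s'" for t
        using iff[of "?g t"] that by (simp add: o_def)
      then show "?g ` core_tuples e ?s' \<subseteq> core_tuples e ?s" by auto
    qed (auto simp: o_def)
  next
    fix t assume t: "t \<in> core_tuples e ?s"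
    then have lt: "length t = e" by (simp add: core_tuples_def)
    have ch: "(\<Sum>m<e. runner_level ?l t 0 m) = x" using t unfolding core_tuples_def len by auto
    let ?n = "runner_level ?l t" and ?n' = "runner_level ?l (?f t)"
    let ?F = "\<lambda>n m. int e * (n m * (n m - 1)) + 2 * (int m + 1) * n m :: int"
    have g: "2 * (\<Sum>m<e. int m + 1) = int e * (int e + 1)" using gauss_int_sum[where n = e and c = 1] by simp
    have "(\<Sum>m<e. ?F (?n' p) m) = (\<Sum>m<e. ?F (?n 0) m + (2 * int e * ?n 0 m + 2 * (int m + 1)))"
    proof (rule sum.cong)
      fix m assume "m \<in> {..<e}"
      then have "?n' p m = ?n 0 m + 1" using rl(1)[of m t] lt by simp
      then show "?F (?n' p) m = ?F (?n 0) m + (2 * int e * ?n 0 m + 2 * (int m + 1))"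
        by (simp only:) (simp add: algebra_simps)
    qed simp
    also have "\<dots> = (\<Sum>m<e. ?F (?n 0) m) + (2 * int e * x + int e * (int e + 1))"
    proof -
      have "(\<Sum>m<e. 2 * int e * ?n 0 m) = 2 * int e * x" unfolding sum_distrib_left[symmetric] ch ..
      moreover have "(\<Sum>m<e. 2 * (int m + 1)) = int e * (int e + 1)" unfolding sum_distrib_left[symmetric] g ..
      ultimately show ?thesis
        unfolding sum.distrib[of "?F (?n 0)"] sum.distrib[of "\<lambda>m. 2 * int e * ?n 0 m"] by (simp only:)
    qed
    finally have P: "(\<Sum>m<e. ?F (?n' p) m) - (x + int e) * (x + int e + 1) = (\<Sum>m<e. ?F (?n 0) m) - x * (x + 1)"
      by (simp add: algebra_simps)
    have Q: "(\<Sum>m<e. ?F (?n' j) m) = (\<Sum>m<e. ?F (?n (Suc j)) m)" for j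
    proof (rule sum.cong)
      fix m assume "m \<in> {..<e}"
      then have "?n' j m = ?n (Suc j) m" using rl(2)[of m t j] lt by simp
      then show "?F (?n' j) m = ?F (?n (Suc j)) m" by (simp only:)
    qed simp
    define H H' where "H j = (\<Sum>m<e. ?F (?n j) m) - ?s ! j * (?s ! j + 1)"
      and "H' j = (\<Sum>m<e. ?F (?n' j) m) - ?s' ! j * (?s' ! j + 1)" for j
    have "(\<Sum>j<?l. H' j) = (\<Sum>j<p. H (Suc j)) + H 0"
    proof -
      have "H' p = H 0" using P unfolding H_def H'_def nth' nth_Cons_0 .
      moreover have "H' j = H (Suc j)" if "j < p" for j unfolding H_def H'_def nth'(2)[OF that] nth_Cons_Suc Q ..
      ultimately show ?thesis by simp
    qed
    also have "\<dots> = (\<Sum>j<?l. H j)" unfolding sum.lessThan_Suc_shift by simp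
    finally have "2 * core_size e ?s' (?f t) = 2 * core_size e ?s t"
      unfolding core_size_twice len H_def H'_def .
    then show "core_size e ?s' (?f t) = core_size e ?s t" by simp
  qed auto
qed

text \<open>
  Conjugating partitions reflects the abacus; on tuples this is reversal with a change of sign.
\<close>

lemma conjugate_runner_level:
  fixes t :: "int list"
  assumes "length t = e" "j < l" "m < e"
  shows "runner_level l (map uminus (rev t)) j m = - runner_level l t (l - 1 - j) (e - 1 - m)"
  proof -
    define c y where "c = int l" and "y = t ! (e - 1 - m)"
    have c: "c > 0" "int j < c" using assms by (auto simp: c_def)
    have "(- y + int j) div c = - ((y + (c - 1 - int j)) div c)"
    proof -
      define d r where "d = (y + (c - 1 - int j)) div c" and "r = (y + (c - 1 - int j)) mod c"
      have "y + (c - 1 - int j) = d * c + r" by (simp add: d_def r_def)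
      then have "- y + int j = (- d) * c + (c - 1 - r)" by (simp add: algebra_simps)
      moreover have "0 \<le> c - 1 - r \<and> c - 1 - r < c" using pos_mod_bound[OF c(1), of "y + (c - 1 - int j)"] pos_mod_sign[OF c(1), of "y + (c - 1 - int j)"] unfolding r_def by linarith
      then have "((- d) * c + (c - 1 - r)) div c = - d"
        using div_mult_self3[of c "- d" "c - 1 - r"] div_pos_pos_trivial[of "c - 1 - r" c] c by simp
      ultimately have "(- y + int j) div c = - d" by (simp only:)
      then show ?thesis by (simp add: d_def)
    qed
    moreover have "int (l - 1 - j) = c - 1 - int j" using assms by (simp add: c_def of_nat_diff)
    moreover have "map uminus (rev t) ! m = - y" using assms by (simp add: rev_nth y_def)
    ultimately show ?thesis by (simp only: runner_level_def c_def y_def)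
  qed

lemma sum_reflect: "(\<Sum>m<n. h (n - 1 - m)) = sum (h :: nat \<Rightarrow> int) {..<n}"
  using sum.nat_diff_reindex[of h n] by simp

lemma conjugate_charge:
  assumes "length t = e" "j < l"
  shows "(\<Sum>m<e. runner_level l (map uminus (rev t)) j m) = - (\<Sum>m<e. runner_level l t (l - 1 - j) m)"
  using conjugate_runner_level[OF assms] sum_reflect[of "runner_level l t (l - 1 - j)" e] by (simp add: sum_negf)

lemma conjugate_core_tuples:
  assumes "t \<in> core_tuples e s"
  shows "map uminus (rev t) \<in> core_tuples e (map uminus (rev s))"
proof -
  have "length t = e" using assms by (simp add: core_tuples_def)
  moreover have "(\<Sum>m<e. runner_level (length s) (map uminus (rev t)) j m) = map uminus (rev s) ! j" if "j < length s" for j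
    unfolding conjugate_charge[OF \<open>length t = e\<close> that] using assms that by (simp add: core_tuples_def rev_nth)
  ultimately show ?thesis by (simp add: core_tuples_def)
qed

lemma core_series_conjugate:
  assumes l: "length s > 0" and e: "e > 0"
  shows "core_series e (map uminus (rev s)) = core_series e s"
proof -
  let ?l = "length s" and ?s = "map uminus (rev s)"
  let ?f = "\<lambda>t. map uminus (rev t) :: int list"
  have inv: "?f (?f t) = t" for t by (simp add: rev_map o_def)
  show ?thesis
  proof (rule core_series_bij[OF l _ e, of _ ?f])
    show "bij_betw ?f (core_tuples e s) (core_tuples e ?s)"
    proof (rule bij_betw_byWitness[of _ ?f])
      show "?f ` core_tuples e s \<subseteq> core_tuples e ?s" using conjugate_core_tuples by blast
      show "?f ` core_tuples e ?s \<subseteq> core_tuples e s" using conjugate_core_tuples[of _ e ?s] inv[of s] by auto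
    qed (simp_all add: inv)
  next
    fix t assume "t \<in> core_tuples e s"
    then have len: "length t = e" and ch: "\<And>j. j < ?l \<Longrightarrow> (\<Sum>m<e. runner_level ?l t j m) = s ! j" by (auto simp: core_tuples_def)
    let ?F = "\<lambda>n m. int e * (n m * (n m - 1)) + 2 * (int m + 1) * n m :: int"
    define G where "G j = (\<Sum>m<e. ?F (runner_level ?l t j) m) - s ! j * (s ! j + 1)" for j
    have "2 * core_size e ?s (?f t) = (\<Sum>j<?l. G (?l - 1 - j))"
      unfolding core_size_twice length_map length_rev
    proof (rule sum.cong)
      fix j assume "j \<in> {..<?l}"
      then have j: "j < ?l" "?l - 1 - j < ?l" by auto
      let ?n = "runner_level ?l t (?l - 1 - j)"
      define h where "h m = int e * (?n m * (?n m + 1)) - 2 * (int e - int m) * ?n m" for m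
      have "(\<Sum>m<e. ?F (runner_level ?l (?f t) j) m) = (\<Sum>m<e. h (e - 1 - m))"
        by (rule sum.cong) (auto simp: conjugate_runner_level[OF len j(1)] h_def of_nat_diff algebra_simps)
      also have "\<dots> = (\<Sum>m<e. h m)" by (rule sum_reflect)
      also have "\<dots> = (\<Sum>m<e. ?F ?n m - 2 * ?n m)" by (rule sum.cong) (auto simp: h_def algebra_simps)
      also have "\<dots> = (\<Sum>m<e. ?F ?n m) - 2 * s ! (?l - 1 - j)"
        unfolding sum_subtractf sum_distrib_left[symmetric] ch[OF j(2)] ..
      finally have "(\<Sum>m<e. ?F (runner_level ?l (?f t) j) m) = (\<Sum>m<e. ?F ?n m) - 2 * s ! (?l - 1 - j)" .
      moreover have "?s ! j = - s ! (?l - 1 - j)" using j by (simp add: rev_nth)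
      ultimately show "(\<Sum>m<e. ?F (runner_level ?l (?f t) j) m) - ?s ! j * (?s ! j + 1) = G (?l - 1 - j)"
        by (simp add: G_def algebra_simps)
    qed simp
    also have "\<dots> = sum G {..<?l}" by (rule sum_reflect)
    also have "\<dots> = 2 * core_size e s t" unfolding core_size_twice by (rule sum.cong) (simp_all add: G_def)
    finally show "core_size e ?s (?f t) = core_size e s t" by simp
  qed (use l in simp)
qed

section \<open>Repeated charges\<close>

lemma runner_level_mono: "l > 0 \<Longrightarrow> j \<le> j' \<Longrightarrow> runner_level l t j m \<le> runner_level l t j' m"
  unfolding runner_level_def by (rule zdiv_mono1) auto

text \<open>
  If the charge is constant on blocks of length \<open>k\<close>, then the levels do not change
  within a block, which forces all \<open>t\<^sub>m\<close> to be divisible by \<open>k\<close>.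
  Thus the core consists of \<open>k\<close> copies of each component of a core for the shorter
  charge.
\<close>

lemma core_series_repeat:
  assumes l: "length s > 0" and e: "e > 0" and k: "k > 0" and len: "length s' = k * length s"
    and nth': "\<And>j. j < k * length s \<Longrightarrow> s' ! j = s ! (j div k)"
  shows "core_series e s' = core_series e s oo q ^ k"
proof -
  let ?l = "length s" and ?l' = "k * length s"
  let ?f = "map (\<lambda>x. int k * x)"
  have rl: "runner_level ?l' (?f t) j m = runner_level ?l t (j div k) m" if "m < length t" for t j m
  proof -
    have "(int k * (t ! m) + int j) div int ?l' = ((int k * (t ! m) + int j) div int k) div int ?l"
      by (simp add: zdiv_zmult2_eq)
    also have "(int k * (t ! m) + int j) div int k = t ! m + int (j div k)" using k by (simp add: zdiv_int)
    finally show ?thesis using that by (simp add: runner_level_def)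
  qed
  have dk: "j div k < ?l" if "j < ?l'" for j using that k by (simp add: less_mult_imp_div_less mult.commute)
  have into: "?f t \<in> core_tuples e s'" if t: "t \<in> core_tuples e s" for t
  proof -
    have "length t = e" using t by (simp add: core_tuples_def)
    moreover have "(\<Sum>m<e. runner_level ?l' (?f t) j m) = s' ! j" if "j < ?l'" for j
      using t rl that dk[OF that] by (simp add: core_tuples_def nth')
    ultimately show ?thesis by (simp add: core_tuples_def len)
  qed
  have dvd: "int k dvd t ! m" if t: "t \<in> core_tuples e s'" and m: "m < e" for t m
  proof -
    define r u where "r = (t ! m) mod int k" and "u = (t ! m) div int k"
    have tm: "t ! m = int k * u + r" by (simp add: r_def u_def)
    have r: "0 \<le> r" "r < int k" using k by (auto simp: r_def)
    define b where "b = nat ((- (u + 1)) mod int ?l)"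
    have "0 \<le> (- (u + 1)) mod int ?l" "(- (u + 1)) mod int ?l < int ?l" using l by auto
    then have b: "b < ?l" "int b = (- (u + 1)) mod int ?l" unfolding b_def by linarith+
    have "int ?l dvd u + 1 + int b" unfolding b(2) by (simp add: mod_eq_0_iff_dvd[symmetric] mod_add_right_eq)
    then obtain c where c: "u + 1 + int b = int ?l * c" by blast
    have j1: "b * k + (k - 1) < ?l'"
    proof -
      have "b * k + k \<le> ?l * k" using b(1) by (metis Suc_leI add.commute mult_Suc mult_le_mono1)
      then show ?thesis using k by (simp add: mult.commute)
    qed
    then have j0: "b * k < ?l'" by (rule le_less_trans[rotated]) simp
    have "(\<Sum>m<e. runner_level ?l' t (b * k) m) = (\<Sum>m<e. runner_level ?l' t (b * k + (k - 1)) m)"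
    proof -
      have "(b * k + (k - 1)) div k = b" by (rule div_nat_eqI) (use k in \<open>auto simp: mult.commute\<close>)
      then show ?thesis using t j0 j1 k by (simp add: core_tuples_def len nth')
    qed
    then have "(\<Sum>m<e. runner_level ?l' t (b * k + (k - 1)) m - runner_level ?l' t (b * k) m) = 0" by (simp add: sum_subtractf)
    moreover have "\<forall>m\<in>{..<e}. 0 \<le> runner_level ?l' t (b * k + (k - 1)) m - runner_level ?l' t (b * k) m"
      using runner_level_mono[of ?l' "b * k" "b * k + (k - 1)" t] l k by auto
    ultimately have eq: "runner_level ?l' t (b * k + (k - 1)) m = runner_level ?l' t (b * k) m"
      using m by (subst (asm) sum_nonneg_eq_0_iff) auto
    have "r = 0"
    proof (rule ccontr)
      assume "r \<noteq> 0"
      then have r1: "1 \<le> r" using r by simp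
      have ub: "int k * u = int k * (int ?l * c) - int k - int k * int b" using arg_cong[OF c, of "\<lambda>z. int k * z"] by (simp add: algebra_simps)
      have "c \<le> (t ! m + int (b * k + (k - 1))) div int ?l'"
        using r1 k l ub by (subst le_div_iff_mult_le) (auto simp: tm of_nat_diff algebra_simps)
      moreover have "\<not> c \<le> (t ! m + int (b * k)) div int ?l'"
        using r k l ub by (subst le_div_iff_mult_le) (auto simp: tm algebra_simps)
      ultimately show False using eq unfolding runner_level_def by simp
    qed
    then show ?thesis by (simp add: r_def mod_eq_0_iff_dvd)
  qed
  have "bij_betw ?f (core_tuples e s) (core_tuples e s')"
  proof (rule bij_betw_imageI)
    show "inj_on ?f (core_tuples e s)" using k by (auto intro!: inj_onI dest!: map_injective simp: inj_on_def)
    show "?f ` core_tuples e s = core_tuples e s'"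
    proof (intro equalityI subsetI)
      fix t assume t: "t \<in> core_tuples e s'"
      let ?u = "map (\<lambda>x. x div int k) t"
      have lt: "length t = e" using t by (simp add: core_tuples_def)
      have tu: "t = ?f ?u"
        using dvd[OF t] lt by (intro nth_equalityI) auto
      have "(\<Sum>m<e. runner_level ?l ?u j m) = s ! j" if "j < ?l" for j
      proof -
        have jk: "j * k < ?l'" using that k by (simp add: mult.commute)
        have "(\<Sum>m<e. runner_level ?l ?u j m) = (\<Sum>m<e. runner_level ?l' t (j * k) m)"
        proof (rule sum.cong)
          fix m assume "m \<in> {..<e}"
          then have "m < length ?u" using lt by simp
          from rl[OF this, of "j * k"] show "runner_level ?l ?u j m = runner_level ?l' t (j * k) m"
            using k unfolding tu[symmetric] by simp
        qed simp
        also have "\<dots> = s ! j" using t jk k by (simp add: core_tuples_def len nth')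
        finally show ?thesis .
      qed
      then have "?u \<in> core_tuples e s" using lt by (simp add: core_tuples_def)
      then show "t \<in> ?f ` core_tuples e s" using tu by blast
    qed (use into in auto)
  qed
  moreover have "core_size e s' (?f t) = int k * core_size e s t" if t: "t \<in> core_tuples e s" for t
  proof -
    have lt: "length t = e" using t by (simp add: core_tuples_def)
    let ?F = "\<lambda>n m. int e * (n m * (n m - 1)) + 2 * (int m + 1) * n m :: int"
    define G where "G j = (\<Sum>m<e. ?F (runner_level ?l t j) m) - s ! j * (s ! j + 1)" for j
    have "2 * core_size e s' (?f t) = (\<Sum>j<?l'. G (j div k))"
      unfolding core_size_twice len
    proof (rule sum.cong)
      fix j assume "j \<in> {..<?l'}"
      then have "s' ! j = s ! (j div k)" using nth' by simp
      moreover have "(\<Sum>m<e. ?F (runner_level ?l' (?f t) j) m) = (\<Sum>m<e. ?F (runner_level ?l t (j div k)) m)"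
        by (rule sum.cong) (use rl lt in auto)
      ultimately show "(\<Sum>m<e. ?F (runner_level ?l' (?f t) j) m) - s' ! j * (s' ! j + 1) = G (j div k)"
        by (simp add: G_def)
    qed simp
    also have "\<dots> = (\<Sum>i<?l. \<Sum>j\<in>{i*k..<i*k+k}. G (j div k))"
      unfolding sum.nat_group mult.commute[of k] ..
    also have "\<dots> = (\<Sum>i<?l. int k * G i)"
    proof (rule sum.cong)
      fix i
      have "(\<Sum>j\<in>{i*k..<i*k+k}. G (j div k)) = (\<Sum>j\<in>{i*k..<i*k+k}. G i)"
      proof (rule sum.cong)
        fix j assume "j \<in> {i*k..<i*k+k}"
        then have "j div k = i" by (intro div_nat_eqI) (auto simp: algebra_simps)
        then show "G (j div k) = G i" by simp
      qed simp
      then show "(\<Sum>j\<in>{i*k..<i*k+k}. G (j div k)) = int k * G i" by simp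
    qed simp
    also have "\<dots> = int k * (2 * core_size e s t)" unfolding core_size_twice G_def by (simp add: sum_distrib_left)
    finally show ?thesis by simp
  qed
  ultimately have E: "gen_series (core_tuples e s) (\<lambda>t. int k * core_size e s t) = gen_series (core_tuples e s') (core_size e s')"
    by (rule gen_series_bij)
  have "length s' > 0" using len k l by simp
  show ?thesis
    unfolding core_series_tuples[OF l e] core_series_tuples[OF \<open>length s' > 0\<close> e] gen_series_compose[OF k] E ..
qed

section \<open>Lattice weight\<close>

lemma hermite_identity:
  assumes l: "l > 0" shows "(\<Sum>j<l. (t + int j) div int l) = t"
proof -
  obtain p where p: "l = Suc p" using l by (cases l) auto
  define n where "n t j = (t + int j) div int l" for t j
  have sh: "n (t + 1) j = n t (Suc j)" for t j by (simp add: n_def algebra_simps)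
  have last: "n t (Suc p) = n t 0 + 1" for t
  proof -
    have a: "n t (Suc p) = (t + int l) div int l" "n t 0 = t div int l" by (simp_all add: n_def p)
    have b: "(t + int l) div int l = t div int l + 1" using l by simp
    show ?thesis unfolding a b ..
  qed
  have step: "(\<Sum>j<l. n (t + 1) j) = (\<Sum>j<l. n t j) + 1" for t
    unfolding p sum.lessThan_Suc[of "n (t+1)"] sum.lessThan_Suc_shift[of "n t"] sh using last[of t] by simp
  have "(\<Sum>j<l. n t j) = t"
  proof (induction t rule: int_induct[of _ 0])
    case base show ?case using l by (simp add: n_def)
  next
    case (step1 i) then show ?case by (simp add: step)
  next
    case (step2 i) then show ?case using step[of "i - 1"] by simp
  qed
  then show ?thesis by (simp add: n_def)
qed

text \<open>
  Passing from \<open>t\<close> to \<open>t + 1\<close> shifts the summands by one place and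
  changes only the two at the ends, so both sides have the same increments. The point is that the
  quadratic part of the left side depends on \<open>t\<close> alone, up to a term that is linear
  in the levels with weights depending on \<open>j\<close> only.
\<close>

lemma quadratic_runner_sum:
  assumes l: "l > 0"
  shows "(\<Sum>j<l. int (k * l) * (((t + int j) div int l) * ((t + int j) div int l - 1)))
     = int k * t\<^sup>2 - int (k * l) * t + int k * (\<Sum>j<l. (2 * int j - int l + 1) * ((t + int j) div int l))"
proof -
  obtain p where p: "l = Suc p" using l by (cases l) auto
  define n where "n t j = (t + int j) div int l" for t j
  have sh: "n (t + 1) j = n t (Suc j)" for t j by (simp add: n_def algebra_simps)
  have last: "n t (Suc p) = n t 0 + 1" for t
  proof -
    have a: "n t (Suc p) = (t + int l) div int l" "n t 0 = t div int l" by (simp_all add: n_def p)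
    have b: "(t + int l) div int l = t div int l + 1" using l by simp
    show ?thesis unfolding a b ..
  qed
  define A where "A t = (\<Sum>j<l. n t j * (n t j - 1))" for t
  define B where "B t = (\<Sum>j<l. (2 * int j - int l + 1) * n t j)" for t
  have A: "A (t + 1) = A t + 2 * n t 0" for t
  proof -
    have "A (t + 1) = (\<Sum>j<p. n t (Suc j) * (n t (Suc j) - 1)) + n t (Suc p) * (n t (Suc p) - 1)"
      unfolding A_def p by (simp add: sh)
    moreover have "A t = n t 0 * (n t 0 - 1) + (\<Sum>j<p. n t (Suc j) * (n t (Suc j) - 1))"
      unfolding A_def p sum.lessThan_Suc_shift by simp
    ultimately show ?thesis unfolding last by (simp add: algebra_simps)
  qed
  have H: "(\<Sum>j<p. n t (Suc j)) = t - n t 0" for t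
    using hermite_identity[OF l, of t] unfolding p sum.lessThan_Suc_shift n_def by simp
  have B: "B (t + 1) = B t - 2 * t + 2 * int l * n t 0 + int l - 1" for t
  proof -
    have "B (t + 1) = (\<Sum>j<p. (2 * int j - int l + 1) * n t (Suc j)) + (int l - 1) * (n t 0 + 1)"
      unfolding B_def p sum.lessThan_Suc sh last by (simp add: p)
    moreover have "B t = (\<Sum>j<p. (2 * int j - int l + 1) * n t (Suc j) + 2 * n t (Suc j)) + (1 - int l) * n t 0"
      unfolding B_def p sum.lessThan_Suc_shift by (simp add: algebra_simps)
    ultimately show ?thesis
      using H[of t] unfolding sum.distrib sum_distrib_left[symmetric] by (simp add: algebra_simps)
  qed
  have "int l * A t = t\<^sup>2 - int l * t + B t"
  proof (induction t rule: int_induct[of _ 0])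
    case base show ?case using l by (simp add: A_def B_def n_def)
  next
    case (step1 i) then show ?case unfolding A B by (simp add: algebra_simps power2_eq_square)
  next
    case (step2 i) then show ?case using A[of "i - 1"] B[of "i - 1"] by (simp add: algebra_simps power2_eq_square)
  qed
  then have "int k * (int l * A t) = int k * (t\<^sup>2 - int l * t + B t)" by simp
  then show ?thesis unfolding A_def B_def n_def by (simp add: sum_distrib_left algebra_simps)
qed

text \<open>
  Twice the offset between the size of a core and the quadratic form in its tuple.
\<close>

definition charge_const :: "nat \<Rightarrow> int list \<Rightarrow> int" where
  "charge_const k s = (\<Sum>j<length s. s ! j * (s ! j + 1) - int k * (2 * int j - int (length s) + 1) * s ! j)"

text \<open>
  The linear terms left over by \<open>quadratic_runner_sum\<close> are summed over
  \<open>m\<close> first, where they only see the charge.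
\<close>

lemma core_size_quadratic:
  assumes l: "length s > 0" and e: "e = k * length s" and t: "t \<in> core_tuples e s"
  shows "2 * core_size e s t + charge_const k s = (\<Sum>m<e. int k * (t ! m)\<^sup>2 + (2 * (int m + 1) - int e) * t ! m)"
proof -
  let ?l = "length s" and ?n = "runner_level (length s) t"
  have ch: "(\<Sum>m<e. ?n j m) = s ! j" if "j < ?l" for j using t that by (simp add: core_tuples_def)
  have "2 * core_size e s t = (\<Sum>j<?l. \<Sum>m<e. int e * (?n j m * (?n j m - 1)) + 2 * (int m + 1) * ?n j m) - (\<Sum>j<?l. s ! j * (s ! j + 1))"
    unfolding core_size_twice by (simp add: sum_subtractf)
  also have "(\<Sum>j<?l. \<Sum>m<e. int e * (?n j m * (?n j m - 1)) + 2 * (int m + 1) * ?n j m)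
     = (\<Sum>m<e. (\<Sum>j<?l. int e * (?n j m * (?n j m - 1))) + 2 * (int m + 1) * (\<Sum>j<?l. ?n j m))"
    by (subst sum.swap) (simp add: sum.distrib sum_distrib_left)
  also have "\<dots> = (\<Sum>m<e. (int k * (t ! m)\<^sup>2 + (2 * (int m + 1) - int e) * t ! m) + int k * (\<Sum>j<?l. (2 * int j - int ?l + 1) * ?n j m))"
  proof (rule sum.cong)
    fix m
    show "(\<Sum>j<?l. int e * (?n j m * (?n j m - 1))) + 2 * (int m + 1) * (\<Sum>j<?l. ?n j m) = (int k * (t ! m)\<^sup>2 + (2 * (int m + 1) - int e) * t ! m) + int k * (\<Sum>j<?l. (2 * int j - int ?l + 1) * ?n j m)"
      unfolding runner_level_def hermite_identity[OF l] e quadratic_runner_sum[OF l] by (simp add: algebra_simps)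
  qed simp
  also have "\<dots> = (\<Sum>m<e. int k * (t ! m)\<^sup>2 + (2 * (int m + 1) - int e) * t ! m) + int k * (\<Sum>j<?l. (2 * int j - int ?l + 1) * (\<Sum>m<e. ?n j m))"
    unfolding sum.distrib[of "\<lambda>m. int k * (t ! m)\<^sup>2 + (2 * (int m + 1) - int e) * t ! m"] sum_distrib_left
    by (subst sum.swap) (simp add: sum_distrib_left)
  also have "(\<Sum>j<?l. (2 * int j - int ?l + 1) * (\<Sum>m<e. ?n j m)) = (\<Sum>j<?l. (2 * int j - int ?l + 1) * s ! j)"
    by (rule sum.cong) (use ch in auto)
  finally show ?thesis unfolding charge_const_def by (simp add: sum_subtractf sum_distrib_left mult.assoc)
qed

lemma Collect_Sigma_weight:
  assumes "graded I u" "\<And>i. i \<in> I \<Longrightarrow> graded (A i) (v i)"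
  shows "{p \<in> Sigma I A. (case p of (i,a) \<Rightarrow> u i + v i a) = int n}
     = (\<Union>c\<in>{0..n}. SIGMA i:{i\<in>I. u i = int c}. {a\<in>A i. v i a = int (n - c)})"
proof (intro equalityI subsetI)
  fix p assume p: "p \<in> {p \<in> Sigma I A. (case p of (i,a) \<Rightarrow> u i + v i a) = int n}"
  then obtain i a where ia: "p = (i,a)" "i \<in> I" "a \<in> A i" "u i + v i a = int n" by auto
  have "0 \<le> u i" "0 \<le> v i a" using ia assms by (auto simp: graded_def)
  then have "nat (u i) \<in> {0..n}" "p \<in> (SIGMA j:{j\<in>I. u j = int (nat (u i))}. {a\<in>A j. v j a = int (n - nat (u i))})"
    using ia by auto
  then show "p \<in> (\<Union>c\<in>{0..n}. SIGMA i:{i\<in>I. u i = int c}. {a\<in>A i. v i a = int (n - c)})" by blast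
qed auto

lemma graded_Sigma:
  assumes "graded I u" "\<And>i. i \<in> I \<Longrightarrow> graded (A i) (v i)"
  shows "graded (Sigma I A) (\<lambda>(i,a). u i + v i a)"
  unfolding graded_def
proof (intro conjI ballI allI)
  show "0 \<le> (case x of (i, a) \<Rightarrow> u i + v i a)" if "x \<in> Sigma I A" for x using that assms by (auto simp: graded_def)
  fix n :: int
  show "finite {p \<in> Sigma I A. (case p of (i,a) \<Rightarrow> u i + v i a) = n}"
  proof (cases "n \<ge> 0")
    case True
    then obtain m where m: "n = int m" by (metis nonneg_int_cases)
    have "{p \<in> Sigma I A. (case p of (i,a) \<Rightarrow> u i + v i a) = int m}
      = (\<Union>c\<in>{0..m}. SIGMA i:{i\<in>I. u i = int c}. {a\<in>A i. v i a = int (m - c)})"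
      by (rule Collect_Sigma_weight) (use assms in auto)
    moreover have "finite \<dots>"
      using assms by (intro finite_UN_I finite_SigmaI) (auto simp: graded_def)
    ultimately show ?thesis unfolding m by (simp only:)
  next
    case False
    then have "{p \<in> Sigma I A. (case p of (i,a) \<Rightarrow> u i + v i a) = n} = {}" (is "?X = _") using assms by (force simp: graded_def)
    have "finite ?X" unfolding \<open>?X = {}\<close> by (rule finite.emptyI)
    then show ?thesis .
  qed
qed

text \<open>
  Products of series also arise from fibrations in which the fibres differ but all have the same
  series. This is used for fibres cut out by a parity condition and for tuples of varying sum.
\<close>

lemma gen_series_Sigma:
  assumes "graded I u" "\<And>i. i \<in> I \<Longrightarrow> graded (A i) (v i)" "\<And>i. i \<in> I \<Longrightarrow> gen_series (A i) (v i) = C"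
  shows "gen_series (Sigma I A) (\<lambda>(i,a). u i + v i a) = gen_series I u * C"
proof (rule fps_ext)
  fix n :: nat
  have card: "int (card {a\<in>A i. v i a = int d}) = fps_nth C d" if "i \<in> I" for i d
    using assms(3)[OF that] nth_gen_series[of "A i" "v i" d] by simp
  have E: "{p \<in> Sigma I A. (case p of (i,a) \<Rightarrow> u i + v i a) = int n}
      = (\<Union>c\<in>{0..n}. SIGMA i:{i\<in>I. u i = int c}. {a\<in>A i. v i a = int (n - c)})"
    by (rule Collect_Sigma_weight) (use assms in auto)
  have "int (card (\<Union>c\<in>{0..n}. SIGMA i:{i\<in>I. u i = int c}. {a\<in>A i. v i a = int (n - c)}))
     = (\<Sum>c\<in>{0..n}. int (card (SIGMA i:{i\<in>I. u i = int c}. {a\<in>A i. v i a = int (n - c)})))"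
    unfolding of_nat_sum[symmetric]
    by (subst card_UN_disjoint) (use assms in \<open>auto simp: graded_def\<close>)
  also have "\<dots> = (\<Sum>c\<in>{0..n}. int (card {i\<in>I. u i = int c}) * fps_nth C (n - c))"
  proof (rule sum.cong)
    fix c assume "c \<in> {0..n}"
    have "card (SIGMA i:{i\<in>I. u i = int c}. {a\<in>A i. v i a = int (n - c)}) = (\<Sum>i\<in>{i\<in>I. u i = int c}. card {a\<in>A i. v i a = int (n - c)})"
      by (rule card_SigmaI) (use assms in \<open>auto simp: graded_def\<close>)
    then have "int (card (SIGMA i:{i\<in>I. u i = int c}. {a\<in>A i. v i a = int (n - c)})) = (\<Sum>i\<in>{i\<in>I. u i = int c}. fps_nth C (n - c))"
      by (simp add: card)
    then show "int (card (SIGMA i:{i\<in>I. u i = int c}. {a\<in>A i. v i a = int (n - c)})) = int (card {i\<in>I. u i = int c}) * fps_nth C (n - c)"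
      by simp
  qed simp
  finally show "fps_nth (gen_series (Sigma I A) (\<lambda>(i,a). u i + v i a)) n = fps_nth (gen_series I u * C) n"
    by (simp only: nth_gen_series fps_mult_nth E)
qed

section \<open>Tuples of fixed sum\<close>

text \<open>
  The charge of the unique core with tuple \<open>t\<close>.
\<close>

definition charge :: "nat \<Rightarrow> nat \<Rightarrow> int list \<Rightarrow> int list" where
  "charge l e t = map (\<lambda>j. \<Sum>m<e. runner_level l t j m) [0..<l]"

lemma core_tuples_charge: "t \<in> core_tuples e S \<longleftrightarrow> length t = e \<and> charge (length S) e t = S"
proof -
  have "charge (length S) e t = S \<longleftrightarrow> (\<forall>j<length S. (\<Sum>m<e. runner_level (length S) t j m) = S ! j)"
  proof
    assume *: "charge (length S) e t = S"
    have "charge (length S) e t ! j = (\<Sum>m<e. runner_level (length S) t j m)" if "j < length S" for j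
      using that by (simp add: charge_def)
    then show "\<forall>j<length S. (\<Sum>m<e. runner_level (length S) t j m) = S ! j" unfolding * by simp
  next
    assume "\<forall>j<length S. (\<Sum>m<e. runner_level (length S) t j m) = S ! j"
    then show "charge (length S) e t = S" by (intro nth_equalityI) (simp_all add: charge_def)
  qed
  then show ?thesis by (simp add: core_tuples_def)
qed

text \<open>
  Levels increase with the component, by at most one in total over each residue class. Hence only
  finitely many charges occur for a given sum, which is preserved by
  \<open>hermite_identity\<close>.
\<close>

lemma charge_bounds:
  assumes "l > 0"
  shows "sorted (charge l e t)" "last (charge l e t) \<le> hd (charge l e t) + int e"
    and "length t = e \<Longrightarrow> sum_list (charge l e t) = sum_list t"
proof -
  show "sorted (charge l e t)"
    using assms by (auto simp: charge_def sorted_iff_nth_mono intro!: sum_mono runner_level_mono)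
  have "runner_level l t (l - 1) m \<le> runner_level l t 0 m + 1" for m
  proof -
    have "(t ! m + int (l - 1)) div int l \<le> (t ! m + int l) div int l" by (rule zdiv_mono1) (use assms in auto)
    then show ?thesis using assms by (simp add: runner_level_def)
  qed
  then have "(\<Sum>m<e. runner_level l t (l - 1) m) \<le> (\<Sum>m<e. runner_level l t 0 m + 1)" by (intro sum_mono)
  then show "last (charge l e t) \<le> hd (charge l e t) + int e"
    using assms by (simp add: charge_def last_map hd_map sum.distrib)
  assume "length t = e"
  have "sum_list (charge l e t) = (\<Sum>j<l. \<Sum>m<e. runner_level l t j m)"
    by (simp add: charge_def sum_list_sum_nth atLeast0LessThan)
  also have "\<dots> = (\<Sum>m<e. t ! m)"
    by (subst sum.swap) (simp add: runner_level_def hermite_identity[OF assms])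
  finally show "sum_list (charge l e t) = sum_list t"
    by (simp only: sum_list_sum_nth[of t] atLeast0LessThan \<open>length t = e\<close>)
qed

text \<open>
  Twice the size of a core with \<open>k l\<close> runners on the dual side, up to the constant
  \<open>charge_const\<close>.
\<close>

definition tuple_form :: "nat \<Rightarrow> int list \<Rightarrow> int" where
  "tuple_form k t = (\<Sum>m<length t. int k * (t ! m)\<^sup>2 + (2 * (int m + 1) - int (length t)) * t ! m)"

text \<open>
  Every tuple belongs to exactly one charge, and on the cores of charge \<open>S\<close> the
  common weight exceeds the size by \<open>\<kappa> S\<close>.
\<close>

theorem tuples_of_sum_series:
  assumes e: "e = k * l" "l > 0" "k > 0" and fin: "finite CS"
    and sub: "\<And>S. length S = l \<Longrightarrow> sum_list S = \<sigma> \<Longrightarrow> sorted S \<Longrightarrow> last S \<le> hd S + int e \<Longrightarrow> S \<in> CS"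
    and CS: "\<And>S. S \<in> CS \<Longrightarrow> length S = l \<and> sum_list S = \<sigma> \<and> charge_const k S + c = 2 * int (\<kappa> S)"
  shows "gen_series {t. length t = e \<and> sum_list t = \<sigma>} (\<lambda>t. (tuple_form k t + c) div 2) = (\<Sum>S\<in>CS. q ^ \<kappa> S * core_series e S)"
    and "graded {t. length t = e \<and> sum_list t = \<sigma>} (\<lambda>t. (tuple_form k t + c) div 2)"
proof -
  let ?A = "{t. length t = e \<and> sum_list t = \<sigma>}" and ?w = "\<lambda>t. (tuple_form k t + c) div 2"
  have l: "l > 0" and e0: "e > 0" using e by auto
  have A: "?A = (\<Union>S\<in>CS. core_tuples e S)"
  proof (intro equalityI subsetI)
    fix t assume "t \<in> ?A"
    then have t: "length t = e" "sum_list t = \<sigma>" by auto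
    have "charge l e t \<in> CS" by (rule sub) (use t charge_bounds[OF l, where e = "e" and t = t] in \<open>auto simp: charge_def\<close>)
    moreover have "t \<in> core_tuples e (charge l e t)" using t by (simp add: core_tuples_charge) (simp add: charge_def)
    ultimately show "t \<in> (\<Union>S\<in>CS. core_tuples e S)" by blast
  next
    fix t assume "t \<in> (\<Union>S\<in>CS. core_tuples e S)"
    then obtain S where "S \<in> CS" "t \<in> core_tuples e S" by blast
    then show "t \<in> ?A" using CS[of S] charge_bounds(3)[OF l, where e = "e" and t = t] by (auto simp: core_tuples_charge)
  qed
  have w: "?w t = core_size e S t + int (\<kappa> S)" if "S \<in> CS" "t \<in> core_tuples e S" for S t
  proof -
    have S: "length S = l" "charge_const k S + c = 2 * int (\<kappa> S)" using CS[OF that(1)] by auto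
    have "length t = e" using that by (simp add: core_tuples_def)
    have "2 * core_size e S t + charge_const k S = tuple_form k t"
      unfolding tuple_form_def \<open>length t = e\<close> by (rule core_size_quadratic) (use S l e that in auto)
    then have "tuple_form k t + c = 2 * (core_size e S t + int (\<kappa> S))" using S by simp
    then show ?thesis by simp
  qed
  have series: "gen_series (core_tuples e S) ?w = q ^ \<kappa> S * core_series e S"
    and gr: "graded (core_tuples e S) ?w" if "S \<in> CS" for S
  proof -
    have ls: "length S > 0" using CS[OF that] l by simp
    show "gen_series (core_tuples e S) ?w = q ^ \<kappa> S * core_series e S"
      unfolding core_series_tuples[OF ls e0] gen_series_shift[OF graded_tuples[OF ls e0], symmetric]
      by (rule gen_series_cong) (use w[OF that] in auto)
    show "graded (core_tuples e S) ?w"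
      by (rule iffD2[OF graded_cong[OF refl w[OF that]] graded_shift[OF graded_tuples[OF ls e0]]])
  qed
  have dj: "core_tuples e S \<inter> core_tuples e S' = {}" if "S \<in> CS" "S' \<in> CS" "S \<noteq> S'" for S S'
    using CS[OF that(1)] CS[OF that(2)] that(3) by (auto simp: core_tuples_charge)
  show "gen_series ?A ?w = (\<Sum>S\<in>CS. q ^ \<kappa> S * core_series e S)"
  proof -
    have "gen_series ?A ?w = (\<Sum>S\<in>CS. gen_series (core_tuples e S) ?w)"
      unfolding A by (rule gen_series_UNION(1)[OF fin gr dj])
    also have "\<dots> = (\<Sum>S\<in>CS. q ^ \<kappa> S * core_series e S)" by (rule sum.cong[OF refl series])
    finally show ?thesis .
  qed
  show "graded ?A ?w"
    unfolding A by (rule gen_series_UNION(2)[OF fin gr dj])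
qed

lemma length_4_iff: "length t = 4 \<longleftrightarrow> (\<exists>a b c d. t = [a,b,c,d])"
  by (auto simp: eval_nat_numeral length_Suc_conv)
lemma length_2_iff: "length t = 2 \<longleftrightarrow> (\<exists>a b. t = [a,b])"
  by (auto simp: eval_nat_numeral length_Suc_conv)
lemma length_3_iff: "length t = 3 \<longleftrightarrow> (\<exists>a b c. t = [a,b,c])"
  by (auto simp: eval_nat_numeral length_Suc_conv)

lemma core_series_shift: "length s > 0 \<Longrightarrow> e > 0 \<Longrightarrow> core_series e (map (\<lambda>x. x + m) s) = core_series e s"
proof (induction m rule: int_induct[of _ 0])
  case (step1 i)
  then show ?case using core_series_charge_shift[of "map (\<lambda>x. x + i) s" e] by (simp add: o_def add.assoc)
next
  case (step2 i)
  then show ?case using core_series_charge_shift[of "map (\<lambda>x. x + (i - 1)) s" e] by (simp add: o_def add.assoc)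
qed simp

lemma core_series_rotate2: "e > 0 \<Longrightarrow> core_series e [a,b] = core_series e [b,a + int e]"
  and core_series_rotate3: "e > 0 \<Longrightarrow> core_series e [a,b,c] = core_series e [b,c,a + int e]"
  and core_series_rotate4: "e > 0 \<Longrightarrow> core_series e [a,b,c,d] = core_series e [b,c,d,a + int e]"
  using core_series_rotate[of e "[b]" a] core_series_rotate[of e "[b,c]" a] core_series_rotate[of e "[b,c,d]" a] by auto

section \<open>Charges with a given sum\<close>

lemma charge_const_lists:
  "charge_const k [a] = a * (a + 1)"
  "charge_const k [a,b] = a * (a + 1) + b * (b + 1) + int k * (a - b)"
  "charge_const k [a,b,c] = a * (a + 1) + b * (b + 1) + c * (c + 1) + 2 * int k * (a - c)"
  "charge_const k [a,b,c,d] = a * (a + 1) + b * (b + 1) + c * (c + 1) + d * (d + 1) + int k * (3 * a + b - c - 3 * d)"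
  by (simp_all add: charge_const_def lessThan_Suc algebra_simps)

text \<open>
  In this and the following lemmas of the same shape, the charges of the given sum are enumerated
  with the help of \<open>charge_bounds\<close>, and each is brought to one of a few
  representatives by rotating and translating. The name records \<open>l\<close>, \<open>e\<close>
  and the sum.
\<close>

lemma tuples_4_4_3:
  "gen_series {t. length t = 4 \<and> sum_list t = 3} (\<lambda>t. (tuple_form 1 t + (-1)) div 2) = 4 * core_series 4 [0,0,1,2] + 4 * q ^ 1 * core_series 4 [0,1,1,1]" (is "?series = ?rhs")
  "graded {t. length t = 4 \<and> sum_list t = 3} (\<lambda>t. (tuple_form 1 t + (-1)) div 2)" (is ?graded)
proof -
  let ?CS = "{[-2,1,2,2],[-1,-1,2,3],[-1,0,1,3],[-1,0,2,2],[-1,1,1,2],[0,0,0,3],[0,0,1,2],[0,1,1,1]} :: int list set"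
  let ?\<kappa> = "\<lambda>S. nat ((charge_const 1 S + (-1)) div 2)"
  have sub: "S \<in> ?CS" if S: "length S = 4" "sum_list S = 3" "sorted S" "last S \<le> hd S + int 4" for S
  proof -
    obtain a b c d where S': "S = [a,b,c,d]" using S(1) by (auto simp: length_4_iff)
    have *: "\<forall>a\<in>set [-3..2]. \<forall>b\<in>set [a..a+4]. \<forall>c\<in>set [b..a+4]. (c \<le> 3 - (a+b+c) \<and> 3 - (a+b+c) \<le> a + 4 \<longrightarrow> [a,b,c,3 - (a+b+c)] \<in> ?CS)" by code_simp
    have ord: "a \<le> b \<and> b \<le> c \<and> c \<le> d \<and> d \<le> a + 4" and eq: "d = 3 - (a+b+c)" using S by (auto simp: S')
    have mem: "a \<in> set [-3..2]" "b \<in> set [a..a+4]" "c \<in> set [b..a+4]" using ord eq by auto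
    show ?thesis unfolding S' eq using *[THEN bspec, OF mem(1), THEN bspec, OF mem(2), THEN bspec, OF mem(3), THEN mp] ord[unfolded eq] by simp
  qed
  have CS: "length S = 4 \<and> sum_list S = 3 \<and> charge_const 1 S + (-1) = 2 * int (?\<kappa> S)" if "S \<in> ?CS" for S
    using that by (auto simp: charge_const_lists)
  have s0: "core_series 4 [-2,1,2,2] = core_series 4 [0,1,1,1]" using core_series_rotate4[of 4 "-2" "1" "2" "2"] core_series_shift[of "[0,1,1,1]" 4 "1"] by simp
  have s1: "core_series 4 [-1,-1,2,3] = core_series 4 [0,1,1,1]" using core_series_rotate4[of 4 "-1" "-1" "2" "3"] core_series_rotate4[of 4 "-1" "2" "3" "3"] core_series_shift[of "[0,1,1,1]" 4 "2"] by simp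
  have s2: "core_series 4 [-1,0,1,3] = core_series 4 [0,0,1,2]" using core_series_rotate4[of 4 "-1" "0" "1" "3"] core_series_rotate4[of 4 "0" "1" "3" "3"] core_series_rotate4[of 4 "1" "3" "3" "4"] core_series_shift[of "[0,0,1,2]" 4 "3"] by simp
  have s3: "core_series 4 [-1,0,2,2] = core_series 4 [0,0,1,2]" using core_series_rotate4[of 4 "-1" "0" "2" "2"] core_series_rotate4[of 4 "0" "2" "2" "3"] core_series_shift[of "[0,0,1,2]" 4 "2"] by simp
  have s4: "core_series 4 [-1,1,1,2] = core_series 4 [0,0,1,2]" using core_series_rotate4[of 4 "-1" "1" "1" "2"] core_series_shift[of "[0,0,1,2]" 4 "1"] by simp
  have s5: "core_series 4 [0,0,0,3] = core_series 4 [0,1,1,1]" using core_series_rotate4[of 4 "0" "0" "0" "3"] core_series_rotate4[of 4 "0" "0" "3" "4"] core_series_rotate4[of 4 "0" "3" "4" "4"] core_series_shift[of "[0,1,1,1]" 4 "3"] by simp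
  have E: "(\<Sum>S\<in>?CS. q ^ ?\<kappa> S * core_series 4 S) = 4 * core_series 4 [0,0,1,2] + 4 * q ^ 1 * core_series 4 [0,1,1,1]"
    by (simp add: charge_const_lists s0 s1 s2 s3 s4 s5)
  note R = tuples_of_sum_series[where l = 4 and k = 1 and e = 4 and CS = ?CS and \<sigma> = 3 and c = "-1" and \<kappa> = ?\<kappa>, OF _ _ _ _ sub CS]
  show "?series = ?rhs"
    unfolding E[symmetric] by (rule R(1)) simp_all
  show ?graded by (rule R(2)) simp_all
qed

lemma tuples_4_4_6:
  "gen_series {t. length t = 4 \<and> sum_list t = 6} (\<lambda>t. (tuple_form 1 t + (-10)) div 2) = core_series 4 [0,1,2,3] + 4 * q ^ 1 * core_series 4 [0,0,0,2] + 4 * q ^ 1 * core_series 4 [0,0,1,1]" (is "?series = ?rhs")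
  "graded {t. length t = 4 \<and> sum_list t = 6} (\<lambda>t. (tuple_form 1 t + (-10)) div 2)" (is ?graded)
proof -
  let ?CS = "{[-1,1,3,3],[-1,2,2,3],[0,0,2,4],[0,0,3,3],[0,1,1,4],[0,1,2,3],[0,2,2,2],[1,1,1,3],[1,1,2,2]} :: int list set"
  let ?\<kappa> = "\<lambda>S. nat ((charge_const 1 S + (-10)) div 2)"
  have sub: "S \<in> ?CS" if S: "length S = 4" "sum_list S = 6" "sorted S" "last S \<le> hd S + int 4" for S
  proof -
    obtain a b c d where S': "S = [a,b,c,d]" using S(1) by (auto simp: length_4_iff)
    have *: "\<forall>a\<in>set [-3..2]. \<forall>b\<in>set [a..a+4]. \<forall>c\<in>set [b..a+4]. (c \<le> 6 - (a+b+c) \<and> 6 - (a+b+c) \<le> a + 4 \<longrightarrow> [a,b,c,6 - (a+b+c)] \<in> ?CS)" by code_simp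
    have ord: "a \<le> b \<and> b \<le> c \<and> c \<le> d \<and> d \<le> a + 4" and eq: "d = 6 - (a+b+c)" using S by (auto simp: S')
    have mem: "a \<in> set [-3..2]" "b \<in> set [a..a+4]" "c \<in> set [b..a+4]" using ord eq by auto
    show ?thesis unfolding S' eq using *[THEN bspec, OF mem(1), THEN bspec, OF mem(2), THEN bspec, OF mem(3), THEN mp] ord[unfolded eq] by simp
  qed
  have CS: "length S = 4 \<and> sum_list S = 6 \<and> charge_const 1 S + (-10) = 2 * int (?\<kappa> S)" if "S \<in> ?CS" for S
    using that by (auto simp: charge_const_lists)
  have s0: "core_series 4 [-1,1,3,3] = core_series 4 [0,0,0,2]" using core_series_rotate4[of 4 "-1" "1" "3" "3"] core_series_rotate4[of 4 "1" "3" "3" "3"] core_series_shift[of "[0,0,0,2]" 4 "3"] by simp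
  have s1: "core_series 4 [-1,2,2,3] = core_series 4 [0,0,1,1]" using core_series_rotate4[of 4 "-1" "2" "2" "3"] core_series_shift[of "[0,0,1,1]" 4 "2"] by simp
  have s2: "core_series 4 [0,0,2,4] = core_series 4 [0,0,0,2]" using core_series_rotate4[of 4 "0" "0" "2" "4"] core_series_rotate4[of 4 "0" "2" "4" "4"] core_series_rotate4[of 4 "2" "4" "4" "4"] core_series_shift[of "[0,0,0,2]" 4 "4"] by simp
  have s3: "core_series 4 [0,0,3,3] = core_series 4 [0,0,1,1]" using core_series_rotate4[of 4 "0" "0" "3" "3"] core_series_rotate4[of 4 "0" "3" "3" "4"] core_series_shift[of "[0,0,1,1]" 4 "3"] by simp
  have s4: "core_series 4 [0,1,1,4] = core_series 4 [0,0,1,1]" using core_series_rotate4[of 4 "0" "1" "1" "4"] core_series_rotate4[of 4 "1" "1" "4" "4"] core_series_rotate4[of 4 "1" "4" "4" "5"] core_series_shift[of "[0,0,1,1]" 4 "4"] by simp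
  have s5: "core_series 4 [0,2,2,2] = core_series 4 [0,0,0,2]" using core_series_rotate4[of 4 "0" "2" "2" "2"] core_series_shift[of "[0,0,0,2]" 4 "2"] by simp
  have s6: "core_series 4 [1,1,1,3] = core_series 4 [0,0,0,2]" using core_series_shift[of "[0,0,0,2]" 4 "1"] by simp
  have s7: "core_series 4 [1,1,2,2] = core_series 4 [0,0,1,1]" using core_series_shift[of "[0,0,1,1]" 4 "1"] by simp
  have E: "(\<Sum>S\<in>?CS. q ^ ?\<kappa> S * core_series 4 S) = core_series 4 [0,1,2,3] + 4 * q ^ 1 * core_series 4 [0,0,0,2] + 4 * q ^ 1 * core_series 4 [0,0,1,1]"
    by (simp add: charge_const_lists s0 s1 s2 s3 s4 s5 s6 s7)
  note R = tuples_of_sum_series[where l = 4 and k = 1 and e = 4 and CS = ?CS and \<sigma> = 6 and c = "-10" and \<kappa> = ?\<kappa>, OF _ _ _ _ sub CS]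
  show "?series = ?rhs"
    unfolding E[symmetric] by (rule R(1)) simp_all
  show ?graded by (rule R(2)) simp_all
qed

lemma tuples_4_4_4:
  "gen_series {t. length t = 4 \<and> sum_list t = 4} (\<lambda>t. (tuple_form 1 t + (-4)) div 2) = 4 * core_series 4 [0,1,1,2] + 4 * q ^ 2 * core_series 4 [0,0,0,0] + 2 * core_series 4 [0,0,2,2]" (is "?series = ?rhs")
  "graded {t. length t = 4 \<and> sum_list t = 4} (\<lambda>t. (tuple_form 1 t + (-4)) div 2)" (is ?graded)
proof -
  let ?CS = "{[-2,2,2,2],[-1,-1,3,3],[-1,0,2,3],[-1,1,1,3],[-1,1,2,2],[0,0,0,4],[0,0,1,3],[0,0,2,2],[0,1,1,2],[1,1,1,1]} :: int list set"
  let ?\<kappa> = "\<lambda>S. nat ((charge_const 1 S + (-4)) div 2)"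
  have sub: "S \<in> ?CS" if S: "length S = 4" "sum_list S = 4" "sorted S" "last S \<le> hd S + int 4" for S
  proof -
    obtain a b c d where S': "S = [a,b,c,d]" using S(1) by (auto simp: length_4_iff)
    have *: "\<forall>a\<in>set [-3..2]. \<forall>b\<in>set [a..a+4]. \<forall>c\<in>set [b..a+4]. (c \<le> 4 - (a+b+c) \<and> 4 - (a+b+c) \<le> a + 4 \<longrightarrow> [a,b,c,4 - (a+b+c)] \<in> ?CS)" by code_simp
    have ord: "a \<le> b \<and> b \<le> c \<and> c \<le> d \<and> d \<le> a + 4" and eq: "d = 4 - (a+b+c)" using S by (auto simp: S')
    have mem: "a \<in> set [-3..2]" "b \<in> set [a..a+4]" "c \<in> set [b..a+4]" using ord eq by auto
    show ?thesis unfolding S' eq using *[THEN bspec, OF mem(1), THEN bspec, OF mem(2), THEN bspec, OF mem(3), THEN mp] ord[unfolded eq] by simp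
  qed
  have CS: "length S = 4 \<and> sum_list S = 4 \<and> charge_const 1 S + (-4) = 2 * int (?\<kappa> S)" if "S \<in> ?CS" for S
    using that by (auto simp: charge_const_lists)
  have s0: "core_series 4 [-2,2,2,2] = core_series 4 [0,0,0,0]" using core_series_rotate4[of 4 "-2" "2" "2" "2"] core_series_shift[of "[0,0,0,0]" 4 "2"] by simp
  have s1: "core_series 4 [-1,-1,3,3] = core_series 4 [0,0,0,0]" using core_series_rotate4[of 4 "-1" "-1" "3" "3"] core_series_rotate4[of 4 "-1" "3" "3" "3"] core_series_shift[of "[0,0,0,0]" 4 "3"] by simp
  have s2: "core_series 4 [-1,0,2,3] = core_series 4 [0,1,1,2]" using core_series_rotate4[of 4 "-1" "0" "2" "3"] core_series_rotate4[of 4 "0" "2" "3" "3"] core_series_shift[of "[0,1,1,2]" 4 "2"] by simp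
  have s3: "core_series 4 [-1,1,1,3] = core_series 4 [0,0,2,2]" using core_series_rotate4[of 4 "-1" "1" "1" "3"] core_series_shift[of "[0,0,2,2]" 4 "1"] by simp
  have s4: "core_series 4 [-1,1,2,2] = core_series 4 [0,1,1,2]" using core_series_rotate4[of 4 "-1" "1" "2" "2"] core_series_shift[of "[0,1,1,2]" 4 "1"] by simp
  have s5: "core_series 4 [0,0,0,4] = core_series 4 [0,0,0,0]" using core_series_rotate4[of 4 "0" "0" "0" "4"] core_series_rotate4[of 4 "0" "0" "4" "4"] core_series_rotate4[of 4 "0" "4" "4" "4"] core_series_shift[of "[0,0,0,0]" 4 "4"] by simp
  have s6: "core_series 4 [0,0,1,3] = core_series 4 [0,1,1,2]" using core_series_rotate4[of 4 "0" "0" "1" "3"] core_series_rotate4[of 4 "0" "1" "3" "4"] core_series_rotate4[of 4 "1" "3" "4" "4"] core_series_shift[of "[0,1,1,2]" 4 "3"] by simp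
  have s7: "core_series 4 [1,1,1,1] = core_series 4 [0,0,0,0]" using core_series_shift[of "[0,0,0,0]" 4 "1"] by simp
  have E: "(\<Sum>S\<in>?CS. q ^ ?\<kappa> S * core_series 4 S) = 4 * core_series 4 [0,1,1,2] + 4 * q ^ 2 * core_series 4 [0,0,0,0] + 2 * core_series 4 [0,0,2,2]"
    by (simp add: charge_const_lists s0 s1 s2 s3 s4 s5 s6 s7)
  note R = tuples_of_sum_series[where l = 4 and k = 1 and e = 4 and CS = ?CS and \<sigma> = 4 and c = "-4" and \<kappa> = ?\<kappa>, OF _ _ _ _ sub CS]
  show "?series = ?rhs"
    unfolding E[symmetric] by (rule R(1)) simp_all
  show ?graded by (rule R(2)) simp_all
qed

lemma tuples_2_4_1:
  "gen_series {t. length t = 4 \<and> sum_list t = 1} (\<lambda>t. (tuple_form 2 t + 0) div 2) = 2 * core_series 4 [0,1]" (is "?series = ?rhs")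
  "graded {t. length t = 4 \<and> sum_list t = 1} (\<lambda>t. (tuple_form 2 t + 0) div 2)" (is ?graded)
proof -
  let ?CS = "{[-1,2],[0,1]} :: int list set"
  let ?\<kappa> = "\<lambda>S. nat ((charge_const 2 S + (0)) div 2)"
  have sub: "S \<in> ?CS" if S: "length S = 2" "sum_list S = 1" "sorted S" "last S \<le> hd S + int 4" for S
  proof -
    obtain a b where S': "S = [a,b]" using S(1) by (auto simp: length_2_iff)
    have *: "\<forall>a\<in>set [-3..2]. (a \<le> 1 - (a) \<and> 1 - (a) \<le> a + 4 \<longrightarrow> [a,1 - (a)] \<in> ?CS)" by code_simp
    have ord: "a \<le> b \<and> b \<le> a + 4" and eq: "b = 1 - (a)" using S by (auto simp: S')
    have mem: "a \<in> set [-3..2]" using ord eq by auto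
    show ?thesis unfolding S' eq using *[THEN bspec, OF mem, THEN mp] ord[unfolded eq] by simp
  qed
  have CS: "length S = 2 \<and> sum_list S = 1 \<and> charge_const 2 S + (0) = 2 * int (?\<kappa> S)" if "S \<in> ?CS" for S
    using that by (auto simp: charge_const_lists)
  have s0: "core_series 4 [-1,2] = core_series 4 [0,1]" using core_series_rotate2[of 4 "-1" "2"] core_series_shift[of "[0,1]" 4 "2"] by simp
  have E: "(\<Sum>S\<in>?CS. q ^ ?\<kappa> S * core_series 4 S) = 2 * core_series 4 [0,1]"
    by (simp add: charge_const_lists s0)
  note R = tuples_of_sum_series[where l = 2 and k = 2 and e = 4 and CS = ?CS and \<sigma> = 1 and c = "0" and \<kappa> = ?\<kappa>, OF _ _ _ _ sub CS]
  show "?series = ?rhs"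
    unfolding E[symmetric] by (rule R(1)) simp_all
  show ?graded by (rule R(2)) simp_all
qed

lemma tuples_2_4_2:
  "gen_series {t. length t = 4 \<and> sum_list t = 2} (\<lambda>t. (tuple_form 2 t + (-2)) div 2) = core_series 4 [0,2] + 2 * q ^ 1 * core_series 4 [0,0]" (is "?series = ?rhs")
  "graded {t. length t = 4 \<and> sum_list t = 2} (\<lambda>t. (tuple_form 2 t + (-2)) div 2)" (is ?graded)
proof -
  let ?CS = "{[-1,3],[0,2],[1,1]} :: int list set"
  let ?\<kappa> = "\<lambda>S. nat ((charge_const 2 S + (-2)) div 2)"
  have sub: "S \<in> ?CS" if S: "length S = 2" "sum_list S = 2" "sorted S" "last S \<le> hd S + int 4" for S
  proof -
    obtain a b where S': "S = [a,b]" using S(1) by (auto simp: length_2_iff)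
    have *: "\<forall>a\<in>set [-3..2]. (a \<le> 2 - (a) \<and> 2 - (a) \<le> a + 4 \<longrightarrow> [a,2 - (a)] \<in> ?CS)" by code_simp
    have ord: "a \<le> b \<and> b \<le> a + 4" and eq: "b = 2 - (a)" using S by (auto simp: S')
    have mem: "a \<in> set [-3..2]" using ord eq by auto
    show ?thesis unfolding S' eq using *[THEN bspec, OF mem, THEN mp] ord[unfolded eq] by simp
  qed
  have CS: "length S = 2 \<and> sum_list S = 2 \<and> charge_const 2 S + (-2) = 2 * int (?\<kappa> S)" if "S \<in> ?CS" for S
    using that by (auto simp: charge_const_lists)
  have s0: "core_series 4 [-1,3] = core_series 4 [0,0]" using core_series_rotate2[of 4 "-1" "3"] core_series_shift[of "[0,0]" 4 "3"] by simp
  have s1: "core_series 4 [1,1] = core_series 4 [0,0]" using core_series_shift[of "[0,0]" 4 "1"] by simp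
  have E: "(\<Sum>S\<in>?CS. q ^ ?\<kappa> S * core_series 4 S) = core_series 4 [0,2] + 2 * q ^ 1 * core_series 4 [0,0]"
    by (simp add: charge_const_lists s0 s1)
  note R = tuples_of_sum_series[where l = 2 and k = 2 and e = 4 and CS = ?CS and \<sigma> = 2 and c = "-2" and \<kappa> = ?\<kappa>, OF _ _ _ _ sub CS]
  show "?series = ?rhs"
    unfolding E[symmetric] by (rule R(1)) simp_all
  show ?graded by (rule R(2)) simp_all
qed

lemma tuples_2_6_3:
  "gen_series {t. length t = 6 \<and> sum_list t = 3} (\<lambda>t. (tuple_form 3 t + (-3)) div 2) = core_series 6 [0,3] + 2 * q ^ 1 * core_series 6 [0,1]" (is "?series = ?rhs")
  "graded {t. length t = 6 \<and> sum_list t = 3} (\<lambda>t. (tuple_form 3 t + (-3)) div 2)" (is ?graded)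
proof -
  let ?CS = "{[-1,4],[0,3],[1,2]} :: int list set"
  let ?\<kappa> = "\<lambda>S. nat ((charge_const 3 S + (-3)) div 2)"
  have sub: "S \<in> ?CS" if S: "length S = 2" "sum_list S = 3" "sorted S" "last S \<le> hd S + int 6" for S
  proof -
    obtain a b where S': "S = [a,b]" using S(1) by (auto simp: length_2_iff)
    have *: "\<forall>a\<in>set [-3..2]. (a \<le> 3 - (a) \<and> 3 - (a) \<le> a + 6 \<longrightarrow> [a,3 - (a)] \<in> ?CS)" by code_simp
    have ord: "a \<le> b \<and> b \<le> a + 6" and eq: "b = 3 - (a)" using S by (auto simp: S')
    have mem: "a \<in> set [-3..2]" using ord eq by auto
    show ?thesis unfolding S' eq using *[THEN bspec, OF mem, THEN mp] ord[unfolded eq] by simp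
  qed
  have CS: "length S = 2 \<and> sum_list S = 3 \<and> charge_const 3 S + (-3) = 2 * int (?\<kappa> S)" if "S \<in> ?CS" for S
    using that by (auto simp: charge_const_lists)
  have s0: "core_series 6 [-1,4] = core_series 6 [0,1]" using core_series_rotate2[of 6 "-1" "4"] core_series_shift[of "[0,1]" 6 "4"] by simp
  have s1: "core_series 6 [1,2] = core_series 6 [0,1]" using core_series_shift[of "[0,1]" 6 "1"] by simp
  have E: "(\<Sum>S\<in>?CS. q ^ ?\<kappa> S * core_series 6 S) = core_series 6 [0,3] + 2 * q ^ 1 * core_series 6 [0,1]"
    by (simp add: charge_const_lists s0 s1)
  note R = tuples_of_sum_series[where l = 2 and k = 3 and e = 6 and CS = ?CS and \<sigma> = 3 and c = "-3" and \<kappa> = ?\<kappa>, OF _ _ _ _ sub CS]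
  show "?series = ?rhs"
    unfolding E[symmetric] by (rule R(1)) simp_all
  show ?graded by (rule R(2)) simp_all
qed

lemma tuples_2_6_2:
  "gen_series {t. length t = 6 \<and> sum_list t = 2} (\<lambda>t. (tuple_form 3 t + 0) div 2) = 2 * core_series 6 [0,2] + 2 * q ^ 2 * core_series 6 [0,0]" (is "?series = ?rhs")
  "graded {t. length t = 6 \<and> sum_list t = 2} (\<lambda>t. (tuple_form 3 t + 0) div 2)" (is ?graded)
proof -
  let ?CS = "{[-2,4],[-1,3],[0,2],[1,1]} :: int list set"
  let ?\<kappa> = "\<lambda>S. nat ((charge_const 3 S + (0)) div 2)"
  have sub: "S \<in> ?CS" if S: "length S = 2" "sum_list S = 2" "sorted S" "last S \<le> hd S + int 6" for S
  proof -
    obtain a b where S': "S = [a,b]" using S(1) by (auto simp: length_2_iff)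
    have *: "\<forall>a\<in>set [-3..2]. (a \<le> 2 - (a) \<and> 2 - (a) \<le> a + 6 \<longrightarrow> [a,2 - (a)] \<in> ?CS)" by code_simp
    have ord: "a \<le> b \<and> b \<le> a + 6" and eq: "b = 2 - (a)" using S by (auto simp: S')
    have mem: "a \<in> set [-3..2]" using ord eq by auto
    show ?thesis unfolding S' eq using *[THEN bspec, OF mem, THEN mp] ord[unfolded eq] by simp
  qed
  have CS: "length S = 2 \<and> sum_list S = 2 \<and> charge_const 3 S + (0) = 2 * int (?\<kappa> S)" if "S \<in> ?CS" for S
    using that by (auto simp: charge_const_lists)
  have s0: "core_series 6 [-2,4] = core_series 6 [0,0]" using core_series_rotate2[of 6 "-2" "4"] core_series_shift[of "[0,0]" 6 "4"] by simp
  have s1: "core_series 6 [-1,3] = core_series 6 [0,2]" using core_series_rotate2[of 6 "-1" "3"] core_series_shift[of "[0,2]" 6 "3"] by simp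
  have s2: "core_series 6 [1,1] = core_series 6 [0,0]" using core_series_shift[of "[0,0]" 6 "1"] by simp
  have E: "(\<Sum>S\<in>?CS. q ^ ?\<kappa> S * core_series 6 S) = 2 * core_series 6 [0,2] + 2 * q ^ 2 * core_series 6 [0,0]"
    by (simp add: charge_const_lists s0 s1 s2)
  note R = tuples_of_sum_series[where l = 2 and k = 3 and e = 6 and CS = ?CS and \<sigma> = 2 and c = "0" and \<kappa> = ?\<kappa>, OF _ _ _ _ sub CS]
  show "?series = ?rhs"
    unfolding E[symmetric] by (rule R(1)) simp_all
  show ?graded by (rule R(2)) simp_all
qed

lemma tuples_3_3_1:
  "gen_series {t. length t = 3 \<and> sum_list t = 1} (\<lambda>t. (tuple_form 1 t + 0) div 2) = 3 * core_series 3 [0,0,1]" (is "?series = ?rhs")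
  "graded {t. length t = 3 \<and> sum_list t = 1} (\<lambda>t. (tuple_form 1 t + 0) div 2)" (is ?graded)
proof -
  let ?CS = "{[-1,0,2],[-1,1,1],[0,0,1]} :: int list set"
  let ?\<kappa> = "\<lambda>S. nat ((charge_const 1 S + (0)) div 2)"
  have sub: "S \<in> ?CS" if S: "length S = 3" "sum_list S = 1" "sorted S" "last S \<le> hd S + int 3" for S
  proof -
    obtain a b c where S': "S = [a,b,c]" using S(1) by (auto simp: length_3_iff)
    have *: "\<forall>a\<in>set [-3..2]. \<forall>b\<in>set [a..a+3]. (b \<le> 1 - (a+b) \<and> 1 - (a+b) \<le> a + 3 \<longrightarrow> [a,b,1 - (a+b)] \<in> ?CS)" by code_simp
    have ord: "a \<le> b \<and> b \<le> c \<and> c \<le> a + 3" and eq: "c = 1 - (a+b)" using S by (auto simp: S')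
    have mem: "a \<in> set [-3..2]" "b \<in> set [a..a+3]" using ord eq by auto
    show ?thesis unfolding S' eq using *[THEN bspec, OF mem(1), THEN bspec, OF mem(2), THEN mp] ord[unfolded eq] by simp
  qed
  have CS: "length S = 3 \<and> sum_list S = 1 \<and> charge_const 1 S + (0) = 2 * int (?\<kappa> S)" if "S \<in> ?CS" for S
    using that by (auto simp: charge_const_lists)
  have s0: "core_series 3 [-1,0,2] = core_series 3 [0,0,1]" using core_series_rotate3[of 3 "-1" "0" "2"] core_series_rotate3[of 3 "0" "2" "2"] core_series_shift[of "[0,0,1]" 3 "2"] by simp
  have s1: "core_series 3 [-1,1,1] = core_series 3 [0,0,1]" using core_series_rotate3[of 3 "-1" "1" "1"] core_series_shift[of "[0,0,1]" 3 "1"] by simp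
  have E: "(\<Sum>S\<in>?CS. q ^ ?\<kappa> S * core_series 3 S) = 3 * core_series 3 [0,0,1]"
    by (simp add: charge_const_lists s0 s1)
  note R = tuples_of_sum_series[where l = 3 and k = 1 and e = 3 and CS = ?CS and \<sigma> = 1 and c = "0" and \<kappa> = ?\<kappa>, OF _ _ _ _ sub CS]
  show "?series = ?rhs"
    unfolding E[symmetric] by (rule R(1)) simp_all
  show ?graded by (rule R(2)) simp_all
qed

lemma tuples_3_3_3:
  "gen_series {t. length t = 3 \<and> sum_list t = 3} (\<lambda>t. (tuple_form 1 t + (-4)) div 2) = core_series 3 [0,1,2] + 3 * q ^ 1 * core_series 3 [0,0,0]" (is "?series = ?rhs")
  "graded {t. length t = 3 \<and> sum_list t = 3} (\<lambda>t. (tuple_form 1 t + (-4)) div 2)" (is ?graded)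
proof -
  let ?CS = "{[-1,2,2],[0,0,3],[0,1,2],[1,1,1]} :: int list set"
  let ?\<kappa> = "\<lambda>S. nat ((charge_const 1 S + (-4)) div 2)"
  have sub: "S \<in> ?CS" if S: "length S = 3" "sum_list S = 3" "sorted S" "last S \<le> hd S + int 3" for S
  proof -
    obtain a b c where S': "S = [a,b,c]" using S(1) by (auto simp: length_3_iff)
    have *: "\<forall>a\<in>set [-3..2]. \<forall>b\<in>set [a..a+3]. (b \<le> 3 - (a+b) \<and> 3 - (a+b) \<le> a + 3 \<longrightarrow> [a,b,3 - (a+b)] \<in> ?CS)" by code_simp
    have ord: "a \<le> b \<and> b \<le> c \<and> c \<le> a + 3" and eq: "c = 3 - (a+b)" using S by (auto simp: S')
    have mem: "a \<in> set [-3..2]" "b \<in> set [a..a+3]" using ord eq by auto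
    show ?thesis unfolding S' eq using *[THEN bspec, OF mem(1), THEN bspec, OF mem(2), THEN mp] ord[unfolded eq] by simp
  qed
  have CS: "length S = 3 \<and> sum_list S = 3 \<and> charge_const 1 S + (-4) = 2 * int (?\<kappa> S)" if "S \<in> ?CS" for S
    using that by (auto simp: charge_const_lists)
  have s0: "core_series 3 [-1,2,2] = core_series 3 [0,0,0]" using core_series_rotate3[of 3 "-1" "2" "2"] core_series_shift[of "[0,0,0]" 3 "2"] by simp
  have s1: "core_series 3 [0,0,3] = core_series 3 [0,0,0]" using core_series_rotate3[of 3 "0" "0" "3"] core_series_rotate3[of 3 "0" "3" "3"] core_series_shift[of "[0,0,0]" 3 "3"] by simp
  have s2: "core_series 3 [1,1,1] = core_series 3 [0,0,0]" using core_series_shift[of "[0,0,0]" 3 "1"] by simp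
  have E: "(\<Sum>S\<in>?CS. q ^ ?\<kappa> S * core_series 3 S) = core_series 3 [0,1,2] + 3 * q ^ 1 * core_series 3 [0,0,0]"
    by (simp add: charge_const_lists s0 s1 s2)
  note R = tuples_of_sum_series[where l = 3 and k = 1 and e = 3 and CS = ?CS and \<sigma> = 3 and c = "-4" and \<kappa> = ?\<kappa>, OF _ _ _ _ sub CS]
  show "?series = ?rhs"
    unfolding E[symmetric] by (rule R(1)) simp_all
  show ?graded by (rule R(2)) simp_all
qed

lemma tuples_2_2_1:
  "gen_series {t. length t = 2 \<and> sum_list t = 1} (\<lambda>t. (tuple_form 1 t + (-1)) div 2) = core_series 2 [0,1]" (is "?series = ?rhs")
  "graded {t. length t = 2 \<and> sum_list t = 1} (\<lambda>t. (tuple_form 1 t + (-1)) div 2)" (is ?graded)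
proof -
  let ?CS = "{[0,1]} :: int list set"
  let ?\<kappa> = "\<lambda>S. nat ((charge_const 1 S + (-1)) div 2)"
  have sub: "S \<in> ?CS" if S: "length S = 2" "sum_list S = 1" "sorted S" "last S \<le> hd S + int 2" for S
  proof -
    obtain a b where S': "S = [a,b]" using S(1) by (auto simp: length_2_iff)
    have *: "\<forall>a\<in>set [-3..2]. (a \<le> 1 - (a) \<and> 1 - (a) \<le> a + 2 \<longrightarrow> [a,1 - (a)] \<in> ?CS)" by code_simp
    have ord: "a \<le> b \<and> b \<le> a + 2" and eq: "b = 1 - (a)" using S by (auto simp: S')
    have mem: "a \<in> set [-3..2]" using ord eq by auto
    show ?thesis unfolding S' eq using *[THEN bspec, OF mem, THEN mp] ord[unfolded eq] by simp
  qed
  have CS: "length S = 2 \<and> sum_list S = 1 \<and> charge_const 1 S + (-1) = 2 * int (?\<kappa> S)" if "S \<in> ?CS" for S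
    using that by (auto simp: charge_const_lists)
  have E: "(\<Sum>S\<in>?CS. q ^ ?\<kappa> S * core_series 2 S) = core_series 2 [0,1]"
    by (simp add: charge_const_lists)
  note R = tuples_of_sum_series[where l = 2 and k = 1 and e = 2 and CS = ?CS and \<sigma> = 1 and c = "-1" and \<kappa> = ?\<kappa>, OF _ _ _ _ sub CS]
  show "?series = ?rhs"
    unfolding E[symmetric] by (rule R(1)) simp_all
  show ?graded by (rule R(2)) simp_all
qed

section \<open>One-dimensional theta series\<close>

text \<open>
  Triangular numbers, indexed by all integers so that the symmetry \<open>x \<mapsto> 1 -
  x\<close> is available. This symmetry exchanges even and odd indices, and each parity class by
  itself gives \<open>\<psi>\<close>.
\<close>

definition tri :: "int \<Rightarrow> int" where "tri x = x * (x - 1) div 2"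

lemma tri_twice: "2 * tri x = x * (x - 1)"
  unfolding tri_def by (simp add: even_mult_iff)

lemma tri_reflect: "tri (1 - x) = tri x"
  by (simp add: tri_def algebra_simps)

lemma graded_int:
  assumes "\<And>x::int. x \<in> A \<Longrightarrow> \<bar>x\<bar> \<le> w x + K" "\<And>x. x \<in> A \<Longrightarrow> 0 \<le> w x"
  shows "graded A w"
  unfolding graded_def
proof (intro conjI ballI allI)
  show "finite {x\<in>A. w x = n}" for n
  proof (rule finite_subset)
    show "{x\<in>A. w x = n} \<subseteq> {- (n + K)..n + K}"
    proof
      fix x assume "x \<in> {x\<in>A. w x = n}"
      then show "x \<in> {- (n + K)..n + K}" using assms(1)[of x] by auto
    qed
  qed simp
qed (use assms in auto)

lemma abs_le_square: "\<bar>x\<bar> \<le> (x::int)\<^sup>2"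
proof -
  have "\<bar>x\<bar> * 1 \<le> \<bar>x\<bar> * \<bar>x\<bar>" if "x \<noteq> 0" using that by (intro mult_left_mono) auto
  then show ?thesis by (cases "x = 0") (auto simp: power2_eq_square)
qed

lemma graded_square: "graded A (\<lambda>x::int. x\<^sup>2)"
  by (rule graded_int[where K = 0]) (use abs_le_square in auto)

lemma graded_tri: "graded A tri"
proof (rule graded_int[where K = 1])
  fix x
  show "0 \<le> tri x"
  proof -
    have "0 \<le> x * (x - 1)" by (cases "x \<ge> 1") (auto intro: mult_nonneg_nonneg mult_nonpos_nonpos)
    then show ?thesis by (simp add: tri_def)
  qed
  have "0 \<le> (x - 2)\<^sup>2 + (x - 1) * x \<and> 0 \<le> x\<^sup>2 + (x + 1) * x"
  proof -
    have "0 \<le> (x - 1) * x" "0 \<le> (x + 1) * x"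
      by (cases "x \<ge> 1"; auto intro: mult_nonneg_nonneg mult_nonpos_nonpos)
         (cases "x \<ge> 0"; auto intro: mult_nonneg_nonneg mult_nonpos_nonpos)
    then show ?thesis by simp
  qed
  moreover have "0 \<le> (x - 1) * (x - 2)" by (cases "x \<ge> 2") (auto intro: mult_nonneg_nonneg mult_nonpos_nonpos)
  moreover have "0 \<le> x\<^sup>2 + x" using abs_le_square[of x] by linarith
  ultimately show "\<bar>x\<bar> \<le> tri x + 1" using tri_twice[of x] by (simp add: algebra_simps power2_eq_square abs_le_iff)
qed

lemma psi_even: "gen_series {p. even p} tri = psi"
proof -
  let ?f = "\<lambda>t::nat. if even t then - int t else int t + 1"
  let ?g = "\<lambda>p::int. if p > 0 then nat (p - 1) else nat (- p)"
  have "bij_betw ?f UNIV {p. even p}"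
    by (rule bij_betw_byWitness[of _ ?g]) (auto simp: even_nat_iff)
  moreover have "tri (?f t) = int (t * (t + 1) div 2)" for t
  proof -
    have "even (t * (t + 1))" by simp
    then have "2 * (t * (t + 1) div 2) = t * (t + 1)" by simp
    from arg_cong[OF this, of int] have "2 * int (t * (t + 1) div 2) = int t * (int t + 1)"
      unfolding of_nat_mult by simp
    moreover have "2 * tri (?f t) = int t * (int t + 1)" unfolding tri_twice by (simp add: algebra_simps)
    ultimately show ?thesis by simp
  qed
  ultimately have "gen_series UNIV (\<lambda>t::nat. int (t * (t + 1) div 2)) = gen_series {p. even p} tri"
    by (rule gen_series_bij)
  then show ?thesis by (simp add: psi_def)
qed

text \<open>
  The reflection \<open>p \<mapsto> 1 - p\<close> preserves triangular numbers and changes the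
  parity. It makes parity conditions on an index harmless.
\<close>

lemma psi_parity: "gen_series {p. even p \<longleftrightarrow> b} tri = psi"
proof (cases b)
  case False
  have "bij_betw (\<lambda>p::int. 1 - p) {p. even p} {p. even p \<longleftrightarrow> b}"
    by (rule bij_betw_byWitness[of _ "\<lambda>p. 1 - p"]) (use False in auto)
  then show ?thesis using gen_series_bij[of "\<lambda>p. 1 - p" "{p. even p}" _ tri tri] tri_reflect psi_even by simp
qed (simp add: psi_even)

lemma psi_twice: "gen_series UNIV tri = 2 * psi"
proof -
  have U: "(UNIV::int set) = {p. even p \<longleftrightarrow> True} \<union> {p. even p \<longleftrightarrow> False}" by auto
  show ?thesis unfolding U
    by (subst gen_series_Un) (auto simp only: psi_parity graded_tri mult_2 intro: graded_tri)
qed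

lemma psi_double: "gen_series UNIV (\<lambda>v. tri (2 * v)) = psi"
proof -
  have "bij_betw (\<lambda>v::int. 2 * v) UNIV {p. even p}"
    by (rule bij_betw_byWitness[of _ "\<lambda>p. p div 2"]) auto
  then show ?thesis using gen_series_bij[of "\<lambda>v. 2 * v" UNIV _ tri] psi_even by simp
qed

lemma psi_scaled:
  assumes "k > 0" shows "gen_series {p. even p \<longleftrightarrow> b} (\<lambda>p. int k * tri p) = psi oo q ^ k"
  unfolding gen_series_compose[OF assms, of "{p. even p \<longleftrightarrow> b}" tri, symmetric] psi_parity ..

lemma psi_twice_scaled:
  assumes "k > 0" shows "gen_series UNIV (\<lambda>p. int k * tri p) = 2 * (psi oo q ^ k)"
  unfolding gen_series_compose[OF assms, of UNIV tri, symmetric] psi_twice mult_2 by (rule fps_compose_add_distrib)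

lemma phi_scaled: "k > 0 \<Longrightarrow> gen_series UNIV (\<lambda>n. int k * n\<^sup>2) = phi oo q ^ k"
  unfolding phi_def by (rule gen_series_compose[symmetric])

lemma compose_powers: "a > 0 \<Longrightarrow> b > 0 \<Longrightarrow> ((f :: int fps) oo q ^ a) oo q ^ b = f oo q ^ (a * b)"
proof (rule fps_ext)
  fix n assume ab: "a > 0" "b > 0"
  show "fps_nth ((f oo q ^ a) oo q ^ b) n = fps_nth (f oo q ^ (a * b)) n"
  proof (cases "b dvd n")
    case True
    then obtain m where m: "n = b * m" by blast
    then show ?thesis using ab by (simp add: fps_nth_compose_X_power mult.commute[of a b] nat_mult_dvd_cancel_disj div_mult2_eq)
  next
    case False
    then have "\<not> a * b dvd n" by (meson dvd_mult_right)
    then show ?thesis using False ab by (simp add: fps_nth_compose_X_power)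
  qed
qed

text \<open>
  Sum and difference of two even indices: \<open>a (2a - 1) + b (2b - 1)\<close> equals \<open>(a
  - b)\<^sup>2 + s (s - 1)\<close> with \<open>s = a + b\<close>, and \<open>s\<close> has the
  parity of \<open>a - b\<close>.
\<close>

lemma psi_square: "psi\<^sup>2 = phi * (psi oo q ^ 2)"
proof -
  let ?A = "{p::int. even p} \<times> {p::int. even p}"
  let ?B = "Sigma (UNIV::int set) (\<lambda>u. {s::int. even s \<longleftrightarrow> even u})"
  let ?f = "\<lambda>(p,r). ((p - r) div 2, (p + r) div 2)" and ?g = "\<lambda>(u,s). (u + s, s - u)"
  have "gen_series ?A (\<lambda>(p,r). tri p + tri r) = gen_series ?B (\<lambda>(u,s). u\<^sup>2 + int 2 * tri s)"
  proof (rule gen_series_bij)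
    show "bij_betw ?f ?A ?B"
      by (rule bij_betw_byWitness[of _ ?g]; clarsimp simp: image_subset_iff; presburger)
    fix x assume "x \<in> ?A"
    then obtain a b where x: "x = (2 * a, 2 * b)" by (auto elim!: evenE)
    show "(case ?f x of (u,s) \<Rightarrow> u\<^sup>2 + int 2 * tri s) = (case x of (p,r) \<Rightarrow> tri p + tri r)"
      using tri_twice[of "a + b"] tri_twice[of "2 * a"] tri_twice[of "2 * b"] by (simp add: x power2_eq_square algebra_simps)
  qed
  also have "\<dots> = phi * (psi oo q ^ 2)" unfolding phi_def
    by (rule gen_series_Sigma) (auto simp only: psi_scaled zero_less_numeral intro: graded_square graded_scale graded_tri)
  finally show ?thesis by (simp add: gen_series_times graded_tri psi_even power2_eq_square)
qed

section \<open>Sums of squares by parity\<close>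

definition par :: "bool \<Rightarrow> int set" where "par b = {x. even x \<longleftrightarrow> b}"

text \<open>
  The theta series of the even or of the odd integers, with the square halved and rounded down. In
  sums of squares of mixed parity the roundings add up to a constant.
\<close>

definition half_squares :: "bool \<Rightarrow> int fps" where "half_squares b = gen_series (par b) (\<lambda>x. x\<^sup>2 div 2)"

lemma graded_half: "graded (par b) (\<lambda>x. x\<^sup>2 div 2)"
proof (rule graded_int[where K = 1])
  fix x :: int
  have "0 \<le> (\<bar>x\<bar> - 1)\<^sup>2" by simp
  then have "2 * \<bar>x\<bar> \<le> x\<^sup>2 + 1" by (simp add: power2_diff)
  then show "\<bar>x\<bar> \<le> x\<^sup>2 div 2 + 1" by linarith
qed simp

lemma half_squares_even: "half_squares True = phi oo q ^ 2"
proof -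
  have "bij_betw (\<lambda>v::int. 2 * v) UNIV (par True)"
    by (rule bij_betw_byWitness[of _ "\<lambda>p. p div 2"]) (auto simp: par_def)
  then have "gen_series UNIV (\<lambda>v. int 2 * v\<^sup>2) = half_squares True" unfolding half_squares_def
    by (rule gen_series_bij) (simp add: power2_eq_square)
  then show ?thesis using phi_scaled[of 2] by simp
qed

lemma half_squares_odd: "half_squares False = 2 * (psi oo q ^ 4)"
proof -
  have "bij_betw (\<lambda>v::int. 2 * v - 1) UNIV (par False)"
    by (rule bij_betw_byWitness[of _ "\<lambda>p. (p + 1) div 2"]) (auto simp: par_def elim!: oddE)
  then have "gen_series UNIV (\<lambda>v. int 4 * tri v) = half_squares False" unfolding half_squares_def
  proof (rule gen_series_bij)
    fix v :: int
    have "(2 * v - 1)\<^sup>2 = 2 * (int 4 * tri v) + 1" using tri_twice[of v] by (simp add: power2_eq_square algebra_simps)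
    then show "(2 * v - 1)\<^sup>2 div 2 = int 4 * tri v" by simp
  qed
  then show ?thesis using psi_twice_scaled[of 4] by simp
qed

lemma square_half: "x \<in> par b \<Longrightarrow> (x::int)\<^sup>2 = 2 * (x\<^sup>2 div 2) + of_bool (\<not> b)"
proof -
  assume "x \<in> par b"
  then have "x\<^sup>2 mod 2 = of_bool (\<not> b)" by (auto simp: par_def parity_cases mod2_eq_if)
  then show ?thesis using mult_div_mod_eq[of 2 "x\<^sup>2"] by simp
qed

text \<open>
  The substitution \<open>(x, y) \<mapsto> (x + y, x - y)\<close> reaches exactly the pairs of
  equal parity, which are separated into even and odd ones.
\<close>

lemma phi_square: "phi\<^sup>2 = (phi oo q ^ 2)\<^sup>2 + 4 * q * (psi oo q ^ 4)\<^sup>2"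
proof -
  let ?w = "\<lambda>(u,v). (u\<^sup>2 + v\<^sup>2) div 2 :: int"
  let ?A = "UNIV \<times> UNIV :: (int \<times> int) set"
  let ?f = "\<lambda>(x,y). (x + y, x - y)" and ?g = "\<lambda>(u,v). ((u + v) div 2, (u - v) div 2)"
  have P: "gen_series (par b \<times> par b) ?w = q ^ of_bool (\<not> b) * (half_squares b * half_squares b)" (is ?P)
    and G: "graded (par b \<times> par b) ?w" (is ?G) for b
  proof -
    have w: "?w x = (case x of (u,v) \<Rightarrow> u\<^sup>2 div 2 + v\<^sup>2 div 2) + int (of_bool (\<not> b))" if "x \<in> par b \<times> par b" for x
      using that square_half[of "fst x" b] square_half[of "snd x" b] by (cases b) (auto simp: split_beta)
    have g: "graded (par b \<times> par b) (\<lambda>(u,v). u\<^sup>2 div 2 + v\<^sup>2 div 2)" by (intro graded_times graded_half)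
    show ?P unfolding half_squares_def gen_series_times[OF graded_half graded_half, symmetric] gen_series_shift[OF g, symmetric]
      by (rule gen_series_cong[OF refl w])
    show ?G by (rule iffD2[OF graded_cong[OF refl w] graded_shift[OF g]])
  qed
  have "gen_series ?A (\<lambda>(x,y). x\<^sup>2 + y\<^sup>2) = gen_series (par True \<times> par True \<union> par False \<times> par False) ?w"
  proof (rule gen_series_bij)
    show "bij_betw ?f ?A (par True \<times> par True \<union> par False \<times> par False)"
      by (rule bij_betw_byWitness[of _ ?g]; clarsimp simp: image_subset_iff par_def; presburger)
    show "?w (?f x) = (case x of (x,y) \<Rightarrow> x\<^sup>2 + y\<^sup>2)" for x :: "int \<times> int"
      by (cases x) (simp add: power2_eq_square algebra_simps)
  qed
  also have "\<dots> = (half_squares True * half_squares True) + q * (half_squares False * half_squares False)"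
    by (subst gen_series_Un) (use P[of True] P[of False] G[of True] G[of False] in \<open>auto simp: par_def\<close>)
  finally have "gen_series ?A (\<lambda>(x,y). x\<^sup>2 + y\<^sup>2) = \<dots>" .
  moreover have "gen_series ?A (\<lambda>(x,y). x\<^sup>2 + y\<^sup>2) = phi * phi"
    unfolding phi_def by (rule gen_series_times[OF graded_square graded_square])
  ultimately show ?thesis
    unfolding half_squares_even half_squares_odd by (simp add: power2_eq_square[of phi] power2_eq_square[of "phi oo _"] power2_eq_square[of "psi oo _"] algebra_simps)
qed

lemma three_par:
  assumes "of_bool (\<not> a) + of_bool (\<not> b) + of_bool (\<not> c) = d + 2 * int k"
  shows "gen_series ((par a \<times> par b) \<times> par c) (\<lambda>((x,y),z). (x\<^sup>2 + y\<^sup>2 + z\<^sup>2 - d) div 2) = q ^ k * (half_squares a * half_squares b * half_squares c)" (is ?P)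
    and "graded ((par a \<times> par b) \<times> par c) (\<lambda>((x,y),z). (x\<^sup>2 + y\<^sup>2 + z\<^sup>2 - d) div 2)" (is ?G)
proof -
  let ?w = "\<lambda>((x,y),z). (x\<^sup>2 + y\<^sup>2 + z\<^sup>2 - d) div 2"
  let ?v = "\<lambda>(p,z). (case p of (x,y) \<Rightarrow> x\<^sup>2 div 2 + y\<^sup>2 div 2) + z\<^sup>2 div 2 :: int"
  have w: "?w p = ?v p + int k" if "p \<in> (par a \<times> par b) \<times> par c" for p
  proof -
    obtain x y z where p: "p = ((x,y),z)" by (cases p) auto
    have "x\<^sup>2 + y\<^sup>2 + z\<^sup>2 - d = 2 * (x\<^sup>2 div 2 + y\<^sup>2 div 2 + z\<^sup>2 div 2 + int k)"
      using square_half[of x a] square_half[of y b] square_half[of z c] that assms by (auto simp: p)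
    then show ?thesis by (simp add: p)
  qed
  have g: "graded (par a \<times> par b) (\<lambda>(x,y). x\<^sup>2 div 2 + y\<^sup>2 div 2)" by (intro graded_times graded_half)
  then have g': "graded ((par a \<times> par b) \<times> par c) ?v" by (intro graded_times graded_half)
  show ?P unfolding half_squares_def gen_series_times[OF graded_half graded_half, symmetric]
      gen_series_times[OF g graded_half, symmetric] gen_series_shift[OF g', symmetric]
    by (rule gen_series_cong[OF refl w])
  show ?G by (rule iffD2[OF graded_cong[OF refl w] graded_shift[OF g']])
qed

lemma three_squares_even_sum:
  "gen_series {((x,y),z). even (x + y + z)} (\<lambda>((x,y),z). (x\<^sup>2 + y\<^sup>2 + z\<^sup>2 - 0) div 2) = (phi oo q ^ 2) ^ 3 + 12 * q * (phi oo q ^ 2) * (psi oo q ^ 4)\<^sup>2"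
proof -
  let ?w = "\<lambda>((x,y),z). (x\<^sup>2 + y\<^sup>2 + z\<^sup>2 - 0) div 2 :: int"
  let ?I = "{((True,True),True), ((True,False),False), ((False,True),False), ((False,False),True)}"
  let ?A = "\<lambda>((a,b),c). (par a \<times> par b) \<times> par c"
  have "{((x,y),z). even (x + y + z)} = (\<Union>i\<in>?I. ?A i)" by (auto simp: par_def)
  moreover have "gen_series (\<Union>i\<in>?I. ?A i) ?w = (\<Sum>i\<in>?I. gen_series (?A i) ?w)"
  proof (rule gen_series_UNION(1))
    show "graded (?A i) ?w" if "i \<in> ?I" for i
      using that three_par(2)[of True True True 0 0] three_par(2)[of True False False 0 1] three_par(2)[of False True False 0 1] three_par(2)[of False False True 0 1]
      by (elim insertE emptyE) simp_all
    show "?A i \<inter> ?A j = {}" if "i \<noteq> j" for i j using that by (auto simp: par_def)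
  qed simp
  ultimately show ?thesis
    using three_par(1)[of True True True 0 0] three_par(1)[of True False False 0 1] three_par(1)[of False True False 0 1] three_par(1)[of False False True 0 1]
    by (simp add: half_squares_even half_squares_odd power2_eq_square power3_eq_cube algebra_simps)
qed

lemma three_squares_odd_sum:
  "gen_series {((x,y),z). odd (x + y + z)} (\<lambda>((x,y),z). (x\<^sup>2 + y\<^sup>2 + z\<^sup>2 - 1) div 2) = 6 * (phi oo q ^ 2)\<^sup>2 * (psi oo q ^ 4) + 8 * q * (psi oo q ^ 4) ^ 3"
proof -
  let ?w = "\<lambda>((x,y),z). (x\<^sup>2 + y\<^sup>2 + z\<^sup>2 - 1) div 2 :: int"
  let ?I = "{((False,True),True), ((True,False),True), ((True,True),False), ((False,False),False)}"
  let ?A = "\<lambda>((a,b),c). (par a \<times> par b) \<times> par c"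
  have "{((x,y),z). odd (x + y + z)} = (\<Union>i\<in>?I. ?A i)" by (auto simp: par_def)
  moreover have "gen_series (\<Union>i\<in>?I. ?A i) ?w = (\<Sum>i\<in>?I. gen_series (?A i) ?w)"
  proof (rule gen_series_UNION(1))
    show "graded (?A i) ?w" if "i \<in> ?I" for i
      using that three_par(2)[of False True True 1 0] three_par(2)[of True False True 1 0] three_par(2)[of True True False 1 0] three_par(2)[of False False False 1 1]
      by (elim insertE emptyE) simp_all
    show "?A i \<inter> ?A j = {}" if "i \<noteq> j" for i j using that by (auto simp: par_def)
  qed simp
  ultimately show ?thesis
    using three_par(1)[of False True True 1 0] three_par(1)[of True False True 1 0] three_par(1)[of True True False 1 0] three_par(1)[of False False False 1 1]
    by (simp add: half_squares_even half_squares_odd power2_eq_square power3_eq_cube algebra_simps)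
qed

section \<open>Theta series of lattices of tuples\<close>

lemma tuple_form_lists:
  "tuple_form k [a,b] = int k * (a\<^sup>2 + b\<^sup>2) + 2 * b"
  "tuple_form k [a,b,c] = int k * (a\<^sup>2 + b\<^sup>2 + c\<^sup>2) - a + b + 3 * c"
  "tuple_form k [a,b,c,d] = int k * (a\<^sup>2 + b\<^sup>2 + c\<^sup>2 + d\<^sup>2) - 2 * a + 2 * c + 4 * d"
  by (simp_all add: tuple_form_def lessThan_Suc algebra_simps)

lemma tuple_form_6:
  "tuple_form k [a,b,c,d,f,g] = int k * (a\<^sup>2 + b\<^sup>2 + c\<^sup>2 + d\<^sup>2 + f\<^sup>2 + g\<^sup>2) - 4 * a - 2 * b + 2 * d + 4 * f + 6 * g"
  by (simp add: tuple_form_def lessThan_Suc algebra_simps)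

lemma length_6_iff: "length t = 6 \<longleftrightarrow> (\<exists>a b c d f g. t = [a,b,c,d,f,g])"
  by (auto simp: eval_nat_numeral length_Suc_conv)

text \<open>
  For \<open>l = 1\<close> every tuple of sum \<open>\<alpha>\<close> is a core of charge
  \<open>[\<alpha>]\<close>.
\<close>

lemma single_runner:
  assumes "e > 0"
  shows "gen_series {t. length t = e \<and> sum_list t = \<alpha>} (\<lambda>t. (tuple_form e t + - (\<alpha> * (\<alpha> + 1))) div 2) = core_series e [\<alpha>]"
    and "graded {t. length t = e \<and> sum_list t = \<alpha>} (\<lambda>t. (tuple_form e t + - (\<alpha> * (\<alpha> + 1))) div 2)"
proof -
  have sub: "S \<in> {[\<alpha>]}" if "length S = 1" "sum_list S = \<alpha>" for S using that by (auto simp: length_Suc_conv)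
  note R = tuples_of_sum_series[where l = 1 and k = e and e = e and CS = "{[\<alpha>]}" and \<sigma> = \<alpha> and c = "- (\<alpha> * (\<alpha> + 1))" and \<kappa> = "\<lambda>_. 0"]
  show "graded {t. length t = e \<and> sum_list t = \<alpha>} (\<lambda>t. (tuple_form e t + - (\<alpha> * (\<alpha> + 1))) div 2)"
    by (rule R(2)) (use assms sub in \<open>auto simp: charge_const_lists\<close>)
  have "gen_series {t. length t = e \<and> sum_list t = \<alpha>} (\<lambda>t. (tuple_form e t + - (\<alpha> * (\<alpha> + 1))) div 2) = (\<Sum>S\<in>{[\<alpha>]}. q ^ 0 * core_series e S)"
    by (rule R(1)) (use assms sub in \<open>auto simp: charge_const_lists\<close>)
  then show "gen_series {t. length t = e \<and> sum_list t = \<alpha>} (\<lambda>t. (tuple_form e t + - (\<alpha> * (\<alpha> + 1))) div 2) = core_series e [\<alpha>]" by simp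
qed

lemma half_eq: "2 * a = b \<Longrightarrow> a = (b::int) div 2" by simp

lemma tri_four: "4 * tri x = 2 * (x * (x - 1))" using tri_twice[of x] by simp

text \<open>
  For tuples of sum \<open>\<sigma>\<close> the three sums \<open>t\<^sub>0 + t\<^sub>i\<close>
  determine the tuple; the only restriction on them is that they have the parity of
  \<open>\<sigma>\<close> in total. With respect to these coordinates, suitably translated by
  \<open>a, b, c\<close>, the quadratic form becomes diagonal.
\<close>

lemma four_tuples_series:
  assumes V: "\<And>x y z w. x + y + z + w = \<sigma> \<Longrightarrow> V ((x + y - a, x + z - b), x + w - c) = (tuple_form k [x,y,z,w] + C) div 2"
  shows "gen_series {t. length t = 4 \<and> sum_list t = \<sigma>} (\<lambda>t. (tuple_form k t + C) div 2) = gen_series {((u,v),w). even (u + v + w + (a + b + c + \<sigma>))} V"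
proof (rule gen_series_bij)
  let ?f = "\<lambda>t::int list. ((t ! 0 + t ! 1 - a, t ! 0 + t ! 2 - b), t ! 0 + t ! 3 - c)"
  let ?g = "\<lambda>((u,v),w). [(u + v + w + (a + b + c) - \<sigma>) div 2, u + a - (u + v + w + (a + b + c) - \<sigma>) div 2,
     v + b - (u + v + w + (a + b + c) - \<sigma>) div 2, w + c - (u + v + w + (a + b + c) - \<sigma>) div 2]"
  show "bij_betw ?f {t. length t = 4 \<and> sum_list t = \<sigma>} {((u,v),w). even (u + v + w + (a + b + c + \<sigma>))}"
    by (rule bij_betw_byWitness[of _ ?g]; clarsimp simp: image_subset_iff length_4_iff; presburger)
  fix t assume "t \<in> {t. length t = 4 \<and> sum_list t = \<sigma>}"
  then obtain x y z w where "t = [x,y,z,w]" "x + y + z + w = \<sigma>" by (auto simp: length_4_iff)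
  then show "V (?f t) = (tuple_form k t + C) div 2" using V[of x y z w] by simp
qed

lemma swap_coordinates:
  "gen_series {((u,v),w::int). even (u + v + w + (n::int))} V = gen_series {((u,v),w). even (u + v + w + n)} (\<lambda>((u,v),w). V ((u,w),v))"
proof (rule gen_series_bij)
  show "bij_betw (\<lambda>((u,v),w). ((u,w),v)) {((u,v),w::int). even (u + v + w + n)} {((u,v),w). even (u + v + w + n)}"
    by (rule bij_betw_byWitness[of _ "\<lambda>((u,v),w). ((u,w),v)"]) (auto simp: algebra_simps)
qed auto

text \<open>
  The parity condition restricts the last index to even or to odd numbers, depending on the
  others; by \<open>psi_parity\<close> both cases contribute the same factor.
\<close>

lemma parity_last_series:
  assumes "graded (UNIV \<times> UNIV) u" "k > 0"
  shows "gen_series {((x,y),z). even (x + y + z + n)} (\<lambda>((x,y),z). u (x,y) + int k * tri z) = gen_series (UNIV \<times> UNIV) u * (psi oo q ^ k)"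
proof -
  have "{((x,y),z). even (x + y + z + n)} = Sigma (UNIV \<times> UNIV) (\<lambda>(x,y). {z. even z \<longleftrightarrow> even (x + y + n)})" by auto
  moreover have "gen_series (Sigma (UNIV \<times> UNIV) (\<lambda>(x,y). {z. even z \<longleftrightarrow> even (x + y + n)})) (\<lambda>(p,z). u p + int k * tri z) = gen_series (UNIV \<times> UNIV) u * (psi oo q ^ k)"
    by (rule gen_series_Sigma) (use assms in \<open>auto intro!: graded_scale graded_tri simp: psi_scaled\<close>)
  moreover have "(\<lambda>((x,y),z). u (x,y) + int k * tri z) = (\<lambda>(p,z). u p + int k * tri z)" by auto
  ultimately show ?thesis by (simp only:)
qed

lemma tuples_sum_3_series: "gen_series {t. length t = 4 \<and> sum_list t = 3} (\<lambda>t. (tuple_form 1 t + (-1)) div 2) = 4 * psi ^ 3"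
proof -
  have "gen_series {t. length t = 4 \<and> sum_list t = 3} (\<lambda>t. (tuple_form 1 t + (-1)) div 2)
      = gen_series {((x,y),z). even (x + y + z + (3 + 2 + 1 + 3))} (\<lambda>((x,y),z). (case (x,y) of (x,y) \<Rightarrow> tri x + tri y) + int 1 * tri z)"
  proof (rule four_tuples_series)
    fix x y z w :: int assume "x + y + z + w = 3"
    then have w: "w = 3 - x - y - z" by simp
    show "(\<lambda>((x,y),z). (case (x,y) of (x,y) \<Rightarrow> tri x + tri y) + int 1 * tri z) ((x + y - 3, x + z - 2), x + w - 1) = (tuple_form 1 [x,y,z,w] + (-1)) div 2"
      by (rule half_eq) (simp add: w tuple_form_lists tri_twice power2_eq_square algebra_simps)
  qed
  also have "\<dots> = gen_series (UNIV \<times> UNIV) (\<lambda>(x,y). tri x + tri y) * (psi oo q ^ 1)"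
    by (rule parity_last_series, intro graded_times graded_scale graded_tri graded_square) simp_all
  also have "\<dots> = 4 * psi ^ 3"
    unfolding gen_series_times[OF graded_tri graded_tri] psi_twice by (simp add: power3_eq_cube)
  finally show ?thesis .
qed

lemma tuples_sum_6_series: "gen_series {t. length t = 4 \<and> sum_list t = 6} (\<lambda>t. (tuple_form 1 t + (-10)) div 2) = (phi oo q ^ 2) ^ 3 + 12 * q * (phi oo q ^ 2) * (psi oo q ^ 4)\<^sup>2"
proof -
  have "gen_series {t. length t = 4 \<and> sum_list t = 6} (\<lambda>t. (tuple_form 1 t + (-10)) div 2)
      = gen_series {((x,y),z). even (x + y + z + (5 + 4 + 3 + 6))} (\<lambda>((x,y),z). (x\<^sup>2 + y\<^sup>2 + z\<^sup>2 - 0) div 2)"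
  proof (rule four_tuples_series)
    fix x y z w :: int assume "x + y + z + w = 6"
    then have w: "w = 6 - x - y - z" by simp
    have "(x + y - 5)\<^sup>2 + (x + z - 4)\<^sup>2 + (x + w - 3)\<^sup>2 - 0 = tuple_form 1 [x,y,z,w] + (-10)"
      by (simp add: w tuple_form_lists power2_eq_square algebra_simps)
    then show "(\<lambda>((x,y),z). (x\<^sup>2 + y\<^sup>2 + z\<^sup>2 - 0) div 2) ((x + y - 5, x + z - 4), x + w - 3) = (tuple_form 1 [x,y,z,w] + (-10)) div 2"
      by simp
  qed
  also have "{((x,y),z). even (x + y + z + (5 + 4 + 3 + 6::int))} = {((x,y),z). even (x + y + z)}" by auto
  finally show ?thesis unfolding three_squares_even_sum .
qed

lemma tuples_sum_4_series: "gen_series {t. length t = 4 \<and> sum_list t = 4} (\<lambda>t. (tuple_form 1 t + (-4)) div 2) = 6 * (phi oo q ^ 2)\<^sup>2 * (psi oo q ^ 4) + 8 * q * (psi oo q ^ 4) ^ 3"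
proof -
  have "gen_series {t. length t = 4 \<and> sum_list t = 4} (\<lambda>t. (tuple_form 1 t + (-4)) div 2)
      = gen_series {((x,y),z). even (x + y + z + (4 + 3 + 2 + 4))} (\<lambda>((x,y),z). (x\<^sup>2 + y\<^sup>2 + z\<^sup>2 - 1) div 2)"
  proof (rule four_tuples_series)
    fix x y z w :: int assume "x + y + z + w = 4"
    then have w: "w = 4 - x - y - z" by simp
    have "(x + y - 4)\<^sup>2 + (x + z - 3)\<^sup>2 + (x + w - 2)\<^sup>2 - 1 = tuple_form 1 [x,y,z,w] + (-4)"
      by (simp add: w tuple_form_lists power2_eq_square algebra_simps)
    then show "(\<lambda>((x,y),z). (x\<^sup>2 + y\<^sup>2 + z\<^sup>2 - 1) div 2) ((x + y - 4, x + z - 3), x + w - 2) = (tuple_form 1 [x,y,z,w] + (-4)) div 2"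
      by simp
  qed
  also have "{((x,y),z). even (x + y + z + (4 + 3 + 2 + 4::int))} = {((x,y),z). odd (x + y + z)}" by auto
  finally show ?thesis unfolding three_squares_odd_sum .
qed

lemma tuples_sum_1_series: "gen_series {t. length t = 4 \<and> sum_list t = 1} (\<lambda>t. (tuple_form 2 t + 0) div 2) = 2 * phi * (psi oo q ^ 2)\<^sup>2"
proof -
  have "gen_series {t. length t = 4 \<and> sum_list t = 1} (\<lambda>t. (tuple_form 2 t + 0) div 2)
      = gen_series {((x,y),z). even (x + y + z + (1 + 1 + 0 + 1))} (\<lambda>((x,y),z). (case (x,y) of (x,y) \<Rightarrow> int 2 * tri x + y\<^sup>2) + int 2 * tri z)"
  proof (rule four_tuples_series)
    fix x y z w :: int assume "x + y + z + w = 1"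
    then have w: "w = 1 - x - y - z" by simp
    show "(\<lambda>((x,y),z). (case (x,y) of (x,y) \<Rightarrow> int 2 * tri x + y\<^sup>2) + int 2 * tri z) ((x + y - 1, x + z - 1), x + w - 0) = (tuple_form 2 [x,y,z,w] + 0) div 2"
      by (rule half_eq) (simp add: w tuple_form_lists tri_four power2_eq_square algebra_simps)
  qed
  also have "\<dots> = gen_series (UNIV \<times> UNIV) (\<lambda>(x,y). int 2 * tri x + y\<^sup>2) * (psi oo q ^ 2)"
    by (rule parity_last_series, intro graded_times graded_scale graded_tri graded_square) simp_all
  also have "gen_series (UNIV \<times> UNIV) (\<lambda>(x,y). int 2 * tri x + y\<^sup>2) = gen_series UNIV (\<lambda>x. int 2 * tri x) * phi"
    unfolding phi_def by (rule gen_series_times, intro graded_scale graded_tri graded_square) (simp, rule graded_square)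
  finally show ?thesis unfolding psi_twice_scaled[OF zero_less_numeral] by (simp add: power2_eq_square[of "psi oo _"] ac_simps)
qed

lemma tuples_sum_2_series: "gen_series {t. length t = 4 \<and> sum_list t = 2} (\<lambda>t. (tuple_form 2 t + (-2)) div 2) = (psi oo q ^ 2) * phi\<^sup>2"
proof -
  have "gen_series {t. length t = 4 \<and> sum_list t = 2} (\<lambda>t. (tuple_form 2 t + (-2)) div 2)
      = gen_series {((x,y),z). even (x + y + z + (2 + 1 + 1 + 2))} (\<lambda>((x,y),z). (case (x,z) of (x,z) \<Rightarrow> x\<^sup>2 + z\<^sup>2) + int 2 * tri y)"
  proof (rule four_tuples_series)
    fix x y z w :: int assume "x + y + z + w = 2"
    then have w: "w = 2 - x - y - z" by simp
    show "(\<lambda>((x,y),z). (case (x,z) of (x,z) \<Rightarrow> x\<^sup>2 + z\<^sup>2) + int 2 * tri y) ((x + y - 2, x + z - 1), x + w - 1) = (tuple_form 2 [x,y,z,w] + (-2)) div 2"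
      by (rule half_eq) (simp add: w tuple_form_lists tri_four power2_eq_square algebra_simps)
  qed
  also have "\<dots> = gen_series {((x,y),z). even (x + y + z + (2 + 1 + 1 + 2))} (\<lambda>((x,y),z). (case (x,y) of (x,z) \<Rightarrow> x\<^sup>2 + z\<^sup>2) + int 2 * tri z)"
    by (subst swap_coordinates) (simp only: prod.case)
  also have "\<dots> = gen_series (UNIV \<times> UNIV) (\<lambda>(x,z). x\<^sup>2 + z\<^sup>2) * (psi oo q ^ 2)"
    by (rule parity_last_series, intro graded_times graded_scale graded_tri graded_square) simp_all
  also have "gen_series (UNIV \<times> UNIV) (\<lambda>(x,z). x\<^sup>2 + z\<^sup>2) = phi * phi"
    unfolding phi_def by (rule gen_series_times) (auto intro: graded_square)
  finally show ?thesis by (simp only: power2_eq_square ac_simps)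
qed

lemma graded_double: "graded A (\<lambda>v. tri (2 * v))"
proof (rule graded_int[where K = 1])
  fix v :: int
  have "0 \<le> (\<bar>v\<bar> - 1)\<^sup>2" "\<bar>v\<bar> \<le> v\<^sup>2" by (simp_all add: abs_le_square)
  moreover have "tri (2 * v) = 2 * v\<^sup>2 - v" using tri_twice[of "2 * v"] by (simp add: power2_eq_square algebra_simps)
  ultimately show "\<bar>v\<bar> \<le> tri (2 * v) + 1" "0 \<le> tri (2 * v)" by linarith+
qed

text \<open>
  Here \<open>t\<^sub>0 + t\<^sub>2\<close>, \<open>t\<^sub>0 - t\<^sub>2\<close> and
  \<open>t\<^sub>1 - t\<^sub>3\<close> are orthogonal coordinates of equal parity.
\<close>

lemma four_cores_series: "core_series 4 [0] = psi * (psi oo q ^ 2)\<^sup>2"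
proof -
  let ?B = "Sigma UNIV (\<lambda>v::int. {p::int. even p \<longleftrightarrow> even v})"
  let ?D = "Sigma ?B (\<lambda>(v,p). {r::int. even r \<longleftrightarrow> even v})"
  let ?u = "\<lambda>(v,p). tri (2 * v) + int 2 * tri p"
  let ?f = "\<lambda>t::int list. ((t ! 0 + t ! 2, t ! 0 - t ! 2), t ! 1 - t ! 3)"
  let ?g = "\<lambda>((v,p),r). [(v + p) div 2, (r - v) div 2, (v - p) div 2, (- v - r) div 2]"
  have g2: "graded A (\<lambda>p. int 2 * tri p)" for A by (intro graded_scale graded_tri) simp
  have "core_series 4 [0] = gen_series {t. length t = 4 \<and> sum_list t = 0} (\<lambda>t. (tuple_form 4 t + - (0 * (0 + 1))) div 2)"
    by (rule single_runner(1)[symmetric]) simp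
  also have "\<dots> = gen_series ?D (\<lambda>(x,r). ?u x + int 2 * tri r)"
  proof (rule gen_series_bij)
    show "bij_betw ?f {t. length t = 4 \<and> sum_list t = 0} ?D"
      by (rule bij_betw_byWitness[of _ ?g]; clarsimp simp: image_subset_iff length_4_iff; presburger)
    fix t :: "int list" assume "t \<in> {t. length t = 4 \<and> sum_list t = 0}"
    then obtain x y z w where t: "t = [x,y,z,w]" "x + y + z + w = 0" by (auto simp: length_4_iff)
    then have w: "w = - x - y - z" by simp
    show "(\<lambda>(x,r). ?u x + int 2 * tri r) (?f t) = (tuple_form 4 t + - (0 * (0 + 1))) div 2"
      by (rule half_eq) (simp add: t(1) w tuple_form_lists tri_twice tri_four power2_eq_square algebra_simps)
  qed
  also have "\<dots> = gen_series ?B ?u * (psi oo q ^ 2)"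
    by (rule gen_series_Sigma[OF graded_Sigma[OF graded_double g2]]) (simp_all only: split_beta g2 psi_scaled zero_less_numeral)
  also have "gen_series ?B ?u = gen_series UNIV (\<lambda>v. tri (2 * v)) * (psi oo q ^ 2)"
    by (rule gen_series_Sigma[OF graded_double g2]) (simp only: psi_scaled zero_less_numeral)
  finally show ?thesis unfolding psi_double by (simp add: power2_eq_square algebra_simps)
qed

lemma two_cores_series: "core_series 2 [0] = psi"
proof -
  have "core_series 2 [0] = gen_series {t. length t = 2 \<and> sum_list t = 0} (\<lambda>t. (tuple_form 2 t + - (0 * (0 + 1))) div 2)"
    by (rule single_runner(1)[symmetric]) simp
  also have "\<dots> = gen_series UNIV (\<lambda>v. tri (2 * v))"
  proof (rule gen_series_bij)
    show "bij_betw (\<lambda>t::int list. t ! 0) {t. length t = 2 \<and> sum_list t = 0} UNIV"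
      by (rule bij_betw_byWitness[of _ "\<lambda>v. [v, - v]"]) (auto simp: length_2_iff)
    fix t :: "int list" assume "t \<in> {t. length t = 2 \<and> sum_list t = 0}"
    then obtain x where t: "t = [x, - x]" by (auto simp: length_2_iff eq_neg_iff_add_eq_0 add.commute)
    show "tri (2 * t ! 0) = (tuple_form 2 t + - (0 * (0 + 1))) div 2"
      by (rule half_eq) (simp add: t tuple_form_lists tri_twice power2_eq_square algebra_simps)
  qed
  finally show ?thesis unfolding psi_double .
qed

lemma tuples_2_series: "gen_series {t. length t = 2 \<and> sum_list t = 1} (\<lambda>t. (tuple_form 1 t + (-1)) div 2) = phi"
  unfolding phi_def
proof (rule gen_series_bij)
  show "bij_betw (\<lambda>t::int list. t ! 1) {t. length t = 2 \<and> sum_list t = 1} UNIV"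
    by (rule bij_betw_byWitness[of _ "\<lambda>v. [1 - v, v]"]) (auto simp: length_2_iff)
  fix t :: "int list" assume "t \<in> {t. length t = 2 \<and> sum_list t = 1}"
  then obtain x where t: "t = [1 - x, x]" by (auto simp: length_2_iff)
  show "(t ! 1)\<^sup>2 = (tuple_form 1 t + (-1)) div 2"
    by (rule half_eq) (simp add: t tuple_form_lists power2_eq_square algebra_simps)
qed

section \<open>Triples and 3-cores\<close>

text \<open>
  The size of the core for \<open>e = 3\<close> and charge \<open>[\<alpha>]\<close> with the
  given tuple of sum \<open>\<alpha>\<close>.
\<close>

definition size3 :: "int \<Rightarrow> int \<times> int \<times> int \<Rightarrow> int" where
  "size3 \<alpha> = (\<lambda>(x,y,z). (3 * (x\<^sup>2 + y\<^sup>2 + z\<^sup>2) - \<alpha>\<^sup>2) div 2 + z - x)"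

definition triples :: "int \<Rightarrow> (int \<times> int \<times> int) set" where
  "triples \<alpha> = {(x,y,z). x + y + z = \<alpha>}"

lemma size3_twice: "x + y + z = \<alpha> \<Longrightarrow> 2 * size3 \<alpha> (x,y,z) = 3 * (x\<^sup>2 + y\<^sup>2 + z\<^sup>2) - \<alpha>\<^sup>2 + 2 * (z - x)"
proof -
  assume "x + y + z = \<alpha>"
  then have E: "3 * (x\<^sup>2 + y\<^sup>2 + z\<^sup>2) - \<alpha>\<^sup>2 = 2 * (x\<^sup>2 + y\<^sup>2 + z\<^sup>2 - x * y - x * z - y * z)"
    by (auto simp: power2_eq_square algebra_simps)
  show ?thesis by (simp only: size3_def prod.case E) simp
qed

lemma triples_series: "gen_series (triples \<alpha>) (size3 \<alpha>) = core_series 3 [0]" "graded (triples \<alpha>) (size3 \<alpha>)"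
proof -
  let ?f = "\<lambda>t::int list. (t ! 0, t ! 1, t ! 2)"
  let ?A = "{t. length t = 3 \<and> sum_list t = \<alpha>}" and ?w = "\<lambda>t. (tuple_form 3 t + - (\<alpha> * (\<alpha> + 1))) div 2"
  have b: "bij_betw ?f ?A (triples \<alpha>)"
    by (rule bij_betw_byWitness[of _ "\<lambda>(x,y,z). [x,y,z]"]) (auto simp: length_3_iff triples_def)
  have w: "size3 \<alpha> (?f t) = ?w t" if "t \<in> ?A" for t
  proof -
    from that obtain x y z where t: "t = [x,y,z]" "x + y + z = \<alpha>" by (auto simp: length_3_iff)
    then have y: "y = \<alpha> - x - z" by simp
    show ?thesis by (rule half_eq) (use size3_twice[OF t(2)] in \<open>simp add: t(1) y tuple_form_lists power2_eq_square algebra_simps\<close>)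
  qed
  have "core_series 3 [\<alpha>] = core_series 3 [0]" using core_series_shift[of "[0]" 3 \<alpha>] by simp
  then show "gen_series (triples \<alpha>) (size3 \<alpha>) = core_series 3 [0]"
    using gen_series_bij[OF b, of "size3 \<alpha>" ?w, OF w] single_runner(1)[of 3 \<alpha>] by simp
  show "graded (triples \<alpha>) (size3 \<alpha>)"
    by (rule graded_bij[OF b _ single_runner(2)], rule w) simp_all
qed

text \<open>
  Pairs of triples whose sums add up to \<open>\<sigma>\<close> are fibred over the sum
  \<open>\<beta>\<close> of the second one; all fibres have the same series because the series of
  3-cores does not depend on the charge.
\<close>

lemma pair_of_triples_series:
  assumes u: "graded UNIV u" and k: "k > 0"
  shows "gen_series (Sigma UNIV (\<lambda>\<beta>. triples (\<sigma> - \<beta>) \<times> triples \<beta>)) (\<lambda>(\<beta>,p). u \<beta> + (case p of (a,b) \<Rightarrow> int k * size3 (\<sigma> - \<beta>) a + int k * size3 \<beta> b))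
     = gen_series UNIV u * (core_series 3 [0] oo q ^ k)\<^sup>2"
proof (rule gen_series_Sigma[OF u])
  fix \<beta> :: int
  have g: "graded (triples \<alpha>) (\<lambda>x. int k * size3 \<alpha> x)" for \<alpha> by (rule graded_scale[OF triples_series(2) k])
  have s: "gen_series (triples \<alpha>) (\<lambda>x. int k * size3 \<alpha> x) = core_series 3 [0] oo q ^ k" for \<alpha>
    unfolding gen_series_compose[OF k, symmetric] triples_series(1) ..
  show "graded (triples (\<sigma> - \<beta>) \<times> triples \<beta>) (\<lambda>p. case p of (a,b) \<Rightarrow> int k * size3 (\<sigma> - \<beta>) a + int k * size3 \<beta> b)"
    by (rule graded_times[OF g g])
  show "gen_series (triples (\<sigma> - \<beta>) \<times> triples \<beta>) (\<lambda>p. case p of (a,b) \<Rightarrow> int k * size3 (\<sigma> - \<beta>) a + int k * size3 \<beta> b) = (core_series 3 [0] oo q ^ k)\<^sup>2"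
    using gen_series_times[OF g g, of "\<sigma> - \<beta>" \<beta>] by (simp add: s power2_eq_square)
qed

text \<open>
  The entries of even and of odd index are translated and reversed so that completing the square
  leaves a function of \<open>\<beta>\<close> only.
\<close>

lemma six_tuples_series:
  assumes u: "graded UNIV u" "\<And>\<beta>. 2 * u \<beta> = (\<sigma> - \<beta>)\<^sup>2 + \<beta>\<^sup>2 + 2 * \<beta> - 4 + C"
  shows "gen_series {t. length t = 6 \<and> sum_list t = \<sigma>} (\<lambda>t. (tuple_form 3 t + C) div 2) = gen_series UNIV u * (core_series 3 [0])\<^sup>2"
proof -
  let ?D = "Sigma UNIV (\<lambda>\<beta>. triples (\<sigma> - \<beta>) \<times> triples \<beta>)"
  let ?v = "\<lambda>(\<beta>,p). u \<beta> + (case p of (a,b) \<Rightarrow> int 1 * size3 (\<sigma> - \<beta>) a + int 1 * size3 \<beta> b)"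
  let ?f = "\<lambda>t::int list. (t ! 1 + t ! 3 + t ! 5, ((t ! 4 + 1, t ! 2, t ! 0 - 1), (t ! 5 + 1, t ! 3, t ! 1 - 1)))"
  let ?g = "\<lambda>(\<beta>::int,((x::int,y::int,z::int),(x'::int,y'::int,z'::int))). [z + 1, z' + 1, y, y', x - 1, x' - 1]"
  have "gen_series {t. length t = 6 \<and> sum_list t = \<sigma>} (\<lambda>t. (tuple_form 3 t + C) div 2) = gen_series ?D ?v"
  proof (rule gen_series_bij)
    show "bij_betw ?f {t. length t = 6 \<and> sum_list t = \<sigma>} ?D"
      by (rule bij_betw_byWitness[of _ ?g]) (auto simp: length_6_iff triples_def)
    fix t assume "t \<in> {t. length t = 6 \<and> sum_list t = \<sigma>}"
    then obtain a b c d x y where t: "t = [a,b,c,d,x,y]" "a + b + c + d + x + y = \<sigma>" by (auto simp: length_6_iff)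
    have s: "(x + 1) + c + (a - 1) = \<sigma> - (b + d + y)" "(y + 1) + d + (b - 1) = b + d + y" using t(2) by auto
    show "?v (?f t) = (tuple_form 3 t + C) div 2"
      by (rule half_eq) (use size3_twice[OF s(1)] size3_twice[OF s(2)] u(2)[of "b + d + y"] in
        \<open>simp add: t(1) tuple_form_6 power2_eq_square algebra_simps\<close>)
  qed
  also have "\<dots> = gen_series UNIV u * (core_series 3 [0] oo q ^ 1)\<^sup>2" by (rule pair_of_triples_series[OF u(1)]) simp
  finally show ?thesis by simp
qed

text \<open>
  The entries of even and of odd index form two triples of opposite sums, and each contributes
  twice the size of a 3-core plus the square of its sum.
\<close>

lemma six_cores_series: "core_series 6 [0] = psi * (core_series 3 [0] oo q ^ 2)\<^sup>2"
proof -
  let ?D = "Sigma UNIV (\<lambda>\<beta>. triples (0 - \<beta>) \<times> triples \<beta>)"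
  let ?v = "\<lambda>(\<beta>,p). tri (2 * (- \<beta>)) + (case p of (a,b) \<Rightarrow> int 2 * size3 (0 - \<beta>) a + int 2 * size3 \<beta> b)"
  let ?f = "\<lambda>t::int list. (t ! 1 + t ! 3 + t ! 5, ((t ! 0, t ! 2, t ! 4), (t ! 1, t ! 3, t ! 5)))"
  let ?g = "\<lambda>(\<beta>::int,((x::int,y::int,z::int),(x'::int,y'::int,z'::int))). [x,x',y,y',z,z']"
  have neg: "bij (uminus :: int \<Rightarrow> int)" by (simp add: bij_uminus)
  have gn: "gen_series UNIV (\<lambda>\<beta>. tri (2 * (- \<beta>))) = psi"
    using gen_series_bij[OF neg, of "\<lambda>v. tri (2 * v)"] psi_double by simp
  have gr: "graded UNIV (\<lambda>\<beta>. tri (2 * (- \<beta>)))"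
    by (rule graded_bij[OF neg, where w = "\<lambda>v. tri (2 * v)"]) (simp_all add: graded_double)
  have "core_series 6 [0] = gen_series {t. length t = 6 \<and> sum_list t = 0} (\<lambda>t. (tuple_form 6 t + - (0 * (0 + 1))) div 2)"
    by (rule single_runner(1)[symmetric]) simp
  also have "\<dots> = gen_series ?D ?v"
  proof (rule gen_series_bij)
    show "bij_betw ?f {t. length t = 6 \<and> sum_list t = 0} ?D"
      by (rule bij_betw_byWitness[of _ ?g]) (auto simp: length_6_iff triples_def)
    fix t :: "int list" assume "t \<in> {t. length t = 6 \<and> sum_list t = 0}"
    then obtain a b c d x y where t: "t = [a,b,c,d,x,y]" "a + b + c + d + x + y = 0" by (auto simp: length_6_iff)
    have s: "a + c + x = 0 - (b + d + y)" "b + d + y = b + d + y" using t(2) by auto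
    show "?v (?f t) = (tuple_form 6 t + - (0 * (0 + 1))) div 2"
      by (rule half_eq) (use size3_twice[OF s(1)] size3_twice[OF s(2)] tri_twice[of "2 * (- (b + d + y))"] s(1) in
        \<open>simp add: t(1) tuple_form_6 power2_eq_square algebra_simps\<close>)
  qed
  also have "\<dots> = gen_series UNIV (\<lambda>\<beta>. tri (2 * (- \<beta>))) * (core_series 3 [0] oo q ^ 2)\<^sup>2"
    by (rule pair_of_triples_series[OF gr]) simp
  finally show ?thesis unfolding gn .
qed

lemma tuples_6_sum_3_series: "gen_series {t. length t = 6 \<and> sum_list t = 3} (\<lambda>t. (tuple_form 3 t + (-3)) div 2) = phi * (core_series 3 [0])\<^sup>2"
proof -
  have b: "bij (\<lambda>\<beta>::int. \<beta> + 1)" by (rule bij_betw_byWitness[of _ "\<lambda>\<beta>. \<beta> - 1"]) auto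
  have s: "gen_series UNIV (\<lambda>\<beta>::int. (\<beta> - 1)\<^sup>2) = phi"
    unfolding phi_def using gen_series_bij[OF b, of "\<lambda>\<beta>. (\<beta> - 1)\<^sup>2" "\<lambda>\<beta>. \<beta>\<^sup>2"] by simp
  have g: "graded UNIV (\<lambda>\<beta>::int. (\<beta> - 1)\<^sup>2)" by (rule graded_bij[OF b _ graded_square]) simp
  show ?thesis unfolding s[symmetric]
    by (rule six_tuples_series[OF g]) (simp add: power2_eq_square algebra_simps)
qed

lemma tuples_6_sum_2_series: "gen_series {t. length t = 6 \<and> sum_list t = 2} (\<lambda>t. (tuple_form 3 t + 0) div 2) = 2 * (psi oo q ^ 2) * (core_series 3 [0])\<^sup>2"
  unfolding psi_twice_scaled[of 2, OF zero_less_numeral, symmetric]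
proof (rule six_tuples_series)
  show "graded UNIV (\<lambda>p. int 2 * tri p)" by (intro graded_scale graded_tri) simp
  show "2 * (int 2 * tri \<beta>) = (2 - \<beta>)\<^sup>2 + \<beta>\<^sup>2 + 2 * \<beta> - 4 + 0" for \<beta>
    using tri_twice[of \<beta>] by (simp add: power2_eq_square algebra_simps)
qed

section \<open>Level three\<close>

lemma gen_series_copies:
  assumes "finite I" "graded A v"
  shows "gen_series (I \<times> A) (\<lambda>(i,x). 0 + v x) = of_nat (card I) * gen_series A v"
proof -
  have gI: "graded I (\<lambda>_. 0)" using assms by (simp add: graded_def)
  have "gen_series I (\<lambda>_. 0) = of_nat (card I)"
  proof (rule fps_ext)
    fix n show "fps_nth (gen_series I (\<lambda>_. 0)) n = fps_nth (of_nat (card I)) n"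
      by (cases n) (simp_all add: nth_gen_series fps_of_nat[symmetric])
  qed
  then show ?thesis using gen_series_times[OF gI assms(2)] by simp
qed

text \<open>
  The map \<open>(x, y, w) \<mapsto> (x - y, y - w, w - x)\<close> is a similarity of ratio
  \<open>\<surd>3\<close> of the plane of sum zero. After a translation it maps the tuples of the
  3-cores onto one of three classes of tuples of sum 1, distinguished by \<open>t\<^sub>0 -
  t\<^sub>1\<close> modulo 3; the other two classes arise by cyclic rotation.
\<close>

lemma three_tuples_sum_1_series: "gen_series {t. length t = 3 \<and> sum_list t = 1} (\<lambda>t. (tuple_form 1 t + 0) div 2) = 3 * core_series 3 [0]"
proof -
  let ?A = "{0,1,2::int} \<times> triples 0"
  let ?B = "{t. length t = 3 \<and> sum_list t = (1::int)}"
  let ?f = "\<lambda>(r,(x,y,w)). if r = (0::int) then [x - y + 1, y - w, w - x::int] else if r = 1 then [w - x + 2, x - y, y - w - 1] else [y - w + 1, w - x + 1, x - y - 1]"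
  let ?y = "\<lambda>t::int list. (1 - t ! 0 + t ! 1) div 3" and ?x = "\<lambda>t::int list. (2 - t ! 0 + t ! 1) div 3" and ?w = "\<lambda>t::int list. (t ! 1 - t ! 0) div 3"
  let ?g = "\<lambda>t. if (t ! 0 - t ! 1) mod 3 = 1 then (0::int, (t ! 0 - 1 + ?y t, ?y t, ?y t - t ! 1))
     else if (t ! 0 - t ! 1) mod 3 = 2 then (1, (?x t, ?x t - t ! 1, t ! 1 - 2 * ?x t))
     else (2, (1 - t ! 0 - 2 * ?w t, t ! 0 - 1 + ?w t, ?w t))"
  have b: "bij_betw ?f ?A ?B"
  proof (rule bij_betw_byWitness[of _ ?g])
    show "\<forall>a\<in>?A. ?g (?f a) = a"
    proof
      fix a assume "a \<in> ?A"
      then obtain r x y w where a: "a = (r,(x,y,w))" "r = 0 \<or> r = 1 \<or> r = 2" and s: "x + y + w = 0" by (auto simp: triples_def)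
      have w: "w = - x - y" using s by simp
      from a(2) show "?g (?f a) = a"
        by (elim disjE; simp add: a(1) w; presburger)
    qed
    have d: "z mod 3 = 1 \<Longrightarrow> 3 * ((1 - z) div 3) = 1 - z" "z mod 3 = 2 \<Longrightarrow> 3 * ((2 - z) div 3) = 2 - z" "z mod 3 = 0 \<Longrightarrow> 3 * (- z div 3) = - z" for z :: int
      by presburger+
    have 3: "?f (?g t) = t \<and> ?g t \<in> ?A" if "t \<in> ?B" for t
    proof -
      from that obtain x y z where t: "t = [x,y,z]" and s: "x + y + z = 1" by (auto simp: length_3_iff)
      have z: "z = 1 - x - y" using s by simp
      have dd: "1 - x + y = 1 - (x - y)" "2 - x + y = 2 - (x - y)" "y - x = - (x - y)" by simp_all
      have "(x - y) mod 3 = 0 \<or> (x - y) mod 3 = 1 \<or> (x - y) mod 3 = 2" by presburger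
      then show ?thesis
        unfolding t using d[of "x - y"] unfolding dd[symmetric]
        by (elim disjE) (simp_all add: z triples_def)
    qed
    show "\<forall>t\<in>?B. ?f (?g t) = t" by (rule ballI) (rule conjunct1[OF 3])
    show "?g ` ?B \<subseteq> ?A" by (rule image_subsetI) (rule conjunct2[OF 3])
    show "?f ` ?A \<subseteq> ?B" by (auto simp: triples_def)
  qed
  have "gen_series ?A (\<lambda>(i,x). 0 + size3 0 x) = gen_series ?B (\<lambda>t. (tuple_form 1 t + 0) div 2)"
  proof (rule gen_series_bij[OF b])
    fix a assume "a \<in> ?A"
    then obtain r x y w where a: "a = (r,(x,y,w))" "r \<in> {0,1,2}" and s: "x + y + w = 0" by (auto simp: triples_def)
    then have w: "w = - x - y" by simp
    have "tuple_form 1 (?f a) + 0 = 2 * size3 0 (x,y,w)"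
      unfolding size3_twice[OF s] using a(2) by (auto simp: a(1) w tuple_form_lists power2_eq_square algebra_simps)
    then show "(tuple_form 1 (?f a) + 0) div 2 = (case a of (i,x) \<Rightarrow> 0 + size3 0 x)" by (simp add: a(1))
  qed
  then show ?thesis using gen_series_copies[OF _ triples_series(2)[of 0], of "{0,1,2::int}"] triples_series(1)[of 0] by simp
qed

text \<open>
  For sum zero, \<open>Y\<close> is three times the sum of the squares, which is even, so rounding
  up removes the fractional part.
\<close>

lemma rank_sum_zero: assumes "a + b + c = 0" shows "rk [a,b,c] = (a\<^sup>2 + b\<^sup>2 + c\<^sup>2) div 2"
proof -
  have c: "c = - a - b" using assms by simp
  define N where "N = a\<^sup>2 + a * b + b\<^sup>2"
  have S: "a\<^sup>2 + b\<^sup>2 + c\<^sup>2 = 2 * N" by (simp add: c N_def power2_eq_square algebra_simps)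
  have Y: "(\<Sum>i<length [a,b,c]. \<Sum>j\<in>{..<length [a,b,c]} - {i}. [a,b,c] ! i * ([a,b,c] ! i - [a,b,c] ! j)) = 6 * N"
    by (simp add: lessThan_Suc c N_def insert_Diff_if power2_eq_square algebra_simps)
  have "\<lceil>(real_of_int (6 * N) - real (length [a,b,c]) + 1) / (2 * real (length [a,b,c]))\<rceil> = N"
    by (rule ceiling_unique) (auto simp: field_simps)
  then show ?thesis unfolding rk_def Let_def Y S by simp
qed

definition norm3 :: "int \<times> int \<times> int \<Rightarrow> int" where "norm3 = (\<lambda>(x,y,z). (x\<^sup>2 + y\<^sup>2 + z\<^sup>2) div 2)"

lemma norm3_twice: "x + y + z = 0 \<Longrightarrow> 2 * norm3 (x,y,z) = x\<^sup>2 + y\<^sup>2 + z\<^sup>2"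
proof -
  assume "x + y + z = 0"
  then have z: "z = - x - y" by simp
  have "x\<^sup>2 + y\<^sup>2 + z\<^sup>2 = 2 * (x\<^sup>2 + x * y + y\<^sup>2)" by (simp add: z power2_eq_square algebra_simps)
  then show ?thesis by (simp add: norm3_def)
qed

lemma r30_triples: "r30 = gen_series (triples 0) norm3"
  unfolding r30_def
proof (rule gen_series_bij)
  show "bij_betw (\<lambda>t::int list. (t ! 0, t ! 1, t ! 2)) {t. length t = 3 \<and> sum_list t = 0} (triples 0)"
    by (rule bij_betw_byWitness[of _ "\<lambda>(x,y,z). [x,y,z]"]) (auto simp: length_3_iff triples_def)
  fix t :: "int list" assume "t \<in> {t. length t = 3 \<and> sum_list t = 0}"
  then obtain x y z where t: "t = [x,y,z]" "x + y + z = 0" by (auto simp: length_3_iff)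
  then show "norm3 (t ! 0, t ! 1, t ! 2) = rk t" by (simp add: rank_sum_zero norm3_def)
qed

lemma three_tuples_sum_3_series:
  "gen_series {t. length t = 3 \<and> sum_list t = 3} (\<lambda>t. (tuple_form 1 t + (-4)) div 2) = r30"
  "graded (triples 0) norm3"
proof -
  let ?f = "\<lambda>t::int list. (t ! 0 - 2, t ! 1 - 1, t ! 2)"
  have b: "bij_betw ?f {t. length t = 3 \<and> sum_list t = 3} (triples 0)"
    by (rule bij_betw_byWitness[of _ "\<lambda>(x,y,z). [x + 2,y + 1,z]"]) (auto simp: length_3_iff triples_def)
  have w: "norm3 (?f t) = (tuple_form 1 t + (-4)) div 2" if "t \<in> {t. length t = 3 \<and> sum_list t = 3}" for t
  proof -
    from that obtain x y z where t: "t = [x,y,z]" "x + y + z = 3" by (auto simp: length_3_iff)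
    then have z: "z = 3 - x - y" and s: "(x - 2) + (y - 1) + z = 0" by simp_all
    show ?thesis by (rule half_eq) (use norm3_twice[OF s] in \<open>simp add: t(1) z tuple_form_lists power2_eq_square algebra_simps\<close>)
  qed
  show "gen_series {t. length t = 3 \<and> sum_list t = 3} (\<lambda>t. (tuple_form 1 t + (-4)) div 2) = r30"
    unfolding r30_triples by (rule gen_series_bij[OF b]) (rule w)
  show "graded (triples 0) norm3"
    by (rule graded_bij[OF b _ tuples_3_3_3(2)]) (rule w)
qed

text \<open>
  Listing the residues modulo 3 of the three entries as a permutation of 2, 0, 1 selects which of
  \<open>3 x - 1\<close>, \<open>3 y\<close>, \<open>3 w + 1\<close> stands where.
\<close>

definition select3 :: "int \<Rightarrow> int \<times> int \<times> int \<Rightarrow> int" where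
  "select3 m = (\<lambda>(x,y,w). if m = 2 then 3 * x - 1 else if m = 0 then 3 * y else 3 * w + 1)"

text \<open>
  A triple of sum zero has entries that are either all congruent or all incongruent modulo 3. The
  first kind is the image of the lattice under the similarity of ratio \<open>\<surd>3\<close>;
  the second kind consists of the six permutations of \<open>(3 x - 1, 3 y, 3 w + 1)\<close>.
\<close>

lemma r30_cubed: "r30 = (r30 oo q ^ 3) + 6 * q * (core_series 3 [0] oo q ^ 3)"
proof -
  let ?E = "{(x,y,z) \<in> triples 0. 3 dvd x - y}" and ?N = "{(x,y,z) \<in> triples 0. \<not> 3 dvd x - y}"
  have "?E \<union> ?N = triples 0" by auto
  moreover have "gen_series (?E \<union> ?N) norm3 = gen_series ?E norm3 + gen_series ?N norm3"
    by (rule gen_series_Un) (auto intro!: graded_subset[OF three_tuples_sum_3_series(2)])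
  ultimately have split: "r30 = gen_series ?E norm3 + gen_series ?N norm3" unfolding r30_triples by simp
  have E: "r30 oo q ^ 3 = gen_series ?E norm3"
    unfolding r30_triples gen_series_compose[of 3 "triples 0" norm3, OF zero_less_numeral]
  proof (rule gen_series_bij)
    let ?f = "\<lambda>(x,y,w). (x - y, y - w, w - x) :: int \<times> int \<times> int"
    let ?g = "\<lambda>(a,b,c). ((a - c) div 3, (b - a) div 3, (c - b) div 3) :: int \<times> int \<times> int"
    show "bij_betw ?f (triples 0) ?E"
    proof (rule bij_betw_byWitness[of _ ?g])
      have 1: "?g (?f p) = p \<and> ?f p \<in> ?E" if "p \<in> triples 0" for p
      proof -
        from that obtain x y w where p: "p = (x,y,w)" and s: "x + y + w = 0" by (auto simp: triples_def)
        have e: "x - y - (w - x) = 3 * x" "y - w - (x - y) = 3 * y" "w - x - (y - w) = 3 * w" "x - y - (y - w) = 3 * (- y)" using s by simp_all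
        have "?g (?f p) = p" unfolding p prod.case e by simp
        moreover have "?f p \<in> ?E" unfolding p prod.case triples_def mem_Collect_eq e by simp
        ultimately show ?thesis by (rule conjI)
      qed
      show "\<forall>p\<in>triples 0. ?g (?f p) = p" by (rule ballI) (rule conjunct1[OF 1])
    show "?f ` triples 0 \<subseteq> ?E" by (rule image_subsetI) (rule conjunct2[OF 1])
      have 2: "?f (?g p) = p \<and> ?g p \<in> triples 0" if "p \<in> ?E" for p
      proof -
        from that obtain a b c where p: "p = (a,b,c)" and s: "a + b + c = 0" "3 dvd a - b" by (auto simp: triples_def)
        have "3 dvd a - c" "3 dvd b - a" "3 dvd c - b" using s by presburger+
        then have "3 * ((a - c) div 3) = a - c" "3 * ((b - a) div 3) = b - a" "3 * ((c - b) div 3) = c - b" by simp_all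
        then show ?thesis using s(1) by (simp add: p triples_def)
      qed
      show "\<forall>p\<in>?E. ?f (?g p) = p" by (rule ballI) (rule conjunct1[OF 2])
    show "?g ` ?E \<subseteq> triples 0" by (rule image_subsetI) (rule conjunct2[OF 2])
    qed
    fix p assume "p \<in> triples 0"
    then obtain x y w where p: "p = (x,y,w)" and s: "x + y + w = 0" by (auto simp: triples_def)
    then have w: "w = - x - y" by simp
    have "2 * norm3 (x - y, y - w, w - x) = 2 * (3 * norm3 (x,y,w))"
      using norm3_twice[OF s] norm3_twice[of "x - y" "y - w" "w - x"] by (simp add: w power2_eq_square algebra_simps)
    then show "norm3 (case p of (x,y,w) \<Rightarrow> (x - y, y - w, w - x)) = int 3 * norm3 p" by (simp add: p)
  qed
  let ?I = "{(2,0),(2,1),(0,2),(0,1),(1,2),(1,0)} :: (int \<times> int) set"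
  let ?f = "\<lambda>((\<alpha>,\<beta>),p). (select3 \<alpha> p, select3 \<beta> p, select3 (3 - \<alpha> - \<beta>) p)"
  let ?g = "\<lambda>(a,b,c). ((a mod 3, b mod 3), (if a mod 3 = 2 then (a + 1) div 3 else if b mod 3 = 2 then (b + 1) div 3 else (c + 1) div 3,
     if a mod 3 = 0 then a div 3 else if b mod 3 = 0 then b div 3 else c div 3,
     if a mod 3 = 1 then a div 3 else if b mod 3 = 1 then b div 3 else c div (3::int)))"
  have b: "bij_betw ?f (?I \<times> triples 0) ?N"
  proof (rule bij_betw_byWitness[of _ ?g])
    have m: "(3 * x - 1) mod 3 = 2" "(3 * x + 1) mod 3 = 1" "(3 * x + 1) div 3 = x" "\<not> 3 dvd 3 * x - 1 - 3 * y" "\<not> 3 dvd 3 * x - 1 - (3 * y + 1)"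
      "\<not> 3 dvd 3 * x - (3 * y + 1)" "\<not> 3 dvd 3 * x + 1 - 3 * y" "\<not> 3 dvd 3 * x - (3 * y - 1)" "\<not> 3 dvd 3 * x + 1 - (3 * y - 1)" for x y :: int by presburger+
    have 4: "?g (?f a) = a \<and> ?f a \<in> ?N" if "a \<in> ?I \<times> triples 0" for a
    proof -
      from that obtain \<alpha> \<beta> x y w where a: "a = ((\<alpha>,\<beta>),(x,y,w))" "(\<alpha>,\<beta>) \<in> ?I" and s: "x + y + w = 0" by (auto simp: triples_def)
      have w: "w = - x - y" using s by simp
      from a(2) show ?thesis
        by (elim insertE emptyE; simp add: a(1) select3_def m triples_def; use s in presburger)
    qed
    show "\<forall>a\<in>?I \<times> triples 0. ?g (?f a) = a" by (rule ballI) (rule conjunct1[OF 4])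
    show "?f ` (?I \<times> triples 0) \<subseteq> ?N" by (rule image_subsetI) (rule conjunct2[OF 4])
    have 5: "?f (?g p) = p \<and> ?g p \<in> ?I \<times> triples 0" if "p \<in> ?N" for p
    proof -
      from that obtain a b c where p: "p = (a,b,c)" and s: "a + b + c = 0" "\<not> 3 dvd a - b" by (auto simp: triples_def)
      have c: "c = - a - b" using s by simp
      have ex: "a mod 3 = 2 \<Longrightarrow> \<exists>x. a = 3 * x - 1" "a mod 3 = 0 \<Longrightarrow> \<exists>x. a = 3 * x" "a mod 3 = 1 \<Longrightarrow> \<exists>x. a = 3 * x + 1" for a :: int
        by presburger+
      have m3: "a mod 3 = 0 \<or> a mod 3 = 1 \<or> a mod 3 = 2" for a :: int by presburger
      have ne: "a mod 3 \<noteq> b mod 3" using s(2) by (simp add: mod_eq_dvd_iff)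
      have lin: "r + r' + r'' = 3 * (- A - B - C)" if "3 * A + r = a" "3 * B + r' = b" "3 * C + r'' = c" for A B C r r' r''
        using s(1) that by (presburger | algebra | smt (verit))
      have "a mod 3 + b mod 3 + c mod 3 = 3 * (- (a div 3) - b div 3 - c div 3)"
        by (rule lin) (rule mult_div_mod_eq)+
      then have "3 dvd a mod 3 + b mod 3 + c mod 3" by (rule dvdI)
      then have "(a mod 3 = 2 \<and> b mod 3 = 0 \<and> c mod 3 = 1) \<or> (a mod 3 = 2 \<and> b mod 3 = 1 \<and> c mod 3 = 0) \<or> (a mod 3 = 0 \<and> b mod 3 = 2 \<and> c mod 3 = 1)
        \<or> (a mod 3 = 0 \<and> b mod 3 = 1 \<and> c mod 3 = 2) \<or> (a mod 3 = 1 \<and> b mod 3 = 2 \<and> c mod 3 = 0) \<or> (a mod 3 = 1 \<and> b mod 3 = 0 \<and> c mod 3 = 2)"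
      proof -
        have "(r = 2 \<and> r' = 0 \<and> r'' = 1) \<or> (r = 2 \<and> r' = 1 \<and> r'' = 0) \<or> (r = 0 \<and> r' = 2 \<and> r'' = 1) \<or> (r = 0 \<and> r' = 1 \<and> r'' = 2) \<or> (r = 1 \<and> r' = 2 \<and> r'' = 0) \<or> (r = 1 \<and> r' = 0 \<and> r'' = 2)"
          if "r = 0 \<or> r = 1 \<or> r = 2" "r' = 0 \<or> r' = 1 \<or> r' = 2" "r'' = 0 \<or> r'' = 1 \<or> r'' = 2" "r \<noteq> r'" "3 dvd r + r' + r''" for r r' r'' :: int
          using that by (elim disjE) simp_all
        from this[OF m3 m3 m3 ne \<open>3 dvd a mod 3 + b mod 3 + c mod 3\<close>] show ?thesis .
      qed
      then show ?thesis
      proof (elim disjE conjE)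
        assume *: "a mod 3 = 2" "b mod 3 = 0" "c mod 3 = 1"
        obtain x y w where **: "a = 3 * x - 1" "b = 3 * y" "c = 3 * w + 1" using ex(1)[OF *(1)] ex(2)[OF *(2)] ex(3)[OF *(3)] by blast
        have "x + y + w = 0" using s(1) ** by simp
        then show ?thesis unfolding p prod.case ** by (simp add: m select3_def triples_def)
      next
        assume *: "a mod 3 = 2" "b mod 3 = 1" "c mod 3 = 0"
        obtain x y w where **: "a = 3 * x - 1" "b = 3 * w + 1" "c = 3 * y" using ex(1)[OF *(1)] ex(3)[OF *(2)] ex(2)[OF *(3)] by blast
        have "x + y + w = 0" using s(1) ** by simp
        then show ?thesis unfolding p prod.case ** by (simp add: m select3_def triples_def)
      next
        assume *: "a mod 3 = 0" "b mod 3 = 2" "c mod 3 = 1"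
        obtain x y w where **: "a = 3 * y" "b = 3 * x - 1" "c = 3 * w + 1" using ex(2)[OF *(1)] ex(1)[OF *(2)] ex(3)[OF *(3)] by blast
        have "x + y + w = 0" using s(1) ** by simp
        then show ?thesis unfolding p prod.case ** by (simp add: m select3_def triples_def)
      next
        assume *: "a mod 3 = 0" "b mod 3 = 1" "c mod 3 = 2"
        obtain x y w where **: "a = 3 * y" "b = 3 * w + 1" "c = 3 * x - 1" using ex(2)[OF *(1)] ex(3)[OF *(2)] ex(1)[OF *(3)] by blast
        have "x + y + w = 0" using s(1) ** by simp
        then show ?thesis unfolding p prod.case ** by (simp add: m select3_def triples_def)
      next
        assume *: "a mod 3 = 1" "b mod 3 = 2" "c mod 3 = 0"
        obtain x y w where **: "a = 3 * w + 1" "b = 3 * x - 1" "c = 3 * y" using ex(3)[OF *(1)] ex(1)[OF *(2)] ex(2)[OF *(3)] by blast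
        have "x + y + w = 0" using s(1) ** by simp
        then show ?thesis unfolding p prod.case ** by (simp add: m select3_def triples_def)
      next
        assume *: "a mod 3 = 1" "b mod 3 = 0" "c mod 3 = 2"
        obtain x y w where **: "a = 3 * w + 1" "b = 3 * y" "c = 3 * x - 1" using ex(3)[OF *(1)] ex(2)[OF *(2)] ex(1)[OF *(3)] by blast
        have "x + y + w = 0" using s(1) ** by simp
        then show ?thesis unfolding p prod.case ** by (simp add: m select3_def triples_def)
      qed
    qed
    show "\<forall>p\<in>?N. ?f (?g p) = p" by (rule ballI) (rule conjunct1[OF 5])
    show "?g ` ?N \<subseteq> ?I \<times> triples 0" by (rule image_subsetI) (rule conjunct2[OF 5])
  qed
  have g: "graded (triples 0) (\<lambda>p. int 3 * size3 0 p)" by (rule graded_scale[OF triples_series(2)]) simp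
  have g': "graded (?I \<times> triples 0) (\<lambda>(i,p). 0 + int 3 * size3 0 p)"
    by (rule graded_times[OF _ g]) (simp add: graded_def)
  have "gen_series (?I \<times> triples 0) (\<lambda>x. (case x of (i,p) \<Rightarrow> 0 + int 3 * size3 0 p) + int 1) = gen_series ?N norm3"
  proof (rule gen_series_bij[OF b])
    fix a assume "a \<in> ?I \<times> triples 0"
    then obtain \<alpha> \<beta> x y w where a: "a = ((\<alpha>,\<beta>),(x,y,w))" "(\<alpha>,\<beta>) \<in> ?I" and s: "x + y + w = 0" by (auto simp: triples_def)
    then have w: "w = - x - y" by simp
    have "?f a = (select3 \<alpha> (x,y,w), select3 \<beta> (x,y,w), select3 (3 - \<alpha> - \<beta>) (x,y,w))" by (simp add: a(1))
    moreover have "select3 \<alpha> (x,y,w) + select3 \<beta> (x,y,w) + select3 (3 - \<alpha> - \<beta>) (x,y,w) = 0"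
      using a(2) by (auto simp: select3_def w)
    ultimately have "2 * norm3 (?f a) = (select3 \<alpha> (x,y,w))\<^sup>2 + (select3 \<beta> (x,y,w))\<^sup>2 + (select3 (3 - \<alpha> - \<beta>) (x,y,w))\<^sup>2"
      using norm3_twice by simp
    also have "\<dots> = (3 * x - 1)\<^sup>2 + (3 * y)\<^sup>2 + (3 * w + 1)\<^sup>2" using a(2) by (auto simp: select3_def)
    also have "\<dots> = 2 * (3 * size3 0 (x,y,w) + 1)" using size3_twice[OF s] by (simp add: power2_eq_square algebra_simps)
    finally show "norm3 (?f a) = (case a of (i,p) \<Rightarrow> 0 + int 3 * size3 0 p) + int 1" by (simp add: a(1))
  qed
  then have "gen_series ?N norm3 = q ^ 1 * gen_series (?I \<times> triples 0) (\<lambda>(i,p). 0 + int 3 * size3 0 p)"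
    using gen_series_shift[OF g', of 1] by simp
  also have "gen_series (?I \<times> triples 0) (\<lambda>(i,p). 0 + int 3 * size3 0 p) = of_nat (card ?I) * gen_series (triples 0) (\<lambda>p. int 3 * size3 0 p)"
    by (rule gen_series_copies[OF _ g]) simp
  also have "gen_series (triples 0) (\<lambda>p. int 3 * size3 0 p) = core_series 3 [0] oo q ^ 3"
    using gen_series_compose[of 3 "triples 0" "size3 0"] triples_series(1)[of 0] by simp
  finally have N: "gen_series ?N norm3 = q ^ 1 * (of_nat (card ?I) * (core_series 3 [0] oo q ^ 3))" .
  have "r30 = (r30 oo q ^ 3) + gen_series ?N norm3" unfolding E by (rule split)
  then show ?thesis unfolding N by (simp add: mult.assoc mult.left_commute)
qed

section \<open>The series identities\<close>

lemma cancel_numeral: "numeral k * (x :: int fps) = numeral k * y \<Longrightarrow> x = y"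
  by (simp add: fps_eq_iff numeral_fps_const)

lemma compose_mult: "k > 0 \<Longrightarrow> ((f :: int fps) * g) oo q ^ k = (f oo q ^ k) * (g oo q ^ k)"
  by (rule fps_compose_mult_distrib) simp

lemma compose_square: "k > 0 \<Longrightarrow> ((f :: int fps)\<^sup>2) oo q ^ k = (f oo q ^ k)\<^sup>2"
  by (simp only: power2_eq_square compose_mult)

lemma compose_numeral: "numeral c oo q ^ k = (numeral c :: int fps)"
  by (simp add: numeral_fps_const)

lemma compose_q: "k > 0 \<Longrightarrow> q oo q ^ k = q ^ k"
  by (rule fps_X_fps_compose_startby0) simp

lemma compose_q_power: "k > 0 \<Longrightarrow> q ^ j oo q ^ k = q ^ (k * j)"
  by (induction j) (simp_all add: compose_mult compose_q power_add)

lemmas compose_simps = compose_mult compose_square compose_numeral compose_q compose_q_power compose_powers fps_compose_add_distrib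

lemma core_series_doubled: "e > 0 \<Longrightarrow> core_series e [a,a] = core_series e [a] oo q ^ 2"
  and core_series_doubled_pair: "e > 0 \<Longrightarrow> core_series e [a,a,b,b] = core_series e [a,b] oo q ^ 2"
  and core_series_tripled: "e > 0 \<Longrightarrow> core_series e [a,a,a] = core_series e [a] oo q ^ 3"
proof -
  assume e: "e > 0"
  show "core_series e [a,a] = core_series e [a] oo q ^ 2"
  proof (rule core_series_repeat[OF _ e])
    fix j assume "j < 2 * length [a]"
    then have "j = 0 \<or> j = 1" by auto
    then show "[a,a] ! j = [a] ! (j div 2)" by auto
  qed simp_all
  show "core_series e [a,a,a] = core_series e [a] oo q ^ 3"
  proof (rule core_series_repeat[OF _ e])
    fix j assume "j < 3 * length [a]"
    then have "j = 0 \<or> j = 1 \<or> j = 2" by auto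
    then show "[a,a,a] ! j = [a] ! (j div 3)" by auto
  qed simp_all
  show "core_series e [a,a,b,b] = core_series e [a,b] oo q ^ 2"
  proof (rule core_series_repeat[OF _ e])
    fix j assume "j < 2 * length [a,b]"
    then have "j = 0 \<or> j = 1 \<or> j = 2 \<or> j = 3" by auto
    then show "[a,a,b,b] ! j = [a,b] ! (j div 2)" by auto
  qed simp_all
qed

lemma series_2_00: "core_series 2 [0,0] = psi oo q ^ 2"
  by (simp only: core_series_doubled zero_less_numeral two_cores_series)

lemma series_2_01: "core_series 2 [0,1] = phi"
  using tuples_2_2_1(1) tuples_2_series by simp

lemma series_4_00: "core_series 4 [0,0] = (psi oo q ^ 2) * (psi oo q ^ 4)\<^sup>2"
  by (simp only: core_series_doubled four_cores_series compose_simps zero_less_numeral) simp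

lemma series_4_01: "core_series 4 [0,1] = (psi oo q ^ 2) * psi\<^sup>2"
proof (rule cancel_numeral)
  show "2 * core_series 4 [0,1] = 2 * ((psi oo q ^ 2) * psi\<^sup>2)"
    using tuples_2_4_1(1) tuples_sum_1_series unfolding psi_square by (simp add: power2_eq_square[of "psi oo _"] ac_simps)
qed

lemma series_4_02_sum: "core_series 4 [0,2] + 2 * q * core_series 4 [0,0] = (psi oo q ^ 2) * phi\<^sup>2"
  using tuples_2_4_2(1) tuples_sum_2_series by simp

lemma series_4_02: "core_series 4 [0,2] = (psi oo q ^ 2) * ((phi oo q ^ 2)\<^sup>2 + 2 * q * (psi oo q ^ 4)\<^sup>2)"
proof -
  have "core_series 4 [0,2] = (psi oo q ^ 2) * phi\<^sup>2 - 2 * q * core_series 4 [0,0]"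
    using series_4_02_sum by (simp add: algebra_simps)
  then show ?thesis unfolding series_4_00 phi_square by (simp add: algebra_simps)
qed

lemma series_6_00: "core_series 6 [0,0] = (psi oo q ^ 2) * (core_series 3 [0] oo q ^ 4)\<^sup>2"
  by (simp only: core_series_doubled six_cores_series compose_simps zero_less_numeral) simp

lemma series_6_02: "core_series 6 [0,2] = (psi oo q ^ 2) * ((core_series 3 [0])\<^sup>2 - q ^ 2 * (core_series 3 [0] oo q ^ 4)\<^sup>2)"
proof -
  have "2 * (core_series 6 [0,2] + q ^ 2 * core_series 6 [0,0]) = 2 * ((psi oo q ^ 2) * (core_series 3 [0])\<^sup>2)"
    using tuples_2_6_2(1) tuples_6_sum_2_series by (simp add: algebra_simps)
  then have "core_series 6 [0,2] + q ^ 2 * core_series 6 [0,0] = (psi oo q ^ 2) * (core_series 3 [0])\<^sup>2" by (rule cancel_numeral)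
  then have "core_series 6 [0,2] = (psi oo q ^ 2) * (core_series 3 [0])\<^sup>2 - q ^ 2 * core_series 6 [0,0]" by (simp add: algebra_simps)
  then show ?thesis unfolding series_6_00 by (simp add: algebra_simps)
qed

lemma series_6_03: "core_series 6 [0,3] + 2 * q * core_series 6 [0,1] = phi * (core_series 3 [0])\<^sup>2"
  using tuples_2_6_3(1) tuples_6_sum_3_series by simp

lemma series_3_000: "core_series 3 [0,0,0] = core_series 3 [0] oo q ^ 3"
  by (simp only: core_series_tripled zero_less_numeral)

lemma series_3_001: "core_series 3 [0,0,1] = core_series 3 [0]"
  by (rule cancel_numeral) (use tuples_3_3_1(1) three_tuples_sum_1_series in simp)

lemma series_3_012: "core_series 3 [0,1,2] = (r30 oo q ^ 3) + 3 * q * (core_series 3 [0] oo q ^ 3)"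
proof -
  have "core_series 3 [0,1,2] + 3 * q * core_series 3 [0,0,0] = r30"
    using tuples_3_3_3(1) three_tuples_sum_3_series(1) by simp
  then have "core_series 3 [0,1,2] + 3 * q * (core_series 3 [0] oo q ^ 3) = (r30 oo q ^ 3) + 6 * q * (core_series 3 [0] oo q ^ 3)"
    using r30_cubed unfolding series_3_000 by simp
  then show ?thesis by (simp add: algebra_simps)
qed

lemma series_4_0000: "core_series 4 [0,0,0,0] = (psi oo q ^ 4) * (psi oo q ^ 8)\<^sup>2"
  by (simp only: core_series_doubled_pair series_4_00 compose_simps zero_less_numeral) simp

lemma series_4_0011: "core_series 4 [0,0,1,1] = (psi oo q ^ 4) * (psi oo q ^ 2)\<^sup>2"
  by (simp only: core_series_doubled_pair series_4_01 compose_simps zero_less_numeral) simp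

lemma series_4_0022: "core_series 4 [0,0,2,2] = (psi oo q ^ 4) * ((phi oo q ^ 4)\<^sup>2 + 2 * q ^ 2 * (psi oo q ^ 8)\<^sup>2)"
  by (simp only: core_series_doubled_pair series_4_02 compose_simps zero_less_numeral) simp

lemma series_4_0012: "core_series 4 [0,0,1,2] + q * core_series 4 [0,1,1,1] = psi ^ 3"
  by (rule cancel_numeral[of "num.Bit0 (num.Bit0 num.One)"]) (use tuples_4_4_3(1) tuples_sum_3_series in \<open>simp add: algebra_simps\<close>)

lemma series_4_0001: "core_series 4 [0,0,0,1] = core_series 4 [0,1,1,1]"
  using core_series_conjugate[of "[0,0,0,1]" 4] core_series_shift[of "[-1,0,0,0]" 4 1] by simp

text \<open>
  The surplus term for the charge \<open>[0,0,1,1]\<close>, which is known by doubling, is moved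
  to the other side with the help of \<open>psi_square\<close>.
\<close>

lemma series_4_0123: "core_series 4 [0,1,2,3] + 4 * q * core_series 4 [0,0,0,2] = (phi oo q ^ 2) ^ 3 + 8 * q * (phi oo q ^ 2) * (psi oo q ^ 4)\<^sup>2"
proof -
  have "(psi oo q ^ 2)\<^sup>2 = (phi oo q ^ 2) * (psi oo q ^ 4)"
    using arg_cong[OF psi_square, of "\<lambda>f. f oo q ^ 2"] by (simp add: compose_square compose_mult compose_powers)
  moreover have "core_series 4 [0,1,2,3] + 4 * q * core_series 4 [0,0,0,2] + 4 * q * core_series 4 [0,0,1,1] = (phi oo q ^ 2) ^ 3 + 12 * q * (phi oo q ^ 2) * (psi oo q ^ 4)\<^sup>2"
    using tuples_4_4_6(1) tuples_sum_6_series by simp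
  ultimately show ?thesis unfolding series_4_0011 by (simp add: power2_eq_square[of "psi oo _"] algebra_simps)
qed

text \<open>
  The terms for \<open>[0,0,0,0]\<close> and \<open>[0,0,2,2]\<close>, known by doubling, combine
  to a multiple of \<open>\<psi>(q\<^sup>4) \<phi>(q\<^sup>2)\<^sup>2\<close>.
\<close>

lemma series_4_0112: "core_series 4 [0,1,1,2] = (psi oo q ^ 4) * ((phi oo q ^ 2)\<^sup>2 + 2 * q * (psi oo q ^ 4)\<^sup>2)"
proof (rule cancel_numeral[of "num.Bit0 (num.Bit0 num.One)"])
  define a b c d where "a = psi oo q ^ 4" and "b = phi oo q ^ 2" and "c = phi oo q ^ 4" and "d = psi oo q ^ 8"
  have ph: "b\<^sup>2 = c\<^sup>2 + 4 * q ^ 2 * d\<^sup>2"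
    using arg_cong[OF phi_square, of "\<lambda>f. f oo q ^ 2"] unfolding b_def c_def d_def
    by (simp add: compose_square compose_mult compose_powers compose_numeral compose_q fps_compose_add_distrib)
  have "4 * core_series 4 [0,1,1,2] + 4 * q ^ 2 * core_series 4 [0,0,0,0] + 2 * core_series 4 [0,0,2,2] = 6 * b\<^sup>2 * a + 8 * q * a ^ 3"
    unfolding a_def b_def using tuples_4_4_4(1) tuples_sum_4_series by simp
  then have "4 * core_series 4 [0,1,1,2] + 2 * (a * (c\<^sup>2 + 4 * q ^ 2 * d\<^sup>2)) = 6 * b\<^sup>2 * a + 8 * q * a ^ 3"
    unfolding series_4_0000 series_4_0022 a_def[symmetric] c_def[symmetric] d_def[symmetric] by (simp add: algebra_simps)
  then have "4 * core_series 4 [0,1,1,2] = 4 * (a * (b\<^sup>2 + 2 * q * a\<^sup>2))"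
    unfolding ph[symmetric] by (simp add: algebra_simps power3_eq_cube power2_eq_square[of a])
  then show "4 * core_series 4 [0,1,1,2] = 4 * ((psi oo q ^ 4) * ((phi oo q ^ 2)\<^sup>2 + 2 * q * (psi oo q ^ 4)\<^sup>2))"
    unfolding a_def b_def .
qed

section \<open>Ordinary cores on the abacus\<close>

lemma down_closed_int_set:
  assumes "\<And>m::int. P m \<Longrightarrow> P (m - 1)" "\<And>m. m \<le> L \<Longrightarrow> P m" "\<And>m. m > K \<Longrightarrow> \<not> P m"
  shows "\<exists>n. \<forall>m. P m \<longleftrightarrow> m < n"
proof -
  have down: "P (m - int k)" if "P m" for m k
  proof (induction k)
    case (Suc k)
    have "m - int (Suc k) = m - int k - 1" by simp
    then show ?case using assms(1)[OF Suc.IH] by (simp only:)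
  qed (use that in simp)
  have ex: "\<not> P (L + int (nat (K - L) + 1))" by (rule assms(3)) simp
  define k where "k = (LEAST k. \<not> P (L + int k))"
  have k: "\<not> P (L + int k)" unfolding k_def by (rule LeastI[of "\<lambda>k. \<not> P (L + int k)", OF ex])
  have least: "P (L + int i)" if "i < k" for i using not_less_Least that unfolding k_def by blast
  have "P m \<longleftrightarrow> m < L + int k" for m
  proof
    assume m: "P m"
    show "m < L + int k"
    proof (rule ccontr)
      assume "\<not> m < L + int k"
      then have eq: "m - int (nat (m - L - int k)) = L + int k" by simp
      show False using k down[OF m, of "nat (m - L - int k)"] unfolding eq by blast
    qed
  next
    assume m: "m < L + int k"
    show "P m"
    proof (cases "m \<le> L")
      case False
      then have eq: "L + int (nat (m - L)) = m" and lt: "nat (m - L) < k" using m by auto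
      show ?thesis using least[OF lt] unfolding eq .
    qed (rule assms(2))
  qed
  then show ?thesis by blast
qed

lemma core_beads_one:
  "core_beads e 1 t 0 = {k. (k - 1) div int e < t ! nat ((k - 1) mod int e)}"
  by (simp add: core_beads_def runner_level_def)

text \<open>
  A bead set closed under subtracting \<open>e\<close> is a down-set in each residue class, and
  the tuple lists their upper ends.
\<close>

lemma is_core_single:
  assumes e: "e > 0" and lam: "is_partition lam"
  shows "is_core e [0] [lam] \<longleftrightarrow> (\<forall>\<beta>\<in>beta_set lam 0. \<beta> - int e \<in> beta_set lam 0)"
proof -
  let ?S = "beta_set lam 0"
  have "is_core e [0] [lam] \<longleftrightarrow> (\<exists>t. length t = e \<and> ?S = core_beads e 1 t 0)"
    using is_core_iff[of "[0]" e "[lam]"] e lam by (simp add: is_multipartition_def)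
  also have "\<dots> \<longleftrightarrow> (\<forall>\<beta>\<in>?S. \<beta> - int e \<in> ?S)"
  proof
    assume "\<exists>t. length t = e \<and> ?S = core_beads e 1 t 0"
    then obtain t where t: "?S = core_beads e 1 t 0" by blast
    show "\<forall>\<beta>\<in>?S. \<beta> - int e \<in> ?S"
    proof
      fix \<beta> assume "\<beta> \<in> ?S"
      have "(\<beta> - int e - 1) div int e = (\<beta> - 1) div int e - 1" "(\<beta> - int e - 1) mod int e = (\<beta> - 1) mod int e"
        using e div_mult_self2[of "int e" "\<beta> - 1" "-1"] mod_mult_self2[of "\<beta> - 1" "int e" "-1"] by (simp_all add: algebra_simps)
      then show "\<beta> - int e \<in> ?S" using \<open>\<beta> \<in> ?S\<close> unfolding t core_beads_one by simp
    qed
  next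
    assume closed: "\<forall>\<beta>\<in>?S. \<beta> - int e \<in> ?S"
    obtain Z where Z: "\<And>k. k \<ge> Z \<Longrightarrow> lam k = 0" using partition_eventually_zero[OF lam] by blast
    have low: "\<beta> \<in> ?S" if "\<beta> \<le> - int Z" for \<beta>
    proof -
      have "lam (nat (- \<beta>)) = 0" using that by (intro Z) simp
      then have "\<beta> = int (lam (nat (- \<beta>))) - int (nat (- \<beta>)) + 0" using that by simp
      then show ?thesis unfolding beta_set_def by blast
    qed
    have high: "\<beta> \<le> int (lam 0)" if "\<beta> \<in> ?S" for \<beta>
    proof -
      obtain k where k: "\<beta> = int (lam k) - int k" using \<open>\<beta> \<in> ?S\<close> by (auto simp: beta_set_def)
      have "lam k \<le> lam 0" using lam by (auto simp: is_partition_def antimono_def)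
      then show ?thesis by (simp add: k)
    qed
    have "\<exists>n. \<forall>m. (int e * m + int r + 1 \<in> ?S) \<longleftrightarrow> m < n" for r
    proof (rule down_closed_int_set)
      fix m assume "int e * m + int r + 1 \<in> ?S"
      with closed have "int e * m + int r + 1 - int e \<in> ?S" by blast
      then show "int e * (m - 1) + int r + 1 \<in> ?S" by (simp add: algebra_simps)
    next
      fix m :: int assume m: "m \<le> - int (Z + r + 1)"
      have a: "int e * m \<le> 1 * m" using m e by (intro mult_right_mono_neg) auto
      have b: "m \<le> - int Z - int r - 1" using m by simp
      show "int e * m + int r + 1 \<in> ?S" by (rule low) (use a b in linarith)
    next
      fix m :: int assume m: "m > int (lam 0)"
      have a: "1 * m \<le> int e * m" using m e by (intro mult_right_mono) auto
      show "int e * m + int r + 1 \<notin> ?S"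
      proof
        assume "int e * m + int r + 1 \<in> ?S"
        then have "int e * m + int r + 1 \<le> int (lam 0)" by (rule high)
        then show False using a m by linarith
      qed
    qed
    then obtain N where N: "\<And>r m. (int e * m + int r + 1 \<in> ?S) \<longleftrightarrow> m < N r" by metis
    have "?S = core_beads e 1 (map N [0..<e]) 0"
    proof (intro set_eqI)
      fix k
      have r: "0 \<le> (k - 1) mod int e" "(k - 1) mod int e < int e" using e by auto
      have "k = int e * ((k - 1) div int e) + int (nat ((k - 1) mod int e)) + 1" using r by simp
      then have "k \<in> ?S \<longleftrightarrow> (k - 1) div int e < N (nat ((k - 1) mod int e))" using N by metis
      then show "k \<in> ?S \<longleftrightarrow> k \<in> core_beads e 1 (map N [0..<e]) 0" unfolding core_beads_one using r by simp
    qed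
    then show "\<exists>t. length t = e \<and> ?S = core_beads e 1 t 0" by (intro exI[of _ "map N [0..<e]"]) simp
  qed
  finally show ?thesis .
qed

lemma partition_decreasing: "is_partition lam \<Longrightarrow> i \<le> j \<Longrightarrow> lam j \<le> lam i"
  by (auto simp: is_partition_def antimono_def)

lemma beta_gap:
  assumes lam: "is_partition lam" and m: "int (lam (Suc m)) - int (Suc m) < \<gamma>" "\<gamma> < int (lam m) - int m"
  shows "\<gamma> \<notin> beta_set lam 0"
proof
  assume "\<gamma> \<in> beta_set lam 0"
  then obtain k where k: "\<gamma> = int (lam k) - int k" by (auto simp: beta_set_def)
  show False
  proof (cases "k \<le> m")
    case True
    then show False using partition_decreasing[OF lam True] m k by simp
  next
    case False
    then have "Suc m \<le> k" by simp
    then show False using partition_decreasing[OF lam, of "Suc m" k] m k by simp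
  qed
qed

lemma subpartition:
  assumes lam: "is_partition lam" and "\<And>k. mu k \<le> lam k" "\<And>k. mu (Suc k) \<le> mu k"
  shows "is_partition mu"
proof -
  have "{k. mu k \<noteq> 0} \<subseteq> {k. lam k \<noteq> 0}" using assms(2) by (metis (mono_tags, lifting) Collect_mono le_zero_eq)
  moreover have "finite {k. lam k \<noteq> 0}" using lam by (simp add: is_partition_def)
  ultimately show ?thesis using assms(3) by (auto simp: is_partition_def antimono_iff_le_Suc intro: finite_subset)
qed

lemma adjacent_sym: "(x, y) \<in> adjacent \<Longrightarrow> (y, x) \<in> adjacent"
  by (auto simp: adjacent_def abs_minus_commute)

lemma adjacent_iff: "((i,j),(i',j')) \<in> adjacent \<longleftrightarrow> (i = i' \<and> (j' = Suc j \<or> j = Suc j')) \<or> (j = j' \<and> (i' = Suc i \<or> i = Suc i'))"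
  by (auto simp: adjacent_def)

lemma rim_hook_path:
  assumes lam: "is_partition lam" and mu: "\<And>k. mu k \<le> lam k" "\<And>k. mu (Suc k) \<le> mu k"
    and R: "young lam - young mu = {x,y,z}" and dist: "x \<noteq> y" "y \<noteq> z" "x \<noteq> z" and adj: "(x,y) \<in> adjacent" "(y,z) \<in> adjacent"
  shows "\<exists>R. removable_rim_hook lam R \<and> card R = 3"
proof (intro exI conjI)
  let ?R = "{x,y,z}"
  show card: "card ?R = 3" using dist by simp
  have sub: "young mu \<subseteq> young lam" using mu(1) by (auto simp: young_def intro: less_le_trans)
  let ?r = "(adjacent \<inter> ?R \<times> ?R)\<^sup>*"
  have s: "(x,y) \<in> ?r" "(y,x) \<in> ?r" "(y,z) \<in> ?r" "(z,y) \<in> ?r" using adj adj[THEN adjacent_sym] by (auto intro!: r_into_rtrancl)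
  then have "(x,z) \<in> ?r" "(z,x) \<in> ?r" by (auto intro: rtrancl_trans)
  with s have conn: "\<forall>u\<in>?R. \<forall>v\<in>?R. (u,v) \<in> ?r" by auto
  have "\<not> {(i, j), (i + 1, j), (i, j + 1), (i + 1, j + 1)} \<subseteq> ?R" for i j :: nat
  proof
    assume "{(i, j), (i + 1, j), (i, j + 1), (i + 1, j + 1)} \<subseteq> ?R"
    then have "card {(i, j), (i + 1, j), (i, j + 1), (i + 1, j + 1)} \<le> card ?R" by (intro card_mono) auto
    then show False using card by simp
  qed
  moreover have "young mu = young lam - ?R" using R sub by blast
  moreover have "is_partition mu" by (rule subpartition[OF lam mu])
  moreover have "?R \<subseteq> young lam" using R by blast
  ultimately show "removable_rim_hook lam ?R" unfolding removable_rim_hook_def using conn by blast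
qed

text \<open>
  A connected graph on three vertices contains a path through all of them.
\<close>

lemma three_path:
  assumes c: "card R = 3" and conn: "\<forall>x\<in>R. \<forall>y\<in>R. (x, y) \<in> (adjacent \<inter> R \<times> R)\<^sup>*"
  shows "\<exists>x y z. R = {x,y,z} \<and> x \<noteq> y \<and> y \<noteq> z \<and> x \<noteq> z \<and> (x,y) \<in> adjacent \<and> (y,z) \<in> adjacent"
proof -
  obtain x y z where R: "R = {x,y,z}" "x \<noteq> y" "y \<noteq> z" "x \<noteq> z" using c by (auto simp: card_3_iff)
  have nb: "\<exists>v\<in>R. v \<noteq> u \<and> (u,v) \<in> adjacent" if u: "u \<in> R" "u' \<in> R" "u \<noteq> u'" for u u'
  proof -
    have "(u,u') \<in> (adjacent \<inter> R \<times> R)\<^sup>*" using conn u by blast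
    then obtain v where "(u,v) \<in> adjacent \<inter> R \<times> R" using u(3) by (meson converse_rtranclE)
    then have v: "v \<in> R" "(u,v) \<in> adjacent" by auto
    then have "v \<noteq> u" by (auto simp: adjacent_def)
    with v show ?thesis by blast
  qed
  have x: "(x,y) \<in> adjacent \<or> (x,z) \<in> adjacent" using nb[of x y] R by auto
  have y: "(y,x) \<in> adjacent \<or> (y,z) \<in> adjacent" using nb[of y x] R by auto
  have z: "(z,x) \<in> adjacent \<or> (z,y) \<in> adjacent" using nb[of z x] R by auto
  consider "(x,y) \<in> adjacent" "(y,z) \<in> adjacent" | "(y,x) \<in> adjacent" "(x,z) \<in> adjacent" | "(x,z) \<in> adjacent" "(z,y) \<in> adjacent"
    using x y z adjacent_sym[of x y] adjacent_sym[of y x] adjacent_sym[of y z] adjacent_sym[of z y] adjacent_sym[of x z] adjacent_sym[of z x] by argo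
  then show ?thesis
  proof cases
    case 1
    show ?thesis by (rule exI[of _ x], rule exI[of _ y], rule exI[of _ z]) (use R 1 in simp)
  next
    case 2
    have "R = {y,x,z}" using R(1) by (simp add: insert_commute)
    then show ?thesis by (intro exI[of _ y] exI[of _ x] exI[of _ z] conjI) (use R 2 in simp_all)
  next
    case 3
    have "R = {x,z,y}" using R(1) by (simp add: insert_commute)
    then show ?thesis by (intro exI[of _ x] exI[of _ z] exI[of _ y] conjI) (use R 3 in simp_all)
  qed
qed

text \<open>
  Moving the bead \<open>\<beta>\<close> three places down removes a rim hook. Its shape depends
  on which of the two positions in between are occupied: none gives a horizontal strip, both a
  vertical strip, and one of them a bent hook.
\<close>

lemma rim_hook_of_gap:
  assumes lam: "is_partition lam" and b: "\<beta> \<in> beta_set lam 0" "\<beta> - 3 \<notin> beta_set lam 0"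
  shows "\<exists>R. removable_rim_hook lam R \<and> card R = 3"
proof -
  obtain i where i: "\<beta> = int (lam i) - int i" using b(1) by (auto simp: beta_set_def)
  define a where "a = lam i"
  have dec: "lam (Suc k) \<le> lam k" for k using partition_decreasing[OF lam, of k "Suc k"] by simp
  have up: "a \<le> lam k" if "k \<le> i" for k using partition_decreasing[OF lam that] by (simp add: a_def)
  have ne: "int (lam k) - int k \<noteq> \<beta> - 3" for k
  proof
    assume "int (lam k) - int k = \<beta> - 3"
    then have "\<beta> - 3 = int (lam k) - int k + 0" by simp
    then show False using b(2) unfolding beta_set_def by blast
  qed
  note d = dec[of i] dec[of "Suc i"] dec[of "Suc (Suc i)"]
  consider (A) "lam (Suc i) + 3 \<le> a" | (B) "Suc (lam (Suc i)) = a" "lam (Suc (Suc i)) + 2 \<le> a"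
    | (C) "lam (Suc i) = a" "lam (Suc (Suc i)) + 2 \<le> a" | (D) "lam (Suc i) = a" "lam (Suc (Suc i)) = a" "lam (Suc (Suc (Suc i))) + 1 \<le> a"
    using ne[of "Suc i"] ne[of "Suc (Suc i)"] ne[of "Suc (Suc (Suc i))"] d unfolding i a_def by linarith
  then show ?thesis
  proof cases
    case A
    define mu where "mu k = (if k = i then a - 3 else lam k)" for k
    show ?thesis
    proof (rule rim_hook_path[OF lam, of mu "(i,a-3)" "(i,a-2)" "(i,a-1)"])
      show "mu (Suc k) \<le> mu k" for k using A dec[of k] up[of k] by (auto simp: mu_def a_def)
      show "young lam - young mu = {(i,a-3),(i,a-2),(i,a-1)}" using A by (auto simp: young_def mu_def a_def split: if_splits)
    qed (use A in \<open>auto simp: mu_def a_def adjacent_iff\<close>)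
  next
    case B
    define mu where "mu k = (if k = i \<or> k = Suc i then a - 2 else lam k)" for k
    show ?thesis
    proof (rule rim_hook_path[OF lam, of mu "(i,a-1)" "(i,a-2)" "(Suc i,a-2)"])
      show "mu (Suc k) \<le> mu k" for k using B dec[of k] up[of k] by (auto simp: mu_def a_def)
      show "young lam - young mu = {(i,a-1),(i,a-2),(Suc i,a-2)}" using B by (auto simp: young_def mu_def a_def split: if_splits)
    qed (use B in \<open>auto simp: mu_def a_def adjacent_iff\<close>)
  next
    case C
    define mu where "mu k = (if k = i then a - 1 else if k = Suc i then a - 2 else lam k)" for k
    show ?thesis
    proof (rule rim_hook_path[OF lam, of mu "(i,a-1)" "(Suc i,a-1)" "(Suc i,a-2)"])
      show "mu (Suc k) \<le> mu k" for k using C dec[of k] up[of k] by (auto simp: mu_def a_def)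
      show "young lam - young mu = {(i,a-1),(Suc i,a-1),(Suc i,a-2)}" using C by (auto simp: young_def mu_def a_def split: if_splits)
    qed (use C in \<open>auto simp: mu_def a_def adjacent_iff\<close>)
  next
    case D
    define mu where "mu k = (if k = i \<or> k = Suc i \<or> k = Suc (Suc i) then a - 1 else lam k)" for k
    show ?thesis
    proof (rule rim_hook_path[OF lam, of mu "(i,a-1)" "(Suc i,a-1)" "(Suc (Suc i),a-1)"])
      show "mu (Suc k) \<le> mu k" for k using D dec[of k] up[of k] by (auto simp: mu_def a_def)
      show "young lam - young mu = {(i,a-1),(Suc i,a-1),(Suc (Suc i),a-1)}" using D by (auto simp: young_def mu_def a_def split: if_splits)
    qed (use D in \<open>auto simp: mu_def a_def adjacent_iff\<close>)
  qed
qed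

lemma skew_row:
  assumes "\<And>c. (c = u) \<longleftrightarrow> m \<le> c \<and> c < (l::nat)" shows "m = u \<and> l = Suc u"
  using assms[of u] assms[of m] assms[of "l - 1"] by auto

lemma skew_row_two:
  assumes "\<And>c. (c = u \<or> c = Suc u) \<longleftrightarrow> m \<le> c \<and> c < (l::nat)" shows "m = u \<and> l = Suc (Suc u)"
  using assms[of u] assms[of "Suc u"] assms[of m] assms[of "l - 1"] by auto

lemma skew_row_three:
  assumes "\<And>c. (c = u \<or> c = Suc u \<or> c = Suc (Suc u)) \<longleftrightarrow> m \<le> c \<and> c < (l::nat)" shows "m = u \<and> l = Suc (Suc (Suc u))"
  using assms[of u] assms[of "Suc u"] assms[of "Suc (Suc u)"] assms[of m] assms[of "l - 1"] by auto

text \<open>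
  The three cells form a path. Of the six shapes, two are not skew shapes, and in the other four
  the row lengths show that the bead of the first row involved can move down by three places.
\<close>

lemma gap_of_rim_hook:
  assumes lam: "is_partition lam" and R: "removable_rim_hook lam R" "card R = 3"
  shows "\<exists>\<beta>\<in>beta_set lam 0. \<beta> - 3 \<notin> beta_set lam 0"
proof -
  obtain mu where mu: "is_partition mu" "young mu = young lam - R" and sub: "R \<subseteq> young lam"
    using R(1)[unfolded removable_rim_hook_def] by (elim conjE exE)
  have row: "(r,c) \<in> R \<longleftrightarrow> mu r \<le> c \<and> c < lam r" for r c
  proof -
    have "(r,c) \<in> R \<longleftrightarrow> (r,c) \<in> young lam \<and> (r,c) \<notin> young mu" using mu(2) sub by blast
    then show ?thesis by (auto simp: young_def)
  qed
  have le: "mu r \<le> lam r" for r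
  proof (rule ccontr)
    assume "\<not> mu r \<le> lam r"
    then have "(r, lam r) \<in> young mu" by (simp add: young_def)
    then show False unfolding mu(2) by (simp add: young_def)
  qed
  have empty: "mu r = lam r" if "\<And>c. (r,c) \<notin> R" for r using that[of "mu r"] row[of r "mu r"] le[of r] by simp
  have dl: "lam (Suc k) \<le> lam k" for k using partition_decreasing[OF lam, of k "Suc k"] by simp
  have dm: "mu (Suc k) \<le> mu k" for k using partition_decreasing[OF mu(1), of k "Suc k"] by simp
  have gap: ?thesis if "int (lam (Suc m)) - int (Suc m) < int (lam i) - int i - 3" "int (lam i) - int i - 3 < int (lam m) - int m" for i m
  proof -
    have "int (lam i) - int i \<in> beta_set lam 0" by (auto simp: beta_set_def)
    then show ?thesis using beta_gap[OF lam that] by blast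
  qed
  obtain x y z where P: "R = {x,y,z}" "x \<noteq> y" "y \<noteq> z" "x \<noteq> z" "(x,y) \<in> adjacent" "(y,z) \<in> adjacent"
  proof -
    have "\<forall>x\<in>R. \<forall>y\<in>R. (x, y) \<in> (adjacent \<inter> R \<times> R)\<^sup>*" using R(1)[unfolded removable_rim_hook_def] by (elim conjE)
    from three_path[OF R(2) this] show ?thesis using that by (elim exE conjE)
  qed
  obtain i j where y: "y = (i,j)" by (cases y)
  have horizontal: ?thesis if "R = {(i,u),(i,Suc u),(i,Suc (Suc u))}" for i u
  proof -
    have "mu i = u \<and> lam i = Suc (Suc (Suc u))" by (rule skew_row_three) (use row[of i] in \<open>simp add: that\<close>)
    moreover have "mu (Suc i) = lam (Suc i)" by (rule empty) (simp add: that)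
    ultimately show ?thesis using dm[of i] by (intro gap[where i = i and m = i]) auto
  qed
  have vertical: ?thesis if "R = {(i,u),(Suc i,u),(Suc (Suc i),u)}" for i u
  proof -
    have "mu i = u \<and> lam i = Suc u" "mu (Suc i) = u \<and> lam (Suc i) = Suc u" "mu (Suc (Suc i)) = u \<and> lam (Suc (Suc i)) = Suc u"
      by (rule skew_row; use row[of i] row[of "Suc i"] row[of "Suc (Suc i)"] in \<open>simp add: that\<close>)+
    moreover have "mu (Suc (Suc (Suc i))) = lam (Suc (Suc (Suc i)))" by (rule empty) (simp add: that)
    ultimately show ?thesis using dm[of "Suc (Suc i)"] by (intro gap[where i = i and m = "Suc (Suc i)"]) auto
  qed
  have upper_left: ?thesis if "R = {(i,u),(i,Suc u),(Suc i,u)}" for i u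
  proof -
    have "mu i = u \<and> lam i = Suc (Suc u)" by (rule skew_row_two) (use row[of i] in \<open>simp add: that\<close>)
    moreover have "mu (Suc i) = u \<and> lam (Suc i) = Suc u" by (rule skew_row) (use row[of "Suc i"] in \<open>simp add: that\<close>)
    moreover have "mu (Suc (Suc i)) = lam (Suc (Suc i))" by (rule empty) (simp add: that)
    ultimately show ?thesis using dm[of "Suc i"] by (intro gap[where i = i and m = "Suc i"]) auto
  qed
  have lower_right: ?thesis if "R = {(i,Suc u),(Suc i,u),(Suc i,Suc u)}" for i u
  proof -
    have "mu i = Suc u \<and> lam i = Suc (Suc u)" by (rule skew_row) (use row[of i] in \<open>simp add: that\<close>)
    moreover have "mu (Suc i) = u \<and> lam (Suc i) = Suc (Suc u)" by (rule skew_row_two) (use row[of "Suc i"] in \<open>simp add: that\<close>)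
    moreover have "mu (Suc (Suc i)) = lam (Suc (Suc i))" by (rule empty) (simp add: that)
    ultimately show ?thesis using dm[of "Suc i"] by (intro gap[where i = i and m = "Suc i"]) auto
  qed
  have upper_right: ?thesis if "R = {(i,u),(i,Suc u),(Suc i,Suc u)}" for i u
  proof -
    have "mu i = u" using skew_row_two[of u "mu i" "lam i"] row[of i] by (simp add: that)
    moreover have "mu (Suc i) = Suc u" using skew_row[of "Suc u" "mu (Suc i)" "lam (Suc i)"] row[of "Suc i"] by (simp add: that)
    ultimately show ?thesis using dm[of i] by simp
  qed
  have lower_left: ?thesis if "R = {(i,u),(Suc i,u),(Suc i,Suc u)}" for i u
  proof -
    have "lam i = Suc u" using skew_row[of u "mu i" "lam i"] row[of i] by (simp add: that)
    moreover have "lam (Suc i) = Suc (Suc u)" using skew_row_two[of u "mu (Suc i)" "lam (Suc i)"] row[of "Suc i"] by (simp add: that)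
    ultimately show ?thesis using dl[of i] by simp
  qed
  obtain xi xj zi zj where xz: "x = (xi,xj)" "z = (zi,zj)" by (cases x, cases z) auto
  have x: "(xi = i \<and> (xj = Suc j \<or> j = Suc xj)) \<or> (xj = j \<and> (xi = Suc i \<or> i = Suc xi))"
    using P(5) unfolding y xz adjacent_iff by auto
  have z: "(zi = i \<and> (zj = Suc j \<or> j = Suc zj)) \<or> (zj = j \<and> (zi = Suc i \<or> i = Suc zi))"
    using P(6) unfolding y xz adjacent_iff by auto
  have RR: ?thesis if "xi = i" "xj = Suc j" "zi = i" "zj = Suc j"
    using that P(4) by (simp add: xz)
  have RL: ?thesis if "xi = i" "xj = Suc j" "zi = i" "j = Suc zj"
    by (rule horizontal[of i zj]) (use that in \<open>simp add: P(1) y xz insert_commute\<close>)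
  have RD: ?thesis if "xi = i" "xj = Suc j" "zj = j" "zi = Suc i"
    by (rule upper_left[of i j]) (use that in \<open>simp add: P(1) y xz insert_commute\<close>)
  have RU: ?thesis if "xi = i" "xj = Suc j" "zj = j" "i = Suc zi"
    by (rule lower_left[of zi j]) (use that in \<open>simp add: P(1) y xz insert_commute\<close>)
  have LR: ?thesis if "xi = i" "j = Suc xj" "zi = i" "zj = Suc j"
    by (rule horizontal[of i xj]) (use that in \<open>simp add: P(1) y xz insert_commute\<close>)
  have LL: ?thesis if "xi = i" "j = Suc xj" "zi = i" "j = Suc zj"
    using that P(4) by (simp add: xz)
  have LD: ?thesis if "xi = i" "j = Suc xj" "zj = j" "zi = Suc i"
    by (rule upper_right[of i xj]) (use that in \<open>simp add: P(1) y xz insert_commute\<close>)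
  have LU: ?thesis if "xi = i" "j = Suc xj" "zj = j" "i = Suc zi"
    by (rule lower_right[of zi xj]) (use that in \<open>simp add: P(1) y xz insert_commute\<close>)
  have DR: ?thesis if "xj = j" "xi = Suc i" "zi = i" "zj = Suc j"
    by (rule upper_left[of i j]) (use that in \<open>simp add: P(1) y xz insert_commute\<close>)
  have DL: ?thesis if "xj = j" "xi = Suc i" "zi = i" "j = Suc zj"
    by (rule upper_right[of i zj]) (use that in \<open>simp add: P(1) y xz insert_commute\<close>)
  have DD: ?thesis if "xj = j" "xi = Suc i" "zj = j" "zi = Suc i"
    using that P(4) by (simp add: xz)
  have DU: ?thesis if "xj = j" "xi = Suc i" "zj = j" "i = Suc zi"
    by (rule vertical[of zi j]) (use that in \<open>simp add: P(1) y xz insert_commute\<close>)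
  have UR: ?thesis if "xj = j" "i = Suc xi" "zi = i" "zj = Suc j"
    by (rule lower_left[of xi j]) (use that in \<open>simp add: P(1) y xz insert_commute\<close>)
  have UL: ?thesis if "xj = j" "i = Suc xi" "zi = i" "j = Suc zj"
    by (rule lower_right[of xi zj]) (use that in \<open>simp add: P(1) y xz insert_commute\<close>)
  have UD: ?thesis if "xj = j" "i = Suc xi" "zj = j" "zi = Suc i"
    by (rule vertical[of xi j]) (use that in \<open>simp add: P(1) y xz insert_commute\<close>)
  have UU: ?thesis if "xj = j" "i = Suc xi" "zj = j" "i = Suc zi"
    using that P(4) by (simp add: xz)
  show ?thesis using x
  proof (elim disjE conjE)
    assume a: "xi = i" "xj = Suc j"
    show ?thesis using z by (elim disjE conjE) (erule (1) RR[OF a] | erule (1) RL[OF a] | erule (1) RD[OF a] | erule (1) RU[OF a])+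
  next
    assume a: "xi = i" "j = Suc xj"
    show ?thesis using z by (elim disjE conjE) (erule (1) LR[OF a] | erule (1) LL[OF a] | erule (1) LD[OF a] | erule (1) LU[OF a])+
  next
    assume a: "xj = j" "xi = Suc i"
    show ?thesis using z by (elim disjE conjE) (erule (1) DR[OF a] | erule (1) DL[OF a] | erule (1) DD[OF a] | erule (1) DU[OF a])+
  next
    assume a: "xj = j" "i = Suc xi"
    show ?thesis using z by (elim disjE conjE) (erule (1) UR[OF a] | erule (1) UL[OF a] | erule (1) UD[OF a] | erule (1) UU[OF a])+
  qed
qed

lemma ordinary_core_iff:
  assumes "is_partition lam"
  shows "is_ordinary_core 3 lam \<longleftrightarrow> is_core 3 [0] [lam]"
  unfolding is_ordinary_core_def is_core_single[OF zero_less_numeral assms]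
  using rim_hook_of_gap[OF assms] gap_of_rim_hook[OF assms] assms by auto

theorem c3_core_series: "c3 = core_series 3 [0]"
  unfolding c3_def core_series_def
proof (rule gen_series_bij)
  show "bij_betw (\<lambda>lam. [lam]) {lam. is_ordinary_core 3 lam} {\<Lambda>. is_core 3 [0] \<Lambda>}"
  proof (rule bij_betw_byWitness[of _ hd])
    have p: "is_ordinary_core 3 lam \<Longrightarrow> is_partition lam" for lam by (simp add: is_ordinary_core_def)
    have l: "\<exists>lam. \<Lambda> = [lam] \<and> is_partition lam" if "is_core 3 [0] \<Lambda>" for \<Lambda>
      using that by (auto simp: is_core_def is_multipartition_def length_Suc_conv)
    show "\<forall>\<Lambda>\<in>{\<Lambda>. is_core 3 [0] \<Lambda>}. [hd \<Lambda>] = \<Lambda>" using l by force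
    show "(\<lambda>lam. [lam]) ` {lam. is_ordinary_core 3 lam} \<subseteq> {\<Lambda>. is_core 3 [0] \<Lambda>}" using ordinary_core_iff p by auto
    show "hd ` {\<Lambda>. is_core 3 [0] \<Lambda>} \<subseteq> {lam. is_ordinary_core 3 lam}" using ordinary_core_iff l by force
  qed simp
qed (simp add: msize_def)

section \<open>Sums of two values of the hexagonal norm form\<close>

text \<open>
  The norm form of the Eisenstein integers.
\<close>

definition hexnorm :: "int \<Rightarrow> int \<Rightarrow> int" where "hexnorm x y = x\<^sup>2 + x * y + y\<^sup>2"

lemma hexnorm_four: "4 * hexnorm x y = (2 * x + y)\<^sup>2 + 3 * y\<^sup>2"
  by (simp add: hexnorm_def power2_eq_square algebra_simps)

lemma hexnorm_nonneg: "0 \<le> hexnorm x y"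
proof -
  have "0 \<le> 4 * hexnorm x y" unfolding hexnorm_four by simp
  then show ?thesis by simp
qed

lemma hexnorm_eq_0: "hexnorm x y = 0 \<Longrightarrow> x = 0 \<and> y = 0"
proof -
  assume "hexnorm x y = 0"
  then have "(2 * x + y)\<^sup>2 + 3 * y\<^sup>2 = 0" using hexnorm_four[of x y] by simp
  moreover have "0 \<le> (2 * x + y)\<^sup>2" "0 \<le> y\<^sup>2" by simp_all
  ultimately have "(2 * x + y)\<^sup>2 = 0" "y\<^sup>2 = 0" by linarith+
  then show ?thesis by simp
qed

text \<open>
  Writing the sum of two norms as \<open>\<bar>\<alpha>\<bar>\<^sup>2 +
  \<bar>\<beta>\<bar>\<^sup>2\<close> with Eisenstein integers, this is the identity of Euler and
  Lagrange with first term \<open>\<alpha> cnj \<alpha>' + \<beta> cnj \<beta>'\<close> and second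
  term \<open>\<alpha> \<beta>' - \<beta> \<alpha>'\<close>.
\<close>

lemma hexnorm_product:
  "(hexnorm a b + hexnorm e f) * (hexnorm c d + hexnorm g h)
    = hexnorm ((a*c + a*d + b*d) + (e*g + e*h + f*h)) ((b*c - a*d) + (f*g - e*h))
    + hexnorm ((a*g - b*h) - (e*c - f*d)) ((a*h + b*g + b*h) - (e*d + f*c + f*d))"
  by (simp add: hexnorm_def power2_eq_square algebra_simps)

definition two_hexnorms :: "int \<Rightarrow> bool" where
  "two_hexnorms n \<longleftrightarrow> (\<exists>x y z w. n = hexnorm x y + hexnorm z w)"

lemma two_hexnorms_mult: "two_hexnorms m \<Longrightarrow> two_hexnorms n \<Longrightarrow> two_hexnorms (m * n)"
  unfolding two_hexnorms_def using hexnorm_product by blast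

lemma centered_residue:
  assumes "(m::int) > 0" shows "\<exists>r k. y = r + m * k \<and> 2 * \<bar>r\<bar> \<le> m"
proof -
  define s where "s = y mod m"
  have s: "0 \<le> s" "s < m" "y = s + m * (y div m)" using assms by (auto simp: s_def)
  show ?thesis
  proof (cases "2 * s \<le> m")
    case True then show ?thesis using s by (intro exI[of _ s] exI[of _ "y div m"]) auto
  next
    case False then show ?thesis using s by (intro exI[of _ "s - m"] exI[of _ "y div m + 1"]) (auto simp: algebra_simps)
  qed
qed

text \<open>
  First \<open>y\<close> is reduced modulo \<open>m\<close> and then \<open>2 x + y\<close> modulo
  \<open>2 m\<close>; reducing \<open>x\<close> and \<open>y\<close> separately would only give
  \<open>3 m\<^sup>2 / 4\<close>, which is too large for the descent.
\<close>

lemma hexnorm_reduce: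
  assumes m: "(m::int) > 0"
  shows "\<exists>x' y' k j. x = x' + m * k \<and> y = y' + m * j \<and> 16 * hexnorm x' y' \<le> 7 * m\<^sup>2"
proof -
  obtain y' j where y: "y = y' + m * j" "2 * \<bar>y'\<bar> \<le> m" using centered_residue[OF m] by blast
  obtain r k where r: "2 * x + y' = r + (2 * m) * k" "2 * \<bar>r\<bar> \<le> 2 * m" using centered_residue[of "2 * m" "2 * x + y'"] m by auto
  define x' where "x' = x - m * k"
  have rx: "2 * x' + y' = r" using r(1) by (simp add: x'_def algebra_simps)
  have "\<bar>r\<bar>\<^sup>2 \<le> m\<^sup>2" using r(2) by (intro power_mono) auto
  moreover have "(2 * \<bar>y'\<bar>)\<^sup>2 \<le> m\<^sup>2" using y(2) by (intro power_mono) auto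
  ultimately have "4 * (4 * hexnorm x' y') \<le> 7 * m\<^sup>2" unfolding hexnorm_four rx by (simp add: power_mult_distrib)
  then have "16 * hexnorm x' y' \<le> 7 * m\<^sup>2" by simp
  moreover have "x = x' + m * k" by (simp add: x'_def)
  ultimately show ?thesis using y(1) by blast
qed

lemma hexnorm_scale: "hexnorm (m * x) (m * y) = m\<^sup>2 * hexnorm x y"
  by (simp add: hexnorm_def power2_eq_square algebra_simps)

text \<open>
  Reducing the coordinates modulo \<open>m\<close> gives a representation of a smaller multiple
  \<open>r m\<close> of \<open>m\<close>. In the product of the two representations all
  coordinates are divisible by \<open>m\<close>.
\<close>

lemma two_hexnorms_descent:
  assumes p: "prime (p::nat)" and m: "1 < m" "m < int p" and t: "two_hexnorms (m * int p)"
  shows "\<exists>r. 0 < r \<and> r < m \<and> two_hexnorms (r * int p)"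
proof -
  obtain a b e f where F: "m * int p = hexnorm a b + hexnorm e f" using t by (auto simp: two_hexnorms_def)
  have m0: "m > 0" using m by simp
  obtain c d k1 k2 where cd: "a = c + m * k1" "b = d + m * k2" "16 * hexnorm c d \<le> 7 * m\<^sup>2"
    using hexnorm_reduce[OF m0, of a b] by blast
  obtain g h k3 k4 where gh: "e = g + m * k3" "f = h + m * k4" "16 * hexnorm g h \<le> 7 * m\<^sup>2"
    using hexnorm_reduce[OF m0, of e f] by blast
  define S where "S = hexnorm c d + hexnorm g h"
  have "S = m * int p - m * (2*c*k1 + m*k1\<^sup>2 + c*k2 + d*k1 + m*k1*k2 + 2*d*k2 + m*k2\<^sup>2 + 2*g*k3 + m*k3\<^sup>2 + g*k4 + h*k3 + m*k3*k4 + 2*h*k4 + m*k4\<^sup>2)"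
    unfolding F S_def cd(1,2) gh(1,2) hexnorm_def by (simp add: power2_eq_square algebra_simps)
  then have "m dvd S" by (simp add: dvd_diff)
  then obtain r where r: "S = m * r" by blast
  have S: "0 \<le> S" "16 * S \<le> 14 * m\<^sup>2" using hexnorm_nonneg[of c d] hexnorm_nonneg[of g h] cd(3) gh(3) by (auto simp: S_def)
  have "m * (16 * r) \<le> m * (14 * m)" using S(2) unfolding r by (simp add: power2_eq_square algebra_simps)
  then have "16 * r \<le> 14 * m" using m0 by simp
  then have rm: "r < m" using m0 by linarith
  have r0: "0 \<le> r" using S(1) m0 unfolding r by (simp add: zero_le_mult_iff)
  have "r \<noteq> 0"
  proof
    assume "r = 0"
    then have "hexnorm c d = 0" "hexnorm g h = 0" using r hexnorm_nonneg[of c d] hexnorm_nonneg[of g h] by (auto simp: S_def)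
    then have "c = 0" "d = 0" "g = 0" "h = 0" using hexnorm_eq_0 by blast+
    have "m * int p = m\<^sup>2 * (hexnorm k1 k2 + hexnorm k3 k4)" unfolding F cd(1,2) gh(1,2) \<open>c = 0\<close> \<open>d = 0\<close> \<open>g = 0\<close> \<open>h = 0\<close> add_0 hexnorm_scale distrib_left by (rule refl)
    then have "m * int p = m * (m * (hexnorm k1 k2 + hexnorm k3 k4))" by (simp add: power2_eq_square algebra_simps)
    then have "int p = m * (hexnorm k1 k2 + hexnorm k3 k4)" using m0 by simp
    then have "m dvd int p" by simp
    then have "nat m dvd p" using m0 by (simp add: nat_dvd_iff)
    then have "nat m = 1 \<or> nat m = p" using p by (simp add: prime_nat_iff)
    then show False using m by auto
  qed
  with r0 have "0 < r" by simp
  define X1 Y1 X2 Y2 where "X1 = (a*c + a*d + b*d) + (e*g + e*h + f*h)" and "Y1 = (b*c - a*d) + (f*g - e*h)"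
    and "X2 = (a*g - b*h) - (e*c - f*d)" and "Y2 = (a*h + b*g + b*h) - (e*d + f*c + f*d)"
  have P: "(m * int p) * (m * r) = hexnorm X1 Y1 + hexnorm X2 Y2"
    unfolding F r[symmetric] S_def X1_def Y1_def X2_def Y2_def by (rule hexnorm_product)
  have "X1 = S + m * (k1*c + k1*d + k2*d + k3*g + k3*h + k4*h)" "Y1 = m * (k2*c - k1*d + k4*g - k3*h)"
    "X2 = m * (k1*g - k2*h - k3*c + k4*d)" "Y2 = m * (k1*h + k2*g + k2*h - k3*d - k4*c - k4*d)"
    unfolding X1_def Y1_def X2_def Y2_def S_def cd(1,2) gh(1,2) hexnorm_def by (simp_all add: power2_eq_square algebra_simps)
  then have "m dvd X1" "m dvd Y1" "m dvd X2" "m dvd Y2" using r by simp_all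
  then obtain x1 y1 x2 y2 where "X1 = m * x1" "Y1 = m * y1" "X2 = m * x2" "Y2 = m * y2" by (elim dvdE)
  then have "m\<^sup>2 * (r * int p) = m\<^sup>2 * (hexnorm x1 y1 + hexnorm x2 y2)"
    using P by (simp add: hexnorm_scale power2_eq_square algebra_simps)
  then have "r * int p = hexnorm x1 y1 + hexnorm x2 y2" using m0 by simp
  then show ?thesis using \<open>0 < r\<close> rm unfolding two_hexnorms_def by blast
qed

text \<open>
  The values \<open>x\<^sup>2 + x + 1\<close> and \<open>- z\<^sup>2\<close> for \<open>0 \<le> x,
  z \<le> (p - 1) / 2\<close> give \<open>p + 1\<close> residues modulo \<open>p\<close>, so they
  collide.
\<close>

lemma two_hexnorms_multiple_of_prime:
  assumes p: "prime (p::nat)" "odd p"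
  shows "\<exists>m. 0 < m \<and> m < int p \<and> two_hexnorms (m * int p)"
proof -
  obtain h where h: "p = 2 * h + 1" using p(2) by (elim oddE)
  have h1: "h \<ge> 1" using p(1) h by (cases h) auto
  let ?H = "{0..int h}"
  let ?f = "\<lambda>x::int. (x\<^sup>2 + x + 1) mod int p" and ?g = "\<lambda>z::int. (- z\<^sup>2) mod int p"
  have pp: "int p dvd u * v \<Longrightarrow> int p dvd u \<or> int p dvd v" for u v
    using p(1) by (simp add: prime_dvd_mult_iff)
  have small: "u = 0" if "int p dvd u" "\<bar>u\<bar> < int p" for u :: int using that zdvd_imp_le[of "int p" "\<bar>u\<bar>"] by (cases "u = 0") auto
  have "inj_on ?f ?H"
  proof (rule inj_onI)
    fix x y assume xy: "x \<in> ?H" "y \<in> ?H" "?f x = ?f y"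
    then have "int p dvd (x - y) * (x + y + 1)" by (simp add: mod_eq_dvd_iff power2_eq_square algebra_simps)
    then consider "int p dvd x - y" | "int p dvd x + y + 1" using pp by blast
    then show "x = y"
    proof cases
      case 1 then show ?thesis using small[of "x - y"] xy h by auto
    next
      case 2
      then have "int p \<le> x + y + 1" using zdvd_imp_le xy by auto
      then show ?thesis using xy h by auto
    qed
  qed
  moreover have "inj_on ?g ?H"
  proof (rule inj_onI)
    fix x y assume xy: "x \<in> ?H" "y \<in> ?H" "?g x = ?g y"
    then have "int p dvd (y - x) * (x + y)" by (simp add: mod_eq_dvd_iff power2_eq_square algebra_simps)
    then consider "int p dvd y - x" | "int p dvd x + y" using pp by blast
    then show "x = y"
    proof cases
      case 1 then show ?thesis using small[of "y - x"] xy h by auto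
    next
      case 2 then have "x + y = 0" using small[of "x + y"] xy h by auto
      then show ?thesis using xy by auto
    qed
  qed
  ultimately have card: "card (?f ` ?H) = h + 1" "card (?g ` ?H) = h + 1" by (simp_all add: card_image)
  have "?f ` ?H \<inter> ?g ` ?H \<noteq> {}"
  proof
    assume "?f ` ?H \<inter> ?g ` ?H = {}"
    then have "card (?f ` ?H \<union> ?g ` ?H) = 2 * h + 2" using card by (subst card_Un_disjoint) auto
    moreover have "?f ` ?H \<union> ?g ` ?H \<subseteq> {0..<int p}" using h by auto
    then have "card (?f ` ?H \<union> ?g ` ?H) \<le> card {0..<int p}" by (rule card_mono[rotated]) simp
    ultimately show False using h by simp
  qed
  then obtain x z where xz: "x \<in> ?H" "z \<in> ?H" "?f x = ?g z" by (auto simp: set_eq_iff)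
  then have "int p dvd hexnorm x 1 + hexnorm z 0" by (simp add: mod_eq_dvd_iff hexnorm_def power2_eq_square algebra_simps)
  then obtain m where m: "hexnorm x 1 + hexnorm z 0 = m * int p" by (metis dvd_def mult.commute)
  have "0 < hexnorm x 1" using hexnorm_eq_0[of x 1] hexnorm_nonneg[of x 1] by (cases "hexnorm x 1 = 0") auto
  then have "0 < m * int p" using m hexnorm_nonneg[of z 0] by linarith
  then have m0: "0 < m" by (simp add: zero_less_mult_iff)
  have "x\<^sup>2 \<le> (int h)\<^sup>2" "z\<^sup>2 \<le> (int h)\<^sup>2" "x \<le> int h" using xz by (auto intro!: power_mono)
  moreover have "hexnorm x 1 = x\<^sup>2 + x + 1" "hexnorm z 0 = z\<^sup>2" by (simp_all add: hexnorm_def)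
  ultimately have "m * int p \<le> 2 * (int h)\<^sup>2 + int h + 1" unfolding m[symmetric] by linarith
  also have "\<dots> < int p * int p"
  proof -
    have "0 < int h * 3 + int h * (int h * 2)" by (intro add_pos_pos mult_pos_pos) (use h1 in auto)
    then show ?thesis by (simp add: h power2_eq_square algebra_simps)
  qed
  finally have "m < int p" using h by simp
  then show ?thesis using m0 m unfolding two_hexnorms_def by metis
qed

lemma two_hexnorms_prime: assumes p: "prime (p::nat)" shows "two_hexnorms (int p)"
proof (cases "odd p")
  case False
  then have "p = 2" using p primes_dvd_imp_eq two_is_prime_nat by blast
  moreover have "two_hexnorms 2" unfolding two_hexnorms_def by (intro exI[of _ 1] exI[of _ 0] exI[of _ 1] exI[of _ 0]) (simp add: hexnorm_def)
  ultimately show ?thesis by simp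
next
  case True
  obtain m where "0 < m \<and> m < int p \<and> two_hexnorms (m * int p)" using two_hexnorms_multiple_of_prime[OF p True] by blast
  then show ?thesis
  proof (induction "nat m" arbitrary: m rule: less_induct)
    case less
    show ?case
    proof (cases "m = 1")
      case True then show ?thesis using less.prems by simp
    next
      case False
      then obtain r where r: "0 < r" "r < m" "two_hexnorms (r * int p)" using two_hexnorms_descent[OF p, of m] less.prems by auto
      then show ?thesis using less.hyps[of r] less.prems by auto
    qed
  qed
qed

theorem all_two_hexnorms: "two_hexnorms (int n)"
proof (induction n rule: less_induct)
  case (less n)
  consider "n = 0" | "n = 1" | "n > 1" by linarith
  then show ?case
  proof cases
    case 1 show ?thesis unfolding two_hexnorms_def by (intro exI[of _ 0]) (simp add: hexnorm_def 1)
  next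
    case 2 show ?thesis unfolding two_hexnorms_def by (intro exI[of _ 1] exI[of _ 0] exI[of _ 0] exI[of _ 0]) (simp add: hexnorm_def 2)
  next
    case 3
    then obtain p where p: "prime p" "p dvd n" using prime_factor_nat[of n] by auto
    then obtain k where k: "n = p * k" by blast
    have "k > 0" using 3 k by (cases k) auto
    then have "1 * k < p * k" using prime_gt_1_nat[OF p(1)] by (intro mult_less_mono1) auto
    then have "k < n" by (simp add: k)
    then have "two_hexnorms (int k)" by (rule less)
    then show ?thesis using two_hexnorms_mult[OF two_hexnorms_prime[OF p(1)], of "int k"] by (simp add: k)
  qed
qed

section \<open>Hyperbolic kernels and Lambert series\<close>

text \<open>
  Up to a factor 2, the hyperbolic sine and cosine of \<open>- k ln x\<close>.
\<close>

definition sh :: "real \<Rightarrow> int \<Rightarrow> real" where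
  "sh x k = x powi (-k) - x powi k"

definition ch :: "real \<Rightarrow> int \<Rightarrow> real" where
  "ch x k = x powi (-k) + x powi k"

abbreviation OddZ :: "int set" where "OddZ \<equiv> {k. odd k}"
abbreviation EvenZ :: "int set" where "EvenZ \<equiv> {k. even k}"
abbreviation OddP :: "int set" where "OddP \<equiv> {k. odd k \<and> k > 0}"

lemma sh_minus [simp]: "sh x (-k) = - sh x k"
  by (simp add: sh_def)

lemma ch_minus [simp]: "ch x (-k) = ch x k"
  by (simp add: ch_def)

lemma powi_add: "0 < x \<Longrightarrow> (x::real) powi (a + b) = x powi a * x powi b"
  by (simp add: power_int_add)

lemma powi_double: "x \<noteq> 0 \<Longrightarrow> (x::real) powi (2 * k) = x powi k * x powi k"
  using power_int_add[of x k k] by simp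

lemma ch_flip: "ch x (a - b) = ch x (b - a)"
  using ch_minus[of x "b - a"] by simp

lemma sh_ch_double: "x \<noteq> 0 \<Longrightarrow> sh x k * ch x k = sh x (2 * k)"
  using powi_double[of x k] powi_double[of x "-k"] by (simp add: sh_def ch_def algebra_simps)

lemma ch_double:
  assumes "x \<noteq> 0" shows "(ch x k)\<^sup>2 + (sh x k)\<^sup>2 = 2 * ch x (2 * k)"
proof -
  have "x powi k * x powi (-k) = 1" using assms by (simp add: power_int_minus)
  then show ?thesis
    using powi_double[of x k] powi_double[of x "-k"] assms by (simp add: sh_def ch_def power2_eq_square algebra_simps)
qed

lemma powi_mult_base: "x \<noteq> 0 \<Longrightarrow> (x ^ n :: real) powi k = x powi (int n * k)"
  by (simp add: power_int_power)

lemma sh_power: "x \<noteq> 0 \<Longrightarrow> sh (x ^ n) k = sh x (int n * k)"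
  by (simp add: sh_def powi_mult_base)

lemma ch_power: "x \<noteq> 0 \<Longrightarrow> ch (x ^ n) k = ch x (int n * k)"
  by (simp add: ch_def powi_mult_base)

lemma ch_pos: "x > 0 \<Longrightarrow> ch x k > 0"
  unfolding ch_def by (intro add_pos_pos) auto

lemma sh_pos: "0 < x \<Longrightarrow> x < 1 \<Longrightarrow> k > 0 \<Longrightarrow> sh x k > 0"
  unfolding sh_def using power_int_strict_decreasing[of "-k" k x] by simp

lemma sh_nonzero: "0 < x \<Longrightarrow> x < 1 \<Longrightarrow> k \<noteq> 0 \<Longrightarrow> sh x k \<noteq> 0"
  using sh_pos[of x k] sh_pos[of x "-k"] by (cases "k > 0") (simp_all del: power_int_minus)

lemma powi_neg_pos: "x > 0 \<Longrightarrow> k \<ge> 0 \<Longrightarrow> (x::real) powi (-k) = 1 / x ^ nat k"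
  by (simp add: power_int_minus_divide power_int_nonneg_exp)

lemma inverse_ch_le:
  assumes "0 < x" "x < 1" shows "1 / ch x k \<le> x ^ nat \<bar>k\<bar>"
proof -
  have *: "1 / ch x k \<le> x ^ nat k" if "k \<ge> 0" for k
  proof -
    have "ch x k \<ge> x powi (-k)" using assms by (simp add: ch_def)
    then have "1 / ch x k \<le> 1 / x powi (-k)"
      using assms by (intro divide_left_mono mult_pos_pos ch_pos) auto
    also have "\<dots> = x ^ nat k" using that assms by (simp add: powi_neg_pos)
    finally show ?thesis .
  qed
  show ?thesis using *[of k] *[of "-k"] by (cases "k \<ge> 0") auto
qed

lemma inverse_sh_le:
  assumes "0 < x" "x < 1" "k \<noteq> 0" shows "\<bar>1 / sh x k\<bar> \<le> x ^ nat \<bar>k\<bar> / (1 - x)"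
proof -
  have *: "\<bar>1 / sh x k\<bar> \<le> x ^ nat k / (1 - x)" if k: "k > 0" for k
  proof -
    have p: "x powi k \<le> x * 1"
      using k assms power_int_decreasing[of 1 k x] by simp
    have "x powi (-k) \<ge> 1" using k assms power_int_decreasing[of "-k" 0 x] by simp
    then have "x powi (-k) * (1 - x) \<le> x powi (-k) - x"
      using assms by (simp add: algebra_simps mult_left_le)
    also have "\<dots> \<le> sh x k" using p by (simp add: sh_def)
    finally have s: "x powi (-k) * (1 - x) \<le> sh x k" .
    have "\<bar>1 / sh x k\<bar> = 1 / sh x k" using sh_pos[of x k] assms k by simp
    also have "\<dots> \<le> 1 / (x powi (-k) * (1 - x))"
      using s assms sh_pos[of x k] k by (intro divide_left_mono mult_pos_pos) auto
    also have "\<dots> = x ^ nat k / (1 - x)" using k assms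
      by (simp add: powi_neg_pos)
    finally show ?thesis .
  qed
  show ?thesis using *[of k] *[of "-k"] assms(3) by (cases "k > 0") auto
qed

lemma coth_bound:
  assumes "0 < x" "x < 1" "k \<noteq> 0" shows "\<bar>ch x k / sh x k\<bar> \<le> 2 / (1 - x)"
proof -
  have *: "ch x k \<le> 2 * x powi (-k)" if k: "k > 0" for k
    using power_int_decreasing[of "-k" k x] assms k by (simp add: ch_def)
  have **: "\<bar>ch x k / sh x k\<bar> \<le> 2 / (1 - x)" if k: "k > 0" for k
  proof -
    have "\<bar>ch x k / sh x k\<bar> = ch x k * \<bar>1 / sh x k\<bar>" using ch_pos[of x k] assms by (simp add: abs_mult)
    also have "\<dots> \<le> (2 * x powi (-k)) * (x ^ nat \<bar>k\<bar> / (1 - x))"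
      using *[OF k] inverse_sh_le[of x k] ch_pos[of x k] k assms by (intro mult_mono) auto
    also have "\<dots> = 2 / (1 - x)" using k assms by (simp add: powi_neg_pos)
    finally show ?thesis .
  qed
  show ?thesis using **[of k] **[of "-k"] assms(3) by (cases "k > 0") auto
qed

lemma geometric_summable_int:
  fixes x :: real assumes "0 < x" "x < 1"
  shows "(\<lambda>k::int. x ^ nat \<bar>k\<bar>) summable_on A"
proof -
  have n: "(\<lambda>n::nat. x ^ n) summable_on UNIV"
    using assms by (intro summable_nonneg_imp_summable_on) (auto intro: summable_geometric)
  have 1: "(\<lambda>k::int. x ^ nat \<bar>k\<bar>) summable_on range int"
    using n by (subst summable_on_reindex) (auto simp: o_def)
  have 2: "(\<lambda>k::int. x ^ nat \<bar>k\<bar>) summable_on range (\<lambda>n. - int n)"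
    using n by (subst summable_on_reindex) (auto simp: o_def inj_on_def)
  have u: "UNIV = range int \<union> range (\<lambda>n. - int n)"
  proof (intro equalityI subsetI)
    fix k :: int
    show "k \<in> range int \<union> range (\<lambda>n. - int n)" by (cases k rule: int_cases2) auto
  qed auto
  have "(\<lambda>k::int. x ^ nat \<bar>k\<bar>) summable_on UNIV"
    unfolding u by (rule summable_on_union[OF 1 2])
  then show ?thesis by (rule summable_on_subset_banach) auto
qed

lemma summable_on_le_geometric:
  fixes f :: "int \<Rightarrow> real"
  assumes "0 < x" "x < 1" "\<And>k. k \<in> A \<Longrightarrow> \<bar>f k\<bar> \<le> c * x ^ nat \<bar>k\<bar>"
  shows "f abs_summable_on A"
  using assms(3) by (intro abs_summable_on_comparison_test'[where g = "\<lambda>k. c * x ^ nat \<bar>k\<bar>"]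
     summable_on_cmult_right geometric_summable_int assms(1,2)) auto

lemma powi_square_le:
  assumes "0 < x" "x < (1::real)" shows "x powi (k\<^sup>2) \<le> x ^ nat \<bar>k\<bar>"
proof -
  have "\<bar>k\<bar> * 1 \<le> \<bar>k\<bar> * \<bar>k\<bar>" if "k \<noteq> 0" using that by (intro mult_left_mono) auto
  then have "\<bar>k\<bar> \<le> k\<^sup>2" by (cases "k = 0") (auto simp: power2_eq_square)
  then show ?thesis using assms
    by (simp add: power_int_nonneg_exp power_decreasing nat_mono)
qed

lemma theta_summable:
  assumes "0 < x" "x < (1::real)" shows "(\<lambda>k. x powi (k\<^sup>2)) abs_summable_on A"
  using powi_square_le[OF assms] assms
  by (intro summable_on_le_geometric[of x _ _ 1]) auto

lemma inverse_ch_summable: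
  assumes "0 < x" "x < (1::real)" shows "(\<lambda>k. 1 / ch x k) abs_summable_on A"
  using inverse_ch_le[OF assms] ch_pos[of x] assms
  by (intro summable_on_le_geometric[of x _ _ 1]) (auto simp: less_imp_le)

lemma inverse_sh_summable:
  assumes "0 < x" "x < (1::real)" "0 \<notin> A" shows "(\<lambda>k. 1 / sh x k) abs_summable_on A"
proof (rule summable_on_le_geometric[OF assms(1,2), of _ _ "1/(1-x)"])
  fix k assume "k \<in> A"
  then have "k \<noteq> 0" using assms(3) by auto
  then show "\<bar>1 / sh x k\<bar> \<le> 1 / (1 - x) * x ^ nat \<bar>k\<bar>"
    using inverse_sh_le[OF assms(1,2)] by simp
qed

lemma abs_summable_on_real: "f abs_summable_on A \<Longrightarrow> (f :: _ \<Rightarrow> real) summable_on A"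
  by (rule abs_summable_summable)

lemma infsum_odd_zero:
  fixes f :: "int \<Rightarrow> real"
  assumes "\<And>k. k \<in> A \<Longrightarrow> -k \<in> A" "\<And>k. k \<in> A \<Longrightarrow> f (-k) = - f k"
  shows "infsum f A = 0"
proof -
  have "infsum f A = infsum (\<lambda>k. f (-k)) A"
    by (rule infsum_reindex_bij_witness[of _ uminus uminus]) (use assms(1) in auto)
  also have "\<dots> = infsum (\<lambda>k. - f k) A" by (rule infsum_cong) (use assms in auto)
  also have "\<dots> = - infsum f A" by (rule infsum_uminus)
  finally show ?thesis by simp
qed

text \<open>
  A Lambert series that is evaluated in two ways: as the square of another Lambert series
  (\<open>Lser_square\<close>) and as a product of theta functions (\<open>U_square\<close>).
\<close>

definition U :: "real \<Rightarrow> real" where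
  "U x = infsum (\<lambda>j. ch x j / (sh x j)\<^sup>2) OddP"

lemma infsum_symmetric:
  fixes f :: "int \<Rightarrow> real"
  assumes A: "A = B \<union> uminus ` B" and B: "\<And>k. k \<in> B \<Longrightarrow> k > 0"
    and s: "f summable_on A" and e: "\<And>k. k \<in> B \<Longrightarrow> f (-k) = f k"
  shows "infsum f A = 2 * infsum f B"
proof -
  have "infsum f A = infsum f B + infsum f (uminus ` B)"
    unfolding A
  proof (rule infsum_Un_disjoint)
    show "f summable_on B" "f summable_on uminus ` B"
      using s by (auto intro: summable_on_subset_banach simp: A)
    show "B \<inter> uminus ` B = {}"
    proof (intro equals0I)
      fix k assume "k \<in> B \<inter> uminus ` B"
      then obtain m where "k \<in> B" "m \<in> B" "k = - m" by auto
      with B[of k] B[of m] show False by simp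
    qed
  qed
  also have "infsum f (uminus ` B) = infsum (\<lambda>k. f (-k)) B"
    by (subst infsum_reindex) (simp_all add: o_def)
  also have "\<dots> = infsum f B" by (rule infsum_cong) (use e in auto)
  finally show ?thesis by simp
qed

lemma OddZ_split: "OddZ = OddP \<union> uminus ` OddP"
proof (intro equalityI subsetI)
  fix k assume k: "k \<in> OddZ"
  then have "k \<noteq> 0" by auto
  with k show "k \<in> OddP \<union> uminus ` OddP"
    by (cases "k > 0") (auto intro!: image_eqI[of _ _ "-k"])
qed auto

lemma infsum_odd_symmetric:
  fixes f :: "int \<Rightarrow> real"
  assumes "f summable_on OddZ" "\<And>k. odd k \<Longrightarrow> f (-k) = f k"
  shows "infsum f OddZ = 2 * infsum f OddP"
  by (rule infsum_symmetric[OF OddZ_split]) (use assms in auto)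

lemma OddP_image: "OddP = range (\<lambda>n. 2 * int n + 1)"
proof (intro equalityI subsetI)
  fix k assume "k \<in> OddP"
  then have "k = 2 * int (nat (k div 2)) + 1" by (auto elim!: oddE)
  then show "k \<in> range (\<lambda>n. 2 * int n + 1)" by blast
qed auto

lemma infsum_OddP: "infsum f OddP = infsum (\<lambda>n::nat. f (2 * int n + 1)) UNIV"
  unfolding OddP_image by (subst infsum_reindex) (auto simp: inj_on_def o_def)

lemma partial_fraction_aux:
  fixes a b n c d :: real
  assumes "a \<noteq> 0" "b \<noteq> 0" "n \<noteq> 0" "c * n = d * a + 2 * b"
  shows "c / (a * b) = d / (n * b) + 2 / (n * a)"
proof -
  have "c / (a * b) = (c * n) / (a * b * n)" using assms(3) by simp
  also have "\<dots> = d / (n * b) + 2 / (n * a)"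
    unfolding assms(4) using assms(1-3) by (simp add: add_divide_distrib mult.commute)
  finally show ?thesis .
qed

text \<open>
  The addition theorem in the form of a partial fraction decomposition: each term on the right has
  \<open>a\<close> or \<open>b\<close> in only one odd factor.
\<close>

lemma hyperbolic_partial_fractions:
  assumes "0 < x" "x < 1" "a \<noteq> 0" "b \<noteq> 0" "a + b \<noteq> 0"
  shows "ch x a / (sh x a * sh x b) = ch x (a+b) / (sh x (a+b) * sh x b) + 2 / (sh x (a+b) * sh x a)"
proof -
  have n: "sh x a \<noteq> 0" "sh x b \<noteq> 0" "sh x (a+b) \<noteq> 0" using assms by (simp_all add: sh_nonzero)
  define u v where "u = x powi a" and "v = x powi b"
  have uv: "u \<noteq> 0" "v \<noteq> 0" "x powi (-a) = 1 / u" "x powi (-b) = 1 / v" "x powi (a+b) = u * v" "x powi (-(a+b)) = 1 / (u * v)"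
    using assms
    by (auto simp: u_def v_def power_int_add power_int_minus_divide simp del: minus_add_distrib)
  have e: "(u' + u) * (u' * v' - u * v) = (u' * v' + u * v) * (u' - u) + 2 * (v' - v)"
    if "u * u' = 1" for u v u' v' :: real
  proof -
    have "(u' + u) * (u' * v' - u * v) = (u' * v' + u * v) * (u' - u) + 2 * (u * u') * (v' - v)" by (simp add: algebra_simps)
    with that show ?thesis by simp
  qed
  have "ch x a * sh x (a+b) = ch x (a+b) * sh x a + 2 * sh x b"
    using e[of u "1 / u" "1 / v" v] uv(1) by (simp del: minus_add_distrib add: sh_def ch_def uv u_def[symmetric] v_def[symmetric])
  from partial_fraction_aux[OF n this] show ?thesis .
qed

lemma product_abs_summable:
  fixes f :: "'a \<Rightarrow> real" and g :: "'b \<Rightarrow> real"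
  assumes "f abs_summable_on A" "g abs_summable_on B"
  shows "(\<lambda>(a, b). f a * g b) abs_summable_on A \<times> B"
  unfolding abs_summable_on_Sigma_iff
proof (intro conjI ballI)
  fix a assume "a \<in> A"
  show "(\<lambda>b. case (a, b) of (a, b) \<Rightarrow> f a * g b) abs_summable_on B"
    using summable_on_cmult_right[OF assms(2), of "\<bar>f a\<bar>"] by (simp add: abs_mult)
next
  have "(\<lambda>a. \<bar>f a\<bar> * (\<Sum>\<^sub>\<infinity>b\<in>B. \<bar>g b\<bar>)) summable_on A"
    using assms(1) by (intro summable_on_cmult_left) auto
  then have "(\<lambda>a. \<Sum>\<^sub>\<infinity>b\<in>B. \<bar>f a * g b\<bar>) summable_on A"
    by (simp add: abs_mult infsum_cmult_right')
  then show "(\<lambda>a. \<Sum>\<^sub>\<infinity>b\<in>B. norm (case (a, b) of (a, b) \<Rightarrow> f a * g b)) abs_summable_on A"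
    by (simp add: infsum_nonneg)
qed

lemma infsum_product:
  fixes f :: "'a \<Rightarrow> real" and g :: "'b \<Rightarrow> real"
  assumes "f abs_summable_on A" "g abs_summable_on B"
  shows "infsum (\<lambda>(a, b). f a * g b) (A \<times> B) = infsum f A * infsum g B"
proof -
  have "infsum (\<lambda>(a, b). f a * g b) (A \<times> B) = infsum (\<lambda>a. infsum (\<lambda>b. f a * g b) B) A"
    using infsum_Sigma_banach[OF abs_summable_on_real[OF product_abs_summable[OF assms]]] by simp
  then show ?thesis by (simp add: infsum_cmult_right' infsum_cmult_left')
qed

lemma infsum_single:
  fixes g :: "'a \<Rightarrow> real"
  assumes "a \<in> A" "\<And>b. b \<in> A \<Longrightarrow> b \<noteq> a \<Longrightarrow> g b = 0" shows "infsum g A = g a"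
  by (rule infsumI, rule has_sum_finite_neutralI[of "{a}"]) (use assms in auto)

lemma coth_csch_summable:
  assumes x: "0 < x" "x < 1" and w: "w abs_summable_on EvenZ"
  shows "(\<lambda>(N,j). w N * (ch x (N-j) / (sh x (N-j) * sh x j))) summable_on EvenZ \<times> OddZ"
proof (rule abs_summable_on_real, rule abs_summable_on_comparison_test)
  have "(\<lambda>j. 2 / (1-x) * (1 / sh x j)) abs_summable_on OddZ"
    using summable_on_cmult_right[OF inverse_sh_summable[OF x, of OddZ], of "2/(1-x)"] x by (simp add: abs_mult)
  from product_abs_summable[OF w this]
  show "(\<lambda>(N,j). w N * (2 / (1-x) * (1 / sh x j))) abs_summable_on EvenZ \<times> OddZ" .
next
  fix p :: "int \<times> int" assume "p \<in> EvenZ \<times> OddZ"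
  then obtain N j where p: "p = (N, j)" "even N" "odd j" by auto
  then have "N - j \<noteq> 0" by auto
  from coth_bound[OF x this]
  have "\<bar>w N\<bar> * (\<bar>ch x (N - j) / sh x (N - j)\<bar> * \<bar>1 / sh x j\<bar>) \<le> \<bar>w N\<bar> * (2 / (1 - x) * \<bar>1 / sh x j\<bar>)"
    by (intro mult_left_mono mult_right_mono) auto
  then show "norm (case p of (N,j) \<Rightarrow> w N * (ch x (N-j) / (sh x (N-j) * sh x j)))
     \<le> norm (case p of (N,j) \<Rightarrow> w N * (2 / (1-x) * (1 / sh x j)))"
    using x by (simp add: p abs_mult)
qed

lemma odd_reflect_sum:
  fixes f :: "int \<Rightarrow> real"
  assumes "even N"
  shows "infsum (\<lambda>j. f (N - j)) OddZ = infsum f OddZ" "(\<lambda>j. f (N - j)) summable_on OddZ \<longleftrightarrow> f summable_on OddZ"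
proof -
  show "infsum (\<lambda>j. f (N - j)) OddZ = infsum f OddZ"
    by (rule infsum_reindex_bij_witness[of _ "\<lambda>j. N - j" "\<lambda>j. N - j"]) (use assms in auto)
  show "(\<lambda>j. f (N - j)) summable_on OddZ \<longleftrightarrow> f summable_on OddZ"
    by (rule summable_on_reindex_bij_witness[of _ "\<lambda>j. N - j" "\<lambda>j. N - j"]) (use assms in auto)
qed

lemma square_sh_summable:
  assumes x: "0 < x" "x < 1"
  shows "(\<lambda>j. ch x j / (sh x j)\<^sup>2) abs_summable_on OddZ"
proof (rule abs_summable_on_comparison_test)
  show "(\<lambda>j. 2 / (1-x) * (1 / sh x j)) abs_summable_on OddZ"
    using summable_on_cmult_right[OF inverse_sh_summable[OF x, of OddZ], of "2/(1-x)"] x by (simp add: abs_mult)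
  fix j :: int assume "j \<in> OddZ" then have j: "j \<noteq> 0" by auto
  have "\<bar>ch x j / sh x j\<bar> * \<bar>1 / sh x j\<bar> \<le> 2 / (1 - x) * \<bar>1 / sh x j\<bar>"
    by (intro mult_right_mono coth_bound x j) auto
  then show "norm (ch x j / (sh x j)\<^sup>2) \<le> norm (2 / (1-x) * (1 / sh x j))"
    using x by (simp add: abs_mult power2_eq_square)
qed

lemma U_twice:
  assumes x: "0 < x" "x < 1"
  shows "infsum (\<lambda>j. ch x j / (sh x j)\<^sup>2) OddZ = 2 * U x"
  unfolding U_def by (rule infsum_odd_symmetric[OF abs_summable_on_real[OF square_sh_summable[OF x]]]) auto

text \<open>
  Only the diagonal \<open>D + j = 0\<close> contributes. For any other value \<open>N\<close> of
  \<open>D + j\<close> the partial fractions leave sums of odd functions over all odd numbers, and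
  these vanish.
\<close>

lemma coth_csch_sum:
  assumes x: "0 < x" "x < 1" and w: "w abs_summable_on EvenZ"
  shows "infsum (\<lambda>(D,j). w (D+j) * (ch x D / (sh x D * sh x j))) (OddZ \<times> OddZ) = - 2 * w 0 * U x"
    and "(\<lambda>(D,j). w (D+j) * (ch x D / (sh x D * sh x j))) summable_on (OddZ \<times> OddZ)"
proof -
  let ?f = "\<lambda>(N,j). w N * (ch x (N-j) / (sh x (N-j) * sh x j))"
  note S = coth_csch_summable[OF assms]
  show "(\<lambda>(D,j). w (D+j) * (ch x D / (sh x D * sh x j))) summable_on (OddZ \<times> OddZ)"
    by (rule iffD1[OF summable_on_reindex_bij_witness[of "EvenZ \<times> OddZ" "\<lambda>(D,j). (D+j,j)" "\<lambda>(N,j). (N-j,j)" "OddZ \<times> OddZ"] S]) auto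
  have "infsum (\<lambda>(D,j). w (D+j) * (ch x D / (sh x D * sh x j))) (OddZ \<times> OddZ) = infsum ?f (EvenZ \<times> OddZ)"
    by (rule infsum_reindex_bij_witness[of _ "\<lambda>(N,j). (N-j,j)" "\<lambda>(D,j). (D+j,j)"]) auto
  also have "\<dots> = infsum (\<lambda>N. infsum (\<lambda>j. w N * (ch x (N-j) / (sh x (N-j) * sh x j))) OddZ) EvenZ"
    using infsum_Sigma_banach[OF S] by simp
  also have "\<dots> = infsum (\<lambda>j. w 0 * (ch x (0-j) / (sh x (0-j) * sh x j))) OddZ"
  proof (rule infsum_single)
    fix N :: int assume N: "N \<in> EvenZ" "N \<noteq> 0"
    have s1: "(\<lambda>j. ch x N / sh x N * (1 / sh x j)) summable_on OddZ"
      by (rule summable_on_cmult_right[OF abs_summable_on_real[OF inverse_sh_summable[OF x]]]) auto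
    have s2: "(\<lambda>j. 2 / sh x N * (1 / sh x (N - j))) summable_on OddZ"
      using N odd_reflect_sum(2)[of N "\<lambda>j. 1 / sh x j"]
        abs_summable_on_real[OF inverse_sh_summable[OF x, of OddZ]]
      by (intro summable_on_cmult_right) auto
    have z: "infsum (\<lambda>j. 1 / sh x j) OddZ = 0" by (rule infsum_odd_zero) auto
    have "infsum (\<lambda>j. ch x (N-j) / (sh x (N-j) * sh x j)) OddZ
        = infsum (\<lambda>j. ch x N / sh x N * (1 / sh x j) + 2 / sh x N * (1 / sh x (N - j))) OddZ"
    proof (rule infsum_cong)
      fix j :: int assume "j \<in> OddZ"
      then have "j \<noteq> 0" "N - j \<noteq> 0" using N by auto
      with hyperbolic_partial_fractions[OF x, of "N-j" j] N
      show "ch x (N-j) / (sh x (N-j) * sh x j) = ch x N / sh x N * (1 / sh x j) + 2 / sh x N * (1 / sh x (N - j))"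
        by simp
    qed
    also have "\<dots> = ch x N / sh x N * infsum (\<lambda>j. 1 / sh x j) OddZ + 2 / sh x N * infsum (\<lambda>j. 1 / sh x (N - j)) OddZ"
      by (subst infsum_add[OF s1 s2]) (simp only: infsum_cmult_right')
    also have "\<dots> = 0" using odd_reflect_sum(1)[of N "\<lambda>j. 1 / sh x j"] N z by simp
    finally show "infsum (\<lambda>j. w N * (ch x (N-j) / (sh x (N-j) * sh x j))) OddZ = 0"
      by (simp only: infsum_cmult_right')
  qed simp
  also have "\<dots> = - w 0 * infsum (\<lambda>j. ch x j / (sh x j)\<^sup>2) OddZ"
    by (subst infsum_cmult_right' [symmetric], rule infsum_cong) (simp add: power2_eq_square)
  also have "\<dots> = - 2 * w 0 * U x" by (simp add: U_twice[OF x])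
  finally show "infsum (\<lambda>(D,j). w (D+j) * (ch x D / (sh x D * sh x j))) (OddZ \<times> OddZ) = - 2 * w 0 * U x" .
qed

section \<open>Products of Lambert series\<close>

text \<open>
  By \<open>Lser_theta_product\<close> this series counts sums of the square of a positive odd and
  the square of an even number.
\<close>

definition Lser :: "real \<Rightarrow> real" where
  "Lser x = infsum (\<lambda>d. 1 / ch x d) OddP"

lemma Lser_twice:
  assumes x: "0 < x" "x < 1"
  shows "infsum (\<lambda>d. 1 / ch x d) OddZ = 2 * Lser x"
  unfolding Lser_def by (rule infsum_odd_symmetric[OF abs_summable_on_real[OF inverse_ch_summable[OF x]]]) auto

lemma card_odd_below: "card {b::int. odd b \<and> 0 < b \<and> b < 2 * int M} = M"
proof -
  have "{b::int. odd b \<and> 0 < b \<and> b < 2 * int M} = (\<lambda>i. 2 * int i + 1) ` {..<M}"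
  proof (intro equalityI subsetI)
    fix b assume "b \<in> {b::int. odd b \<and> 0 < b \<and> b < 2 * int M}"
    then have "b = 2 * int (nat ((b-1) div 2)) + 1" "nat ((b-1) div 2) < M" by (auto elim!: oddE)
    then show "b \<in> (\<lambda>i. 2 * int i + 1) ` {..<M}" by blast
  qed auto
  then show ?thesis by (simp add: card_image inj_on_def)
qed

lemma tanh_sum:
  assumes x: "0 < x" "x < 1" and N: "even N" "N > 0"
  shows "infsum (\<lambda>b. sh x b / ch x b + sh x (N-b) / ch x (N-b)) OddZ = of_int N"
proof -
  define eps where "eps = (\<lambda>b. of_int (sgn b) - sh x b / ch x b)"
  have eps_minus: "eps (-b) = - eps b" for b by (simp add: eps_def sgn_minus)
  have eps_pos: "eps b = 2 * x ^ nat b * (1 / ch x b)" if "b > 0" for b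
  proof -
    have "1 - sh x b / ch x b = (ch x b - sh x b) / ch x b" using ch_pos[of x b] x by (simp add: diff_divide_distrib)
    also have "ch x b - sh x b = 2 * x ^ nat b" using that by (simp add: ch_def sh_def power_int_nonneg_exp)
    finally show ?thesis using that by (simp add: eps_def)
  qed
  have eps_le1: "\<bar>eps b\<bar> \<le> 2 * x ^ nat \<bar>b\<bar>" if "b > 0" for b
  proof -
    have "1 / ch x b \<le> 1" using inverse_ch_le[OF x, of b] power_le_one[of x "nat \<bar>b\<bar>"] x by linarith
    then have "2 * x ^ nat b * (1 / ch x b) \<le> 2 * x ^ nat b * 1" using x by (intro mult_left_mono) auto
    then show ?thesis using that ch_pos[of x b] x by (simp add: eps_pos)
  qed
  have "\<bar>eps b\<bar> \<le> 2 * x ^ nat \<bar>b\<bar>" if "b \<in> OddZ" for b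
    using eps_le1[of b] eps_le1[of "-b"] that by (cases b "0::int" rule: linorder_cases) (auto simp: eps_minus)
  then have se: "eps summable_on OddZ"
    by (rule abs_summable_on_real[OF summable_on_le_geometric[OF x]])
  have se': "(\<lambda>b. eps (N - b)) summable_on OddZ" using se odd_reflect_sum(2)[OF N(1)] by blast
  have ze: "infsum eps OddZ = 0" by (rule infsum_odd_zero) (auto simp: eps_minus)
  have z: "infsum (\<lambda>b. eps b + eps (N - b)) OddZ = 0"
    by (subst infsum_add[OF se se']) (simp add: odd_reflect_sum(1)[OF N(1)] ze)
  have zs: "(\<lambda>b. eps b + eps (N - b)) summable_on OddZ" by (rule summable_on_add[OF se se'])
  let ?s = "\<lambda>b. of_int (sgn b + sgn (N - b)) :: real"
  let ?B = "{b::int. odd b \<and> 0 < b \<and> b < N}"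
  obtain M where M: "N = 2 * int M" using N
  proof -
    from N obtain k where "N = 2 * k" "k > 0" by (auto elim!: evenE)
    then show thesis using that[of "nat k"] by simp
  qed
  have fB: "finite ?B" by (rule finite_subset[of _ "{0..N}"]) auto
  have hs: "(?s has_sum (\<Sum>b\<in>?B. 2)) OddZ"
  proof (rule has_sum_finite_neutralI[OF fB])
    show "?s b = 0" if "b \<in> OddZ - ?B" for b using that N by (auto simp: sgn_if)
    show "(\<Sum>b\<in>?B. 2) = sum ?s ?B" by (rule sum.cong) auto
  qed auto
  have "infsum (\<lambda>b. sh x b / ch x b + sh x (N-b) / ch x (N-b)) OddZ = infsum (\<lambda>b. ?s b + - (eps b + eps (N - b))) OddZ"
    by (rule infsum_cong) (simp add: eps_def)
  also have "\<dots> = infsum ?s OddZ + infsum (\<lambda>b. - (eps b + eps (N - b))) OddZ"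
    by (rule infsum_add[OF has_sum_imp_summable[OF hs]]) (simp only: summable_on_uminus zs)
  also have "\<dots> = of_int N"
    unfolding infsum_uminus z infsumI[OF hs] using card_odd_below[of M] by (simp add: M)
  finally show ?thesis .
qed

lemma sech_product:
  assumes x: "0 < x" "x < 1" and "a + b \<noteq> 0"
  shows "1 / (ch x a * ch x b) = (sh x a / ch x a + sh x b / ch x b) / (2 * sh x (a + b))"
proof -
  have c: "ch x a > 0" "ch x b > 0" using ch_pos x by auto
  have s: "sh x (a+b) \<noteq> 0" using sh_nonzero x assms(3) by auto
  have uv: "x powi (a+b) = x powi a * x powi b" "x powi (-(a+b)) = x powi (-a) * x powi (-b)"
    using x power_int_add[of x a b] power_int_add[of x "-a" "-b"] by auto
  have "sh x a * ch x b + sh x b * ch x a = 2 * sh x (a+b)"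
    unfolding sh_def ch_def uv by (simp add: algebra_simps)
  then have "sh x a / ch x a + sh x b / ch x b = 2 * sh x (a+b) / (ch x a * ch x b)"
    using c by (simp add: add_frac_eq mult.commute)
  then show ?thesis using s by simp
qed

lemma sech_inner_sum:
  assumes x: "0 < x" "x < 1" and N: "even N" "N \<noteq> 0"
  shows "infsum (\<lambda>b. 1 / (ch x (N-b) * ch x b)) OddZ = of_int N / (2 * sh x N)"
proof -
  have pos: "infsum (\<lambda>b. 1 / (ch x (N-b) * ch x b)) OddZ = of_int N / (2 * sh x N)" if N: "even N" "N > 0" for N
  proof -
    have "infsum (\<lambda>b. 1 / (ch x (N-b) * ch x b)) OddZ
      = infsum (\<lambda>b. (sh x b / ch x b + sh x (N-b) / ch x (N-b)) * (1 / (2 * sh x N))) OddZ"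
      by (rule infsum_cong) (use N sech_product[OF x, of "N-_" _] in \<open>simp add: add.commute\<close>)
    then show ?thesis by (simp only: infsum_cmult_left' tanh_sum[OF x N]) simp
  qed
  show ?thesis
  proof (cases "N > 0")
    case False
    then have M: "even (-N)" "-N > 0" using N by auto
    have "infsum (\<lambda>b. 1 / (ch x (N-b) * ch x b)) OddZ = infsum (\<lambda>b. 1 / (ch x (-N-b) * ch x b)) OddZ"
      by (rule infsum_reindex_bij_witness[of _ uminus uminus]) (auto simp: ch_flip[of x _ N])
    also have "\<dots> = of_int N / (2 * sh x N)" by (subst pos[OF M]) simp
    finally show ?thesis .
  qed (use pos N in auto)
qed

lemma has_sum_odd_powers:
  fixes y :: real assumes "0 < y" "y < 1"
  shows "((\<lambda>n::nat. y ^ (2 * n + 1)) has_sum (y / (1 - y\<^sup>2))) UNIV"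
proof -
  have "(\<lambda>n. (y\<^sup>2) ^ n) sums (1 / (1 - y\<^sup>2))" using assms by (intro geometric_sums) (simp add: power_less_one_iff abs_square_less_1)
  then have "(\<lambda>n. y * (y\<^sup>2) ^ n) sums (y * (1 / (1 - y\<^sup>2)))" by (rule sums_mult)
  then show ?thesis using assms by (intro sums_nonneg_imp_has_sum) (simp_all add: power_mult)
qed

lemma has_sum_derived_geometric:
  fixes z :: real assumes "0 < z" "z < 1"
  shows "((\<lambda>M::nat. of_nat (Suc M) * z ^ Suc M) has_sum (z / (1 - z)\<^sup>2)) UNIV"
proof -
  have "(\<lambda>M. z * (of_nat (Suc M) * z ^ M)) sums (z * (1 / (1 - z)\<^sup>2))"
    using assms by (intro sums_mult geometric_deriv_sums) auto
  then show ?thesis using assms by (intro sums_nonneg_imp_has_sum) (simp_all add: mult.left_commute)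
qed

lemma inverse_sh_alt:
  assumes "0 < x" "x < 1" "n > 0"
  shows "1 / sh x (int n) = x ^ n / (1 - (x ^ n)\<^sup>2)"
  using assms by (simp add: sh_def powi_neg_pos power2_eq_square divide_simps)

lemma lambert_swap:
  assumes x: "0 < x" "x < 1" and s: "(\<lambda>M::nat. real (Suc M) * (1 / sh x (int (2 * Suc M)))) summable_on UNIV"
  shows "infsum (\<lambda>M::nat. real (Suc M) * (1 / sh x (int (2 * Suc M)))) UNIV = infsum (\<lambda>d. 1 / (sh x d)\<^sup>2) OddP"
proof -
  let ?f = "\<lambda>M n. real (Suc M) * x ^ (2 * Suc M * (2 * n + 1))"
  have i1: "((\<lambda>n. ?f M n) has_sum (real (Suc M) * (1 / sh x (int (2 * Suc M))))) UNIV" for M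
  proof -
    have "0 < x ^ (2 * Suc M)" "x ^ (2 * Suc M) < 1" using x by (auto intro: power_less_one_iff[THEN iffD2] simp del: power_Suc)
    from has_sum_cmult_right[OF has_sum_odd_powers[OF this], of "real (Suc M)"]
    show ?thesis using x by (subst inverse_sh_alt) (simp_all only: power_mult, simp)
  qed
  have i2: "((\<lambda>M. ?f M n) has_sum (1 / (sh x (2 * int n + 1))\<^sup>2)) UNIV" for n
  proof -
    have b: "0 < x ^ (2 * (2 * n + 1))" "x ^ (2 * (2 * n + 1)) < 1" using x by (auto intro: power_less_one_iff[THEN iffD2] simp del: power_Suc)
    have "(1 / sh x (int m))\<^sup>2 = x ^ (2 * m) / (1 - x ^ (2 * m))\<^sup>2" if "m > 0" for m
      using x that by (subst inverse_sh_alt) (simp_all add: power_divide power_mult [symmetric] mult.commute)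
    from this[of "2 * n + 1"]
    have "(1 / sh x (int (2 * n + 1)))\<^sup>2 = x ^ (2 * (2 * n + 1)) / (1 - x ^ (2 * (2 * n + 1)))\<^sup>2"
      by simp
    then have e: "1 / (sh x (2 * int n + 1))\<^sup>2 = x ^ (2 * (2 * n + 1)) / (1 - x ^ (2 * (2 * n + 1)))\<^sup>2"
      by (simp add: power_divide add.commute)
    have "?f M n = real (Suc M) * (x ^ (2 * (2 * n + 1))) ^ Suc M" for M
      by (simp only: power_mult [symmetric] mult.assoc) (simp add: mult.commute mult.left_commute)
    then show ?thesis by (simp only: e has_sum_derived_geometric[OF b])
  qed
  have S: "(\<lambda>(M,n). ?f M n) summable_on UNIV \<times> UNIV"
    by (rule summable_on_SigmaI[where g = "\<lambda>M. real (Suc M) * (1 / sh x (int (2 * Suc M)))"]) (use i1 s x in auto)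
  have "infsum (\<lambda>M::nat. real (Suc M) * (1 / sh x (int (2 * Suc M)))) UNIV = infsum (\<lambda>M. infsum (\<lambda>n. ?f M n) UNIV) UNIV"
    by (rule infsum_cong) (use infsumI[OF i1] in simp)
  also have "\<dots> = infsum (\<lambda>n. infsum (\<lambda>M. ?f M n) UNIV) UNIV"
    by (rule infsum_swap_banach[OF S])
  also have "\<dots> = infsum (\<lambda>n. 1 / (sh x (2 * int n + 1))\<^sup>2) UNIV"
    by (rule infsum_cong) (use infsumI[OF i2] in simp)
  finally show ?thesis by (simp only: infsum_OddP)
qed

definition EvenP :: "int set" where "EvenP = {k. even k \<and> k > 0}"

lemma EvenP_image: "EvenP = range (\<lambda>n. int (2 * Suc n))"
proof (intro equalityI subsetI)
  fix k assume "k \<in> EvenP"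
  then obtain m where "k = 2 * m" "m > 0" by (auto simp: EvenP_def elim!: evenE)
  then have "k = int (2 * Suc (nat (m - 1)))" by simp
  then show "k \<in> range (\<lambda>n. int (2 * Suc n))" by blast
qed (auto simp: EvenP_def)

lemma EvenZ_split: "EvenZ - {0} = EvenP \<union> uminus ` EvenP"
proof (intro equalityI subsetI)
  fix k assume k: "k \<in> EvenZ - {0}"
  then show "k \<in> EvenP \<union> uminus ` EvenP"
    by (cases "k > 0") (auto simp: EvenP_def intro!: image_eqI[of _ _ "-k"])
qed (auto simp: EvenP_def)

text \<open>
  The square is grouped by the sum \<open>N\<close> of the two indices. The inner sums are
  evaluated by \<open>sech_inner_sum\<close>, and \<open>lambert_swap\<close> rearranges the
  resulting double series.
\<close>

lemma Lser_square:
  assumes x: "0 < x" "x < 1"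
  shows "(Lser x)\<^sup>2 = U (x\<^sup>2)"
proof -
  have Sp: "(\<lambda>(a,b). 1 / ch x a * (1 / ch x b)) summable_on OddZ \<times> OddZ"
    by (rule abs_summable_on_real[OF product_abs_summable[OF inverse_ch_summable[OF x] inverse_ch_summable[OF x]]])
  have S: "(\<lambda>(N,b). 1 / (ch x (N-b) * ch x b)) summable_on EvenZ \<times> OddZ"
    by (rule iffD1[OF summable_on_reindex_bij_witness[of "OddZ \<times> OddZ" "\<lambda>(N,b). (N-b,b)" "\<lambda>(D,j). (D+j,j)" "EvenZ \<times> OddZ"] Sp]) auto
  define g where "g N = infsum (\<lambda>b. 1 / (ch x (N-b) * ch x b)) OddZ" for N
  have g0: "g N = of_int N / (2 * sh x N)" if "even N" "N \<noteq> 0" for N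
    unfolding g_def by (rule sech_inner_sum[OF x that])
  have gs: "g summable_on EvenZ"
    using summable_on_Sigma_banach[OF S] unfolding g_def .
  have ss: "(\<lambda>d. 1 / (sh x d)\<^sup>2) summable_on OddP"
  proof (rule abs_summable_on_real, rule abs_summable_on_comparison_test)
    show "(\<lambda>j. 1 / (1-x) * (1 / sh x j)) abs_summable_on OddP"
      using summable_on_cmult_right[OF inverse_sh_summable[OF x, of OddP], of "1/(1-x)"] x by (simp add: abs_mult)
    fix j :: int assume "j \<in> OddP" then have j: "j \<noteq> 0" by auto
    have "x ^ nat \<bar>j\<bar> / (1 - x) \<le> 1 / (1 - x)" using x by (intro divide_right_mono power_le_one) auto
    with inverse_sh_le[OF x j] have "\<bar>1 / sh x j\<bar> \<le> 1 / (1 - x)" by linarith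
    then have "\<bar>1 / sh x j\<bar> * \<bar>1 / sh x j\<bar> \<le> 1 / (1 - x) * \<bar>1 / sh x j\<bar>" by (intro mult_right_mono) auto
    then show "norm (1 / (sh x j)\<^sup>2) \<le> norm (1 / (1-x) * (1 / sh x j))"
      using x by (simp add: abs_mult power2_eq_square)
  qed
  have cs': "(\<lambda>d. 1 / (ch x d)\<^sup>2) summable_on OddZ"
  proof (rule abs_summable_on_real, rule abs_summable_on_comparison_test)
    show "(\<lambda>j. 1 / ch x j) abs_summable_on OddZ" by (rule inverse_ch_summable[OF x])
    fix j :: int
    have "x ^ nat \<bar>j\<bar> \<le> 1" using x by (intro power_le_one) auto
    then have "1 / ch x j \<le> 1" using inverse_ch_le[OF x, of j] by linarith
    then have "\<bar>1 / ch x j\<bar> \<le> 1" using ch_pos[of x j] x by simp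
    then have "\<bar>1 / ch x j\<bar> * \<bar>1 / ch x j\<bar> \<le> 1 * \<bar>1 / ch x j\<bar>" by (intro mult_right_mono) auto
    then show "norm (1 / (ch x j)\<^sup>2) \<le> norm (1 / ch x j)"
      by (simp add: abs_mult power2_eq_square)
  qed
  then have cs: "(\<lambda>d. 1 / (ch x d)\<^sup>2) summable_on OddP" by (rule summable_on_subset_banach) auto
  have ins: "EvenZ = insert 0 (EvenZ - {0})" by auto
  have gs': "g summable_on (EvenZ - {0})" using gs by (rule summable_on_subset_banach) auto
  have g_even: "g (-k) = g k" if "k \<in> EvenP" for k using that by (subst (1 2) g0) (auto simp: EvenP_def)
  have gP: "infsum g (EvenZ - {0}) = 2 * infsum g EvenP"
    by (rule infsum_symmetric[OF EvenZ_split _ gs' g_even]) (auto simp: EvenP_def)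
  have gM: "g (int (2 * Suc M)) = real (Suc M) * (1 / sh x (int (2 * Suc M)))" for M
    by (subst g0) (auto simp: add_divide_distrib)
  have "infsum g EvenP = infsum (\<lambda>M::nat. real (Suc M) * (1 / sh x (int (2 * Suc M)))) UNIV"
    unfolding EvenP_image by (subst infsum_reindex) (simp_all only: o_def gM, auto simp: inj_on_def)
  moreover have "(\<lambda>M::nat. real (Suc M) * (1 / sh x (int (2 * Suc M)))) summable_on UNIV"
  proof -
    have "g summable_on range (\<lambda>n. int (2 * Suc n))"
      using gs by (rule summable_on_subset_banach) auto
    then show ?thesis by (subst (asm) summable_on_reindex) (simp_all only: o_def gM, auto simp: inj_on_def)
  qed
  ultimately have gE: "infsum g EvenP = infsum (\<lambda>d. 1 / (sh x d)\<^sup>2) OddP" using lambert_swap[OF x] by simp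
  have g00: "g 0 = 2 * infsum (\<lambda>d. 1 / (ch x d)\<^sup>2) OddP"
    unfolding g_def by (subst infsum_odd_symmetric[symmetric, OF cs']) (simp_all add: power2_eq_square)
  have "(2 * Lser x)\<^sup>2 = infsum (\<lambda>(a,b). 1 / ch x a * (1 / ch x b)) (OddZ \<times> OddZ)"
    by (subst infsum_product[OF inverse_ch_summable[OF x] inverse_ch_summable[OF x]]) (simp only: Lser_twice[OF x] power2_eq_square)
  also have "\<dots> = infsum (\<lambda>(N,b). 1 / (ch x (N-b) * ch x b)) (EvenZ \<times> OddZ)"
    by (rule infsum_reindex_bij_witness[of _ "\<lambda>(N,b). (N-b,b)" "\<lambda>(D,j). (D+j,j)"]) auto
  also have "\<dots> = infsum g EvenZ"
    unfolding g_def using infsum_Sigma_banach[OF S, symmetric] by simp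
  also have "\<dots> = g 0 + infsum g (EvenZ - {0})"
    by (subst ins, rule infsum_insert[OF gs']) auto
  also have "\<dots> = 2 * (infsum (\<lambda>d. 1 / (ch x d)\<^sup>2) OddP + infsum (\<lambda>d. 1 / (sh x d)\<^sup>2) OddP)"
    by (simp add: g00 gP gE)
  also have "infsum (\<lambda>d. 1 / (ch x d)\<^sup>2) OddP + infsum (\<lambda>d. 1 / (sh x d)\<^sup>2) OddP
     = infsum (\<lambda>d. 1 / (ch x d)\<^sup>2 + 1 / (sh x d)\<^sup>2) OddP"
    by (rule infsum_add[symmetric, OF cs ss])
  also have "\<dots> = infsum (\<lambda>d. 2 * (ch (x\<^sup>2) d / (sh (x\<^sup>2) d)\<^sup>2)) OddP"
  proof (rule infsum_cong)
    fix d :: int assume "d \<in> OddP"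
    then have nz: "sh x d \<noteq> 0" "ch x d \<noteq> 0" using sh_nonzero[OF x, of d] ch_pos[of x d] x by auto
    have "1 / (ch x d)\<^sup>2 + 1 / (sh x d)\<^sup>2 = ((ch x d)\<^sup>2 + (sh x d)\<^sup>2) / (sh x d * ch x d)\<^sup>2"
      using nz by (simp add: field_simps)
    also have "\<dots> = 2 * (ch (x\<^sup>2) d / (sh (x\<^sup>2) d)\<^sup>2)"
      using x by (simp add: ch_double sh_ch_double sh_power ch_power)
    finally show "1 / (ch x d)\<^sup>2 + 1 / (sh x d)\<^sup>2 = 2 * (ch (x\<^sup>2) d / (sh (x\<^sup>2) d)\<^sup>2)" .
  qed
  also have "\<dots> = 2 * U (x\<^sup>2)" unfolding U_def by (rule infsum_cmult_right')
  finally show ?thesis by (simp add: power_mult_distrib)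
qed

section \<open>Two squares\<close>

definition thE :: "real \<Rightarrow> real" where "thE x = infsum (\<lambda>k. x powi (k\<^sup>2)) EvenZ"
definition thO :: "real \<Rightarrow> real" where "thO x = infsum (\<lambda>k. x powi (k\<^sup>2)) OddZ"
definition ph :: "real \<Rightarrow> real" where "ph x = infsum (\<lambda>k::int. x powi (k\<^sup>2)) UNIV"
definition E0 :: "real \<Rightarrow> real" where "E0 x = infsum (\<lambda>j. 1 / ch x j) UNIV"

lemma parity_UNIV: "(UNIV :: int set) = EvenZ \<union> OddZ" by auto

lemma infsum_parity:
  fixes f :: "int \<Rightarrow> real"
  assumes "f summable_on UNIV"
  shows "infsum f UNIV = infsum f EvenZ + infsum f OddZ"
proof -
  have "f summable_on EvenZ" "f summable_on OddZ" using assms by (auto intro: summable_on_subset_banach)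
  from infsum_Un_disjoint[OF this] have "infsum f (EvenZ \<union> OddZ) = infsum f EvenZ + infsum f OddZ" by auto
  then show ?thesis using parity_UNIV by simp
qed

lemma infsum_Even: "infsum f EvenZ = infsum (\<lambda>j. f (2 * j)) (UNIV :: int set)"
  by (rule infsum_reindex_bij_witness[of _ "\<lambda>j. 2 * j" "\<lambda>j. j div 2"]) auto

lemma ph_split: assumes x: "0 < x" "x < 1" shows "ph x = thE x + thO x"
  unfolding ph_def thE_def thO_def by (rule infsum_parity[OF abs_summable_on_real[OF theta_summable[OF x]]])

lemma thE_ph: assumes x: "0 < x" "x < 1" shows "thE x = ph (x ^ 4)"
  unfolding ph_def thE_def using x by (simp add: infsum_Even powi_mult_base power_mult_distrib)

lemma two_dim_powi: "0 < x \<Longrightarrow> x powi (a\<^sup>2 + b\<^sup>2) = x powi (a\<^sup>2) * x powi ((b::int)\<^sup>2)" for x :: real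
  by (simp add: power_int_add)

lemma theta_product:
  fixes x :: real
  assumes x: "0 < x" "x < 1"
  shows "infsum (\<lambda>(a,b). x powi (a\<^sup>2 + b\<^sup>2)) (A \<times> B) = infsum (\<lambda>k. x powi (k\<^sup>2)) A * infsum (\<lambda>k. x powi (k\<^sup>2)) B"
    "(\<lambda>(a,b). x powi (a\<^sup>2 + b\<^sup>2)) summable_on (A \<times> B)"
  using infsum_product[OF theta_summable[OF x] theta_summable[OF x], of A B] x
    abs_summable_on_real[OF product_abs_summable[OF theta_summable[OF x] theta_summable[OF x], of A B]]
  by (auto simp: two_dim_powi)

lemma half_sum:
  fixes a b :: int assumes "even a = even b"
  shows "(a + b) div 2 + (a - b) div 2 = a" "(a + b) div 2 - (a - b) div 2 = b"
  using assms by presburger+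

lemma theta_rotate:
  fixes x :: real
  assumes x: "0 < x" "x < 1"
  shows "infsum (\<lambda>(a,b). x powi (a\<^sup>2 + b\<^sup>2)) {(a,b). even (a + b) \<and> P ((a + b) div 2) ((a - b) div 2)}
       = infsum (\<lambda>(u,v). (x\<^sup>2) powi (u\<^sup>2 + v\<^sup>2)) {(u,v). P u v}"
proof (rule infsum_reindex_bij_witness[of _ "\<lambda>(u,v). (u+v,u-v)" "\<lambda>(a,b). ((a+b) div 2, (a-b) div 2)"])
  fix p assume "p \<in> {(a,b). even (a + b) \<and> P ((a + b) div 2) ((a - b) div 2)}"
  then obtain a b where p: "p = (a, b)" "even (a + b)" by auto
  define u v where "u = (a + b) div 2" "v = (a - b) div 2"
  have ab: "a = u + v" "b = u - v" using p(2) unfolding u_v_def by presburger+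
  have "x powi (a\<^sup>2 + b\<^sup>2) = x powi (2 * (u\<^sup>2 + v\<^sup>2))" by (simp add: ab power2_sum power2_diff algebra_simps)
  then show "(case (case p of (a,b) \<Rightarrow> ((a+b) div 2, (a-b) div 2)) of (u,v) \<Rightarrow> (x\<^sup>2) powi (u\<^sup>2 + v\<^sup>2)) = (case p of (a,b) \<Rightarrow> x powi (a\<^sup>2 + b\<^sup>2))"
    using x by (simp add: p u_v_def[symmetric] powi_mult_base)
qed (auto simp: half_sum)

lemma ph_square: assumes x: "0 < x" "x < 1" shows "(ph x)\<^sup>2 = (ph (x\<^sup>2))\<^sup>2 + 2 * thE x * thO x"
proof -
  have x2: "0 < x\<^sup>2" "x\<^sup>2 < 1" using x by (auto simp: power_less_one_iff abs_square_less_1)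
  have "(ph (x\<^sup>2))\<^sup>2 = infsum (\<lambda>(u,v). (x\<^sup>2) powi (u\<^sup>2 + v\<^sup>2)) (UNIV \<times> UNIV)"
    unfolding ph_def by (subst theta_product[OF x2]) (simp add: power2_eq_square)
  also have "\<dots> = infsum (\<lambda>(a,b). x powi (a\<^sup>2 + b\<^sup>2)) (EvenZ \<times> EvenZ \<union> OddZ \<times> OddZ)"
  proof -
    have "{(a,b). even (a + b) \<and> True} = EvenZ \<times> EvenZ \<union> OddZ \<times> OddZ" "{(u::int,v::int). True} = UNIV \<times> UNIV" by auto
    with theta_rotate[OF x, of "\<lambda>_ _. True"] show ?thesis by simp
  qed
  also have "\<dots> = thE x * thE x + thO x * thO x"
    unfolding thE_def thO_def
    by (subst infsum_Un_disjoint[OF theta_product(2)[OF x] theta_product(2)[OF x]]) (auto simp: theta_product[OF x])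
  finally show ?thesis by (simp add: ph_split[OF x] power2_eq_square algebra_simps)
qed

lemma thO_square: assumes x: "0 < x" "x < 1" shows "(thO x)\<^sup>2 = 2 * thO (x\<^sup>2) * thE (x\<^sup>2)"
proof -
  have x2: "0 < x\<^sup>2" "x\<^sup>2 < 1" using x by (auto simp: power_less_one_iff abs_square_less_1)
  have s: "{(a, b). even (a + b) \<and> odd ((a + b) div 2 + (a - b) div 2)} = OddZ \<times> OddZ"
  proof -
    have "odd ((a + b) div 2 + (a - b) div 2) \<longleftrightarrow> odd a" if "even (a + b)" for a b :: int
    proof -
      have "(a + b) div 2 + (a - b) div 2 = a" using that by presburger
      then show ?thesis by simp
    qed
    then show ?thesis by auto
  qed
  have "(thO x)\<^sup>2 = infsum (\<lambda>(a,b). x powi (a\<^sup>2 + b\<^sup>2)) (OddZ \<times> OddZ)"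
    unfolding thO_def by (subst theta_product[OF x]) (simp add: power2_eq_square)
  also have "\<dots> = infsum (\<lambda>(u,v). (x\<^sup>2) powi (u\<^sup>2 + v\<^sup>2)) {(u,v). odd (u + v)}"
    using theta_rotate[OF x, of "\<lambda>u v. odd (u + v)"] unfolding s by simp
  also have "{(u,v). odd (u + v)} = OddZ \<times> EvenZ \<union> EvenZ \<times> OddZ" by auto
  also have "infsum (\<lambda>(u,v). (x\<^sup>2) powi (u\<^sup>2 + v\<^sup>2)) \<dots> = thO (x\<^sup>2) * thE (x\<^sup>2) + thE (x\<^sup>2) * thO (x\<^sup>2)"
    unfolding thE_def thO_def
    by (subst infsum_Un_disjoint[OF theta_product(2)[OF x2] theta_product(2)[OF x2]]) (auto simp: theta_product[OF x2])
  finally show ?thesis by simp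
qed

lemma E0_recursion: assumes x: "0 < x" "x < 1" shows "E0 x = E0 (x\<^sup>2) + 2 * Lser x"
proof -
  have "E0 x = infsum (\<lambda>j. 1 / ch x j) EvenZ + infsum (\<lambda>j. 1 / ch x j) OddZ"
    unfolding E0_def by (rule infsum_parity[OF abs_summable_on_real[OF inverse_ch_summable[OF x]]])
  then show ?thesis using x by (simp add: Lser_twice infsum_Even E0_def ch_power)
qed

lemma alternating_geometric:
  assumes x: "0 < x"
  shows "(\<Sum>i<m. (-1) ^ i * x powi (c * (2 * int i + 1 - int m))) * ch x c = x powi (-(c * int m)) - (-1) ^ m * x powi (c * int m)"
proof -
  let ?g = "\<lambda>i. (-1) ^ i * x powi (c * (2 * int i - int m))"
  have "(-1) ^ i * x powi (c * (2 * int i + 1 - int m)) * ch x c = ?g i - ?g (Suc i)" for i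
  proof -
    have a: "x powi (c * (2 * int i - int m)) = x powi (c * (2 * int i + 1 - int m)) * x powi (-c)"
      using x by (subst power_int_add [symmetric]) (auto simp: algebra_simps)
    have b: "x powi (c * (2 * int (Suc i) - int m)) = x powi (c * (2 * int i + 1 - int m)) * x powi c"
      using x by (subst power_int_add [symmetric]) (auto simp: algebra_simps)
    show ?thesis unfolding a b ch_def by (simp add: algebra_simps)
  qed
  then have "(\<Sum>i<m. (-1) ^ i * x powi (c * (2 * int i + 1 - int m))) * ch x c = (\<Sum>i<m. ?g i - ?g (Suc i))"
    unfolding sum_distrib_right by simp
  also have "\<dots> = ?g 0 - ?g m" by (rule sum_lessThan_telescope')
  finally show ?thesis by simp
qed

lemma geometric_sinh:
  assumes x: "0 < x"
  shows "(\<Sum>i<m. x powi (c * (2 * int i + 1 - int m))) * sh x c = sh x (c * int m)"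
proof -
  let ?g = "\<lambda>i. x powi (c * (2 * int i - int m))"
  have "x powi (c * (2 * int i + 1 - int m)) * sh x c = ?g i - ?g (Suc i)" for i
  proof -
    have a: "x powi (c * (2 * int i - int m)) = x powi (c * (2 * int i + 1 - int m)) * x powi (-c)"
      using x by (subst power_int_add [symmetric]) (auto simp: algebra_simps)
    have b: "x powi (c * (2 * int (Suc i) - int m)) = x powi (c * (2 * int i + 1 - int m)) * x powi c"
      using x by (subst power_int_add [symmetric]) (auto simp: algebra_simps)
    show ?thesis unfolding a b sh_def by (simp add: algebra_simps)
  qed
  then have "(\<Sum>i<m. x powi (c * (2 * int i + 1 - int m))) * sh x c = (\<Sum>i<m. ?g i - ?g (Suc i))"
    unfolding sum_distrib_right by simp
  also have "\<dots> = ?g 0 - ?g m" by (rule sum_lessThan_telescope')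
  finally show ?thesis by (simp add: sh_def)
qed

lemma infsum_sum_finite:
  fixes f :: "'a \<Rightarrow> 'b \<Rightarrow> real"
  assumes "finite I" "\<And>i. i \<in> I \<Longrightarrow> (f i) summable_on A"
  shows "infsum (\<lambda>j. \<Sum>i\<in>I. f i j) A = (\<Sum>i\<in>I. infsum (f i) A)" "(\<lambda>j. \<Sum>i\<in>I. f i j) summable_on A"
  using assms by (induction I rule: finite_induct) (auto simp: infsum_add summable_on_add)

text \<open>
  Completing the square: multiplying the terms of a theta series by \<open>x powi (2 j t)\<close>
  shifts its index by \<open>t\<close> and leaves the factor \<open>x powi (- t\<^sup>2)\<close>.
  This is where the negative powers in the expansions come from.
\<close>

lemma theta_shift:
  fixes x :: real
  assumes x: "0 < x" "x < 1" and fI: "finite I"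
    and V: "\<And>i. i \<in> I \<Longrightarrow> infsum (\<lambda>k. x powi (k\<^sup>2)) ((\<lambda>j. j + t i) ` B) = V"
  shows "infsum (\<lambda>j. x powi (j\<^sup>2) * (\<Sum>i\<in>I. e i * x powi (2 * j * t i))) B
       = V * (\<Sum>i\<in>I. e i * x powi (-((t i)\<^sup>2)))"
    and "(\<lambda>j. x powi (j\<^sup>2) * (\<Sum>i\<in>I. e i * x powi (2 * j * t i))) summable_on B"
proof -
  have eq: "x powi (j\<^sup>2) * (e i * x powi (2 * j * t i)) = (e i * x powi (-((t i)\<^sup>2))) * x powi ((j + t i)\<^sup>2)" for i j
  proof -
    have "j\<^sup>2 + 2 * j * t i = -((t i)\<^sup>2) + (j + t i)\<^sup>2" by (simp add: power2_sum)
    then have "x powi (j\<^sup>2) * x powi (2 * j * t i) = x powi (-((t i)\<^sup>2)) * x powi ((j + t i)\<^sup>2)"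
      using x power_int_add[of x "j\<^sup>2" "2 * j * t i"] power_int_add[of x "-((t i)\<^sup>2)" "(j + t i)\<^sup>2"] by simp
    then show ?thesis by (simp add: ac_simps)
  qed
  have re: "infsum (\<lambda>j. x powi ((j + t i)\<^sup>2)) B = V"
           "(\<lambda>j. x powi ((j + t i)\<^sup>2)) summable_on B" if "i \<in> I" for i
  proof -
    have inj: "inj_on (\<lambda>j. j + t i) B" by (simp add: inj_on_def)
    show "infsum (\<lambda>j. x powi ((j + t i)\<^sup>2)) B = V"
      using V[OF that] by (subst (asm) infsum_reindex[OF inj]) (simp add: o_def)
    show "(\<lambda>j. x powi ((j + t i)\<^sup>2)) summable_on B"
      using abs_summable_on_real[OF theta_summable[OF x, of "(\<lambda>j. j + t i) ` B"]]
      by (subst (asm) summable_on_reindex[OF inj]) (simp add: o_def)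
  qed
  have "infsum (\<lambda>j. x powi (j\<^sup>2) * (\<Sum>i\<in>I. e i * x powi (2 * j * t i))) B
      = infsum (\<lambda>j. \<Sum>i\<in>I. (e i * x powi (-((t i)\<^sup>2))) * x powi ((j + t i)\<^sup>2)) B"
    by (simp only: sum_distrib_left eq)
  also have "\<dots> = (\<Sum>i\<in>I. infsum (\<lambda>j. (e i * x powi (-((t i)\<^sup>2))) * x powi ((j + t i)\<^sup>2)) B)"
    by (rule infsum_sum_finite[OF fI]) (intro summable_on_cmult_right re)
  also have "\<dots> = (\<Sum>i\<in>I. (e i * x powi (-((t i)\<^sup>2))) * V)"
    by (rule sum.cong) (simp_all add: infsum_cmult_right' re)
  also have "\<dots> = (\<Sum>i\<in>I. e i * x powi (-((t i)\<^sup>2))) * V"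
    by (rule sum_distrib_right [symmetric])
  finally show "infsum (\<lambda>j. x powi (j\<^sup>2) * (\<Sum>i\<in>I. e i * x powi (2 * j * t i))) B
       = V * (\<Sum>i\<in>I. e i * x powi (-((t i)\<^sup>2)))" by (simp only: mult.commute)
  have "(\<lambda>j. \<Sum>i\<in>I. (e i * x powi (-((t i)\<^sup>2))) * x powi ((j + t i)\<^sup>2)) summable_on B"
    by (rule infsum_sum_finite(2)[OF fI]) (intro summable_on_cmult_right re)
  then show "(\<lambda>j. x powi (j\<^sup>2) * (\<Sum>i\<in>I. e i * x powi (2 * j * t i))) summable_on B"
    by (simp only: sum_distrib_left eq)
qed

lemma translate_parity:
  "even t \<Longrightarrow> (\<lambda>j. j + t) ` OddZ = OddZ" "even t \<Longrightarrow> (\<lambda>j. j + t) ` EvenZ = EvenZ" "odd t \<Longrightarrow> (\<lambda>j. j + t) ` OddZ = EvenZ"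
  by (auto intro!: image_eqI[of _ _ "_ - t"])

lemma has_sum_alternating_odd_powers:
  fixes u :: real assumes u: "0 < u" "u < 1"
  shows "((\<lambda>i::nat. (-1) ^ i * u ^ (2 * i + 1)) has_sum (u / (1 + u\<^sup>2))) UNIV"
proof -
  have l: "u\<^sup>2 < 1" using u by (simp add: power_less_one_iff abs_square_less_1)
  have "(\<lambda>n. u * (- (u\<^sup>2)) ^ n) sums (u * (1 / (1 - (- (u\<^sup>2)))))"
    using l u by (intro sums_mult geometric_sums) simp
  moreover have "u * (- (u\<^sup>2)) ^ i = (-1) ^ i * u ^ (2 * i + 1)" for i
    by (subst power_minus) (simp add: power_mult)
  ultimately have s: "(\<lambda>i. (-1) ^ i * u ^ (2 * i + 1)) sums (u / (1 + u\<^sup>2))" by simp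
  have "summable (\<lambda>i. norm ((-1) ^ i * u ^ (2 * i + 1)))"
    using has_sum_imp_sums[OF has_sum_odd_powers[OF u]] u by (simp add: sums_iff abs_mult power_abs)
  then show ?thesis using s by (rule norm_summable_imp_has_sum)
qed

lemma inverse_ch_alt:
  assumes "0 < x" shows "1 / ch x (int n) = x ^ n / (1 + (x ^ n)\<^sup>2)"
  using assms by (simp add: ch_def powi_neg_pos power2_eq_square divide_simps)

lemma nat_pairs_by_sum:
  fixes f :: "nat \<Rightarrow> nat \<Rightarrow> real"
  assumes s: "(\<lambda>(m,i). f m i) summable_on UNIV \<times> UNIV"
    and anti: "\<And>m i. odd (m + i) \<Longrightarrow> f m i = - f i m"
  shows "infsum (\<lambda>(m,i). f m i) (UNIV \<times> UNIV) = infsum (\<lambda>n. \<Sum>i<2*n+1. f (2*n-i) i) UNIV"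
proof -
  let ?O = "{(m,i). odd (m + i)} :: (nat \<times> nat) set"
  let ?E = "{(m,i). even (m + i)} :: (nat \<times> nat) set"
  have sub: "(\<lambda>(m,i). f m i) summable_on A" for A by (rule summable_on_subset_banach[OF s]) auto
  have u: "UNIV \<times> UNIV = ?E \<union> ?O" by auto
  have "infsum (\<lambda>(m,i). f m i) ?O = infsum (\<lambda>(m,i). f i m) ?O"
    by (rule infsum_reindex_bij_witness[of _ prod.swap prod.swap]) auto
  also have "\<dots> = infsum (\<lambda>p. - (case p of (m,i) \<Rightarrow> f m i)) ?O"
    by (rule infsum_cong) (use anti in \<open>auto simp: add.commute\<close>)
  also have "\<dots> = - infsum (\<lambda>(m,i). f m i) ?O" by (rule infsum_uminus)
  finally have z: "infsum (\<lambda>(m,i). f m i) ?O = 0" by simp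
  have "infsum (\<lambda>(m,i). f m i) (UNIV \<times> UNIV) = infsum (\<lambda>(m,i). f m i) ?E"
    unfolding u by (subst infsum_Un_disjoint[OF sub sub]) (use z in auto)
  also have "\<dots> = infsum (\<lambda>(n,i). f (2*n-i) i) (Sigma UNIV (\<lambda>n. {..<2*n+1}))"
    by (rule infsum_reindex_bij_witness[of _ "\<lambda>(n,i). (2*n-i,i)" "\<lambda>(m,i). ((m+i) div 2,i)"]) auto
  also have "\<dots> = infsum (\<lambda>n. infsum (\<lambda>i. f (2*n-i) i) {..<2*n+1}) UNIV"
  proof -
    have "(\<lambda>(n,i). f (2*n-i) i) summable_on (Sigma UNIV (\<lambda>n. {..<2*n+1}))"
      by (rule iffD2[OF summable_on_reindex_bij_witness[of _ "\<lambda>(m,i). ((m+i) div 2,i)" "\<lambda>(n,i). (2*n-i,i)" ?E] sub]) auto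
    from infsum_Sigma_banach[OF this] show ?thesis by simp
  qed
  finally show ?thesis by simp
qed

lemma Lser_square_differences:
  assumes x: "0 < x" "x < 1"
  shows "Lser x = infsum (\<lambda>n. \<Sum>i<2*n+1. (-1) ^ i * x ^ ((2*(2*n-i)+1) * (2*i+1))) UNIV"
proof -
  let ?f = "\<lambda>m i. (-1) ^ i * x ^ ((2*m+1) * (2*i+1)) :: real"
  have h: "(?f m has_sum (1 / ch x (2 * int m + 1))) UNIV" for m
  proof -
    have "0 < x ^ (2*m+1)" "x ^ (2*m+1) < 1" using x by (auto intro: power_less_one_iff[THEN iffD2] simp del: power_Suc)
    from has_sum_alternating_odd_powers[OF this] inverse_ch_alt[of x "2*m+1"] x show ?thesis
      by (simp only: power_mult [symmetric]) (simp add: add.commute)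
  qed
  have g: "(\<lambda>n::nat. x ^ n) abs_summable_on UNIV"
    using x by (intro summable_nonneg_imp_summable_on) (auto intro: summable_geometric)
  have S: "(\<lambda>(m,i). ?f m i) summable_on UNIV \<times> UNIV"
  proof (rule abs_summable_on_real, rule abs_summable_on_comparison_test[OF product_abs_summable[OF g g]])
    fix p :: "nat \<times> nat"
    obtain m i where p: "p = (m, i)" by force
    have "x ^ ((2*m+1) * (2*i+1)) \<le> x ^ (m + i)" using x by (intro power_decreasing) auto
    then show "norm (case p of (m,i) \<Rightarrow> ?f m i) \<le> norm (case p of (a,b) \<Rightarrow> x ^ a * x ^ b)"
      using x by (simp add: p abs_mult power_abs power_add)
  qed
  have "Lser x = infsum (\<lambda>m. 1 / ch x (2 * int m + 1)) UNIV" unfolding Lser_def by (rule infsum_OddP)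
  also have "\<dots> = infsum (\<lambda>m. infsum (?f m) UNIV) UNIV" by (rule infsum_cong) (use infsumI[OF h] in simp)
  also have "\<dots> = infsum (\<lambda>(m,i). ?f m i) (UNIV \<times> UNIV)" using infsum_Sigma_banach[OF S] by simp
  also have "\<dots> = infsum (\<lambda>n. \<Sum>i<2*n+1. ?f (2*n-i) i) UNIV"
  proof (rule nat_pairs_by_sum[OF S])
    fix m i :: nat assume "odd (m + i)"
    then have "(-1) ^ i = - ((-1) ^ m :: real)" by (cases "even i") auto
    then show "?f m i = - ?f i m" by (simp only: mult.commute)
  qed
  finally show ?thesis .
qed

lemma Lser_theta:
  assumes x: "0 < x" "x < 1"
  shows "Lser x * thE x = thO x * E0 (x ^ 4)"
proof -
  have E04: "E0 (x ^ 4) = infsum (\<lambda>j. 1 / ch x (4 * j)) UNIV" using x by (simp add: E0_def ch_power)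
  have x4: "0 < x ^ 4" "x ^ 4 < 1" using x by (auto simp: power_less_one_iff)
  have cs: "(\<lambda>j. 1 / ch x (4 * j)) abs_summable_on UNIV"
    using inverse_ch_summable[OF x4, of UNIV] x by (simp add: ch_power)
  let ?f = "\<lambda>(s,j). x powi ((s + 2 * j)\<^sup>2) * (1 / ch x (4 * j))"
  have S: "?f summable_on OddZ \<times> UNIV"
    by (rule iffD1[OF summable_on_reindex_bij_witness[of "OddZ \<times> UNIV" "\<lambda>(s,j). (s + 2 * j, j)" "\<lambda>(N,j). (N - 2 * j, j)" "OddZ \<times> UNIV"]
      abs_summable_on_real[OF product_abs_summable[OF theta_summable[OF x, of OddZ] cs]]]) auto
  define F where "F s = infsum (\<lambda>j. x powi ((s + 2 * j)\<^sup>2) * (1 / ch x (4 * j))) UNIV" for s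
  have Fs: "F summable_on OddZ" using summable_on_Sigma_banach[of "\<lambda>s j. x powi ((s + 2 * j)\<^sup>2) * (1 / ch x (4 * j))"] S
    unfolding F_def by simp
  have inner: "(\<lambda>j. x powi ((s + 2 * j)\<^sup>2) * (1 / ch x (4 * j))) summable_on UNIV" if "s \<in> OddZ" for s
    using summable_on_SigmaD1[of "\<lambda>s j. x powi ((s + 2 * j)\<^sup>2) * (1 / ch x (4 * j))" OddZ "\<lambda>_. UNIV" s] S that by auto
  have refl: "infsum (\<lambda>j. x powi ((s - 2 * j)\<^sup>2) * (1 / ch x (4 * j))) UNIV = F s"
    and refl': "(\<lambda>j. x powi ((s - 2 * j)\<^sup>2) * (1 / ch x (4 * j))) summable_on UNIV \<longleftrightarrow> (\<lambda>j. x powi ((s + 2 * j)\<^sup>2) * (1 / ch x (4 * j))) summable_on UNIV" for s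
  proof -
    have c: "ch x (4 * - j) = ch x (4 * j)" for j using ch_minus[of x "4 * j"] by simp
    show "infsum (\<lambda>j. x powi ((s - 2 * j)\<^sup>2) * (1 / ch x (4 * j))) UNIV = F s"
      unfolding F_def by (rule infsum_reindex_bij_witness[of _ uminus uminus]) (auto simp: c[simplified])
    show "(\<lambda>j. x powi ((s - 2 * j)\<^sup>2) * (1 / ch x (4 * j))) summable_on UNIV \<longleftrightarrow> (\<lambda>j. x powi ((s + 2 * j)\<^sup>2) * (1 / ch x (4 * j))) summable_on UNIV"
      by (rule summable_on_reindex_bij_witness[of _ uminus uminus]) (auto simp: c[simplified])
  qed
  have F_minus: "F (-s) = F s" for s
  proof -
    have "F (-s) = infsum (\<lambda>j. x powi ((s - 2 * j)\<^sup>2) * (1 / ch x (4 * j))) UNIV"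
      unfolding F_def by (rule infsum_cong) (simp add: power2_commute[of s] add.commute)
    then show ?thesis by (simp only: refl)
  qed
  have key: "2 * F (2 * int n + 1) = thE x * (\<Sum>i<2*n+1. (-1) ^ i * x ^ ((2*(2*n-i)+1) * (2*i+1)))" for n
  proof -
    define s where "s = int (2 * n + 1)"
    let ?t = "\<lambda>i. 2 * int i + 1 - s"
    have so: "s \<in> OddZ" by (simp add: s_def)
    have "2 * F s = infsum (\<lambda>j. x powi ((s + 2 * j)\<^sup>2) * (1 / ch x (4 * j)) + x powi ((s - 2 * j)\<^sup>2) * (1 / ch x (4 * j))) UNIV"
      by (subst infsum_add[OF inner[OF so]]) (use inner[OF so] refl refl' in \<open>auto simp: F_def\<close>)
    also have "\<dots> = infsum (\<lambda>j. x powi (s\<^sup>2) * (x powi ((2 * j)\<^sup>2) * (\<Sum>i<2*n+1. (-1) ^ i * x powi (2 * (2 * j) * ?t i)))) UNIV"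
    proof (rule infsum_cong)
      fix j :: int
      have a: "x powi ((s + 2 * j)\<^sup>2) = x powi (s\<^sup>2) * x powi ((2*j)\<^sup>2) * x powi (4 * j * s)"
        using x by (simp add: power_int_add [symmetric]) (simp add: power2_sum power_mult_distrib algebra_simps)
      have b: "x powi ((s - 2 * j)\<^sup>2) = x powi (s\<^sup>2) * x powi ((2*j)\<^sup>2) * x powi (-(4 * j * s))"
        using x by (simp add: power_int_add [symmetric] del: power_int_minus) (simp add: power2_diff power_mult_distrib algebra_simps)
      have ch: "(\<Sum>i<2*n+1. (-1) ^ i * x powi (4 * j * ?t i)) * ch x (4 * j) = ch x (4 * j * s)"
        unfolding s_def by (subst alternating_geometric[OF x(1)]) (simp add: ch_def)
      have pos: "ch x (4 * j) > 0" using ch_pos x by simp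
      have "x powi ((s + 2 * j)\<^sup>2) * (1 / ch x (4 * j)) + x powi ((s - 2 * j)\<^sup>2) * (1 / ch x (4 * j))
          = x powi (s\<^sup>2) * x powi ((2*j)\<^sup>2) * (ch x (4 * j * s) / ch x (4 * j))"
        unfolding a b ch_def[of x "4 * j * s"] by (simp add: algebra_simps add_divide_distrib)
      also have "ch x (4 * j * s) / ch x (4 * j) = (\<Sum>i<2*n+1. (-1) ^ i * x powi (4 * j * ?t i))"
        using ch pos by (simp add: field_simps)
      finally show "x powi ((s + 2 * j)\<^sup>2) * (1 / ch x (4 * j)) + x powi ((s - 2 * j)\<^sup>2) * (1 / ch x (4 * j))
          = x powi (s\<^sup>2) * (x powi ((2 * j)\<^sup>2) * (\<Sum>i<2*n+1. (-1) ^ i * x powi (2 * (2 * j) * ?t i)))"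
        by (simp add: mult.assoc)
    qed
    also have "\<dots> = x powi (s\<^sup>2) * infsum (\<lambda>j. x powi (j\<^sup>2) * (\<Sum>i<2*n+1. (-1) ^ i * x powi (2 * j * ?t i))) EvenZ"
      by (simp only: infsum_cmult_right' infsum_Even)
    also have "\<dots> = x powi (s\<^sup>2) * (thE x * (\<Sum>i<2*n+1. (-1) ^ i * x powi (-((?t i)\<^sup>2))))"
      unfolding thE_def by (subst theta_shift[OF x, where V = "infsum (\<lambda>k. x powi (k\<^sup>2)) EvenZ"]) (auto simp: s_def translate_parity)
    also have "x powi (s\<^sup>2) * (thE x * (\<Sum>i<2*n+1. (-1) ^ i * x powi (-((?t i)\<^sup>2)))) = thE x * (\<Sum>i<2*n+1. (-1) ^ i * (x powi (s\<^sup>2) * x powi (-((?t i)\<^sup>2))))"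
      unfolding sum_distrib_left by (rule sum.cong) (simp_all only: ac_simps)
    also have "(\<Sum>i<2*n+1. (-1) ^ i * (x powi (s\<^sup>2) * x powi (-((?t i)\<^sup>2)))) = (\<Sum>i<2*n+1. (-1) ^ i * x ^ ((2*(2*n-i)+1) * (2*i+1)))"
    proof (rule sum.cong)
      fix i assume "i \<in> {..<2*n+1}"
      then have i: "i \<le> 2 * n" by simp
      have "s\<^sup>2 + - ((?t i)\<^sup>2) = int ((2*(2*n-i)+1) * (2*i+1))"
      proof -
        obtain k where k: "2 * n = i + k" using i le_Suc_ex by blast
        then have "s = int i + int k + 1" "2 * n - i = k" by (auto simp: s_def)
        then show ?thesis by (simp add: power2_eq_square algebra_simps)
      qed
      then have "x powi (s\<^sup>2) * x powi (-((?t i)\<^sup>2)) = x ^ ((2*(2*n-i)+1) * (2*i+1))"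
        using x power_int_add[of x "s\<^sup>2" "-((?t i)\<^sup>2)"] by (simp only: power_int_of_nat) simp
      then show "(-1) ^ i * (x powi (s\<^sup>2) * x powi (-((?t i)\<^sup>2))) = (-1) ^ i * x ^ ((2*(2*n-i)+1) * (2*i+1))" by simp
    qed simp
    finally have "2 * F s = thE x * (\<Sum>i<2*n+1. (-1) ^ i * x ^ ((2*(2*n-i)+1) * (2*i+1)))" .
    moreover have "s = 2 * int n + 1" by (simp add: s_def)
    ultimately show ?thesis by (simp only:)
  qed
  have "thO x * E0 (x ^ 4) = infsum (\<lambda>(N,j). x powi (N\<^sup>2) * (1 / ch x (4 * j))) (OddZ \<times> UNIV)"
    unfolding thO_def E04 by (rule infsum_product[OF theta_summable[OF x] cs, symmetric])
  also have "\<dots> = infsum ?f (OddZ \<times> UNIV)"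
    by (rule infsum_reindex_bij_witness[of _ "\<lambda>(s,j). (s + 2 * j, j)" "\<lambda>(N,j). (N - 2 * j, j)"]) auto
  also have "\<dots> = infsum F OddZ" unfolding F_def using infsum_Sigma_banach[OF S, symmetric] by simp
  also have "\<dots> = 2 * infsum F OddP" by (rule infsum_odd_symmetric[OF Fs]) (simp add: F_minus)
  also have "\<dots> = infsum (\<lambda>n. 2 * F (2 * int n + 1)) UNIV" by (simp only: infsum_OddP infsum_cmult_right')
  also have "\<dots> = thE x * Lser x" by (simp only: key infsum_cmult_right' Lser_square_differences[OF x])
  finally show ?thesis by simp
qed

lemma thE_pos: assumes x: "0 < x" "x < 1" shows "thE x \<ge> 1"
proof -
  have "(\<lambda>k. x powi (k\<^sup>2)) summable_on EvenZ" by (rule abs_summable_on_real[OF theta_summable[OF x]])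
  from finite_sum_le_infsum[OF this, of "{0}"] show ?thesis using x by (simp add: thE_def)
qed

lemma thO_nonneg: assumes x: "0 < x" shows "thO x \<ge> 0"
  unfolding thO_def using x by (intro infsum_nonneg) simp

lemma null_comparison:
  fixes f g :: "nat \<Rightarrow> real"
  assumes "eventually (\<lambda>n. norm (f n) \<le> g n) sequentially" "g \<longlonglongrightarrow> 0"
  shows "f \<longlonglongrightarrow> 0"
  by (rule tendsto_0_le[OF assms(2), of f 1], rule eventually_mono[OF assms(1)]) simp

lemma near_zero:
  fixes f :: "int \<Rightarrow> real"
  assumes y: "0 < y" "y \<le> 1/2" and f: "\<And>k. k \<noteq> 0 \<Longrightarrow> 0 \<le> f k \<and> f k \<le> y ^ nat \<bar>k\<bar>"
  shows "\<bar>infsum f UNIV - f 0\<bar> \<le> y * (2 * infsum (\<lambda>k::int. (1/2) ^ nat \<bar>k\<bar>) UNIV)"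
proof -
  have y1: "y < 1" using y by simp
  have fs: "f summable_on (UNIV - {0})"
    by (rule abs_summable_on_real, rule summable_on_le_geometric[OF y(1) y1, of _ _ 1]) (use f in auto)
  have gs: "(\<lambda>k::int. (1/2::real) ^ nat \<bar>k\<bar>) summable_on A" for A by (rule geometric_summable_int) auto
  have "infsum f UNIV = f 0 + infsum f (UNIV - {0})"
    using infsum_insert[OF fs, of 0] by (simp add: insert_UNIV)
  moreover have "infsum f (UNIV - {0}) \<ge> 0" by (rule infsum_nonneg) (use f in auto)
  moreover have "infsum f (UNIV - {0}) \<le> infsum (\<lambda>k. (2 * y) * (1/2) ^ nat \<bar>k\<bar>) (UNIV - {0})"
  proof (rule infsum_mono[OF fs summable_on_cmult_right[OF gs]])
    fix k :: int assume "k \<in> UNIV - {0}"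
    then obtain m where m: "nat \<bar>k\<bar> = Suc m" by (cases "nat \<bar>k\<bar>") auto
    have "f k \<le> y * y ^ m" using f[of k] \<open>k \<in> UNIV - {0}\<close> m by simp
    also have "\<dots> \<le> y * (1/2) ^ m" using y by (intro mult_left_mono power_mono) auto
    finally show "f k \<le> (2 * y) * (1/2) ^ nat \<bar>k\<bar>" by (simp add: m)
  qed
  moreover have "\<dots> \<le> (2 * y) * infsum (\<lambda>k. (1/2) ^ nat \<bar>k\<bar>) UNIV"
    unfolding infsum_cmult_right' using y by (intro mult_left_mono infsum_mono2 gs) auto
  ultimately show ?thesis by (simp add: ac_simps)
qed

text \<open>
  This is the two-square identity of Jacobi. Along \<open>y, y\<^sup>2, y\<^sup>4, \<dots>\<close>
  the successive differences of the quotient of the two sides do not decrease in absolute value,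
  but they tend to 0, because the quotient tends to 1 as the argument tends to 0. Hence the
  quotient is constant.
\<close>

theorem E0_is_square:
  assumes x: "0 < x" "x < 1"
  shows "2 * E0 x = (ph x)\<^sup>2"
proof -
  have php: "ph y \<ge> 1" if "0 < y" "y < 1" for y
    using thE_pos[OF that] thO_nonneg[of y] that ph_split[OF that] by simp
  define c where "c y = 2 * E0 y / (ph y)\<^sup>2" for y
  have c: "2 * E0 y = c y * (ph y)\<^sup>2" if "0 < y" "y < 1" for y using php[OF that] by (simp add: c_def)
  have step: "\<bar>c y - c (y\<^sup>2)\<bar> \<le> \<bar>c (y\<^sup>2) - c ((y\<^sup>2)\<^sup>2)\<bar>" if y: "0 < y" "y < 1" for y
  proof -
    have y2: "0 < y\<^sup>2" "y\<^sup>2 < 1" using y by (auto simp: power_less_one_iff abs_square_less_1)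
    have y4: "0 < y ^ 4" "y ^ 4 < 1" using y by (auto simp: power_less_one_iff)
    have p4: "(y\<^sup>2)\<^sup>2 = y ^ 4" by (simp add: power_mult [symmetric])
    have "4 * Lser y * thE y = 2 * thO y * (2 * E0 (y ^ 4))" using Lser_theta[OF y] by simp
    also have "\<dots> = c (y ^ 4) * (2 * thE y * thO y) * thE y" using c[OF y4] by (simp add: thE_ph[OF y] power2_eq_square)
    also have "2 * thE y * thO y = (ph y)\<^sup>2 - (ph (y\<^sup>2))\<^sup>2" using ph_square[OF y] by simp
    finally have L: "4 * Lser y = c (y ^ 4) * ((ph y)\<^sup>2 - (ph (y\<^sup>2))\<^sup>2)" using thE_pos[OF y] by simp
    have "c y * (ph y)\<^sup>2 = c (y\<^sup>2) * (ph (y\<^sup>2))\<^sup>2 + c (y ^ 4) * ((ph y)\<^sup>2 - (ph (y\<^sup>2))\<^sup>2)"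
      using E0_recursion[OF y] c[OF y] c[OF y2] L by simp
    then have e: "(c y - c (y\<^sup>2)) * (ph y)\<^sup>2 = (c (y ^ 4) - c (y\<^sup>2)) * ((ph y)\<^sup>2 - (ph (y\<^sup>2))\<^sup>2)"
      by (simp add: algebra_simps)
    have "0 \<le> (ph y)\<^sup>2 - (ph (y\<^sup>2))\<^sup>2" using ph_square[OF y] thE_pos[OF y] thO_nonneg[OF y(1)] by simp
    then have "\<bar>c y - c (y\<^sup>2)\<bar> * (ph y)\<^sup>2 = \<bar>c (y ^ 4) - c (y\<^sup>2)\<bar> * ((ph y)\<^sup>2 - (ph (y\<^sup>2))\<^sup>2)"
      using arg_cong[OF e, of abs] by (simp add: abs_mult)
    also have "\<dots> \<le> \<bar>c (y ^ 4) - c (y\<^sup>2)\<bar> * (ph y)\<^sup>2" by (intro mult_left_mono) auto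
    finally show ?thesis using php[OF y] by (simp add: p4 abs_minus_commute)
  qed
  define X where "X n = x ^ (2 ^ n)" for n
  have X: "0 < X n" "X n < 1" "(X n)\<^sup>2 = X (Suc n)" "X 0 = x" for n
    using x by (auto simp: X_def power_less_one_iff power_mult [symmetric] mult.commute)
  have Xlim: "X \<longlonglongrightarrow> 0"
    unfolding X_def using x LIMSEQ_subseq_LIMSEQ[OF LIMSEQ_power_zero[of x], of "\<lambda>n. 2 ^ n"]
    by (simp add: o_def strict_mono_def)
  define M where "M = 2 * infsum (\<lambda>k::int. (1/2::real) ^ nat \<bar>k\<bar>) UNIV"
  have Xhalf: "eventually (\<lambda>n. X n \<le> 1/2) sequentially"
    using order_tendstoD(2)[OF Xlim, of "1/2"] by (auto elim: eventually_mono)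
  have b: "(\<lambda>n. X n * M) \<longlonglongrightarrow> 0" using tendsto_mult_left_zero[OF Xlim] by simp
  have "(\<lambda>n. ph (X n) - 1) \<longlonglongrightarrow> 0"
  proof (rule null_comparison[OF eventually_mono[OF Xhalf] b])
    fix n assume "X n \<le> 1/2"
    from near_zero[OF X(1) this, where f = "\<lambda>k. X n powi (k\<^sup>2)"] X(1)[of n] X(2)[of n] powi_square_le[OF X(1,2)]
    show "norm (ph (X n) - 1) \<le> X n * M" by (simp add: ph_def M_def)
  qed
  then have l1: "(\<lambda>n. ph (X n)) \<longlonglongrightarrow> 1" by (simp add: LIM_zero_iff)
  have "(\<lambda>n. E0 (X n) - 1/2) \<longlonglongrightarrow> 0"
  proof (rule null_comparison[OF eventually_mono[OF Xhalf] b])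
    fix n assume "X n \<le> 1/2"
    from near_zero[OF X(1) this, where f = "\<lambda>k. 1 / ch (X n) k"] X(1)[of n] X(2)[of n] inverse_ch_le[OF X(1,2)] ch_pos[OF X(1)]
    show "norm (E0 (X n) - 1/2) \<le> X n * M" by (simp add: E0_def M_def less_imp_le) (simp add: ch_def)
  qed
  then have l2: "(\<lambda>n. E0 (X n)) \<longlonglongrightarrow> 1/2" by (simp add: LIM_zero_iff)
  have "(\<lambda>n. 2 * E0 (X n) / (ph (X n))\<^sup>2) \<longlonglongrightarrow> 2 * (1/2) / 1\<^sup>2" by (intro tendsto_intros l1 l2) simp
  then have cl: "(\<lambda>n. c (X n)) \<longlonglongrightarrow> 1" by (simp add: c_def)
  have mono: "\<bar>c (X k) - c (X (Suc k))\<bar> \<le> \<bar>c (X (k + n)) - c (X (Suc (k + n)))\<bar>" for k n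
  proof (induction n)
    case (Suc n)
    have "\<bar>c (X (k+n)) - c (X (Suc (k+n)))\<bar> \<le> \<bar>c (X (Suc (k+n))) - c (X (Suc (Suc (k+n))))\<bar>"
      using step[OF X(1,2), of "k + n"] by (simp add: X(3))
    with Suc show ?case by simp
  qed simp
  have "(\<lambda>n. \<bar>c (X (n + k)) - c (X (n + Suc k))\<bar>) \<longlonglongrightarrow> \<bar>1 - 1\<bar>" for k
    by (intro tendsto_intros LIMSEQ_ignore_initial_segment cl)
  then have "\<bar>c (X k) - c (X (Suc k))\<bar> \<le> \<bar>1 - 1 :: real\<bar>" for k
    by (rule LIMSEQ_le_const) (use mono[of k] in \<open>auto simp: add.commute\<close>)
  then have "c (X (Suc k)) = c (X k)" for k by simp
  then have "c (X k) = c (X 0)" for k by (induction k) auto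
  then have "(\<lambda>n. c (X n)) = (\<lambda>n. c (X 0))" by (rule ext)
  with cl have "(\<lambda>n::nat. c (X 0)) \<longlonglongrightarrow> 1" by (simp only:)
  then have "c (X 0) = 1" by (simp add: LIMSEQ_const_iff)
  then show ?thesis using c[OF x] X(4) by simp
qed

definition thP where "thP x = infsum (\<lambda>k. x powi (k\<^sup>2)) OddP"

lemma thO_thP: assumes x: "0 < x" "x < 1" shows "thO x = 2 * thP x"
  unfolding thO_def thP_def by (rule infsum_odd_symmetric[OF abs_summable_on_real[OF theta_summable[OF x]]]) simp

lemma Lser_theta_product:
  assumes x: "0 < x" "x < 1"
  shows "Lser x = thP x * thE x"
proof -
  have x4: "0 < x ^ 4" "x ^ 4 < 1" using x by (auto simp: power_less_one_iff)
  have "Lser x * thE x = thP x * thE x * thE x"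
    using Lser_theta[OF x] E0_is_square[OF x4] by (simp add: thO_thP[OF x] thE_ph[OF x] power2_eq_square)
  then show ?thesis using thE_pos[OF x] by simp
qed

lemma U_square:
  assumes x: "0 < x" "x < 1"
  shows "U (x\<^sup>2) = (thP x * thE x)\<^sup>2" "U (x ^ 4) = thP x ^ 4"
proof -
  show "U (x\<^sup>2) = (thP x * thE x)\<^sup>2" using Lser_square[OF x] Lser_theta_product[OF x] by simp
  have x2: "0 < x\<^sup>2" "x\<^sup>2 < 1" using x by (auto simp: power_less_one_iff abs_square_less_1)
  have "Lser (x\<^sup>2) = (thP x)\<^sup>2"
    using thO_square[OF x] thO_thP[OF x] thO_thP[OF x2] Lser_theta_product[OF x2] by (simp add: power2_eq_square)
  then show "U (x ^ 4) = thP x ^ 4" using Lser_square[OF x2] by (simp add: power_mult [symmetric])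
qed

section \<open>Products of three theta functions\<close>

lemma odd_kernel_half_plane:
  fixes K :: "int \<Rightarrow> int \<Rightarrow> real"
  assumes p: "0 < p" "p < (1::real)"
    and K: "\<And>D j. K (-D) j = - K D j" "\<And>D j. K D (-j) = - K D j"
    and S: "(\<lambda>(D,j). p powi ((D+j)\<^sup>2) * K D j) summable_on OddZ \<times> OddZ"
  shows "(\<lambda>D. infsum (\<lambda>j. (p powi ((D-j)\<^sup>2) - p powi ((D+j)\<^sup>2)) * K D j) OddZ) summable_on OddP"
    "infsum (\<lambda>D. infsum (\<lambda>j. (p powi ((D-j)\<^sup>2) - p powi ((D+j)\<^sup>2)) * K D j) OddZ) OddP
      = - infsum (\<lambda>(D,j). p powi ((D+j)\<^sup>2) * K D j) (OddZ \<times> OddZ)"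
proof -
  define F where "F D = infsum (\<lambda>j. p powi ((D+j)\<^sup>2) * K D j) OddZ" for D
  have Fs: "F summable_on OddZ" using summable_on_Sigma_banach[OF S] unfolding F_def .
  have inner: "(\<lambda>j. p powi ((D+j)\<^sup>2) * K D j) summable_on OddZ" if "D \<in> OddZ" for D
    using summable_on_SigmaD1[of "\<lambda>D j. p powi ((D+j)\<^sup>2) * K D j" OddZ "\<lambda>_. OddZ" D] S that by auto
  have m: "infsum (\<lambda>j. p powi ((D-j)\<^sup>2) * K D j) OddZ = - F D" for D
  proof -
    have "infsum (\<lambda>j. p powi ((D-j)\<^sup>2) * K D j) OddZ = infsum (\<lambda>j. - (p powi ((D+j)\<^sup>2) * K D j)) OddZ"
      by (rule infsum_reindex_bij_witness[of _ uminus uminus]) (auto simp: K)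
    then show ?thesis by (simp only: infsum_uminus F_def)
  qed
  have ms: "(\<lambda>j. p powi ((D-j)\<^sup>2) * K D j) summable_on OddZ" if "D \<in> OddZ" for D
  proof -
    have "(\<lambda>j. - (p powi ((D+j)\<^sup>2) * K D j)) summable_on OddZ" using inner[OF that] by (simp only: summable_on_uminus)
    then show ?thesis
      by (rule iffD1[OF summable_on_reindex_bij_witness[of _ uminus uminus], rotated -1]) (auto simp: K)
  qed
  have F_minus: "F (-D) = F D" for D
    unfolding F_def by (rule infsum_reindex_bij_witness[of _ uminus uminus]) (auto simp: K power2_eq_square algebra_simps)
  have e: "infsum (\<lambda>j. (p powi ((D-j)\<^sup>2) - p powi ((D+j)\<^sup>2)) * K D j) OddZ = - 2 * F D" if "D \<in> OddP" for D
  proof -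
    have D: "D \<in> OddZ" using that by auto
    have "infsum (\<lambda>j. (p powi ((D-j)\<^sup>2) - p powi ((D+j)\<^sup>2)) * K D j) OddZ
        = infsum (\<lambda>j. p powi ((D-j)\<^sup>2) * K D j + - (p powi ((D+j)\<^sup>2) * K D j)) OddZ"
      by (rule infsum_cong) (simp add: algebra_simps)
    also have "\<dots> = - F D + - F D"
      by (subst infsum_add[OF ms[OF D]]) (use inner[OF D] in \<open>simp_all only: m summable_on_uminus infsum_uminus F_def\<close>)
    finally show ?thesis by simp
  qed
  have FP: "(\<lambda>D. -2 * F D) summable_on OddP"
    by (rule summable_on_cmult_right, rule summable_on_subset_banach[OF Fs]) auto
  then show "(\<lambda>D. infsum (\<lambda>j. (p powi ((D-j)\<^sup>2) - p powi ((D+j)\<^sup>2)) * K D j) OddZ) summable_on OddP"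
    by (rule iffD2[OF summable_on_cong, rotated]) (rule e)
  have "infsum (\<lambda>D. infsum (\<lambda>j. (p powi ((D-j)\<^sup>2) - p powi ((D+j)\<^sup>2)) * K D j) OddZ) OddP = infsum (\<lambda>D. -2 * F D) OddP"
    by (rule infsum_cong) (rule e)
  also have "\<dots> = - (2 * infsum F OddP)" by (simp only: infsum_cmult_right')
  also have "2 * infsum F OddP = infsum F OddZ" by (rule infsum_odd_symmetric[OF Fs F_minus, symmetric])
  also have "\<dots> = infsum (\<lambda>(D,j). p powi ((D+j)\<^sup>2) * K D j) (OddZ \<times> OddZ)"
    unfolding F_def using infsum_Sigma_banach[OF S] by simp
  finally show "infsum (\<lambda>D. infsum (\<lambda>j. (p powi ((D-j)\<^sup>2) - p powi ((D+j)\<^sup>2)) * K D j) OddZ) OddP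
      = - infsum (\<lambda>(D,j). p powi ((D+j)\<^sup>2) * K D j) (OddZ \<times> OddZ)" .
qed

text \<open>
  Both kernels are odd in each variable, so the sum over the plane reduces to a sum over \<open>D
  > 0\<close> of terms that are antisymmetrised in \<open>j\<close>.
\<close>

lemma odd_kernels:
  assumes p: "0 < p" "p < (1::real)" and x: "0 < x" "x < (1::real)"
  shows "(\<lambda>D. infsum (\<lambda>j. (p powi ((D-j)\<^sup>2) - p powi ((D+j)\<^sup>2)) * (ch x D / (sh x D * sh x j))) OddZ) summable_on OddP"
    "infsum (\<lambda>D. infsum (\<lambda>j. (p powi ((D-j)\<^sup>2) - p powi ((D+j)\<^sup>2)) * (ch x D / (sh x D * sh x j))) OddZ) OddP = 2 * U x"
    "(\<lambda>D. infsum (\<lambda>j. (p powi ((D-j)\<^sup>2) - p powi ((D+j)\<^sup>2)) * (ch x j / (sh x D * sh x j))) OddZ) summable_on OddP"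
    "infsum (\<lambda>D. infsum (\<lambda>j. (p powi ((D-j)\<^sup>2) - p powi ((D+j)\<^sup>2)) * (ch x j / (sh x D * sh x j))) OddZ) OddP = 2 * U x"
proof -
  have "(\<lambda>k. p powi (k\<^sup>2)) abs_summable_on EvenZ" by (rule theta_summable[OF p])
  note A = coth_csch_sum[OF x this]
  have B: "(\<lambda>(D,j). p powi ((D+j)\<^sup>2) * (ch x j / (sh x D * sh x j))) summable_on (OddZ \<times> OddZ)"
    by (rule iffD2[OF summable_on_reindex_bij_witness[of _ prod.swap prod.swap] A(2)]) (auto simp: ac_simps)
  have "infsum (\<lambda>(D,j). p powi ((D+j)\<^sup>2) * (ch x j / (sh x D * sh x j))) (OddZ \<times> OddZ)
     = infsum (\<lambda>(D,j). p powi ((D+j)\<^sup>2) * (ch x D / (sh x D * sh x j))) (OddZ \<times> OddZ)"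
    by (rule infsum_reindex_bij_witness[of _ prod.swap prod.swap]) (auto simp: ac_simps)
  note B' = this[unfolded A(1)]
  have "- (-2 * p powi (0\<^sup>2) * U x) = 2 * U x" by simp
  then show "(\<lambda>D. infsum (\<lambda>j. (p powi ((D-j)\<^sup>2) - p powi ((D+j)\<^sup>2)) * (ch x D / (sh x D * sh x j))) OddZ) summable_on OddP"
    "infsum (\<lambda>D. infsum (\<lambda>j. (p powi ((D-j)\<^sup>2) - p powi ((D+j)\<^sup>2)) * (ch x D / (sh x D * sh x j))) OddZ) OddP = 2 * U x"
    "(\<lambda>D. infsum (\<lambda>j. (p powi ((D-j)\<^sup>2) - p powi ((D+j)\<^sup>2)) * (ch x j / (sh x D * sh x j))) OddZ) summable_on OddP"
    "infsum (\<lambda>D. infsum (\<lambda>j. (p powi ((D-j)\<^sup>2) - p powi ((D+j)\<^sup>2)) * (ch x j / (sh x D * sh x j))) OddZ) OddP = 2 * U x"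
    using odd_kernel_half_plane[where K = "\<lambda>D j. ch x D / (sh x D * sh x j)", OF p _ _ A(2)]
      odd_kernel_half_plane[where K = "\<lambda>D j. ch x j / (sh x D * sh x j)", OF p _ _ B] A(1) B'
    by simp_all
qed

lemma square_difference_powi:
  fixes y :: real assumes y: "0 < y"
  shows "(y ^ c) powi ((D-j)\<^sup>2) - (y ^ c) powi ((D+j)\<^sup>2) = y powi (int c * D\<^sup>2) * (y powi (int c * j\<^sup>2) * sh y (2 * int c * j * D))"
proof -
  have "int c * (D-j)\<^sup>2 = int c * D\<^sup>2 + (int c * j\<^sup>2 + -(2 * int c * j * D))" "int c * (D+j)\<^sup>2 = int c * D\<^sup>2 + (int c * j\<^sup>2 + 2 * int c * j * D)"
    by (simp_all add: power2_eq_square algebra_simps)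
  then have "(y ^ c) powi ((D-j)\<^sup>2) = y powi (int c * D\<^sup>2) * (y powi (int c * j\<^sup>2) * y powi (-(2 * int c * j * D)))"
    "(y ^ c) powi ((D+j)\<^sup>2) = y powi (int c * D\<^sup>2) * (y powi (int c * j\<^sup>2) * y powi (2 * int c * j * D))"
    using y by (simp_all only: power_int_power powi_add)
  then show ?thesis by (simp add: sh_def algebra_simps)
qed

lemma sum_times_sinh:
  assumes y: "0 < y" "y < 1" and j: "j \<noteq> 0"
  shows "(\<Sum>i<m. y powi (2 * j * (2 * int i + 1 - int m))) = sh y (2 * j * int m) / sh y (2 * j)"
  using geometric_sinh[OF y(1), of "2 * j" m] sh_nonzero[OF y, of "2 * j"] j by (simp add: eq_divide_eq)

text \<open>
  The three expansions whose coefficients are visibly nonnegative; they equal products of three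
  theta functions by \<open>G1_eq\<close>, \<open>G2_eq\<close> and \<open>G3_eq\<close>.
\<close>

definition G1 where "G1 y = infsum (\<lambda>D. y powi (D\<^sup>2) * (ch (y\<^sup>2) D / sh (y\<^sup>2) D) * (\<Sum>i<nat D. y powi (-((2 * int i + 1 - D)\<^sup>2)))) OddP"
definition G2 where "G2 y = infsum (\<lambda>D. y powi (D\<^sup>2) * (1 / sh (y\<^sup>2) D) * (\<Sum>i<nat D. y powi (-((2 * int i - D)\<^sup>2)))) OddP"
definition G3 where "G3 y = infsum (\<lambda>D. y powi (4 * D\<^sup>2) * (ch (y ^ 4) D / sh (y ^ 4) D) * (\<Sum>i<2 * nat D. y powi (-((2 * int i + 1 - 2 * D)\<^sup>2)))) OddP"

lemma G_main_aux:
  assumes "T \<noteq> (0::real)" "\<And>D. D \<in> A \<Longrightarrow> T * f D = g D" "g summable_on A"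
  shows "f summable_on A" "T * infsum f A = infsum g A"
proof -
  have f: "f D = (1 / T) * g D" if "D \<in> A" for D using assms(2)[OF that] assms(1) by (simp add: field_simps)
  have "(\<lambda>D. (1 / T) * g D) summable_on A" by (rule summable_on_cmult_right[OF assms(3)])
  then show "f summable_on A" by (rule iffD2[OF summable_on_cong, rotated]) (rule f)
  have "infsum f A = infsum (\<lambda>D. (1 / T) * g D) A" by (rule infsum_cong) (rule f)
  then show "T * infsum f A = infsum g A" using assms(1) by (simp only: infsum_cmult_right') simp
qed

lemma thP_pos: fixes y :: real assumes y: "0 < y" "y < 1" shows "thP y > 0"
proof -
  have "(\<lambda>k. y powi (k\<^sup>2)) summable_on OddP" by (rule abs_summable_on_real[OF theta_summable[OF y]])
  from finite_sum_le_infsum[OF this, of "{1}"] y show ?thesis by (simp add: thP_def)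
qed

lemma G1_eq:
  assumes y: "0 < y" "y < 1"
  shows "(\<lambda>D. y powi (D\<^sup>2) * (ch (y\<^sup>2) D / sh (y\<^sup>2) D) * (\<Sum>i<nat D. y powi (-((2 * int i + 1 - D)\<^sup>2)))) summable_on OddP"
    "G1 y = thP y * (thE y)\<^sup>2"
proof -
  have y2: "0 < y\<^sup>2" "y\<^sup>2 < 1" using y by (auto simp: power_less_one_iff abs_square_less_1)
  have key: "thO y * (y powi (D\<^sup>2) * (ch (y\<^sup>2) D / sh (y\<^sup>2) D) * (\<Sum>i<nat D. y powi (-((2 * int i + 1 - D)\<^sup>2))))
    = infsum (\<lambda>j. (y powi ((D-j)\<^sup>2) - y powi ((D+j)\<^sup>2)) * (ch (y\<^sup>2) D / (sh (y\<^sup>2) D * sh (y\<^sup>2) j))) OddZ" if D: "D \<in> OddP" for D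
  proof -
    have "thO y * (\<Sum>i<nat D. 1 * y powi (-((2 * int i + 1 - D)\<^sup>2)))
       = infsum (\<lambda>j. y powi (j\<^sup>2) * (\<Sum>i<nat D. 1 * y powi (2 * j * (2 * int i + 1 - D)))) OddZ"
      unfolding thO_def by (rule theta_shift(1)[OF y, symmetric]) (use D in \<open>auto simp: translate_parity\<close>)
    also have "\<dots> = infsum (\<lambda>j. y powi (j\<^sup>2) * (sh y (2 * j * D) / sh y (2 * j))) OddZ"
    proof (rule infsum_cong)
      fix j :: int assume "j \<in> OddZ" then have "j \<noteq> 0" by auto
      from sum_times_sinh[OF y this, of "nat D"] D show "y powi (j\<^sup>2) * (\<Sum>i<nat D. 1 * y powi (2 * j * (2 * int i + 1 - D))) = y powi (j\<^sup>2) * (sh y (2 * j * D) / sh y (2 * j))"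
        by simp
    qed
    finally have e: "thO y * (\<Sum>i<nat D. y powi (-((2 * int i + 1 - D)\<^sup>2))) = infsum (\<lambda>j. y powi (j\<^sup>2) * (sh y (2 * j * D) / sh y (2 * j))) OddZ" by simp
    have "thO y * (y powi (D\<^sup>2) * (ch (y\<^sup>2) D / sh (y\<^sup>2) D) * (\<Sum>i<nat D. y powi (-((2 * int i + 1 - D)\<^sup>2))))
       = y powi (D\<^sup>2) * (ch (y\<^sup>2) D / sh (y\<^sup>2) D) * (thO y * (\<Sum>i<nat D. y powi (-((2 * int i + 1 - D)\<^sup>2))))"
      by (simp only: ac_simps)
    also have "\<dots> = infsum (\<lambda>j. y powi (D\<^sup>2) * (ch (y\<^sup>2) D / sh (y\<^sup>2) D) * (y powi (j\<^sup>2) * (sh y (2 * j * D) / sh y (2 * j)))) OddZ"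
      unfolding e by (rule infsum_cmult_right'[symmetric])
    also have "\<dots> = infsum (\<lambda>j. (y powi ((D-j)\<^sup>2) - y powi ((D+j)\<^sup>2)) * (ch (y\<^sup>2) D / (sh (y\<^sup>2) D * sh (y\<^sup>2) j))) OddZ"
      using square_difference_powi[OF y(1), of 1 D] y by (intro infsum_cong) (simp add: sh_power)
    finally show ?thesis .
  qed
  have T: "thO y \<noteq> 0" using thP_pos[OF y] thO_thP[OF y] by simp
  note G = G_main_aux[OF T key odd_kernels(1)[OF y y2], folded G1_def]
  show "(\<lambda>D. y powi (D\<^sup>2) * (ch (y\<^sup>2) D / sh (y\<^sup>2) D) * (\<Sum>i<nat D. y powi (-((2 * int i + 1 - D)\<^sup>2)))) summable_on OddP"
    by (rule G(1))
  have "thO y * G1 y = 2 * U (y\<^sup>2)" using G(2) odd_kernels(2)[OF y y2] by simp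
  then have "thP y * G1 y = thP y * (thP y * (thE y)\<^sup>2)"
    unfolding thO_thP[OF y] U_square[OF y] by (simp add: power2_eq_square ac_simps)
  then show "G1 y = thP y * (thE y)\<^sup>2" using thP_pos[OF y] by simp
qed

lemma trapezoid:
  fixes f :: "int \<Rightarrow> real"
  assumes "f (int m) = f (- int m)" "m > 0"
  shows "(\<Sum>i<m. f (2 * int i - int m)) = ((\<Sum>i<m+1. f (2 * int i + 1 - int (m+1))) + (\<Sum>i<m-1. f (2 * int i + 1 - int (m-1)))) / 2"
proof -
  obtain k where m: "m = Suc k" using assms(2) by (cases m) auto
  have "(\<Sum>i<m. f (2 * int i - int m)) = f (- int m) + (\<Sum>i<k. f (2 * int i + 1 - int k))"
    unfolding m sum.lessThan_Suc_shift by (simp add: algebra_simps)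
  moreover have "(\<Sum>i<m+1. f (2 * int i + 1 - int (m+1))) = (\<Sum>i<m. f (2 * int i - int m)) + f (int m)"
    by simp
  ultimately show ?thesis using assms(1) by (simp add: m)
qed

lemma sh_add_sub: "0 < y \<Longrightarrow> sh y (a + b) + sh y (a - b) = sh y a * ch y b"
proof -
  assume y: "0 < y"
  have "y powi (a+b) = y powi a * y powi b" "y powi (-(a+b)) = y powi (-a) * y powi (-b)"
    "y powi (a-b) = y powi a * y powi (-b)" "y powi (-(a-b)) = y powi (-a) * y powi b"
    using y power_int_add[of y a b] power_int_add[of y "-a" "-b"] power_int_add[of y a "-b"] power_int_add[of y "-a" b] by auto
  then show ?thesis unfolding sh_def ch_def by (simp only: algebra_simps)
qed

lemma G2_eq:
  assumes y: "0 < y" "y < 1"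
  shows "(\<lambda>D. y powi (D\<^sup>2) * (1 / sh (y\<^sup>2) D) * (\<Sum>i<nat D. y powi (-((2 * int i - D)\<^sup>2)))) summable_on OddP"
    "G2 y = (thP y)\<^sup>2 * thE y"
proof -
  have y2: "0 < y\<^sup>2" "y\<^sup>2 < 1" using y by (auto simp: power_less_one_iff abs_square_less_1)
  have key: "(2 * thE y) * (y powi (D\<^sup>2) * (1 / sh (y\<^sup>2) D) * (\<Sum>i<nat D. y powi (-((2 * int i - D)\<^sup>2))))
    = infsum (\<lambda>j. (y powi ((D-j)\<^sup>2) - y powi ((D+j)\<^sup>2)) * (ch (y\<^sup>2) j / (sh (y\<^sup>2) D * sh (y\<^sup>2) j))) OddZ" if D: "D \<in> OddP" for D
  proof -
    define m where "m = nat D"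
    have m: "odd m" "m > 0" "int m = D" using D by (auto simp: m_def even_nat_iff)
    let ?S = "\<lambda>m. \<Sum>i<m. y powi (-((2 * int i + 1 - int m)\<^sup>2))"
    let ?J = "\<lambda>m j. y powi (j\<^sup>2) * (sh y (2 * j * int m) / sh y (2 * j))"
    have S: "thE y * ?S m = infsum (?J m) OddZ" "?J m summable_on OddZ" if "even m" for m
    proof -
      have eq: "y powi (j\<^sup>2) * (\<Sum>i<m. 1 * y powi (2 * j * (2 * int i + 1 - int m))) = ?J m j" if "j \<in> OddZ" for j
      proof -
        have "j \<noteq> 0" using that by auto
        from sum_times_sinh[OF y this, of m] show ?thesis by simp
      qed
      have V: "infsum (\<lambda>k. y powi (k\<^sup>2)) ((\<lambda>j. j + (2 * int i + 1 - int m)) ` OddZ) = thE y" for i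
        using that by (simp add: translate_parity thE_def)
      note sh = theta_shift[OF y, where e = "\<lambda>_. 1" and I = "{..<m}" and B = OddZ and t = "\<lambda>i. 2 * int i + 1 - int m", OF _ V]
      show "thE y * ?S m = infsum (?J m) OddZ" using sh(1) infsum_cong[of OddZ, OF eq] by simp
      show "?J m summable_on OddZ" using sh(2) summable_on_cong[of OddZ, OF eq] by simp
    qed
    have tr: "2 * (\<Sum>i<m. y powi (-((2 * int i - int m)\<^sup>2))) = ?S (m+1) + ?S (m-1)"
      using trapezoid[of "\<lambda>t. y powi (-(t\<^sup>2))" m] m by simp
    have "2 * thE y * (\<Sum>i<m. y powi (-((2 * int i - int m)\<^sup>2))) = thE y * ?S (m+1) + thE y * ?S (m-1)"
      using arg_cong[OF tr, of "\<lambda>s. thE y * s"] by (simp only: algebra_simps)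
    also have "\<dots> = infsum (\<lambda>j. ?J (m+1) j + ?J (m-1) j) OddZ"
      using m S[of "m+1"] S[of "m-1"] infsum_add[of "?J (m+1)" OddZ "?J (m-1)"] by simp
    also have "\<dots> = infsum (\<lambda>j. y powi (j\<^sup>2) * (sh y (2 * j * D) * ch y (2 * j) / sh y (2 * j))) OddZ"
    proof (rule infsum_cong)
      fix j :: int
      have "sh y (2 * j * D + 2 * j) + sh y (2 * j * D - 2 * j) = sh y (2 * j * D) * ch y (2 * j)"
        by (rule sh_add_sub[OF y(1)])
      moreover have "2 * j * D + 2 * j = 2 * j * int (m+1)" "2 * j * D - 2 * j = 2 * j * int (m-1)"
        using m by (auto simp: algebra_simps of_nat_diff)
      ultimately have "sh y (2 * j * int (m+1)) + sh y (2 * j * int (m-1)) = sh y (2 * j * D) * ch y (2 * j)" by (simp only:)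
      then show "?J (m+1) j + ?J (m-1) j = y powi (j\<^sup>2) * (sh y (2 * j * D) * ch y (2 * j) / sh y (2 * j))"
        by (simp only: distrib_left [symmetric] add_divide_distrib [symmetric])
    qed
    finally have e: "2 * thE y * (\<Sum>i<nat D. y powi (-((2 * int i - D)\<^sup>2))) = \<dots>" using m by (simp only: m_def)
    have "(2 * thE y) * (y powi (D\<^sup>2) * (1 / sh (y\<^sup>2) D) * (\<Sum>i<nat D. y powi (-((2 * int i - D)\<^sup>2))))
      = (y powi (D\<^sup>2) * (1 / sh (y\<^sup>2) D)) * (2 * thE y * (\<Sum>i<nat D. y powi (-((2 * int i - D)\<^sup>2))))"
      by (simp only: ac_simps)
    also have "\<dots> = infsum (\<lambda>j. (y powi (D\<^sup>2) * (1 / sh (y\<^sup>2) D)) * (y powi (j\<^sup>2) * (sh y (2 * j * D) * ch y (2 * j) / sh y (2 * j)))) OddZ"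
      unfolding e by (rule infsum_cmult_right'[symmetric])
    also have "\<dots> = infsum (\<lambda>j. (y powi ((D-j)\<^sup>2) - y powi ((D+j)\<^sup>2)) * (ch (y\<^sup>2) j / (sh (y\<^sup>2) D * sh (y\<^sup>2) j))) OddZ"
      using square_difference_powi[OF y(1), of 1 D] y by (intro infsum_cong) (simp add: sh_power ch_power)
    finally show ?thesis .
  qed
  have T: "2 * thE y \<noteq> 0" using thE_pos[OF y] by simp
  note G = G_main_aux[OF T key odd_kernels(3)[OF y y2], folded G2_def]
  show "(\<lambda>D. y powi (D\<^sup>2) * (1 / sh (y\<^sup>2) D) * (\<Sum>i<nat D. y powi (-((2 * int i - D)\<^sup>2)))) summable_on OddP"
    by (rule G(1))
  have "2 * thE y * G2 y = 2 * U (y\<^sup>2)" using G(2) odd_kernels(4)[OF y y2] by simp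
  then have "thE y * G2 y = thE y * ((thP y)\<^sup>2 * thE y)"
    unfolding U_square[OF y] by (simp add: power2_eq_square ac_simps)
  then show "G2 y = (thP y)\<^sup>2 * thE y" using thE_pos[OF y] by simp
qed

lemma G3_eq:
  assumes y: "0 < y" "y < 1"
  shows "(\<lambda>D. y powi (4 * D\<^sup>2) * (ch (y ^ 4) D / sh (y ^ 4) D) * (\<Sum>i<2 * nat D. y powi (-((2 * int i + 1 - 2 * D)\<^sup>2)))) summable_on OddP"
    "G3 y = thO y * (thP y)\<^sup>2"
proof -
  have y4: "0 < y ^ 4" "y ^ 4 < 1" using y by (auto simp: power_less_one_iff)
  have cls: "infsum (\<lambda>k. y powi (k\<^sup>2)) {k. k mod 4 = 1} = thP y" "infsum (\<lambda>k. y powi (k\<^sup>2)) {k. k mod 4 = 3} = thP y"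
  proof -
    show "infsum (\<lambda>k. y powi (k\<^sup>2)) {k. k mod 4 = 1} = thP y"
      unfolding thP_def by (rule infsum_reindex_bij_witness[of _ "\<lambda>k. if k mod 4 = 1 then k else - k" abs]) (auto simp: abs_if split: if_splits, presburger+)
    show "infsum (\<lambda>k. y powi (k\<^sup>2)) {k. k mod 4 = 3} = thP y"
      unfolding thP_def by (rule infsum_reindex_bij_witness[of _ "\<lambda>k. if k mod 4 = 3 then k else - k" abs]) (auto simp: abs_if split: if_splits, presburger+)
  qed
  have key: "thP y * (y powi (4 * D\<^sup>2) * (ch (y ^ 4) D / sh (y ^ 4) D) * (\<Sum>i<2 * nat D. y powi (-((2 * int i + 1 - 2 * D)\<^sup>2))))
    = infsum (\<lambda>j. ((y ^ 4) powi ((D-j)\<^sup>2) - (y ^ 4) powi ((D+j)\<^sup>2)) * (ch (y ^ 4) D / (sh (y ^ 4) D * sh (y ^ 4) j))) OddZ" if D: "D \<in> OddP" for D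
  proof -
    have V: "infsum (\<lambda>k. y powi (k\<^sup>2)) ((\<lambda>j. j + (2 * int i + 1 - 2 * D)) ` {k. k mod 4 = 2}) = thP y" for i
    proof -
      define t where "t = 2 * int i + 1 - 2 * D"
      have "t mod 4 = 1 \<or> t mod 4 = 3" unfolding t_def by presburger
      then have "(\<lambda>j. j + t) ` {k. k mod 4 = 2} = {k. k mod 4 = 3} \<or> (\<lambda>j. j + t) ` {k. k mod 4 = 2} = {k. k mod 4 = 1}"
      proof
        assume "t mod 4 = 1"
        then have "(\<lambda>j. j + t) ` {k. k mod 4 = 2} = {k. k mod 4 = 3}"
          by (auto intro!: image_eqI[of _ _ "_ - t"]) presburger+
        then show ?thesis by simp
      next
        assume "t mod 4 = 3"
        then have "(\<lambda>j. j + t) ` {k. k mod 4 = 2} = {k. k mod 4 = 1}"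
          by (auto intro!: image_eqI[of _ _ "_ - t"]) presburger+
        then show ?thesis by simp
      qed
      then show ?thesis using cls unfolding t_def [symmetric] by auto
    qed
    have "thP y * (\<Sum>i<2 * nat D. 1 * y powi (-((2 * int i + 1 - 2 * D)\<^sup>2)))
       = infsum (\<lambda>j. y powi (j\<^sup>2) * (\<Sum>i<2 * nat D. 1 * y powi (2 * j * (2 * int i + 1 - 2 * D)))) {k. k mod 4 = 2}"
      by (rule theta_shift(1)[OF y _ V, symmetric]) simp
    also have "\<dots> = infsum (\<lambda>j. y powi ((2*j)\<^sup>2) * (\<Sum>i<2 * nat D. 1 * y powi (2 * (2 * j) * (2 * int i + 1 - 2 * D)))) OddZ"
    proof -
      have "{k::int. k mod 4 = 2} = (\<lambda>j. 2 * j) ` OddZ"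
      proof (intro equalityI subsetI)
        fix k :: int assume "k \<in> {k. k mod 4 = 2}"
        then have "k = 2 * (k div 2)" "k div 2 \<in> OddZ" by (simp, presburger)+
        then show "k \<in> (\<lambda>j. 2 * j) ` OddZ" by (rule image_eqI)
      next
        fix k :: int assume "k \<in> (\<lambda>j. 2 * j) ` OddZ"
        then obtain j where "k = 2 * j" "odd j" by auto
        then show "k \<in> {k. k mod 4 = 2}" by simp presburger
      qed
      then show ?thesis by (simp add: infsum_reindex inj_on_def o_def)
    qed
    also have "\<dots> = infsum (\<lambda>j. y powi (4 * j\<^sup>2) * (sh y (8 * j * D) / sh y (4 * j))) OddZ"
    proof (rule infsum_cong)
      fix j :: int assume "j \<in> OddZ" then have "2 * j \<noteq> 0" by auto
      from sum_times_sinh[OF y this, of "2 * nat D"] D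
      show "y powi ((2*j)\<^sup>2) * (\<Sum>i<2 * nat D. 1 * y powi (2 * (2 * j) * (2 * int i + 1 - 2 * D))) = y powi (4 * j\<^sup>2) * (sh y (8 * j * D) / sh y (4 * j))"
        by (simp add: power_mult_distrib mult.assoc)
    qed
    finally have e: "thP y * (\<Sum>i<2 * nat D. y powi (-((2 * int i + 1 - 2 * D)\<^sup>2))) = infsum (\<lambda>j. y powi (4 * j\<^sup>2) * (sh y (8 * j * D) / sh y (4 * j))) OddZ" by simp
    have "thP y * (y powi (4 * D\<^sup>2) * (ch (y ^ 4) D / sh (y ^ 4) D) * (\<Sum>i<2 * nat D. y powi (-((2 * int i + 1 - 2 * D)\<^sup>2))))
       = y powi (4 * D\<^sup>2) * (ch (y ^ 4) D / sh (y ^ 4) D) * (thP y * (\<Sum>i<2 * nat D. y powi (-((2 * int i + 1 - 2 * D)\<^sup>2))))"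
      by (simp only: ac_simps)
    also have "\<dots> = infsum (\<lambda>j. y powi (4 * D\<^sup>2) * (ch (y ^ 4) D / sh (y ^ 4) D) * (y powi (4 * j\<^sup>2) * (sh y (8 * j * D) / sh y (4 * j)))) OddZ"
      unfolding e by (rule infsum_cmult_right'[symmetric])
    also have "\<dots> = infsum (\<lambda>j. ((y ^ 4) powi ((D-j)\<^sup>2) - (y ^ 4) powi ((D+j)\<^sup>2)) * (ch (y ^ 4) D / (sh (y ^ 4) D * sh (y ^ 4) j))) OddZ"
      unfolding square_difference_powi[OF y(1)] using y by (intro infsum_cong) (simp add: sh_power)
    finally show ?thesis .
  qed
  have T: "thP y \<noteq> 0" using thP_pos[OF y] by simp
  note G = G_main_aux[OF T key odd_kernels(1)[OF y4 y4], folded G3_def]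
  show "(\<lambda>D. y powi (4 * D\<^sup>2) * (ch (y ^ 4) D / sh (y ^ 4) D) * (\<Sum>i<2 * nat D. y powi (-((2 * int i + 1 - 2 * D)\<^sup>2)))) summable_on OddP"
    by (rule G(1))
  have "thP y * G3 y = 2 * U (y ^ 4)" using G(2) odd_kernels(2)[OF y4 y4] by simp
  then have "thP y * G3 y = thP y * (thO y * (thP y)\<^sup>2)"
    unfolding thO_thP[OF y] U_square[OF y] by (simp add: power2_eq_square power4_eq_xxxx ac_simps)
  then show "G3 y = thO y * (thP y)\<^sup>2" using thP_pos[OF y] by simp
qed

section \<open>Representations by three squares\<close>

lemma power_series_zero:
  fixes d :: "nat \<Rightarrow> real"
  assumes s: "\<And>y. 0 < y \<Longrightarrow> y < 1 \<Longrightarrow> (\<lambda>n. d n * y ^ n) sums 0"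
  shows "d n = 0"
proof (induction n rule: less_induct)
  case (less N)
  define b where "b n = d (n + N)" for n
  have bs: "(\<lambda>n. b n * y ^ n) sums 0" if y: "0 < y" "y < 1" for y
  proof -
    have "(\<lambda>n. d (n + N) * y ^ (n + N)) sums (0 - (\<Sum>n<N. d n * y ^ n))"
      by (rule sums_split_initial_segment[OF s[OF y]])
    then have "(\<lambda>n. (d (n + N) * y ^ (n + N)) * inverse (y ^ N)) sums (0 * inverse (y ^ N))"
      by (intro sums_mult2) (simp add: less.IH)
    then show ?thesis using y by (simp add: b_def power_add field_simps)
  qed
  define f where "f y = (\<Sum>n. b n * y ^ n)" for y
  have "(f \<longlongrightarrow> b 0) (at 0)"
  proof (rule powser_limit_0[of "1/2"])
    fix y :: real assume "norm y < 1/2"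
    then have "summable (\<lambda>n. b n * y ^ n)"
      using bs[of "1/2"] by (intro powser_inside[of b "1/2" y]) (auto simp: sums_iff)
    then show "(\<lambda>n. b n * y ^ n) sums f y" by (simp add: f_def summable_sums)
  qed simp
  then have "(f \<longlongrightarrow> b 0) (at_right 0)" by (rule filterlim_mono) (auto simp: at_le)
  moreover have "eventually (\<lambda>y::real. f y = 0) (at_right 0)"
    unfolding eventually_at_right_field by (intro exI[of _ 1]) (use bs in \<open>auto simp: f_def sums_iff\<close>)
  then have "(f \<longlongrightarrow> 0) (at_right 0)" by (rule tendsto_eventually)
  ultimately have "b 0 = 0" using tendsto_unique trivial_limit_at_right_real by blast
  then show ?case by (simp add: b_def)
qed

lemma weighted_sum_power_series:
  fixes w :: "'a \<Rightarrow> nat"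
  assumes s: "\<And>y::real. 0 < y \<Longrightarrow> y < 1 \<Longrightarrow> (\<lambda>a. y ^ w a) summable_on A"
  shows "\<exists>c :: nat \<Rightarrow> real. (\<forall>y. 0 < y \<longrightarrow> y < 1 \<longrightarrow> (\<lambda>n. c n * y ^ n) sums infsum (\<lambda>a. y ^ w a) A)
    \<and> (\<forall>n. c n \<noteq> 0 \<longleftrightarrow> (\<exists>a\<in>A. w a = n))"
proof (intro exI conjI allI impI)
  fix y :: real assume y: "0 < y" "y < 1"
  define F where "F n = {a\<in>A. w a = n}" for n
  define c where "c n = infsum (\<lambda>_. 1::real) (F n)" for n
  show "(\<lambda>n. infsum (\<lambda>_. 1::real) {a\<in>A. w a = n} * y ^ n) sums infsum (\<lambda>a. y ^ w a) A"
  proof -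
    have S: "(\<lambda>(n,a). y ^ n) summable_on (Sigma UNIV F)"
      by (rule iffD1[OF summable_on_reindex_bij_witness[of _ snd "\<lambda>a. (w a, a)"] s[OF y]]) (auto simp: F_def)
    have "infsum (\<lambda>a. y ^ w a) A = infsum (\<lambda>(n,a). y ^ n) (Sigma UNIV F)"
      by (rule infsum_reindex_bij_witness[of _ snd "\<lambda>a. (w a, a)"]) (auto simp: F_def)
    also have "\<dots> = infsum (\<lambda>n. infsum (\<lambda>_. y ^ n) (F n)) UNIV" using infsum_Sigma_banach[OF S] by simp
    also have "(\<lambda>n. infsum (\<lambda>_. y ^ n) (F n)) = (\<lambda>n. c n * y ^ n)"
      unfolding c_def infsum_cmult_left'[symmetric] by simp
    finally have e: "infsum (\<lambda>n. c n * y ^ n) UNIV = infsum (\<lambda>a. y ^ w a) A" by simp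
    have "(\<lambda>n. infsum (\<lambda>_. y ^ n) (F n)) summable_on UNIV" by (rule summable_on_Sigma_banach[OF S])
    also have "(\<lambda>n. infsum (\<lambda>_. y ^ n) (F n)) = (\<lambda>n. c n * y ^ n)"
      unfolding c_def infsum_cmult_left'[symmetric] by simp
    finally have "(\<lambda>n. c n * y ^ n) sums infsum (\<lambda>a. y ^ w a) A" using e by (intro has_sum_imp_sums) (simp add: has_sum_iff)
    then show ?thesis unfolding c_def F_def .
  qed
next
  fix n
  define F where "F n = {a\<in>A. w a = n}" for n
  define c where "c n = infsum (\<lambda>_. 1::real) (F n)" for n
  show "infsum (\<lambda>_. 1::real) {a\<in>A. w a = n} \<noteq> 0 \<longleftrightarrow> (\<exists>a\<in>A. w a = n)"
    unfolding F_def [symmetric] c_def [symmetric]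
  proof
    assume "\<exists>a\<in>A. w a = n"
    then obtain a where a: "a \<in> F n" by (auto simp: F_def)
    have "(\<lambda>a. (1/2::real) ^ w a) summable_on F n"
      by (rule summable_on_subset_banach[OF s[of "1/2"]]) (auto simp: F_def)
    then have "(\<lambda>a. 2 ^ n * (1/2::real) ^ w a) summable_on F n" by (rule summable_on_cmult_right)
    then have "(\<lambda>a. 1::real) summable_on F n"
      by (rule iffD1[OF summable_on_cong, rotated]) (simp add: F_def power_divide)
    from finite_sum_le_infsum[OF this, of "{a}"] a show "c n \<noteq> 0" by (simp add: c_def)
  next
    assume "c n \<noteq> 0"
    then have "F n \<noteq> {}" by (auto simp: c_def)
    then show "\<exists>a\<in>A. w a = n" by (auto simp: F_def)
  qed
qed

text \<open>
  Equal functions on \<open>(0,1)\<close> have the same power series, and as no cancellation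
  occurs, an exponent is attained iff its coefficient is positive.
\<close>

lemma representation_transfer:
  fixes w :: "'a \<Rightarrow> nat" and v :: "'b \<Rightarrow> nat"
  assumes A: "\<And>y::real. 0 < y \<Longrightarrow> y < 1 \<Longrightarrow> (\<lambda>a. y ^ w a) summable_on A"
    and B: "\<And>y::real. 0 < y \<Longrightarrow> y < 1 \<Longrightarrow> (\<lambda>b. y ^ v b) summable_on B"
    and eq: "\<And>y::real. 0 < y \<Longrightarrow> y < 1 \<Longrightarrow> infsum (\<lambda>a. y ^ w a) A = infsum (\<lambda>b. y ^ v b) B"
    and b: "b \<in> B"
  shows "\<exists>a\<in>A. w a = v b"
proof -
  have "\<exists>c :: nat \<Rightarrow> real. (\<forall>y. 0 < y \<longrightarrow> y < 1 \<longrightarrow> (\<lambda>n. c n * y ^ n) sums infsum (\<lambda>a. y ^ w a) A)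
    \<and> (\<forall>n. c n \<noteq> 0 \<longleftrightarrow> (\<exists>a\<in>A. w a = n))"
    by (rule weighted_sum_power_series) (rule A)
  then obtain c :: "nat \<Rightarrow> real" where
    c: "\<forall>y. 0 < y \<longrightarrow> y < 1 \<longrightarrow> (\<lambda>n. c n * y ^ n) sums infsum (\<lambda>a. y ^ w a) A" "\<forall>n. c n \<noteq> 0 \<longleftrightarrow> (\<exists>a\<in>A. w a = n)"
    by blast
  have "\<exists>c :: nat \<Rightarrow> real. (\<forall>y. 0 < y \<longrightarrow> y < 1 \<longrightarrow> (\<lambda>n. c n * y ^ n) sums infsum (\<lambda>a. y ^ v a) B)
    \<and> (\<forall>n. c n \<noteq> 0 \<longleftrightarrow> (\<exists>a\<in>B. v a = n))"
    by (rule weighted_sum_power_series) (rule B)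
  then obtain d :: "nat \<Rightarrow> real" where
    d: "\<forall>y. 0 < y \<longrightarrow> y < 1 \<longrightarrow> (\<lambda>n. d n * y ^ n) sums infsum (\<lambda>b. y ^ v b) B" "\<forall>n. d n \<noteq> 0 \<longleftrightarrow> (\<exists>b\<in>B. v b = n)"
    by blast
  have "(\<lambda>n. (c n - d n) * y ^ n) sums 0" if "0 < y" "y < 1" for y
    using sums_diff[OF c(1)[rule_format, OF that] d(1)[rule_format, OF that]] eq[OF that] by (simp add: left_diff_distrib)
  from power_series_zero[of "\<lambda>n. c n - d n", OF this] have "c n = d n" for n by simp
  then show ?thesis using c(2) d(2) b by metis
qed

lemma has_sum_coth:
  assumes x: "0 < x" "x < (1::real)" and D: "D > 0"
  shows "infsum (\<lambda>h::int. x powi (2 * D * \<bar>h\<bar>)) UNIV = ch x D / sh x D" "(\<lambda>h::int. x powi (2 * D * \<bar>h\<bar>)) summable_on UNIV"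
proof -
  define z where "z = x powi (2 * D)"
  have z: "0 < z" "z < 1" using x D power_int_strict_decreasing[of 0 "2 * D" x] by (auto simp: z_def)
  have e: "x powi (2 * D * \<bar>h\<bar>) = z ^ nat \<bar>h\<bar>" for h
    by (simp add: z_def power_int_mult power_int_nonneg_exp)
  show "(\<lambda>h::int. x powi (2 * D * \<bar>h\<bar>)) summable_on UNIV" unfolding e by (rule geometric_summable_int[OF z])
  let ?P = "{h::int. h > 0}"
  have sP: "(\<lambda>h. z ^ nat \<bar>h\<bar>) summable_on A" for A by (rule geometric_summable_int[OF z])
  have "infsum (\<lambda>h. z ^ nat \<bar>h\<bar>) ?P = infsum (\<lambda>n. z ^ Suc n) UNIV"
  proof (rule infsum_reindex_bij_witness[of _ "\<lambda>n. int (Suc n)" "\<lambda>h. nat (h - 1)"])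
    fix h :: int assume "h \<in> ?P"
    then have "nat \<bar>h\<bar> = Suc (nat (h - 1))" by simp
    then show "z ^ Suc (nat (h - 1)) = z ^ nat \<bar>h\<bar>" by simp
  qed auto
  also have "\<dots> = z / (1 - z)"
  proof -
    have "(\<lambda>n. z * z ^ n) sums (z * (1 / (1 - z)))" using z by (intro sums_mult geometric_sums) auto
    then show ?thesis using z by (intro infsumI sums_nonneg_imp_has_sum) simp_all
  qed
  finally have P: "infsum (\<lambda>h. z ^ nat \<bar>h\<bar>) ?P = z / (1 - z)" .
  have split: "UNIV - {0::int} = ?P \<union> uminus ` ?P"
  proof (intro equalityI subsetI)
    fix h :: int assume "h \<in> UNIV - {0}"
    then show "h \<in> ?P \<union> uminus ` ?P" by (cases "h > 0") (auto intro!: image_eqI[of _ _ "-h"])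
  qed auto
  have "infsum (\<lambda>h. z ^ nat \<bar>h\<bar>) (UNIV - {0}) = 2 * (z / (1 - z))"
    by (subst infsum_symmetric[OF split _ sP]) (simp_all add: P)
  then have "infsum (\<lambda>h. z ^ nat \<bar>h\<bar>) UNIV = 1 + 2 * (z / (1 - z))"
    using infsum_insert[OF sP, of "0::int" "UNIV - {0}"] by (simp add: insert_UNIV)
  also have "\<dots> = (1 + z) / (1 - z)" using z by (simp add: field_simps)
  also have "\<dots> = ch x D / sh x D"
  proof -
    have "z = x powi D * x powi D" using x powi_double by (simp add: z_def)
    then have "ch x D = x powi (-D) * (1 + z)" "sh x D = x powi (-D) * (1 - z)"
      using x by (simp_all add: ch_def sh_def power_int_minus field_simps)
    then show ?thesis using x by simp
  qed
  finally show "infsum (\<lambda>h::int. x powi (2 * D * \<bar>h\<bar>)) UNIV = ch x D / sh x D" unfolding e .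
qed

lemma has_sum_csch:
  assumes x: "0 < x" "x < (1::real)" and D: "D > 0"
  shows "((\<lambda>h::nat. x powi (2 * D * int h + D)) has_sum 1 / sh x D) UNIV"
proof -
  define u where "u = x powi D"
  have u: "0 < u" "u < 1" using x D power_int_strict_decreasing[of 0 D x] by (auto simp: u_def)
  have e: "x powi (2 * D * int h + D) = u ^ (2 * h + 1)" for h
    unfolding u_def power_int_power' by (simp add: algebra_simps)
  have "1 / sh x D = u / (1 - u\<^sup>2)"
    using x u by (simp add: sh_def power_int_minus u_def [symmetric] power2_eq_square divide_simps)
  then show ?thesis unfolding e using has_sum_odd_powers[OF u] by simp
qed

lemma infsum_Sigma_weights:
  fixes f :: "'a \<Rightarrow> 'b \<Rightarrow> real" and g :: "'a \<Rightarrow> nat \<Rightarrow> real"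
  assumes s: "(\<lambda>D. c D * F D * (\<Sum>i\<in>I D. g D i)) summable_on A"
    and nn: "\<And>D. c D \<ge> 0" "\<And>D h. f D h \<ge> 0" "\<And>D i. g D i \<ge> 0"
    and fI: "\<And>D. finite (I D)"
    and F: "\<And>D. D \<in> A \<Longrightarrow> (f D has_sum F D) UNIV"
  shows "(\<lambda>(D,h,i). c D * f D h * g D i) summable_on (Sigma A (\<lambda>D. UNIV \<times> I D))"
    and "infsum (\<lambda>(D,h,i). c D * f D h * g D i) (Sigma A (\<lambda>D. UNIV \<times> I D)) = infsum (\<lambda>D. c D * F D * (\<Sum>i\<in>I D. g D i)) A"
proof -
  have inner: "((\<lambda>(h,i). c D * f D h * g D i) has_sum (c D * F D * (\<Sum>i\<in>I D. g D i))) (UNIV \<times> I D)" if D: "D \<in> A" for D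
  proof -
    have F1: "(\<lambda>h. f D h) abs_summable_on UNIV" using has_sum_imp_summable[OF F[OF D]] nn by simp
    have G1: "g D abs_summable_on I D" using fI by simp
    have 1: "(\<lambda>(h,i). f D h * g D i) summable_on (UNIV \<times> I D)"
      by (rule abs_summable_on_real[OF product_abs_summable[OF F1 G1]])
    have 2: "infsum (\<lambda>(h,i). f D h * g D i) (UNIV \<times> I D) = F D * (\<Sum>i\<in>I D. g D i)"
      using infsum_product[OF F1 G1] infsumI[OF F[OF D]] fI by simp
    have "((\<lambda>(h,i). f D h * g D i) has_sum F D * (\<Sum>i\<in>I D. g D i)) (UNIV \<times> I D)"
      using 1 2 by (simp add: has_sum_iff)
    from has_sum_cmult_right[OF this, of "c D"] show ?thesis by (simp add: case_prod_unfold mult.assoc)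
  qed
  show S: "(\<lambda>(D,h,i). c D * f D h * g D i) summable_on (Sigma A (\<lambda>D. UNIV \<times> I D))"
    by (rule summable_on_SigmaI[where g = "\<lambda>D. c D * F D * (\<Sum>i\<in>I D. g D i)"]) (use inner s nn in auto)
  show "infsum (\<lambda>(D,h,i). c D * f D h * g D i) (Sigma A (\<lambda>D. UNIV \<times> I D)) = infsum (\<lambda>D. c D * F D * (\<Sum>i\<in>I D. g D i)) A"
    using infsum_Sigma_banach[OF S] infsumI[OF inner] by (simp cong: infsum_cong)
qed

lemma three_theta:
  fixes y :: real assumes y: "0 < y" "y < 1"
  shows "(\<lambda>(a,b,c). y ^ nat (a\<^sup>2 + (b\<^sup>2 + c\<^sup>2))) summable_on A \<times> B \<times> C"
    "infsum (\<lambda>(a,b,c). y ^ nat (a\<^sup>2 + (b\<^sup>2 + c\<^sup>2))) (A \<times> B \<times> C)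
      = infsum (\<lambda>k. y powi (k\<^sup>2)) A * (infsum (\<lambda>k. y powi (k\<^sup>2)) B * infsum (\<lambda>k. y powi (k\<^sup>2)) C)"
proof -
  note t = theta_summable[OF y]
  have e: "y ^ nat (a\<^sup>2 + (b\<^sup>2 + c\<^sup>2)) = y powi (a\<^sup>2) * (y powi (b\<^sup>2) * y powi (c\<^sup>2))" for a b c
    using y by (simp add: power_int_nonneg_exp [symmetric] powi_add)
  have P: "(\<lambda>(b,c). y powi (b\<^sup>2) * y powi (c\<^sup>2)) abs_summable_on B \<times> C" by (rule product_abs_summable[OF t t])
  have s: "(\<lambda>(a,p). y powi (a\<^sup>2) * (case p of (b,c) \<Rightarrow> y powi (b\<^sup>2) * y powi (c\<^sup>2))) abs_summable_on A \<times> B \<times> C"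
    by (rule product_abs_summable[OF t P])
  have r: "(\<lambda>(a,b,c). y ^ nat (a\<^sup>2 + (b\<^sup>2 + c\<^sup>2))) = (\<lambda>(a,p). y powi (a\<^sup>2) * (case p of (b,c) \<Rightarrow> y powi (b\<^sup>2) * y powi (c\<^sup>2)))"
    by (auto simp: e)
  show "(\<lambda>(a,b,c). y ^ nat (a\<^sup>2 + (b\<^sup>2 + c\<^sup>2))) summable_on A \<times> B \<times> C"
    unfolding r by (rule abs_summable_on_real[OF s])
  show "infsum (\<lambda>(a,b,c). y ^ nat (a\<^sup>2 + (b\<^sup>2 + c\<^sup>2))) (A \<times> B \<times> C)
      = infsum (\<lambda>k. y powi (k\<^sup>2)) A * (infsum (\<lambda>k. y powi (k\<^sup>2)) B * infsum (\<lambda>k. y powi (k\<^sup>2)) C)"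
    unfolding r by (subst infsum_product[OF t P], subst infsum_product[OF t t]) simp
qed

lemma power_less_one_real: "0 < y \<Longrightarrow> y < (1::real) \<Longrightarrow> n > 0 \<Longrightarrow> 0 < y ^ n \<and> y ^ n < 1"
  by (simp add: power_less_one_iff)

lemma odd_small_square: "\<bar>t\<bar> \<le> D \<Longrightarrow> t\<^sup>2 \<le> (D::int)\<^sup>2"
  by (metis abs_le_square_iff abs_of_nonneg abs_ge_zero order_trans)

text \<open>
  An exponent that occurs in the expansion with hyperbolic kernels also occurs in the product of
  three theta functions.
\<close>

lemma three_squares_from_expansion:
  fixes c :: "int \<Rightarrow> int" and m :: "int \<Rightarrow> 'h \<Rightarrow> int" and t :: "int \<Rightarrow> nat \<Rightarrow> int" and I :: "int \<Rightarrow> nat set"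
  assumes s: "\<And>y::real. 0 < y \<Longrightarrow> y < 1 \<Longrightarrow> (\<lambda>D. y powi (c D) * F y D * (\<Sum>i\<in>I D. y powi (-((t D i)\<^sup>2)))) summable_on OddP"
    and eq: "\<And>y::real. 0 < y \<Longrightarrow> y < 1 \<Longrightarrow> infsum (\<lambda>D. y powi (c D) * F y D * (\<Sum>i\<in>I D. y powi (-((t D i)\<^sup>2)))) OddP
        = infsum (\<lambda>k. y powi (k\<^sup>2)) A * (infsum (\<lambda>k. y powi (k\<^sup>2)) B * infsum (\<lambda>k. y powi (k\<^sup>2)) C)"
    and F: "\<And>y D. 0 < y \<Longrightarrow> y < 1 \<Longrightarrow> D \<in> OddP \<Longrightarrow> ((\<lambda>h. y powi (m D h)) has_sum F y D) UNIV"
    and fI: "\<And>D. finite (I D)"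
    and pos: "\<And>D h i. D \<in> OddP \<Longrightarrow> i \<in> I D \<Longrightarrow> c D + m D h - (t D i)\<^sup>2 \<ge> 0"
    and D: "D \<in> OddP" "i \<in> I D"
  shows "\<exists>x\<in>A. \<exists>y\<in>B. \<exists>z\<in>C. c D + m D h - (t D i)\<^sup>2 = x\<^sup>2 + (y\<^sup>2 + z\<^sup>2)"
proof -
  let ?w = "\<lambda>(a,b,c). nat (a\<^sup>2 + (b\<^sup>2 + c\<^sup>2))"
  let ?v = "\<lambda>(D,h,i). nat (c D + m D h - (t D i)\<^sup>2)"
  let ?S = "Sigma OddP (\<lambda>D. (UNIV :: 'h set) \<times> I D)"
  have "\<exists>p\<in>A \<times> B \<times> C. ?w p = ?v (D,h,i)"
  proof (rule representation_transfer[where B = ?S])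
    fix y :: real assume y: "0 < y" "y < 1"
    have e: "y ^ ?v p = (case p of (D,h,i) \<Rightarrow> y powi (c D) * y powi (m D h) * y powi (-((t D i)\<^sup>2)))" if p: "p \<in> ?S" for p
    proof -
      obtain D h i where p1: "p = (D,h,i)" by (cases p)
      with p have "D \<in> OddP" "i \<in> I D" by auto
      then have "c D + m D h - (t D i)\<^sup>2 \<ge> 0" by (rule pos)
      then have "y ^ ?v p = y powi ((c D + m D h) + (-((t D i)\<^sup>2)))" by (simp add: p1 power_int_nonneg_exp)
      then show ?thesis by (simp only: p1 powi_add[OF y(1)] prod.case)
    qed
    have nn: "y powi k \<ge> 0" for k using y by simp
    note I = infsum_Sigma_weights[OF s[OF y] nn nn nn fI F[OF y]]
    show "(\<lambda>b. y ^ ?v b) summable_on ?S"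
      by (rule iffD2[OF summable_on_cong[OF e] I(1)])
    have "infsum (\<lambda>b. y ^ ?v b) ?S = infsum (\<lambda>(D,h,i). y powi (c D) * y powi (m D h) * y powi (-((t D i)\<^sup>2))) ?S"
      by (rule infsum_cong[OF e])
    also note I(2)
    also note eq[OF y]
    also note three_theta(2)[OF y, symmetric]
    finally show "infsum (\<lambda>a. y ^ ?w a) (A \<times> B \<times> C) = infsum (\<lambda>b. y ^ ?v b) ?S"
      by (simp add: case_prod_unfold)
    show "(\<lambda>a. y ^ ?w a) summable_on A \<times> B \<times> C" using three_theta(1)[OF y] by (simp add: case_prod_unfold)
  next
    show "(D,h,i) \<in> ?S" using D by simp
  qed
  then obtain x y z where xyz: "x \<in> A" "y \<in> B" "z \<in> C" and "nat (x\<^sup>2 + (y\<^sup>2 + z\<^sup>2)) = nat (c D + m D h - (t D i)\<^sup>2)" by auto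
  moreover have "x\<^sup>2 + (y\<^sup>2 + z\<^sup>2) \<ge> 0" by simp
  ultimately have "c D + m D h - (t D i)\<^sup>2 = x\<^sup>2 + (y\<^sup>2 + z\<^sup>2)" using pos[OF D, of h] by linarith
  with xyz show ?thesis by blast
qed

text \<open>
  The exponents \<open>1 + 4 N\<close> occur in \<open>G1\<close> already for \<open>D =
  1\<close>.
\<close>

theorem three_squares_1_mod_4:
  "\<exists>x y z::int. odd x \<and> even y \<and> even z \<and> 1 + 4 * int N = x\<^sup>2 + (y\<^sup>2 + z\<^sup>2)"
proof -
  have "\<exists>x\<in>OddP. \<exists>y\<in>EvenZ. \<exists>z\<in>EvenZ. (1::int)\<^sup>2 + 4 * 1 * \<bar>int N\<bar> - (2 * int 0 + 1 - 1)\<^sup>2 = x\<^sup>2 + (y\<^sup>2 + z\<^sup>2)"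
  proof (rule three_squares_from_expansion[where c = "\<lambda>D. D\<^sup>2" and m = "\<lambda>D h. 4 * D * \<bar>h\<bar>" and t = "\<lambda>D i. 2 * int i + 1 - D"
        and F = "\<lambda>y D. ch (y\<^sup>2) D / sh (y\<^sup>2) D" and I = "\<lambda>D. {..<nat D}"])
    fix y :: real assume y: "0 < y" "y < 1"
    show "(\<lambda>D. y powi D\<^sup>2 * (ch (y\<^sup>2) D / sh (y\<^sup>2) D) * (\<Sum>i<nat D. y powi - (2 * int i + 1 - D)\<^sup>2)) summable_on OddP"
      by (rule G1_eq(1)[OF y])
    show "infsum (\<lambda>D. y powi D\<^sup>2 * (ch (y\<^sup>2) D / sh (y\<^sup>2) D) * (\<Sum>i<nat D. y powi - (2 * int i + 1 - D)\<^sup>2)) OddP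
      = infsum (\<lambda>k. y powi k\<^sup>2) OddP * (infsum (\<lambda>k. y powi k\<^sup>2) EvenZ * infsum (\<lambda>k. y powi k\<^sup>2) EvenZ)"
      using G1_eq(2)[OF y] unfolding G1_def thP_def thE_def power2_eq_square[of "infsum _ _"] .
  next
    fix y :: real and D :: int assume y: "0 < y" "y < 1" and D: "D \<in> OddP"
    have y2: "0 < y\<^sup>2" "y\<^sup>2 < 1" using power_less_one_real[OF y, of 2] by auto
    show "((\<lambda>h. y powi (4 * D * \<bar>h\<bar>)) has_sum ch (y\<^sup>2) D / sh (y\<^sup>2) D) UNIV"
      using has_sum_coth[OF y2, of D] D by (simp add: has_sum_iff power_int_power mult.assoc)
  next
    fix D h :: int and i :: nat assume D: "D \<in> OddP" "i \<in> {..<nat D}"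
    have "(2 * int i + 1 - D)\<^sup>2 \<le> D\<^sup>2" by (rule odd_small_square) (use D in auto)
    moreover have "0 \<le> 4 * D * \<bar>h\<bar>" using D by simp
    ultimately show "0 \<le> D\<^sup>2 + 4 * D * \<bar>h\<bar> - (2 * int i + 1 - D)\<^sup>2" by linarith
  qed auto
  then show ?thesis by auto
qed

text \<open>
  The exponents \<open>2 + 4 N\<close> occur in \<open>G2\<close> already for \<open>D =
  1\<close>.
\<close>

theorem three_squares_2_mod_4:
  "\<exists>x y z::int. odd x \<and> odd y \<and> even z \<and> 2 + 4 * int N = x\<^sup>2 + (y\<^sup>2 + z\<^sup>2)"
proof -
  have "\<exists>x\<in>OddP. \<exists>y\<in>OddP. \<exists>z\<in>EvenZ. (1::int)\<^sup>2 + (4 * 1 * int N + 2 * 1) - (2 * int 0 - 1)\<^sup>2 = x\<^sup>2 + (y\<^sup>2 + z\<^sup>2)"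
  proof (rule three_squares_from_expansion[where c = "\<lambda>D. D\<^sup>2" and m = "\<lambda>D h. 4 * D * int h + 2 * D" and t = "\<lambda>D i. 2 * int i - D"
        and F = "\<lambda>y D. 1 / sh (y\<^sup>2) D" and I = "\<lambda>D. {..<nat D}"])
    fix y :: real assume y: "0 < y" "y < 1"
    show "(\<lambda>D. y powi D\<^sup>2 * (1 / sh (y\<^sup>2) D) * (\<Sum>i<nat D. y powi - (2 * int i - D)\<^sup>2)) summable_on OddP"
      by (rule G2_eq(1)[OF y])
    show "infsum (\<lambda>D. y powi D\<^sup>2 * (1 / sh (y\<^sup>2) D) * (\<Sum>i<nat D. y powi - (2 * int i - D)\<^sup>2)) OddP
      = infsum (\<lambda>k. y powi k\<^sup>2) OddP * (infsum (\<lambda>k. y powi k\<^sup>2) OddP * infsum (\<lambda>k. y powi k\<^sup>2) EvenZ)"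
      using G2_eq(2)[OF y] unfolding G2_def thP_def thE_def power2_eq_square[of "infsum _ _"] mult.assoc .
  next
    fix y :: real and D :: int assume y: "0 < y" "y < 1" and D: "D \<in> OddP"
    have y2: "0 < y\<^sup>2" "y\<^sup>2 < 1" using power_less_one_real[OF y, of 2] by auto
    have "4 * D * int h + 2 * D = int 2 * (2 * D * int h + D)" for h by simp
    then show "((\<lambda>h. y powi (4 * D * int h + 2 * D)) has_sum 1 / sh (y\<^sup>2) D) UNIV"
      using has_sum_csch[OF y2, of D] D by (simp only: power_int_power) auto
  next
    fix D :: int and h i :: nat assume D: "D \<in> OddP" "i \<in> {..<nat D}"
    have "(2 * int i - D)\<^sup>2 \<le> D\<^sup>2" by (rule odd_small_square) (use D in auto)
    moreover have "0 \<le> 4 * D * int h" "0 \<le> 2 * D" using D by auto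
    ultimately show "0 \<le> D\<^sup>2 + (4 * D * int h + 2 * D) - (2 * int i - D)\<^sup>2" by linarith
  qed auto
  then show ?thesis by auto
qed

text \<open>
  The exponents \<open>3 + 8 N\<close> occur in \<open>G3\<close> already for \<open>D =
  1\<close>.
\<close>

theorem three_squares_3_mod_8:
  "\<exists>x y z::int. odd x \<and> odd y \<and> odd z \<and> 3 + 8 * int N = x\<^sup>2 + (y\<^sup>2 + z\<^sup>2)"
proof -
  have "\<exists>x\<in>OddZ. \<exists>y\<in>OddP. \<exists>z\<in>OddP. 4 * (1::int)\<^sup>2 + 8 * 1 * \<bar>int N\<bar> - (2 * int 0 + 1 - 2 * 1)\<^sup>2 = x\<^sup>2 + (y\<^sup>2 + z\<^sup>2)"
  proof (rule three_squares_from_expansion[where c = "\<lambda>D. 4 * D\<^sup>2" and m = "\<lambda>D h. 8 * D * \<bar>h\<bar>" and t = "\<lambda>D i. 2 * int i + 1 - 2 * D"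
        and F = "\<lambda>y D. ch (y ^ 4) D / sh (y ^ 4) D" and I = "\<lambda>D. {..<2 * nat D}"])
    fix y :: real assume y: "0 < y" "y < 1"
    show "(\<lambda>D. y powi (4 * D\<^sup>2) * (ch (y ^ 4) D / sh (y ^ 4) D) * (\<Sum>i<2 * nat D. y powi - (2 * int i + 1 - 2 * D)\<^sup>2)) summable_on OddP"
      by (rule G3_eq(1)[OF y])
    show "infsum (\<lambda>D. y powi (4 * D\<^sup>2) * (ch (y ^ 4) D / sh (y ^ 4) D) * (\<Sum>i<2 * nat D. y powi - (2 * int i + 1 - 2 * D)\<^sup>2)) OddP
      = infsum (\<lambda>k. y powi k\<^sup>2) OddZ * (infsum (\<lambda>k. y powi k\<^sup>2) OddP * infsum (\<lambda>k. y powi k\<^sup>2) OddP)"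
      using G3_eq(2)[OF y] unfolding G3_def thP_def thO_def power2_eq_square[of "infsum _ _"] .
  next
    fix y :: real and D :: int assume y: "0 < y" "y < 1" and D: "D \<in> OddP"
    have y4: "0 < y ^ 4" "y ^ 4 < 1" using power_less_one_real[OF y, of 4] by auto
    show "((\<lambda>h. y powi (8 * D * \<bar>h\<bar>)) has_sum ch (y ^ 4) D / sh (y ^ 4) D) UNIV"
      using has_sum_coth[OF y4, of D] D by (simp add: has_sum_iff power_int_power mult.assoc)
  next
    fix D h :: int and i :: nat assume D: "D \<in> OddP" "i \<in> {..<2 * nat D}"
    have "(2 * int i + 1 - 2 * D)\<^sup>2 \<le> (2 * D)\<^sup>2" by (rule odd_small_square) (use D in auto)
    moreover have "0 \<le> 8 * D * \<bar>h\<bar>" using D by simp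
    ultimately show "0 \<le> 4 * D\<^sup>2 + 8 * D * \<bar>h\<bar> - (2 * int i + 1 - 2 * D)\<^sup>2" by (simp add: power_mult_distrib)
  qed auto
  then show ?thesis by auto
qed

section \<open>Which coefficients are positive\<close>

lemma gen_series_nonneg: "0 \<le> fps_nth (gen_series A w) n"
  by (simp add: nth_gen_series)

lemma core_series_nonneg: "0 \<le> fps_nth (core_series e s) n"
  unfolding core_series_def by (rule gen_series_nonneg)

lemma nth_mult_nonneg:
  assumes "\<And>n. 0 \<le> fps_nth f n" "\<And>n. 0 \<le> fps_nth g n"
  shows "(0::int) \<le> fps_nth (f * g) n"
  unfolding fps_mult_nth using assms by (intro sum_nonneg mult_nonneg_nonneg)

lemma nth_mult_pos:
  assumes "\<And>n. 0 \<le> fps_nth f n" "\<And>n. 0 \<le> fps_nth g n" "0 < fps_nth f a" "0 < fps_nth g b"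
  shows "(0::int) < fps_nth (f * g) (a + b)"
  unfolding fps_mult_nth
proof (rule sum_pos2[of _ a])
  show "0 < fps_nth f a * fps_nth g (a + b - a)" using assms(3,4) by simp
  show "0 \<le> fps_nth f i * fps_nth g (a + b - i)" for i using assms(1,2) by simp
qed auto

lemma three_factors_pos:
  assumes u: "graded A u" and v: "graded B v" and w: "graded D w"
  shows "fps_nth (gen_series A u * gen_series B v * gen_series D w) n > 0 \<longleftrightarrow> (\<exists>a\<in>A. \<exists>b\<in>B. \<exists>d\<in>D. u a + v b + w d = int n)"
proof -
  let ?w = "\<lambda>(p,d). (case p of (a,b) \<Rightarrow> u a + v b) + w d"
  have g: "graded (A \<times> B) (\<lambda>(a,b). u a + v b)" by (rule graded_times[OF u v])
  show ?thesis
    unfolding gen_series_times[OF u v, symmetric] gen_series_times[OF g w, symmetric] nth_gen_series_pos[OF graded_times[OF g w]]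
    by force
qed

lemma graded_tri_scaled: "k > 0 \<Longrightarrow> graded A (\<lambda>p. int k * tri p)"
  by (intro graded_scale graded_tri)

lemma graded_square_scaled: "k > 0 \<Longrightarrow> graded A (\<lambda>n::int. int k * n\<^sup>2)"
  by (intro graded_scale graded_square)

lemma psi_psi_psi_pos:
  assumes "i > 0" "j > 0" "k > 0"
  shows "fps_nth ((psi oo q ^ i) * (psi oo q ^ j) * (psi oo q ^ k)) n > 0 \<longleftrightarrow>
    (\<exists>a b c. even a \<and> even b \<and> even c \<and> int i * tri a + int j * tri b + int k * tri c = int n)"
  unfolding psi_scaled[OF assms(1), of True, symmetric] psi_scaled[OF assms(2), of True, symmetric] psi_scaled[OF assms(3), of True, symmetric]
    three_factors_pos[OF graded_tri_scaled[OF assms(1)] graded_tri_scaled[OF assms(2)] graded_tri_scaled[OF assms(3)]]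
  by auto

lemma psi_phi_phi_pos:
  assumes "i > 0" "j > 0" "k > 0"
  shows "fps_nth ((psi oo q ^ i) * (phi oo q ^ j) * (phi oo q ^ k)) n > 0 \<longleftrightarrow>
    (\<exists>a x y. even a \<and> int i * tri a + int j * x\<^sup>2 + int k * y\<^sup>2 = int n)"
  unfolding psi_scaled[OF assms(1), of True, symmetric] phi_scaled[OF assms(2), symmetric] phi_scaled[OF assms(3), symmetric]
    three_factors_pos[OF graded_tri_scaled[OF assms(1)] graded_square_scaled[OF assms(2)] graded_square_scaled[OF assms(3)]]
  by auto

lemma odd_square_tri: assumes "odd x" shows "\<exists>p. even p \<and> x\<^sup>2 = 8 * tri p + 1"
proof -
  obtain k where k: "x = 2 * k + 1" using assms by (elim oddE)
  show ?thesis
  proof (cases "even k")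
    case True
    then show ?thesis using tri_twice[of "- k"] by (intro exI[of _ "- k"]) (simp add: k power2_eq_square algebra_simps)
  next
    case False
    then show ?thesis using tri_twice[of "k + 1"] by (intro exI[of _ "k + 1"]) (simp add: k power2_eq_square algebra_simps)
  qed
qed

text \<open>
  From \<open>8 n + 5 = x\<^sup>2 + 4 b\<^sup>2 + 4 c\<^sup>2\<close> with odd \<open>x\<close>
  the sum \<open>b\<^sup>2 + c\<^sup>2\<close> is odd, and \<open>b + c\<close>, \<open>b -
  c\<close> are odd numbers.
\<close>

lemma four_cores_pos: "fps_nth (core_series 4 [0]) n > 0"
proof -
  obtain x y z where o: "odd x" "even y" "even z" "1 + 4 * int (2 * n + 1) = x\<^sup>2 + (y\<^sup>2 + z\<^sup>2)"
    using three_squares_1_mod_4 by metis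
  obtain b c where bc: "y = 2 * b" "z = 2 * c" using o by (elim evenE)
  obtain t where t: "even t" "x\<^sup>2 = 8 * tri t + 1" using odd_square_tri[OF o(1)] by blast
  have E: "2 * int n + 1 = 2 * tri t + (b\<^sup>2 + c\<^sup>2)" using o(4) t(2) by (simp add: bc power2_eq_square)
  then have "b\<^sup>2 + c\<^sup>2 = 2 * (int n - tri t) + 1" by simp
  then have "odd (b\<^sup>2 + c\<^sup>2)" by simp
  then have "odd (b + c)" "odd (b - c)" by auto
  then obtain r s where rs: "even r" "(b + c)\<^sup>2 = 8 * tri r + 1" "even s" "(b - c)\<^sup>2 = 8 * tri s + 1" using odd_square_tri by meson
  have "(b + c)\<^sup>2 + (b - c)\<^sup>2 = 2 * (b\<^sup>2 + c\<^sup>2)" by (simp add: power2_eq_square algebra_simps)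
  then have "b\<^sup>2 + c\<^sup>2 = 4 * tri r + 4 * tri s + 1" unfolding rs(2,4) by simp
  then have "tri t + 2 * tri r + 2 * tri s = int n" using E by simp
  then have "fps_nth ((psi oo q ^ 1) * (psi oo q ^ 2) * (psi oo q ^ 2)) n > 0"
    using t rs by (subst psi_psi_psi_pos) auto
  then show ?thesis unfolding four_cores_series by (simp add: power2_eq_square[of "psi oo _"] mult.assoc)
qed

text \<open>
  From \<open>4 n + 2 = x\<^sup>2 + y\<^sup>2 + z\<^sup>2\<close> with odd \<open>x, y\<close> and
  even \<open>z\<close> one obtains \<open>8 n + 4 = 2 x\<^sup>2 + (y + z)\<^sup>2 + (y -
  z)\<^sup>2\<close>, a combination of odd squares.
\<close>

lemma core_4_01_pos: "fps_nth (core_series 4 [0,1]) n > 0"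
proof -
  obtain x y z where o: "odd x" "odd y" "even z" "2 + 4 * int n = x\<^sup>2 + (y\<^sup>2 + z\<^sup>2)"
    using three_squares_2_mod_4 by metis
  have "odd (y + z)" "odd (y - z)" using o by auto
  then obtain r s where rs: "even r" "(y + z)\<^sup>2 = 8 * tri r + 1" "even s" "(y - z)\<^sup>2 = 8 * tri s + 1" using odd_square_tri by meson
  obtain t where t: "even t" "x\<^sup>2 = 8 * tri t + 1" using odd_square_tri[OF o(1)] by blast
  have "(y + z)\<^sup>2 + (y - z)\<^sup>2 = 2 * (y\<^sup>2 + z\<^sup>2)" by (simp add: power2_eq_square algebra_simps)
  then have "y\<^sup>2 + z\<^sup>2 = 4 * tri r + 4 * tri s + 1" unfolding rs(2,4) by simp
  then have "2 * tri t + tri r + tri s = int n" using o(4) unfolding t(2) by simp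
  then have "fps_nth ((psi oo q ^ 2) * (psi oo q ^ 1) * (psi oo q ^ 1)) n > 0"
    using t rs by (subst psi_psi_psi_pos) auto
  then show ?thesis unfolding series_4_01 by (simp add: power2_eq_square[of psi] mult.assoc)
qed

lemma phi_nonneg: "0 \<le> fps_nth phi n" unfolding phi_def by (rule gen_series_nonneg)
lemma psi_nonneg: "0 \<le> fps_nth psi n" unfolding psi_def by (rule gen_series_nonneg)

lemma compose_nonneg: "k > 0 \<Longrightarrow> (\<And>n. 0 \<le> fps_nth f n) \<Longrightarrow> (0::int) \<le> fps_nth (f oo q ^ k) n"
  by (simp add: fps_nth_compose_X_power)

text \<open>
  By \<open>phi_square\<close> the factor \<open>\<phi>(q\<^sup>2)\<^sup>2 + 2 q
  \<psi>(q\<^sup>4)\<^sup>2\<close> is the average of \<open>\<phi>(q)\<^sup>2\<close> and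
  \<open>\<phi>(q\<^sup>2)\<^sup>2\<close>.
\<close>

lemma core_4_02_double: "2 * core_series 4 [0,2] = (psi oo q ^ 2) * (phi oo q ^ 1) * (phi oo q ^ 1) + (psi oo q ^ 2) * (phi oo q ^ 2) * (phi oo q ^ 2)"
proof -
  have "2 * core_series 4 [0,2] = (psi oo q ^ 2) * ((phi oo q ^ 2)\<^sup>2 + 4 * q * (psi oo q ^ 4)\<^sup>2) + (psi oo q ^ 2) * (phi oo q ^ 2)\<^sup>2"
    unfolding series_4_02 by (simp add: algebra_simps)
  then show ?thesis unfolding phi_square[symmetric] by (simp add: power2_eq_square[of phi] power2_eq_square[of "phi oo _"] mult.assoc)
qed

lemma core_4_0112_double: "2 * core_series 4 [0,1,1,2] = (psi oo q ^ 4) * (phi oo q ^ 1) * (phi oo q ^ 1) + (psi oo q ^ 4) * (phi oo q ^ 2) * (phi oo q ^ 2)"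
proof -
  have "2 * core_series 4 [0,1,1,2] = (psi oo q ^ 4) * ((phi oo q ^ 2)\<^sup>2 + 4 * q * (psi oo q ^ 4)\<^sup>2) + (psi oo q ^ 4) * (phi oo q ^ 2)\<^sup>2"
    unfolding series_4_0112 by (simp add: algebra_simps)
  then show ?thesis unfolding phi_square[symmetric] by (simp add: power2_eq_square[of phi] power2_eq_square[of "phi oo _"] mult.assoc)
qed

lemma psi_phi_phi_nonneg: "i > 0 \<Longrightarrow> j > 0 \<Longrightarrow> k > 0 \<Longrightarrow> 0 \<le> fps_nth ((psi oo q ^ i) * (phi oo q ^ j) * (phi oo q ^ k)) n"
  by (intro nth_mult_nonneg compose_nonneg phi_nonneg psi_nonneg)

lemma nth_double: "fps_nth (2 * f) n = 2 * fps_nth (f :: int fps) n"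
  by (simp add: numeral_fps_const)

lemma core_4_02_pos: "fps_nth (core_series 4 [0,2]) n > 0"
proof -
  obtain x y z where o: "odd x" "even y" "even z" "1 + 4 * int n = x\<^sup>2 + (y\<^sup>2 + z\<^sup>2)"
    using three_squares_1_mod_4 by metis
  obtain b c where bc: "y = 2 * b" "z = 2 * c" using o by (elim evenE)
  obtain t where t: "even t" "x\<^sup>2 = 8 * tri t + 1" using odd_square_tri[OF o(1)] by blast
  have "2 * tri t + b\<^sup>2 + c\<^sup>2 = int n" using o(4) t(2) by (simp add: bc power2_eq_square)
  then have "fps_nth ((psi oo q ^ 2) * (phi oo q ^ 1) * (phi oo q ^ 1)) n > 0"
    using t by (subst psi_phi_phi_pos) auto
  then have "fps_nth (2 * core_series 4 [0,2]) n > 0"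
    unfolding core_4_02_double fps_add_nth using psi_phi_phi_nonneg[of 2 2 2 n] by linarith
  then show ?thesis unfolding nth_double by simp
qed

lemma square_mod_8: "\<exists>t::int. x\<^sup>2 = 8 * t \<or> x\<^sup>2 = 8 * t + 1 \<or> x\<^sup>2 = 8 * t + (4::int)"
proof (cases "odd x")
  case True then show ?thesis using odd_square_tri by blast
next
  case False
  then have "even x" by simp
  then obtain a where a: "x = 2 * a" by (elim evenE)
  show ?thesis
  proof (cases "odd a")
    case True
    then obtain p where "a\<^sup>2 = 8 * tri p + 1" using odd_square_tri by blast
    then have "x\<^sup>2 = 8 * (4 * tri p) + 4" by (simp add: a power2_eq_square)
    then show ?thesis by blast
  next
    case False
    then have "even a" by simp
    then obtain b where "a = 2 * b" by (elim evenE)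
    then have "x\<^sup>2 = 8 * (2 * b\<^sup>2)" by (simp add: a power2_eq_square)
    then show ?thesis by blast
  qed
qed

lemma residue_obstructions:
  fixes A B M T X Y Z a b c :: int
  shows "4 * T + X + Y = 4 * M + 3 \<Longrightarrow> X = 8 * a \<or> X = 8 * a + 1 \<or> X = 8 * a + 4 \<Longrightarrow> Y = 8 * b \<or> Y = 8 * b + 1 \<or> Y = 8 * b + 4 \<Longrightarrow> False"
    and "4 * T + 2 * X + 2 * Y = 4 * M + 3 \<Longrightarrow> False"
    and "2 * X + 4 * A + 4 * B = 16 * M + 13 \<Longrightarrow> False"
    and "X + Y + Z = 8 * M + 7 \<Longrightarrow> X = 8 * a \<or> X = 8 * a + 1 \<or> X = 8 * a + 4 \<Longrightarrow> Y = 8 * b \<or> Y = 8 * b + 1 \<or> Y = 8 * b + 4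
      \<Longrightarrow> Z = 8 * c \<or> Z = 8 * c + 1 \<or> Z = 8 * c + 4 \<Longrightarrow> False"
  by presburger+

text \<open>
  The equation \<open>4 T + x\<^sup>2 + y\<^sup>2 = n\<close> becomes \<open>2 n + 1 = u\<^sup>2 +
  (x + y)\<^sup>2 + (x - y)\<^sup>2\<close> with odd \<open>u\<close>, and \<open>2 n + 1\<close>
  is 1 modulo 4 for even \<open>n\<close> and 3 modulo 8 for \<open>n\<close> congruent to 1
  modulo 4.
\<close>

lemma core_4_0112_pos: "fps_nth (core_series 4 [0,1,1,2]) n > 0 \<longleftrightarrow> n mod 4 \<noteq> 3"
proof
  assume n: "n mod 4 \<noteq> 3"
  have "\<exists>t x y. even t \<and> 4 * tri t + x\<^sup>2 + y\<^sup>2 = int n"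
  proof (cases "even n")
    case True
    then obtain m where m: "n = 2 * m" by (elim evenE)
    obtain x y z where o: "odd x" "even y" "even z" "1 + 4 * int m = x\<^sup>2 + (y\<^sup>2 + z\<^sup>2)"
      using three_squares_1_mod_4 by metis
    obtain b c where bc: "y = 2 * b" "z = 2 * c" using o by (elim evenE)
    obtain t where t: "even t" "x\<^sup>2 = 8 * tri t + 1" using odd_square_tri[OF o(1)] by blast
    have "4 * tri t + (b + c)\<^sup>2 + (b - c)\<^sup>2 = int n" using o(4) t(2) by (simp add: bc m power2_eq_square algebra_simps)
    then show ?thesis using t by blast
  next
    case False
    then have "n mod 4 = 1" using n by presburger
    then obtain m where m: "n = 4 * m + 1" by (metis mult_div_mod_eq)
    obtain x y z where o: "odd x" "odd y" "odd z" "3 + 8 * int m = x\<^sup>2 + (y\<^sup>2 + z\<^sup>2)"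
      using three_squares_3_mod_8 by metis
    obtain b c where bc: "y = 2 * b + 1" "z = 2 * c + 1" using o by (elim oddE)
    obtain t where t: "even t" "x\<^sup>2 = 8 * tri t + 1" using odd_square_tri[OF o(1)] by blast
    have "4 * tri t + (b + c + 1)\<^sup>2 + (b - c)\<^sup>2 = int n" using o(4) t(2) by (simp add: bc m power2_eq_square algebra_simps)
    then show ?thesis using t by blast
  qed
  then have "fps_nth ((psi oo q ^ 4) * (phi oo q ^ 1) * (phi oo q ^ 1)) n > 0"
    by (subst psi_phi_phi_pos) auto
  then have "fps_nth (2 * core_series 4 [0,1,1,2]) n > 0"
    unfolding core_4_0112_double fps_add_nth using psi_phi_phi_nonneg[of 4 2 2 n] by linarith
  then show "fps_nth (core_series 4 [0,1,1,2]) n > 0" unfolding nth_double by simp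
next
  assume pos: "fps_nth (core_series 4 [0,1,1,2]) n > 0"
  show "n mod 4 \<noteq> 3"
  proof
    assume n: "n mod 4 = 3"
    then obtain m where m: "n = 4 * m + 3" by (metis mult_div_mod_eq)
    have "fps_nth (2 * core_series 4 [0,1,1,2]) n > 0" using pos unfolding nth_double by simp
    then have "fps_nth ((psi oo q ^ 4) * (phi oo q ^ 1) * (phi oo q ^ 1)) n > 0 \<or> fps_nth ((psi oo q ^ 4) * (phi oo q ^ 2) * (phi oo q ^ 2)) n > 0"
      unfolding core_4_0112_double fps_add_nth by linarith
    then show False
    proof
      assume "fps_nth ((psi oo q ^ 4) * (phi oo q ^ 1) * (phi oo q ^ 1)) n > 0"
      then obtain a x y where "4 * tri a + x\<^sup>2 + y\<^sup>2 = 4 * int m + 3" by (subst (asm) psi_phi_phi_pos) (auto simp: m)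
      moreover obtain t u where "x\<^sup>2 = 8 * t \<or> x\<^sup>2 = 8 * t + 1 \<or> x\<^sup>2 = 8 * t + 4" "y\<^sup>2 = 8 * u \<or> y\<^sup>2 = 8 * u + 1 \<or> y\<^sup>2 = 8 * u + 4"
        using square_mod_8 by meson
      ultimately show False by (rule residue_obstructions(1))
    next
      assume "fps_nth ((psi oo q ^ 4) * (phi oo q ^ 2) * (phi oo q ^ 2)) n > 0"
      then obtain a x y where "4 * tri a + 2 * x\<^sup>2 + 2 * y\<^sup>2 = 4 * int m + 3" by (subst (asm) psi_phi_phi_pos) (auto simp: m)
      then show False by (rule residue_obstructions(2))
    qed
  qed
qed

section \<open>Coefficients of squares of the series of 3-cores\<close>

text \<open>
  In \<open>r30_cubed\<close> only the second summand reaches exponents congruent to 1 modulo 3.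
\<close>

lemma three_cores_nth: "fps_nth r30 (3 * n + 1) = 6 * fps_nth (core_series 3 [0]) n"
proof -
  have "\<not> 3 dvd 3 * n + 1" by presburger
  then have "fps_nth (r30 oo q ^ 3) (3 * n + 1) = 0" by (simp add: fps_nth_compose_X_power)
  moreover have "fps_nth (6 * q * (core_series 3 [0] oo q ^ 3)) (3 * n + 1) = 6 * fps_nth (core_series 3 [0]) n"
    by (simp add: numeral_fps_const mult.assoc fps_nth_compose_X_power)
  ultimately show ?thesis using arg_cong[OF r30_cubed, of "\<lambda>f. fps_nth f (3 * n + 1)"] by simp
qed

lemma norm3_hexnorm: "norm3 (x, y, - x - y) = hexnorm x y"
proof -
  have "x\<^sup>2 + y\<^sup>2 + (- x - y)\<^sup>2 = 2 * hexnorm x y" by (simp add: hexnorm_def power2_eq_square algebra_simps)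
  then show ?thesis by (simp add: norm3_def)
qed

lemma three_cores_pos_iff: "fps_nth (core_series 3 [0]) n > 0 \<longleftrightarrow> (\<exists>x y. hexnorm x y = 3 * int n + 1)"
proof -
  have "fps_nth (core_series 3 [0]) n > 0 \<longleftrightarrow> fps_nth r30 (3 * n + 1) > 0" unfolding three_cores_nth by simp
  also have "\<dots> \<longleftrightarrow> (\<exists>p\<in>triples 0. norm3 p = int (3 * n + 1))"
    unfolding r30_triples by (rule nth_gen_series_pos[OF three_tuples_sum_3_series(2)])
  also have "\<dots> \<longleftrightarrow> (\<exists>x y. norm3 (x, y, - x - y) = 3 * int n + 1)"
  proof
    assume "\<exists>p\<in>triples 0. norm3 p = int (3 * n + 1)"
    then obtain x y z where "x + y + z = 0" "norm3 (x,y,z) = 3 * int n + 1" by (auto simp: triples_def)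
    moreover from this have "z = - x - y" by simp
    ultimately show "\<exists>x y. norm3 (x, y, - x - y) = 3 * int n + 1" by blast
  next
    assume "\<exists>x y. norm3 (x, y, - x - y) = 3 * int n + 1"
    then obtain x y where "norm3 (x, y, - x - y) = 3 * int n + 1" by blast
    then show "\<exists>p\<in>triples 0. norm3 p = int (3 * n + 1)" by (intro bexI[of _ "(x, y, - x - y)"]) (auto simp: triples_def)
  qed
  finally show ?thesis unfolding norm3_hexnorm .
qed

text \<open>
  Norms are 0 or 1 modulo 3, so in a representation of \<open>3 n + 2\<close> as a sum of two
  norms both are 1 modulo 3 and come from 3-cores.
\<close>

lemma three_cores_square_pos: "fps_nth ((core_series 3 [0])\<^sup>2) n > 0"
proof -
  obtain x y z w where F: "int (3 * n + 2) = hexnorm x y + hexnorm z w" using all_two_hexnorms[of "3 * n + 2"] by (auto simp: two_hexnorms_def)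
  have m: "\<exists>k. hexnorm x y = 3 * k \<or> hexnorm x y = 3 * k + 1" for x y
  proof -
    have "\<exists>r k. 2 * x + y = 3 * k + r \<and> (r = 0 \<or> r = 1 \<or> r = - 1)" by presburger
    then obtain r k where r: "2 * x + y = 3 * k + r" "r = 0 \<or> r = 1 \<or> r = - 1" by blast
    have "4 * hexnorm x y = 3 * (3 * k\<^sup>2 + 2 * k * r + y\<^sup>2) + r\<^sup>2"
      unfolding hexnorm_four r(1) by (simp add: power2_eq_square algebra_simps)
    moreover have "r\<^sup>2 = 0 \<or> r\<^sup>2 = 1" using r(2) by auto
    moreover have "\<exists>k. N = 3 * k \<or> N = 3 * k + 1" if "4 * N = 3 * S + R" "R = 0 \<or> R = 1" for N S R :: int using that by presburger
    ultimately show ?thesis by blast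
  qed
  obtain k j where kj: "hexnorm x y = 3 * k \<or> hexnorm x y = 3 * k + 1" "hexnorm z w = 3 * j \<or> hexnorm z w = 3 * j + 1" using m by meson
  have "A = 3 * k + 1 \<and> B = 3 * j + 1" if "A = 3 * k \<or> A = 3 * k + 1" "B = 3 * j \<or> B = 3 * j + 1" "int (3 * n + 2) = A + B" for A B :: int
    using that by presburger
  from this[OF kj F] have e: "hexnorm x y = 3 * k + 1" "hexnorm z w = 3 * j + 1" by simp_all
  then have "0 \<le> k" "0 \<le> j" using hexnorm_nonneg[of x y] hexnorm_nonneg[of z w] by linarith+
  then have kn: "k = int (nat k)" "j = int (nat j)" by simp_all
  have "fps_nth (core_series 3 [0]) (nat k) > 0" "fps_nth (core_series 3 [0]) (nat j) > 0"
    unfolding three_cores_pos_iff using e kn by metis+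
  then have "fps_nth (core_series 3 [0] * core_series 3 [0]) (nat k + nat j) > 0"
    by (intro nth_mult_pos core_series_nonneg)
  moreover have "nat k + nat j = n" using F e kn by linarith
  ultimately show ?thesis by (simp add: power2_eq_square)
qed

lemma three_cores_at_3: "\<not> fps_nth (core_series 3 [0]) 3 > 0"
proof
  assume "fps_nth (core_series 3 [0]) 3 > 0"
  then obtain x y where h: "hexnorm x y = 10" using three_cores_pos_iff[of 3] by auto
  then have "even (x\<^sup>2 + x * y + y\<^sup>2)" by (simp add: hexnorm_def)
  then have "even x \<and> even y" by (auto simp: power2_eq_square)
  then obtain a b where "x = 2 * a" "y = 2 * b" by (elim conjE evenE)
  then have "4 * hexnorm a b = 10" using h hexnorm_scale[of 2 a b] by simp
  moreover have "4 * N \<noteq> 10" for N :: int by presburger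
  ultimately show False by blast
qed

text \<open>
  Doubling a vector multiplies its norm \<open>3 n + 1\<close> by 4.
\<close>

lemma three_cores_double: "fps_nth (core_series 3 [0]) n \<le> fps_nth (core_series 3 [0]) (4 * n + 1)"
proof -
  let ?d = "\<lambda>(x,y,z). (2 * x, 2 * y, 2 * z) :: int \<times> int \<times> int"
  let ?A = "{p \<in> triples 0. norm3 p = int (3 * n + 1)}" and ?B = "{p \<in> triples 0. norm3 p = int (3 * (4 * n + 1) + 1)}"
  have "finite ?B" using three_tuples_sum_3_series(2) by (simp add: graded_def)
  moreover have "?d ` ?A \<subseteq> ?B"
  proof
    fix p assume "p \<in> ?d ` ?A"
    then obtain p' where p': "p = ?d p'" "p' \<in> ?A" by blast
    obtain x y z where xyz: "p' = (x,y,z)" by (cases p')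
    have s: "x + y + z = 0" "norm3 (x,y,z) = int (3 * n + 1)" using p'(2) by (simp_all add: xyz triples_def)
    have s2: "2 * x + 2 * y + 2 * z = 0" using s(1) by simp
    have "2 * norm3 (2 * x, 2 * y, 2 * z) = 2 * (4 * norm3 (x,y,z))"
      unfolding norm3_twice[OF s2] using norm3_twice[OF s(1)] by (simp add: power_mult_distrib)
    then have "norm3 (2 * x, 2 * y, 2 * z) = int (3 * (4 * n + 1) + 1)" using s(2) by simp
    then show "p \<in> ?B" using s2 by (simp add: p'(1) xyz triples_def)
  qed
  moreover have "inj_on ?d ?A" by (rule inj_onI) (simp add: split_beta prod_eq_iff)
  ultimately have "card ?A \<le> card ?B" by (intro card_inj_on_le)
  then have "fps_nth r30 (3 * n + 1) \<le> fps_nth r30 (3 * (4 * n + 1) + 1)" unfolding r30_triples nth_gen_series by simp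
  then show ?thesis unfolding three_cores_nth by simp
qed

lemma three_cores_square_double: "fps_nth ((core_series 3 [0])\<^sup>2) k \<le> fps_nth ((core_series 3 [0])\<^sup>2) (4 * k + 2)"
proof -
  let ?C = "fps_nth (core_series 3 [0])"
  let ?h = "\<lambda>i. ?C i * ?C (4 * k + 2 - i)"
  have "(\<Sum>j\<in>{0..k}. ?C j * ?C (k - j)) \<le> (\<Sum>j\<in>{0..k}. ?h (4 * j + 1))"
  proof (rule sum_mono)
    fix j assume j: "j \<in> {0..k}"
    then have "4 * k + 2 - (4 * j + 1) = 4 * (k - j) + 1" by auto
    then show "?C j * ?C (k - j) \<le> ?h (4 * j + 1)"
      using three_cores_double[of j] three_cores_double[of "k - j"] by (simp add: mult_mono core_series_nonneg)
  qed
  also have "\<dots> = (\<Sum>i\<in>(\<lambda>j. 4 * j + 1) ` {0..k}. ?h i)" by (subst sum.reindex) (auto intro!: inj_onI)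
  also have "\<dots> \<le> (\<Sum>i\<in>{0..4 * k + 2}. ?h i)" by (rule sum_mono2) (auto intro!: mult_nonneg_nonneg core_series_nonneg)
  finally show ?thesis by (simp add: power2_eq_square fps_mult_nth)
qed

lemma psi_at_0: "fps_nth psi 0 > 0" and psi_at_1: "fps_nth psi 1 > 0"
proof -
  have g: "graded {p. even p} tri" by (rule graded_tri)
  show "fps_nth psi 0 > 0" unfolding psi_even[symmetric] nth_gen_series_pos[OF g] by (intro bexI[of _ 0]) (auto simp: tri_def)
  show "fps_nth psi 1 > 0" unfolding psi_even[symmetric] nth_gen_series_pos[OF g] by (intro bexI[of _ 2]) (auto simp: tri_def)
qed

text \<open>
  The triangular numbers 0 and 1 make both parities available.
\<close>

lemma six_cores_pos: "fps_nth (core_series 6 [0]) n > 0"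
proof -
  let ?D = "(core_series 3 [0])\<^sup>2 oo q ^ 2"
  have D: "0 \<le> fps_nth ?D m" "0 < fps_nth ?D (2 * k)" for m k
    using three_cores_square_pos[of k] three_cores_square_pos less_imp_le by (auto simp: fps_nth_compose_X_power)
  have S: "core_series 6 [0] = psi * ?D" unfolding six_cores_series by (simp add: compose_square)
  show ?thesis
  proof (cases "even n")
    case True
    then obtain k where k: "n = 0 + 2 * k" by (auto elim!: evenE)
    show ?thesis unfolding S k by (rule nth_mult_pos[OF psi_nonneg D(1) psi_at_0 D(2)])
  next
    case False
    then obtain k where k: "n = 1 + 2 * k" by (auto elim!: oddE)
    show ?thesis unfolding S k by (rule nth_mult_pos[OF psi_nonneg D(1) psi_at_1 D(2)])
  qed
qed

text \<open>
  The second factor has nonnegative coefficients by \<open>three_cores_square_double\<close>. The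
  subtracted part only affects exponents congruent to 2 modulo 4, and one of \<open>n\<close>,
  \<open>n - 2\<close> avoids this class.
\<close>

lemma core_6_02_pos: "fps_nth (core_series 6 [0,2]) n > 0"
proof -
  let ?S = "(core_series 3 [0])\<^sup>2" and ?D = "(core_series 3 [0])\<^sup>2 - q ^ 2 * (core_series 3 [0] oo q ^ 4)\<^sup>2"
  have nth: "fps_nth ?D m = fps_nth ?S m - (if m < 2 then 0 else if 4 dvd m - 2 then fps_nth ?S ((m - 2) div 4) else 0)" for m
    unfolding compose_square[of 4, OF zero_less_numeral, symmetric] fps_sub_nth fps_X_power_mult_nth by (simp add: fps_nth_compose_X_power)
  have pos: "0 < fps_nth ?D m" if "m mod 4 \<noteq> 2" for m
  proof -
    have "\<not> (2 \<le> m \<and> 4 dvd m - 2)" using that by presburger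
    then show ?thesis unfolding nth using three_cores_square_pos[of m] by auto
  qed
  have D: "0 \<le> fps_nth ?D m" for m
  proof (cases "m mod 4 = 2")
    case True
    then have "m = 4 * ((m - 2) div 4) + 2" by presburger
    then show ?thesis unfolding nth using three_cores_square_double[of "(m - 2) div 4"] three_cores_square_pos[of m] by auto
  next
    case False then show ?thesis using pos less_imp_le by blast
  qed
  have P: "0 \<le> fps_nth (psi oo q ^ 2) m" "0 < fps_nth (psi oo q ^ 2) 0" "0 < fps_nth (psi oo q ^ 2) 2" for m
    using psi_nonneg psi_at_0 psi_at_1 by (simp_all add: fps_nth_compose_X_power)
  show ?thesis
  proof (cases "n mod 4 = 2")
    case True
    obtain m where m: "n = 4 * m + 2" using True by (metis mult_div_mod_eq)
    have a: "2 + (n - 2) = n" by (simp add: m)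
    have b: "(n - 2) mod 4 \<noteq> 2" by (simp add: m)
    show ?thesis using nth_mult_pos[OF P(1) D P(3) pos[OF b]] unfolding a series_6_02 .
  next
    case False
    show ?thesis using nth_mult_pos[OF P(1) D P(2) pos[OF False]] unfolding add_0 series_6_02 .
  qed
qed

section \<open>Vanishing coefficients\<close>

text \<open>
  Twice the size plus 9 of the core with tuple \<open>[a,b,c,d]\<close> and charge
  \<open>[0,1,1,1]\<close>.
\<close>

definition shifted_size :: "int \<Rightarrow> int \<Rightarrow> int \<Rightarrow> int \<Rightarrow> int" where
  "shifted_size a b c d = (a - 1)\<^sup>2 + b\<^sup>2 + (c + 1)\<^sup>2 + (d + 2)\<^sup>2"

text \<open>
  The values 17, 47 and 233 correspond to the sizes 4, 19 and 112; the range of the variables is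
  that allowed by \<open>shifted_size_bound\<close>.
\<close>

lemma shifted_size_check:
  "\<forall>x\<in>set [-5..4]. \<forall>y\<in>set [-5..4]. \<forall>z\<in>set [-5..4].
     shifted_size (4 * x + 3) (4 * y) (4 * z) (4 * (- x - y - z)) \<notin> {17, 47, 233} \<and>
     shifted_size (4 * x) (4 * y + 3) (4 * z) (4 * (- x - y - z)) \<notin> {17, 47, 233} \<and>
     shifted_size (4 * x) (4 * y) (4 * z + 3) (4 * (- x - y - z)) \<notin> {17, 47, 233} \<and>
     shifted_size (4 * x) (4 * y) (4 * z) (4 * (- x - y - z) + 3) \<notin> {17, 47, 233}"
  by code_simp

lemma shifted_size_bound:
  assumes "shifted_size a b c d \<le> 233"
  shows "\<bar>a - 1\<bar> \<le> 15 \<and> \<bar>b\<bar> \<le> 15 \<and> \<bar>c + 1\<bar> \<le> 15"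
proof -
  have B: "\<bar>z\<bar> \<le> 15" if "z\<^sup>2 \<le> 233" for z :: int
  proof (rule ccontr)
    assume "\<not> \<bar>z\<bar> \<le> 15"
    then have "16\<^sup>2 \<le> \<bar>z\<bar>\<^sup>2" by (intro power_mono) auto
    then show False using that by simp
  qed
  have "0 \<le> (a - 1)\<^sup>2" "0 \<le> b\<^sup>2" "0 \<le> (c + 1)\<^sup>2" "0 \<le> (d + 2)\<^sup>2" by simp_all
  then show ?thesis using assms unfolding shifted_size_def by (intro conjI B) linarith+
qed

lemma div_4_cases:
  "\<exists>x r. r \<in> {0,1,2,3} \<and> z = 4 * x + r \<and> (z + 1) div 4 = x + of_bool (r = 3) \<and> (z + 2) div 4 = x + of_bool (r \<ge> 2) \<and> (z + 3) div 4 = (x::int) + of_bool (r \<ge> 1)"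
proof -
  define x r where "x = z div 4" and "r = z mod 4"
  have z: "z = 4 * x + r" by (simp add: x_def r_def)
  have r: "r = 0 \<or> r = 1 \<or> r = 2 \<or> r = 3" unfolding r_def by presburger
  have d: "(4 * x + s) div 4 = x" if "0 \<le> s" "s < 4" for s by (rule int_div_pos_eq) (use that in auto)
  have d': "(4 * x + s) div 4 = x + 1" if "4 \<le> s" "s < 8" for s by (rule int_div_pos_eq[of _ _ _ "s - 4"]) (use that in auto)
  have "(z + 1) div 4 = x + of_bool (r = 3) \<and> (z + 2) div 4 = x + of_bool (r \<ge> 2) \<and> (z + 3) div 4 = x + of_bool (r \<ge> 1)"
    unfolding z add.assoc using r d d' by (elim disjE) simp_all
  with z r show ?thesis by blast
qed

text \<open>
  Equal charges of consecutive components exclude the residues 1 and 2 modulo 4, and the step from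
  0 to 1 produces the residue 3 exactly once.
\<close>

lemma core_tuples_0111:
  assumes "t \<in> core_tuples 4 [0,1,1,1]"
  shows "\<exists>x y z. t = [4*x+3,4*y,4*z,4*(-x-y-z)] \<or> t = [4*x,4*y+3,4*z,4*(-x-y-z)] \<or> t = [4*x,4*y,4*z+3,4*(-x-y-z)] \<or> t = [4*x,4*y,4*z,4*(-x-y-z)+3]"
proof -
  have "length t = 4" using assms by (simp add: core_tuples_def)
  then obtain a b c d where t: "t = [a,b,c,d]" by (auto simp: length_4_iff)
  have len: "length [0,1,1,1::int] = 4" by simp
  have "charge 4 4 t = [0,1,1,1]" using assms unfolding core_tuples_charge len by (rule conjunct2)
  then have s: "sum_list t = 3" using charge_bounds(3)[of 4 t 4] \<open>length t = 4\<close> by simp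
  have r: "(\<Sum>m<4. runner_level 4 t j m) = [0,1,1,1::int] ! j" if "j < 4" for j
    using assms that unfolding core_tuples_def len mem_Collect_eq by blast
  have sum4: "(\<Sum>m<4. f m) = f 0 + f 1 + f 2 + f (3::nat)" for f :: "nat \<Rightarrow> int" by (simp add: eval_nat_numeral)
  have e: "(a + 1) div 4 + (b + 1) div 4 + (c + 1) div 4 + (d + 1) div 4 = 1"
    "(a + 2) div 4 + (b + 2) div 4 + (c + 2) div 4 + (d + 2) div 4 = 1"
    "(a + 3) div 4 + (b + 3) div 4 + (c + 3) div 4 + (d + 3) div 4 = 1"
  proof -
    have n: "[a,b,c,d] ! 0 = a" "[a,b,c,d] ! 1 = b" "[a,b,c,d] ! 2 = c" "[a,b,c,d] ! 3 = d" by simp_all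
    have n': "[0,1,1,1::int] ! 1 = 1" "[0,1,1,1::int] ! 2 = 1" "[0,1,1,1::int] ! 3 = 1" by simp_all
    have lt: "1 < (4::nat)" "2 < (4::nat)" "3 < (4::nat)" by simp_all
    note u = sum4 runner_level_def t n n' of_nat_1 of_nat_numeral
    show "(a + 1) div 4 + (b + 1) div 4 + (c + 1) div 4 + (d + 1) div 4 = 1" using r[OF lt(1)] unfolding u .
    show "(a + 2) div 4 + (b + 2) div 4 + (c + 2) div 4 + (d + 2) div 4 = 1" using r[OF lt(2)] unfolding u .
    show "(a + 3) div 4 + (b + 3) div 4 + (c + 3) div 4 + (d + 3) div 4 = 1" using r[OF lt(3)] unfolding u .
  qed
  have abcd: "a + b + c + d = 3" using s by (simp add: t)
  obtain x i where I: "i \<in> {0,1,2,3}" "a = 4 * x + i" "(a + 1) div 4 = x + of_bool (i = 3)" "(a + 2) div 4 = x + of_bool (i \<ge> 2)" "(a + 3) div 4 = x + of_bool (i \<ge> 1)"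
    using div_4_cases[of a] by blast
  obtain y j where J: "j \<in> {0,1,2,3}" "b = 4 * y + j" "(b + 1) div 4 = y + of_bool (j = 3)" "(b + 2) div 4 = y + of_bool (j \<ge> 2)" "(b + 3) div 4 = y + of_bool (j \<ge> 1)"
    using div_4_cases[of b] by blast
  obtain z k where K: "k \<in> {0,1,2,3}" "c = 4 * z + k" "(c + 1) div 4 = z + of_bool (k = 3)" "(c + 2) div 4 = z + of_bool (k \<ge> 2)" "(c + 3) div 4 = z + of_bool (k \<ge> 1)"
    using div_4_cases[of c] by blast
  obtain w l where L: "l \<in> {0,1,2,3}" "d = 4 * w + l" "(d + 1) div 4 = w + of_bool (l = 3)" "(d + 2) div 4 = w + of_bool (l \<ge> 2)" "(d + 3) div 4 = w + of_bool (l \<ge> 1)"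
    using div_4_cases[of d] by blast
  have E: "x + y + z + w + (of_bool (i = 3) + of_bool (j = 3) + of_bool (k = 3) + of_bool (l = 3)) = 1"
    "x + y + z + w + (of_bool (i \<ge> 2) + of_bool (j \<ge> 2) + of_bool (k \<ge> 2) + of_bool (l \<ge> 2)) = 1"
    "x + y + z + w + (of_bool (i \<ge> 1) + of_bool (j \<ge> 1) + of_bool (k \<ge> 1) + of_bool (l \<ge> 1)) = 1"
    using e unfolding I(3,4,5) J(3,4,5) K(3,4,5) L(3,4,5) by linarith+
  have S: "4 * (x + y + z + w) + (i + j + k + l) = 3" using abcd unfolding I(2) J(2) K(2) L(2) by simp
  have "(i = 3 \<and> j = 0 \<and> k = 0 \<and> l = 0 \<or> i = 0 \<and> j = 3 \<and> k = 0 \<and> l = 0 \<or> i = 0 \<and> j = 0 \<and> k = 3 \<and> l = 0 \<or> i = 0 \<and> j = 0 \<and> k = 0 \<and> l = 3) \<and> x + y + z + w = 0"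
    using I(1) J(1) K(1) L(1) E S by (elim insertE emptyE; simp; linarith?)
  then have "(i = 3 \<and> j = 0 \<and> k = 0 \<and> l = 0 \<or> i = 0 \<and> j = 3 \<and> k = 0 \<and> l = 0 \<or> i = 0 \<and> j = 0 \<and> k = 3 \<and> l = 0 \<or> i = 0 \<and> j = 0 \<and> k = 0 \<and> l = 3) \<and> w = - x - y - z" by simp
  then show ?thesis unfolding t I(2) J(2) K(2) L(2) by (elim conjE disjE) auto
qed

lemma core_4_0111_zero: assumes "n \<in> {4,19,112}" shows "fps_nth (core_series 4 [0,1,1,1]) n = 0"
proof -
  have s: "core_series 4 [0,1,1,1] = gen_series (core_tuples 4 [0,1,1,1]) (core_size 4 [0,1,1,1])" by (rule core_series_tuples) simp_all
  have no: "core_size 4 [0,1,1,1] t \<noteq> int n" if t: "t \<in> core_tuples 4 [0,1,1,1]" for t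
  proof
    assume "core_size 4 [0,1,1,1] t = int n"
    moreover have "2 * core_size 4 [0,1,1,1] t + charge_const 1 [0,1,1,1] = tuple_form 1 t"
    proof -
      have "length t = 4" using t by (simp add: core_tuples_def)
      then show ?thesis unfolding tuple_form_def using core_size_quadratic[of "[0,1,1,1]" 4 1 t] t by simp
    qed
    ultimately have T: "tuple_form 1 t = 2 * int n + 3" by (simp add: charge_const_lists)
    have S: "shifted_size a b c d \<in> {17,47,233}" if "t = [a,b,c,d]" for a b c d
    proof -
      have "shifted_size a b c d = tuple_form 1 t + 6" unfolding that tuple_form_lists shifted_size_def by (simp add: power2_eq_square algebra_simps)
      then show ?thesis using T assms by auto
    qed
    have B: "\<bar>a - 1\<bar> \<le> 15 \<and> \<bar>b\<bar> \<le> 15 \<and> \<bar>c + 1\<bar> \<le> 15" if "t = [a,b,c,d]" for a b c d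
      by (rule shifted_size_bound[of a b c d]) (use S[OF that] in auto)
    obtain x y z where c: "t = [4*x+3,4*y,4*z,4*(-x-y-z)] \<or> t = [4*x,4*y+3,4*z,4*(-x-y-z)] \<or> t = [4*x,4*y,4*z+3,4*(-x-y-z)] \<or> t = [4*x,4*y,4*z,4*(-x-y-z)+3]"
      using core_tuples_0111[OF t] by blast
    then have "\<bar>4 * x\<bar> \<le> 19 \<and> \<bar>4 * y\<bar> \<le> 18 \<and> \<bar>4 * z\<bar> \<le> 19" using B by (elim disjE) force+
    then have "x \<in> set [-5..4]" "y \<in> set [-5..4]" "z \<in> set [-5..4]" by auto
    note chk = shifted_size_check[THEN bspec, OF this(1), THEN bspec, OF this(2), THEN bspec, OF this(3)]
    from c show False using chk S by blast
  qed
  then have E: "{t \<in> core_tuples 4 [0,1,1,1]. core_size 4 [0,1,1,1] t = int n} = {}" by blast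
  show ?thesis unfolding s nth_gen_series E by simp
qed

text \<open>
  At an even exponent \<open>2 m\<close> with \<open>m\<close> congruent to 7 modulo 8 the right
  side of \<open>series_4_0123\<close> counts representations of \<open>m\<close> as a sum of
  three squares, of which there are none; both series on the left have nonnegative coefficients.
\<close>

lemma core_4_0123_0002_zero:
  "fps_nth (core_series 4 [0,1,2,3]) (16 * k + 14) = 0 \<and> fps_nth (core_series 4 [0,0,0,2]) (16 * k + 13) = 0"
proof -
  let ?n = "16 * k + 14"
  let ?P = "(phi oo q ^ 2) * (phi oo q ^ 2) * (phi oo q ^ 2)" and ?Q = "(phi oo q ^ 2) * (psi oo q ^ 4) * (psi oo q ^ 4)"
  have "\<not> fps_nth ?P ?n > 0"
  proof
    assume "fps_nth ?P ?n > 0"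
    then have "\<exists>x\<in>UNIV. \<exists>y\<in>UNIV. \<exists>z\<in>UNIV. int 2 * x\<^sup>2 + int 2 * y\<^sup>2 + int 2 * z\<^sup>2 = int ?n"
      unfolding phi_scaled[OF zero_less_numeral, symmetric]
      by (subst (asm) three_factors_pos) (simp_all only: graded_square_scaled zero_less_numeral)
    then obtain x y z :: int where "2 * x\<^sup>2 + 2 * y\<^sup>2 + 2 * z\<^sup>2 = 16 * int k + 14" by auto
    then have "x\<^sup>2 + y\<^sup>2 + z\<^sup>2 = 8 * int k + 7" by simp
    moreover obtain a b c where "x\<^sup>2 = 8 * a \<or> x\<^sup>2 = 8 * a + 1 \<or> x\<^sup>2 = 8 * a + 4" "y\<^sup>2 = 8 * b \<or> y\<^sup>2 = 8 * b + 1 \<or> y\<^sup>2 = 8 * b + 4"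
      "z\<^sup>2 = 8 * c \<or> z\<^sup>2 = 8 * c + 1 \<or> z\<^sup>2 = 8 * c + 4" using square_mod_8 by meson
    ultimately show False by (rule residue_obstructions(4))
  qed
  moreover have "\<not> fps_nth ?Q (16 * k + 13) > 0"
  proof
    assume "fps_nth ?Q (16 * k + 13) > 0"
    then have "\<exists>x\<in>UNIV. \<exists>a\<in>{p. even p \<longleftrightarrow> True}. \<exists>b\<in>{p. even p \<longleftrightarrow> True}. int 2 * x\<^sup>2 + int 4 * tri a + int 4 * tri b = int (16 * k + 13)"
      unfolding phi_scaled[OF zero_less_numeral, symmetric] psi_scaled[OF zero_less_numeral, of True, symmetric]
      by (subst (asm) three_factors_pos) (simp_all only: graded_square_scaled graded_tri_scaled zero_less_numeral)
    then obtain x a b where "2 * x\<^sup>2 + 4 * tri a + 4 * tri b = 16 * int k + 13" by auto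
    then show False by (rule residue_obstructions(3))
  qed
  moreover have "fps_nth (core_series 4 [0,1,2,3]) ?n + 4 * fps_nth (core_series 4 [0,0,0,2]) (16 * k + 13) = fps_nth ?P ?n + 8 * fps_nth ?Q (16 * k + 13)"
  proof -
    have "core_series 4 [0,1,2,3] + 4 * (q * core_series 4 [0,0,0,2]) = ?P + 8 * (q * ?Q)"
      using series_4_0123 by (simp add: power3_eq_cube power2_eq_square[of "psi oo _"] mult.assoc)
    from arg_cong[OF this, of "\<lambda>f. fps_nth f ?n"] show ?thesis by (simp add: numeral_fps_const add.commute[of 13])
  qed
  ultimately show ?thesis
    using core_series_nonneg[of 4 "[0,1,2,3]" ?n] core_series_nonneg[of 4 "[0,0,0,2]" "16 * k + 13"] by linarith
qed

lemma infinite_progression: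
  assumes "\<And>k. P (16 * k + c)" shows "infinite {n::nat. P n}"
proof
  assume "finite {n. P n}"
  then have "finite (range (\<lambda>k::nat. 16 * k + c))" by (rule finite_subset[rotated]) (use assms in auto)
  then have "finite (UNIV :: nat set)" by (rule finite_imageD) (auto intro: inj_onI)
  then show False by simp
qed

section \<open>The list of identities\<close>

lemma two_cores_pos: "fps_nth (psi oo q ^ 2) n > 0 \<longleftrightarrow> pronic n"
proof -
  have "fps_nth (psi oo q ^ 2) n > 0 \<longleftrightarrow> (\<exists>p\<in>{p. even p \<longleftrightarrow> True}. int 2 * tri p = int n)"
    unfolding psi_scaled[OF zero_less_numeral, of True, symmetric] by (rule nth_gen_series_pos) (rule graded_tri_scaled, simp)
  also have "\<dots> \<longleftrightarrow> (\<exists>p. even p \<and> p * (p - 1) = int n)" using tri_twice by simp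
  also have "\<dots> \<longleftrightarrow> pronic n"
  proof
    assume "\<exists>p. even p \<and> p * (p - 1) = int n"
    then obtain p where p: "p * (p - 1) = int n" by blast
    define k where "k = (if p > 0 then nat (p - 1) else nat (- p))"
    have "int n = int k * (int k + 1)" using p by (auto simp: k_def algebra_simps)
    also have "\<dots> = int (k * (k + 1))" by (simp add: algebra_simps)
    finally show "pronic n" unfolding pronic_def of_nat_eq_iff by blast
  next
    assume "pronic n"
    then obtain k where k: "n = k * (k + 1)" by (auto simp: pronic_def)
    show "\<exists>p. even p \<and> p * (p - 1) = int n"
    proof (cases "even k")
      case True then show ?thesis by (intro exI[of _ "- int k"]) (simp add: k algebra_simps)
    next
      case False then show ?thesis by (intro exI[of _ "int k + 1"]) (simp add: k algebra_simps)
    qed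
  qed
  finally show ?thesis .
qed

lemma phi_pos: "fps_nth phi n > 0 \<longleftrightarrow> (\<exists>k. n = k\<^sup>2)"
proof -
  have "fps_nth phi n > 0 \<longleftrightarrow> (\<exists>x\<in>UNIV. x\<^sup>2 = int n)" unfolding phi_def by (rule nth_gen_series_pos[OF graded_square])
  also have "\<dots> \<longleftrightarrow> (\<exists>k. n = k\<^sup>2)"
  proof
    assume "\<exists>x\<in>UNIV. x\<^sup>2 = int n"
    then obtain x :: int where "x\<^sup>2 = int n" by blast
    then have "int n = int ((nat \<bar>x\<bar>)\<^sup>2)" by simp
    then show "\<exists>k. n = k\<^sup>2" unfolding of_nat_eq_iff by blast
  next
    assume "\<exists>k. n = k\<^sup>2"
    then obtain k where "n = k\<^sup>2" by blast
    then have "(int k)\<^sup>2 = int n" by simp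
    then show "\<exists>x\<in>UNIV. x\<^sup>2 = int n" by blast
  qed
  finally show ?thesis .
qed

lemma compose_pos:
  assumes "k > 0" "\<And>n. fps_nth f n > (0::int)"
  shows "fps_nth (f oo q ^ k) n > 0 \<longleftrightarrow> k dvd n"
  using assms by (simp add: fps_nth_compose_X_power)

lemma core_coeff_pos:
  "core_coeff 2 [0,0] n > 0 \<longleftrightarrow> pronic n" "core_coeff 2 [0,1] n > 0 \<longleftrightarrow> (\<exists>k. n = k^2)"
  "core_coeff 4 [0,0] n > 0 \<longleftrightarrow> even n" "core_coeff 4 [0,1] n > 0" "core_coeff 4 [0,2] n > 0"
  "core_coeff 6 [0,0] n > 0 \<longleftrightarrow> even n" "core_coeff 6 [0,2] n > 0"
  "core_coeff 4 [0,0,0,0] n > 0 \<longleftrightarrow> 4 dvd n" "core_coeff 4 [0,0,1,1] n > 0 \<longleftrightarrow> even n"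
  "core_coeff 4 [0,0,2,2] n > 0 \<longleftrightarrow> even n" "core_coeff 4 [0,1,1,2] n > 0 \<longleftrightarrow> n mod 4 \<noteq> 3"
proof -
  have d: "core_series 4 [0,0,0,0] = core_series 4 [0] oo q ^ 4"
    by (simp only: core_series_doubled_pair core_series_doubled compose_powers zero_less_numeral) simp
  show "core_coeff 2 [0,0] n > 0 \<longleftrightarrow> pronic n" unfolding core_coeff_def series_2_00 by (rule two_cores_pos)
  show "core_coeff 2 [0,1] n > 0 \<longleftrightarrow> (\<exists>k. n = k^2)" unfolding core_coeff_def series_2_01 by (rule phi_pos)
  show "core_coeff 4 [0,0] n > 0 \<longleftrightarrow> even n" unfolding core_coeff_def core_series_doubled[OF zero_less_numeral]
    by (rule compose_pos[OF zero_less_numeral four_cores_pos])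
  show "core_coeff 4 [0,1] n > 0" unfolding core_coeff_def by (rule core_4_01_pos)
  show "core_coeff 4 [0,2] n > 0" unfolding core_coeff_def by (rule core_4_02_pos)
  show "core_coeff 6 [0,0] n > 0 \<longleftrightarrow> even n" unfolding core_coeff_def core_series_doubled[OF zero_less_numeral]
    by (rule compose_pos[OF zero_less_numeral six_cores_pos])
  show "core_coeff 6 [0,2] n > 0" unfolding core_coeff_def by (rule core_6_02_pos)
  show "core_coeff 4 [0,0,0,0] n > 0 \<longleftrightarrow> 4 dvd n" unfolding core_coeff_def d
    by (rule compose_pos[OF zero_less_numeral four_cores_pos])
  show "core_coeff 4 [0,0,1,1] n > 0 \<longleftrightarrow> even n" unfolding core_coeff_def core_series_doubled_pair[OF zero_less_numeral]
    by (rule compose_pos[OF zero_less_numeral core_4_01_pos])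
  show "core_coeff 4 [0,0,2,2] n > 0 \<longleftrightarrow> even n" unfolding core_coeff_def core_series_doubled_pair[OF zero_less_numeral]
    by (rule compose_pos[OF zero_less_numeral core_4_02_pos])
  show "core_coeff 4 [0,1,1,2] n > 0 \<longleftrightarrow> n mod 4 \<noteq> 3" unfolding core_coeff_def by (rule core_4_0112_pos)
qed

lemma core_coeff_zero:
  "n mod 3 = 1 \<or> n mod 3 = 2 \<Longrightarrow> core_coeff 3 [0,0,0] n = 0"
  "n mod 3 = 2 \<Longrightarrow> core_coeff 3 [0,1,2] n = 0"
  "\<not> (\<forall>n. core_coeff 3 [0,0,1] n > 0)"
  "n \<in> {4, 19, 112} \<Longrightarrow> core_coeff 4 [0,0,0,1] n = 0"
  "infinite {n. odd n \<and> core_coeff 4 [0,0,0,2] n = 0}"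
  "infinite {n. even n \<and> core_coeff 4 [0,1,2,3] n = 0}"
proof -
  assume "n mod 3 = 1 \<or> n mod 3 = 2"
  then have "\<not> 3 dvd n" by presburger
  then show "core_coeff 3 [0,0,0] n = 0" by (simp add: core_coeff_def series_3_000 fps_nth_compose_X_power)
next
  assume n: "n mod 3 = 2"
  then have "\<not> 3 dvd n" "\<not> 3 dvd n - 1" by presburger+
  then show "core_coeff 3 [0,1,2] n = 0"
    by (simp add: core_coeff_def series_3_012 fps_nth_compose_X_power numeral_fps_const mult.assoc)
next
  show "\<not> (\<forall>n. core_coeff 3 [0,0,1] n > 0)" unfolding core_coeff_def series_3_001 using three_cores_at_3 by blast
next
  assume "n \<in> {4, 19, 112}"
  then show "core_coeff 4 [0,0,0,1] n = 0" unfolding core_coeff_def series_4_0001 by (rule core_4_0111_zero)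
next
  show "infinite {n. odd n \<and> core_coeff 4 [0,0,0,2] n = 0}"
    by (rule infinite_progression[where c = 13]) (simp add: core_coeff_def core_4_0123_0002_zero)
  show "infinite {n. even n \<and> core_coeff 4 [0,1,2,3] n = 0}"
    by (rule infinite_progression[where c = 14]) (simp add: core_coeff_def core_4_0123_0002_zero)
qed

theorem theorem5p6:
  shows
    "(core_series 2 [0,0] = psi oo q^2
        \<and> (\<forall>n. core_coeff 2 [0,0] n > 0 \<longleftrightarrow> pronic n))
   \<and> (core_series 2 [0,1] = phi
        \<and> (\<forall>n. core_coeff 2 [0,1] n > 0 \<longleftrightarrow> (\<exists>k. n = k^2)))
   \<and> (core_series 4 [0,0] = (psi oo q^2) * (psi oo q^4)^2
        \<and> (\<forall>n. core_coeff 4 [0,0] n > 0 \<longleftrightarrow> even n))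
   \<and> (core_series 4 [0,1] = (psi oo q^2) * psi^2
        \<and> (\<forall>n. core_coeff 4 [0,1] n > 0))
   \<and> (core_series 4 [0,2] = (psi oo q^2) * ((phi oo q^2)^2 + 2 * q * (psi oo q^4)^2)
        \<and> (\<forall>n. core_coeff 4 [0,2] n > 0))
   \<and> (core_series 6 [0,0] = (psi oo q^2) * (c3 oo q^4)^2
        \<and> (\<forall>n. core_coeff 6 [0,0] n > 0 \<longleftrightarrow> even n))
   \<and> (core_series 6 [0,2] = (psi oo q^2) * (c3^2 - q^2 * (c3 oo q^4)^2)
        \<and> (\<forall>n. core_coeff 6 [0,2] n > 0))
   \<and> (core_series 6 [0,3] + 2 * q * core_series 6 [0,1] = phi * c3^2)

   \<and> (core_series 3 [0,0,0] = c3 oo q^3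
        \<and> (\<forall>n. n mod 3 = 1 \<or> n mod 3 = 2 \<longrightarrow> core_coeff 3 [0,0,0] n = 0))
   \<and> (core_series 3 [0,0,1] = c3
        \<and> \<not> (\<forall>n. core_coeff 3 [0,0,1] n > 0))
   \<and> (core_series 3 [0,1,2] = (r30 oo q^3) + 3 * q * (c3 oo q^3)
        \<and> (\<forall>n. n mod 3 = 2 \<longrightarrow> core_coeff 3 [0,1,2] n = 0))

   \<and> (core_series 4 [0,0,0,0] = (psi oo q^4) * (psi oo q^8)^2
        \<and> (\<forall>n. core_coeff 4 [0,0,0,0] n > 0 \<longleftrightarrow> 4 dvd n))
   \<and> (core_series 4 [0,0,1,2] + q * core_series 4 [0,1,1,1] = psi^3
        \<and> core_series 4 [0,0,0,1] = core_series 4 [0,1,1,1]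
        \<and> (\<forall>n\<in>{4, 19, 112}. core_coeff 4 [0,0,0,1] n = 0))
   \<and> (core_series 4 [0,1,2,3] + 4 * q * core_series 4 [0,0,0,2]
          = (phi oo q^2)^3 + 8 * q * (phi oo q^2) * (psi oo q^4)^2
        \<and> infinite {n. odd n \<and> core_coeff 4 [0,0,0,2] n = 0}
        \<and> infinite {n. even n \<and> core_coeff 4 [0,1,2,3] n = 0})
   \<and> (core_series 4 [0,0,1,1] = (psi oo q^4) * (psi oo q^2)^2
        \<and> (\<forall>n. core_coeff 4 [0,0,1,1] n > 0 \<longleftrightarrow> even n))
   \<and> (core_series 4 [0,0,2,2] = (psi oo q^4) * ((phi oo q^4)^2 + 2 * q^2 * (psi oo q^8)^2)
        \<and> (\<forall>n. core_coeff 4 [0,0,2,2] n > 0 \<longleftrightarrow> even n))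
   \<and> (core_series 4 [0,1,1,2] = (psi oo q^4) * ((phi oo q^2)^2 + 2 * q * (psi oo q^4)^2)
        \<and> (\<forall>n. core_coeff 4 [0,1,1,2] n > 0 \<longleftrightarrow> n mod 4 \<noteq> 3))"
  unfolding c3_core_series
  by (intro conjI allI ballI impI core_coeff_pos core_coeff_zero series_2_00 series_2_01 series_4_00 series_4_01 series_4_02
      series_6_00 series_6_02 series_6_03 series_3_000 series_3_001 series_3_012 series_4_0000 series_4_0012 series_4_0001
      series_4_0123 series_4_0011 series_4_0022 series_4_0112)

end
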